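(* Let $k\geq2$ and let $s\geq4$ be integers. Choose a real eigenfunction $U_\ast\in\mathcal{E}_k\cap C^\infty$ satisfying $\mathscr{L}_kU_\ast=\Lambda_kU_\ast$ and $\|U_\ast\|_{X^s}=1$. There are constants $\delta>0$, $\epsilon_0>0$, $C>0$, depending on $k$, $s$ and $U_\ast$ but not on $\epsilon$, such that for every $0<\epsilon<\epsilon_0$ the nonlinear perturbation equation $\partial_tU=\mathscr{L}_kU+\mathcal{B}(U,U)$ has a solution $U^\epsilon\in X^s_{\mathrm{sym}}$ with $U^\epsilon(0)=\epsilon U_\ast$ on the interval $[0,T_\epsilon]$, where $$T_\epsilon=\frac{1}{\Lambda_k}\log\frac{\delta}{\epsilon},$$ and this solution satisfies $$\sup_{0\leq t\leq T_\epsilon}\|U^\epsilon(t)\|_{X^s}\leq C\delta,\qquad \|U^\epsilon(T_\epsilon)\|_{X^s}\geq\frac{\delta}{2}.$$ In particular, the purely magnetic equilibrium $\psi_\ast=0$, $\Phi_\ast=\sin(kx_1)$ is nonlinearly unstable in $X^s_{\mathrm{sym}}$, and an initial perturbation of size $\epsilon$ produces a departure of size independent of $\epsilon$ in time $O(|\log\epsilon|)$.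
   Context: The inertial MHD system on $\mathbb{T}^2=(\mathbb{R}/2\pi\mathbb{Z})^2$ is $$\partial_t\omega+\nabla^\perp\psi\cdot\nabla\omega+\nabla^\perp\Phi\cdot\nabla F=0,\quad \partial_tF+\nabla^\perp\psi\cdot\nabla F=0,\quad \Delta\psi=\omega,\quad (1-\Delta)\Phi=F,$$ $\nabla^\perp f=(-\partial_{x_2}f,\partial_{x_1}f)$. The equilibrium is $\psi_\ast=0$, $\Phi_\ast=\sin(kx_1)$, $\omega_\ast=0$, $F_\ast=(1+k^2)\sin(kx_1)$. A perturbation $U=(\omega,F)$ of it satisfies $\partial_tU=\mathscr{L}_kU+\mathcal{B}(U,U)$, where $$\mathscr{L}_k=-k\cos(kx_1)\,\partial_{x_2}\begin{pmatrix}0 & A_k \\ B_k & 0\end{pmatrix},\quad A_k=I-(1+k^2)(1-\Delta)^{-1},\quad B_k=-(1+k^2)\Delta^{-1},$$ and, with $u_U=\nabla^\perp\Delta^{-1}\omega_U$, $b_U=\nabla^\perp(1-\Delta)^{-1}F_U$, $$\mathcal{B}(U,V)=-\frac12\begin{pmatrix}u_U\cdot\nabla\omega_V+u_V\cdot\nabla\omega_U+b_U\cdot\nabla F_V+b_V\cdot\nabla F_U \\ u_U\cdot\nabla F_V+u_V\cdot\nabla F_U\end{pmatrix}.$$ Nonlinear fields and solutions are real-valued; solutions are strong solutions in $C([0,T];X^s_{\mathrm{sym}})\cap C^1([0,T];X^{s-1}_{\mathrm{sym}})$. Spaces: $X^s=H^{s-1}_0(\mathbb{T}^2)\times H^s(\mathbb{T}^2)\ni(\omega,F)$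 (subscript $0$: mean zero; complexified when discussing spectra), with $\|(\omega,F)\|_{X^s}^2=\|\omega\|_{H^{s-1}}^2+\|F\|_{H^s}^2$. $X^s_{\mathrm{sym}}$ is the closed subspace of $(\omega,F)\in X^s$ that are $2\pi/k$-periodic in $x_1$ and satisfy $\omega(\pi/k-x_1,x_2)=-\omega(x_1,x_2)$, $F(\pi/k-x_1,x_2)=F(x_1,x_2)$, $\omega(x_1,-x_2)=-\omega(x_1,x_2)$, $F(x_1,-x_2)=F(x_1,x_2)$. Leading rate: for $1\leq n<k$, $\lambda_{k,n}$ is the unique positive eigenvalue of $\mathscr{L}_k$ on the invariant subspace of $X^s_{\mathrm{sym}}$ consisting of $\omega=h(x_1)\sin(nx_2)$, $F=f(x_1)\cos(nx_2)$ with $f\in\overline{\operatorname{span}}\{\cos(2jkx_1):j\geq0\}$, $h\in\overline{\operatorname{span}}\{\cos((2j+1)kx_1):j\geq0\}$ (it is simple there). $\Lambda_k=\max_{1\leq n<k}\lambda_{k,n}$, which is the largest growth rate of $\mathscr{L}_k$ on $X^s_{\mathrm{sym}}$, and $\mathcal{E}_k$ is the direct sum of the eigenspaces in $X^s_{\mathrm{sym}}$ of the branches $n$ with $\lambda_{k,n}=\Lambda_k$. *)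

theory Defs
  imports "HOL-Analysis.Analysis" "HOL-Library.Landau_Symbols"
begin

text \<open>
  Functions on the torus are functions on the plane that are \<open>2\<pi>\<close>-periodic in both variables.
  A state is the pair (\<open>\<omega>\<close>, \<open>F\<close>). Everything is complex-valued, so that spectral notions refer to
  the complexified spaces; real-valuedness is imposed separately where it is required.
  Elements of Sobolev spaces are represented by functions, and equality in these spaces is
  equality almost everywhere.
\<close>

type_synonym scalar = "real \<times> real \<Rightarrow> complex"
type_synonym state = "real \<times> real \<Rightarrow> complex \<times> complex"

definition vort :: "state \<Rightarrow> scalar" where
  "vort U = (\<lambda>x. fst (U x))"

definition flux :: "state \<Rightarrow> scalar" where
  "flux U = (\<lambda>x. snd (U x))"

definition ae_eq :: "state \<Rightarrow> state \<Rightarrow> bool" (infix \<open>\<doteq>\<close> 50) where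
  "U \<doteq> V \<longleftrightarrow> (AE x in lborel. U x = V x)"

definition real_state :: "state \<Rightarrow> bool" where
  "real_state U \<longleftrightarrow> (AE x in lborel. vort U x \<in> \<real> \<and> flux U x \<in> \<real>)"

text \<open>\<open>D i j\<close> is the partial derivative of order \<open>i\<close> in the first and \<open>j\<close> in the second variable.\<close>

definition smooth_state :: "state \<Rightarrow> bool" where
  "smooth_state U \<longleftrightarrow> (\<exists>D :: nat \<Rightarrow> nat \<Rightarrow> state. D 0 0 = U \<and>
     (\<forall>i j x. (D i j has_derivative
        (\<lambda>v. fst v *\<^sub>R D (Suc i) j x + snd v *\<^sub>R D i (Suc j) x)) (at x)))"


section \<open>Fourier coefficients and Sobolev spaces\<close>

definition fourier_char :: "int \<times> int \<Rightarrow> scalar" where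
  "fourier_char \<xi> x = cis (of_int (fst \<xi>) * fst x + of_int (snd \<xi>) * snd x)"

definition sqnorm :: "int \<times> int \<Rightarrow> real" where
  "sqnorm \<xi> = of_int (fst \<xi>)^2 + of_int (snd \<xi>)^2"

definition cell :: "(real \<times> real) set" where
  "cell = {0..2*pi} \<times> {0..2*pi}"

definition fourier_coeff :: "scalar \<Rightarrow> int \<times> int \<Rightarrow> complex" where
  "fourier_coeff u \<xi> = (LINT x:cell|lborel. u x * cnj (fourier_char \<xi> x)) / of_real ((2*pi)^2)"

definition sobolev :: "nat \<Rightarrow> scalar set" where
  "sobolev r = {u. u \<in> borel_measurable borel \<and>
     (\<forall>x y. u (x + 2*pi, y) = u (x, y) \<and> u (x, y + 2*pi) = u (x, y)) \<and>
     set_integrable lborel cell (\<lambda>x. (norm (u x))^2) \<and>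
     (\<lambda>\<xi>. (1 + sqnorm \<xi>)^r * (norm (fourier_coeff u \<xi>))^2) summable_on UNIV}"

definition sobolev0 :: "nat \<Rightarrow> scalar set" where
  "sobolev0 r = {u \<in> sobolev r. fourier_coeff u (0, 0) = 0}"

definition sobolev_norm :: "nat \<Rightarrow> scalar \<Rightarrow> real" where
  "sobolev_norm r u = sqrt (\<Sum>\<^sub>\<infinity>\<xi>. (1 + sqnorm \<xi>)^r * (norm (fourier_coeff u \<xi>))^2)"

text \<open>Natural subtraction: the spaces \<open>X_space s\<close> below are meant for \<open>s \<ge> 1\<close>.\<close>

definition X_space :: "nat \<Rightarrow> state set" where
  "X_space s = {U. vort U \<in> sobolev0 (s - 1) \<and> flux U \<in> sobolev s}"

definition X_norm :: "nat \<Rightarrow> state \<Rightarrow> real" where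
  "X_norm s U = sqrt ((sobolev_norm (s - 1) (vort U))^2 + (sobolev_norm s (flux U))^2)"

definition X_sym :: "nat \<Rightarrow> nat \<Rightarrow> state set" where
  "X_sym k s = {U \<in> X_space s. AE (x, y) in lborel.
     U (x + 2*pi / real k, y) = U (x, y) \<and>
     vort U (pi / real k - x, y) = - vort U (x, y) \<and>
     flux U (pi / real k - x, y) = flux U (x, y) \<and>
     vort U (x, - y) = - vort U (x, y) \<and>
     flux U (x, - y) = flux U (x, y)}"

definition X_sym_real :: "nat \<Rightarrow> nat \<Rightarrow> state set" where
  "X_sym_real k s = {U \<in> X_sym k s. real_state U}"


section \<open>Differential operators and their inverses\<close>

text \<open>
  Derivatives are taken in the weak sense, i.e. as Fourier multipliers. The multiplier operators
  below produce the continuous representative given by the Fourier series. They are applied only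
  where this series converges absolutely, which is the case for all operators occurring in the
  equations acting on states in \<open>X_space s\<close> with \<open>s \<ge> 4\<close>.
\<close>

definition multiplier :: "(int \<times> int \<Rightarrow> complex) \<Rightarrow> scalar \<Rightarrow> scalar" where
  "multiplier m u x = (\<Sum>\<^sub>\<infinity>\<xi>. m \<xi> * fourier_coeff u \<xi> * fourier_char \<xi> x)"

definition d1 :: "scalar \<Rightarrow> scalar" where
  "d1 = multiplier (\<lambda>\<xi>. \<i> * of_int (fst \<xi>))"

definition d2 :: "scalar \<Rightarrow> scalar" where
  "d2 = multiplier (\<lambda>\<xi>. \<i> * of_int (snd \<xi>))"

text \<open>Inverse of the Laplacian on mean-zero functions, with mean-zero values.\<close>

definition inv_laplace :: "scalar \<Rightarrow> scalar" where
  "inv_laplace = multiplier (\<lambda>\<xi>. if \<xi> = (0, 0) then 0 else - 1 / of_real (sqnorm \<xi>))"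

definition inv_one_minus_laplace :: "scalar \<Rightarrow> scalar" where
  "inv_one_minus_laplace = multiplier (\<lambda>\<xi>. 1 / of_real (1 + sqnorm \<xi>))"

text \<open>\<open>advect \<phi> g\<close> is \<open>\<nabla>\<^sup>\<bottom>\<phi> \<sqdot> \<nabla>g\<close> with \<open>\<nabla>\<^sup>\<bottom>\<phi> = (-\<partial>\<^sub>2\<phi>, \<partial>\<^sub>1\<phi>)\<close>.\<close>

definition advect :: "scalar \<Rightarrow> scalar \<Rightarrow> scalar" where
  "advect \<phi> g x = - d2 \<phi> x * d1 g x + d1 \<phi> x * d2 g x"


section \<open>The inertial MHD system and its linearization\<close>

definition stream :: "state \<Rightarrow> scalar" where
  "stream U = inv_laplace (vort U)"

definition potential :: "state \<Rightarrow> scalar" where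
  "potential U = inv_one_minus_laplace (flux U)"

text \<open>The system reads \<open>\<partial>\<^sub>t W = mhd W\<close>.\<close>

definition mhd :: "state \<Rightarrow> state" where
  "mhd W x = (- (advect (stream W) (vort W) x + advect (potential W) (flux W) x),
              - advect (stream W) (flux W) x)"

definition equilibrium :: "nat \<Rightarrow> state" where
  "equilibrium k x = (0, of_real ((1 + (real k)^2) * sin (real k * fst x)))"

definition A_op :: "nat \<Rightarrow> scalar \<Rightarrow> scalar" where
  "A_op k u x = u x - of_real (1 + (real k)^2) * inv_one_minus_laplace u x"

definition B_op :: "nat \<Rightarrow> scalar \<Rightarrow> scalar" where
  "B_op k u x = - of_real (1 + (real k)^2) * inv_laplace u x"

definition lin_op :: "nat \<Rightarrow> state \<Rightarrow> state" where
  "lin_op k U x = (- (real k * cos (real k * fst x))) *\<^sub>R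
     (d2 (A_op k (flux U)) x, d2 (B_op k (vort U)) x)"

definition bilin :: "state \<Rightarrow> state \<Rightarrow> state" where
  "bilin U V x = (- (1/2)) *\<^sub>R
     (advect (stream U) (vort V) x + advect (stream V) (vort U) x
        + advect (potential U) (flux V) x + advect (potential V) (flux U) x,
      advect (stream U) (flux V) x + advect (stream V) (flux U) x)"

definition perturbation_rhs :: "nat \<Rightarrow> state \<Rightarrow> state" where
  "perturbation_rhs k U x = lin_op k U x + bilin U U x"


section \<open>Strong solutions and instability\<close>

definition continuous_curve :: "nat \<Rightarrow> nat \<Rightarrow> real \<Rightarrow> (real \<Rightarrow> state) \<Rightarrow> bool" where
  "continuous_curve k s T U \<longleftrightarrow> (\<forall>t\<in>{0..T}. U t \<in> X_sym_real k s \<and>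
     ((\<lambda>\<tau>. X_norm s (\<lambda>x. U \<tau> x - U t x)) \<longlongrightarrow> 0) (at t within {0..T}))"

definition curve_derivative ::
    "nat \<Rightarrow> real \<Rightarrow> (real \<Rightarrow> state) \<Rightarrow> (real \<Rightarrow> state) \<Rightarrow> bool" where
  "curve_derivative s T U U' \<longleftrightarrow> (\<forall>t\<in>{0..T}.
     ((\<lambda>\<tau>. X_norm s (\<lambda>x. (U \<tau> x - U t x) /\<^sub>R (\<tau> - t) - U' t x)) \<longlongrightarrow> 0)
       (at t within {0..T}))"

text \<open>
  Real-valued solutions of \<open>\<partial>\<^sub>t U = G U\<close> on \<open>[0, T]\<close> of class \<open>C\<close> in \<open>X_sym k s\<close> and of class
  \<open>C\<^sup>1\<close> in \<open>X_sym k (s - 1)\<close>.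
\<close>

definition strong_solution ::
    "nat \<Rightarrow> nat \<Rightarrow> (state \<Rightarrow> state) \<Rightarrow> real \<Rightarrow> (real \<Rightarrow> state) \<Rightarrow> bool" where
  "strong_solution k s G T U \<longleftrightarrow> 0 < T \<and> continuous_curve k s T U \<and>
     (\<exists>U'. continuous_curve k (s - 1) T U' \<and> curve_derivative (s - 1) T U U' \<and>
        (\<forall>t\<in>{0..T}. U' t \<doteq> G (U t)))"

text \<open>Lyapunov instability of the stationary state \<open>W\<close> of \<open>\<partial>\<^sub>t U = G U\<close> in \<open>X_sym k s\<close>.\<close>

definition nonlinearly_unstable :: "nat \<Rightarrow> nat \<Rightarrow> (state \<Rightarrow> state) \<Rightarrow> state \<Rightarrow> bool" where
  "nonlinearly_unstable k s G W \<longleftrightarrow> (\<exists>\<eta>>0. \<forall>d>0. \<exists>T U. strong_solution k s G T U \<and>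
     X_norm s (\<lambda>x. U 0 x - W x) < d \<and> (\<exists>t\<in>{0..T}. X_norm s (\<lambda>x. U t x - W x) \<ge> \<eta>))"


section \<open>The leading growth rate\<close>

definition L2_closed_span :: "(nat \<Rightarrow> real \<Rightarrow> real) \<Rightarrow> (real \<Rightarrow> complex) set" where
  "L2_closed_span e = {f. f \<in> borel_measurable borel \<and>
     (\<forall>\<eta>>0. \<exists>N (c :: nat \<Rightarrow> complex).
        (\<integral>\<^sup>+x\<in>{0..2*pi}. ennreal ((norm (f x - (\<Sum>j<N. c j * of_real (e j x))))^2) \<partial>lborel)
          < ennreal \<eta>)}"

definition branch :: "nat \<Rightarrow> nat \<Rightarrow> nat \<Rightarrow> state set" where
  "branch k s n = {U \<in> X_sym k s. \<exists>f h.
     f \<in> L2_closed_span (\<lambda>j x. cos (real (2 * j * k) * x)) \<and>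
     h \<in> L2_closed_span (\<lambda>j x. cos (real ((2 * j + 1) * k) * x)) \<and>
     U \<doteq> (\<lambda>(x, y). (h x * of_real (sin (real n * y)), f x * of_real (cos (real n * y))))}"

definition branch_eigenspace :: "nat \<Rightarrow> nat \<Rightarrow> nat \<Rightarrow> real \<Rightarrow> state set" where
  "branch_eigenspace k s n l = {U \<in> branch k s n. lin_op k U \<doteq> (\<lambda>x. l *\<^sub>R U x)}"

definition growth_rate :: "nat \<Rightarrow> nat \<Rightarrow> nat \<Rightarrow> real" where
  "growth_rate k s n =
     (THE l. 0 < l \<and> (\<exists>U \<in> branch_eigenspace k s n l. \<not> U \<doteq> (\<lambda>x. 0)))"

definition leading_rate :: "nat \<Rightarrow> nat \<Rightarrow> real" where
  "leading_rate k s = Max (growth_rate k s ` {1..<k})"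

definition leading_eigenspace :: "nat \<Rightarrow> nat \<Rightarrow> state set" where
  "leading_eigenspace k s = {U \<in> X_sym k s. \<exists>V.
     (\<forall>n \<in> {n \<in> {1..<k}. growth_rate k s n = leading_rate k s}.
        V n \<in> branch_eigenspace k s n (growth_rate k s n)) \<and>
     U \<doteq> (\<lambda>x. \<Sum>n \<in> {n \<in> {1..<k}. growth_rate k s n = leading_rate k s}. V n x)}"

end

(* The solution with data eps * Us is constructed as a power series in eps whose coefficients V j solve
   linear equations driven by the products of the preceding ones. In a scale of analytic weights that
   shrinks with the degree j, the derivative lost in the quadratic term costs a factor j, and this factor
   is gained back by integrating exp(j Lambda t) in time. Hence V j grows at most like
   D^j exp(j Lambda t), the series converges as long as eps * exp(Lambda t) is small, and the linear term
   eps * exp(Lambda t) Us dominates up to the time T_eps. The linear bound comes from an energy form whose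
   growth is controlled by the top of the spectrum. On each row n < k the square of the linearised
   operator is a rank-one perturbation of a nonpositive operator, which yields the growth rates, and the
   recursion for the Fourier coefficients shows that eigenfunctions are analytic. *)
theory Submission
  imports Defs
begin

section \<open>Abstract tools: square-summable families, entire curves in time, expansion in the
  amplitude\<close>

section \<open>The Hilbert space of square-summable families\<close>

text \<open>The nonlinearity loses one derivative, so a Duhamel iteration in a single Sobolev space
  does not close. Expanding in the amplitude leaves linear equations with bounded operators, solved
  by entire Taylor series in time; existence and growth bounds then come out together. From degree 2
  on, the forcing grows at rate j \<Lambda> with j >= 2, so a linear growth estimate at any rate
  below 2 \<Lambda> is enough in the energy form. This slack pays for everything: \<Lambda>/4 for
  making the energy coercive and \<Lambda>/4 for conjugating the linear operator with analytic
  weights, whence the rate 3 \<Lambda>/2. Three devices keep the analysis real and bounded. Fourier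
  series are centred at x1 = pi/(2k), where the symmetries become parities and the linear operator
  has real coefficients. The vorticity coefficient is divided by the length of its wave vector,
  which makes the blocks of the linear operator bounded and, up to A_k, adjoint to each other. All
  degrees are finally compared in one weight \<open>ew \<kappa>\<close> lying below every
  \<open>W \<kappa> j\<close>.\<close>

typedef 'a ell2 = "{f :: 'a \<Rightarrow> real. (\<lambda>i. (f i)\<^sup>2) summable_on UNIV}"
  morphisms coord of_coord
  by (rule exI[of _ "\<lambda>_. 0"]) simp

lemma of_coord_inverse': "(\<lambda>i. (f i)\<^sup>2) summable_on UNIV \<Longrightarrow> coord (of_coord f) = f"
  using of_coord_inverse by auto

lemma ell2_eqI: "(\<And>i. coord x i = coord y i) \<Longrightarrow> x = y"
  using coord_inject by blast

lemma coord_sq_summable: "(\<lambda>i. (coord x i)\<^sup>2) summable_on UNIV"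
  using coord by blast

lemma mult_summable:
  fixes f g :: "'a \<Rightarrow> real"
  assumes "(\<lambda>i. (f i)\<^sup>2) summable_on UNIV" "(\<lambda>i. (g i)\<^sup>2) summable_on UNIV"
  shows "(\<lambda>i. f i * g i) summable_on UNIV"
proof -
  have "(\<lambda>i. (f i)\<^sup>2 + (g i)\<^sup>2) summable_on UNIV"
    by (intro summable_on_add assms)
  then have "(\<lambda>i. norm (f i * g i)) summable_on UNIV"
  proof (rule summable_on_comparison_test)
    fix i
    have "0 \<le> (\<bar>f i\<bar> - \<bar>g i\<bar>)\<^sup>2" by simp
    then have "2 * (\<bar>f i\<bar> * \<bar>g i\<bar>) \<le> (f i)\<^sup>2 + (g i)\<^sup>2"
      by (simp add: power2_diff)
    moreover have "0 \<le> \<bar>f i\<bar> * \<bar>g i\<bar>" by simp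
    ultimately show "norm (f i * g i) \<le> (f i)\<^sup>2 + (g i)\<^sup>2"
      unfolding real_norm_def abs_mult by linarith
  qed simp
  then show ?thesis by (rule abs_summable_summable)
qed

lemma sq_summable_add:
  fixes f g :: "'a \<Rightarrow> real"
  assumes "(\<lambda>i. (f i)\<^sup>2) summable_on UNIV" "(\<lambda>i. (g i)\<^sup>2) summable_on UNIV"
  shows "(\<lambda>i. (f i + g i)\<^sup>2) summable_on UNIV"
proof -
  have "(\<lambda>i. (f i)\<^sup>2 + (g i)\<^sup>2 + 2 * (f i * g i)) summable_on UNIV"
    by (intro summable_on_add assms summable_on_cmult_right mult_summable)
  then show ?thesis by (simp add: power2_sum algebra_simps)
qed

lemma sq_summable_scale:
  fixes f :: "'a \<Rightarrow> real"
  assumes "(\<lambda>i. (f i)\<^sup>2) summable_on UNIV"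
  shows "(\<lambda>i. (c * f i)\<^sup>2) summable_on UNIV"
  using summable_on_cmult_right[OF assms, of "c\<^sup>2"] by (simp add: power_mult_distrib)

instantiation ell2 :: (type) real_vector
begin

definition "0 = of_coord (\<lambda>_. 0)"
definition "x + y = of_coord (\<lambda>i. coord x i + coord y i)"
definition "x - y = of_coord (\<lambda>i. coord x i - coord y i)"
definition "- x = of_coord (\<lambda>i. - coord x i)"
definition "c *\<^sub>R x = of_coord (\<lambda>i. c * coord x i)"

lemma coord_simps [simp]:
  "coord 0 i = 0"
  "coord (x + y) i = coord x i + coord y i"
  "coord (x - y) i = coord x i - coord y i"
  "coord (- x) i = - coord x i"
  "coord (c *\<^sub>R x) i = c * coord x i"
proof -
  have u: "(\<lambda>i. (- coord z i)\<^sup>2) summable_on UNIV" for z :: "'b ell2"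
    using sq_summable_scale[OF coord_sq_summable[of z], of "-1"] by simp
  show "coord 0 i = 0" by (simp add: zero_ell2_def of_coord_inverse')
  show "coord (x + y) i = coord x i + coord y i"
    by (simp add: plus_ell2_def of_coord_inverse' sq_summable_add coord_sq_summable)
  show "coord (x - y) i = coord x i - coord y i"
    using sq_summable_add[OF coord_sq_summable[of x] u[of y]]
    by (simp add: minus_ell2_def of_coord_inverse')
  show "coord (- x) i = - coord x i"
    unfolding uminus_ell2_def using fun_cong[OF of_coord_inverse'[OF u[of x]]] .
  show "coord (c *\<^sub>R x) i = c * coord x i"
    by (simp add: scaleR_ell2_def of_coord_inverse' sq_summable_scale coord_sq_summable)
qed

instance
  by standard (auto intro!: ell2_eqI simp: algebra_simps)

end

instantiation ell2 :: (type) real_inner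
begin

definition "inner x y = (\<Sum>\<^sub>\<infinity>i. coord x i * coord y i)"
definition "norm (x :: 'a ell2) = sqrt (inner x x)"
definition "dist (x :: 'a ell2) y = norm (x - y)"
definition "sgn (x :: 'a ell2) = inverse (norm x) *\<^sub>R x"
definition "uniformity = (INF e\<in>{0 <..}. principal {(x :: 'a ell2, y). dist x y < e})"
definition "open (U :: 'a ell2 set) \<longleftrightarrow>
  (\<forall>x\<in>U. eventually (\<lambda>(x', y). x' = x \<longrightarrow> y \<in> U) uniformity)"

lemma ell2_inner_summable: "(\<lambda>i. coord x i * coord y i) summable_on UNIV"
  by (intro mult_summable coord_sq_summable)

instance
proof
  fix x y z :: "'a ell2" and c :: real
  show "inner x y = inner y x" by (simp add: inner_ell2_def mult.commute)
  show "inner (x + y) z = inner x z + inner y z"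
    using infsum_add[OF ell2_inner_summable[of x z] ell2_inner_summable[of y z]]
    by (simp add: inner_ell2_def algebra_simps)
  show "inner (c *\<^sub>R x) y = c * inner x y"
    using infsum_cmult_right'[of c "\<lambda>i. coord x i * coord y i" UNIV]
    by (simp add: inner_ell2_def algebra_simps)
  show "0 \<le> inner x x" by (simp add: inner_ell2_def infsum_nonneg)
  show "inner x x = 0 \<longleftrightarrow> x = 0"
  proof
    assume "inner x x = 0"
    then have "coord x i * coord x i = 0" for i
      by (intro nonneg_infsum_le_0D[of "\<lambda>i. coord x i * coord x i" UNIV])
         (auto simp: inner_ell2_def ell2_inner_summable)
    then show "x = 0" by (intro ell2_eqI) simp
  qed (simp add: inner_ell2_def)
qed (simp_all add: norm_ell2_def dist_ell2_def sgn_ell2_def uniformity_ell2_def open_ell2_def)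

end

lemma ell2_norm_sq: "(norm x)\<^sup>2 = (\<Sum>\<^sub>\<infinity>i. (coord x i)\<^sup>2)"
  unfolding power2_norm_eq_inner inner_ell2_def by (simp add: power2_eq_square)

lemma ell2_norm_sq_finite:
  assumes "finite A"
  shows "(\<Sum>i\<in>A. (coord x i)\<^sup>2) \<le> (norm x)\<^sup>2"
  unfolding ell2_norm_sq using assms by (intro finite_sum_le_infsum coord_sq_summable) auto

lemma abs_coord_le: "\<bar>coord x i\<bar> \<le> norm x"
  using ell2_norm_sq_finite[of "{i}" x] by (simp add: abs_le_square_iff[symmetric])

lemma bounded_linear_coord: "bounded_linear (\<lambda>x. coord x i)"
  by (rule bounded_linear_intro[where K = 1]) (auto simp: abs_coord_le)

text \<open>One uniform bound on finite partial sums yields both square-summability, hence that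
  \<open>of_coord\<close> does not return an arbitrary element, and the norm estimate. Operators and
  limits are produced this way.\<close>

lemma of_coord_bounded:
  fixes f :: "'a \<Rightarrow> real"
  assumes "\<And>A. finite A \<Longrightarrow> (\<Sum>i\<in>A. (f i)\<^sup>2) \<le> B\<^sup>2" "0 \<le> B"
  shows "coord (of_coord f) = f" "norm (of_coord f) \<le> B"
proof -
  have s: "(\<lambda>i. (f i)\<^sup>2) summable_on UNIV"
    by (rule nonneg_bdd_above_summable_on) (use assms in \<open>auto intro!: bdd_aboveI[of _ "B\<^sup>2"]\<close>)
  then show c: "coord (of_coord f) = f" by (rule of_coord_inverse')
  have "(norm (of_coord f))\<^sup>2 \<le> B\<^sup>2"
    unfolding ell2_norm_sq c using s assms(1) by (intro infsum_le_finite_sums) auto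
  then show "norm (of_coord f) \<le> B" using assms(2) by (simp add: power2_le_iff_abs_le)
qed

instance ell2 :: (type) banach
proof
  fix X :: "nat \<Rightarrow> 'a ell2"
  assume X: "Cauchy X"
  have "convergent (\<lambda>n. coord (X n) i)" for i
  proof -
    have "Cauchy (\<lambda>n. coord (X n) i)"
      by (rule bounded_linear.Cauchy[OF bounded_linear_coord X])
    then show ?thesis by (simp add: Cauchy_convergent_iff)
  qed
  then obtain f where f: "\<And>i. (\<lambda>n. coord (X n) i) \<longlonglongrightarrow> f i"
    unfolding convergent_def by metis
  \<comment> \<open>For fixed \<open>m\<close> the Cauchy estimate passes to the limit in
    \<open>n\<close> on each finite index set. The bound is uniform in the set, so the difference is
    square-summable with norm at most \<open>e\<close>.\<close>
  have key: "\<exists>N. \<forall>m\<ge>N. coord (of_coord (\<lambda>i. coord (X m) i - f i)) = (\<lambda>i. coord (X m) i - f i)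
      \<and> norm (of_coord (\<lambda>i. coord (X m) i - f i)) \<le> e" if "e > 0" for e
  proof -
    obtain N where N: "\<And>m n. m \<ge> N \<Longrightarrow> n \<ge> N \<Longrightarrow> norm (X m - X n) < e"
      using X \<open>e > 0\<close> by (meson CauchyD)
    have "(\<Sum>i\<in>A. (coord (X m) i - f i)\<^sup>2) \<le> e\<^sup>2" if "m \<ge> N" "finite A" for m A
    proof (rule tendsto_upperbound)
      show "(\<lambda>n. \<Sum>i\<in>A. (coord (X m) i - coord (X n) i)\<^sup>2)
          \<longlonglongrightarrow> (\<Sum>i\<in>A. (coord (X m) i - f i)\<^sup>2)"
        by (intro tendsto_intros f)
      show "\<forall>\<^sub>F n in sequentially. (\<Sum>i\<in>A. (coord (X m) i - coord (X n) i)\<^sup>2) \<le> e\<^sup>2"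
      proof (rule eventually_sequentiallyI[of N])
        fix n assume "n \<ge> N"
        have "(\<Sum>i\<in>A. (coord (X m) i - coord (X n) i)\<^sup>2) \<le> (norm (X m - X n))\<^sup>2"
          using ell2_norm_sq_finite[OF \<open>finite A\<close>, of "X m - X n"] by simp
        also have "\<dots> \<le> e\<^sup>2"
          using N[OF \<open>m \<ge> N\<close> \<open>n \<ge> N\<close>] by (intro power_mono) auto
        finally show "(\<Sum>i\<in>A. (coord (X m) i - coord (X n) i)\<^sup>2) \<le> e\<^sup>2" .
      qed
    qed simp
    then show ?thesis
      using of_coord_bounded[of "\<lambda>i. coord (X _) i - f i" e] \<open>e > 0\<close>
      by (intro exI[of _ N] allI impI conjI) auto
  qed
  obtain M where "coord (of_coord (\<lambda>i. coord (X M) i - f i)) = (\<lambda>i. coord (X M) i - f i)"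
    using key[of 1] by auto
  \<comment> \<open>The limit is square-summable, being a member of the sequence minus a
    square-summable difference.\<close>
  then have "f = coord (X M - of_coord (\<lambda>i. coord (X M) i - f i))"
    by auto
  then obtain x where x: "f = coord x" by blast
  have eq: "coord (of_coord (\<lambda>i. coord (X m) i - f i)) = (\<lambda>i. coord (X m) i - f i) \<Longrightarrow>
     of_coord (\<lambda>i. coord (X m) i - f i) = X m - x" for m
    by (intro ell2_eqI) (simp add: x)
  have "X \<longlonglongrightarrow> x"
  proof (rule metric_LIMSEQ_I)
    fix e :: real assume "e > 0"
    then obtain N where "\<forall>m\<ge>N. coord (of_coord (\<lambda>i. coord (X m) i - f i)) = (\<lambda>i. coord (X m) i - f i)
      \<and> norm (of_coord (\<lambda>i. coord (X m) i - f i)) \<le> e / 2" using key[of "e/2"] by auto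
    then have "norm (X m - x) \<le> e / 2" if "m \<ge> N" for m using eq[of m] that by metis
    then show "\<exists>N. \<forall>m\<ge>N. dist (X m) x < e"
      using \<open>e > 0\<close> by (intro exI[of _ N]) (fastforce simp: dist_norm)
  qed
  then show "convergent X" unfolding convergent_def by blast
qed

text \<open>Multiplication by \<open>d\<close> after reindexing by \<open>\<pi>\<close>. Fourier
  multipliers (\<open>\<pi> = id\<close>), frequency shifts and reflections are all of this
  form.\<close>

definition wop :: "('a \<Rightarrow> real) \<Rightarrow> ('a \<Rightarrow> 'a) \<Rightarrow> 'a ell2 \<Rightarrow> 'a ell2" where
  "wop d \<pi> x = of_coord (\<lambda>i. d i * coord x (\<pi> i))"

context
  fixes d :: "'a \<Rightarrow> real" and \<pi> :: "'a \<Rightarrow> 'a" and B :: real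
  assumes inj: "inj \<pi>" and bd: "\<And>i. \<bar>d i\<bar> \<le> B"
begin

lemma wop_aux:
  assumes "finite A"
  shows "(\<Sum>i\<in>A. (d i * coord x (\<pi> i))\<^sup>2) \<le> (B * norm x)\<^sup>2"
proof -
  have B: "(d i)\<^sup>2 \<le> B\<^sup>2" for i using bd[of i] by (simp add: abs_le_square_iff[symmetric])
  have "(\<Sum>i\<in>A. (d i * coord x (\<pi> i))\<^sup>2) \<le> (\<Sum>i\<in>A. B\<^sup>2 * (coord x (\<pi> i))\<^sup>2)"
    using B by (intro sum_mono) (simp add: power_mult_distrib mult_right_mono)
  also have "\<dots> = B\<^sup>2 * (\<Sum>i\<in>\<pi> ` A. (coord x i)\<^sup>2)"
    using inj by (subst sum.reindex) (auto simp: sum_distrib_left intro: inj_on_subset)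
  also have "\<dots> \<le> B\<^sup>2 * (norm x)\<^sup>2"
    using assms by (intro mult_left_mono ell2_norm_sq_finite) auto
  finally show ?thesis by (simp add: power_mult_distrib)
qed

lemma wop_bound_nonneg: "0 \<le> B"
  using bd[of undefined] by linarith

lemma coord_wop: "coord (wop d \<pi> x) i = d i * coord x (\<pi> i)"
  unfolding wop_def using of_coord_bounded(1)[OF wop_aux] wop_bound_nonneg by simp

lemma norm_wop: "norm (wop d \<pi> x) \<le> B * norm x"
  unfolding wop_def using of_coord_bounded(2)[OF wop_aux] wop_bound_nonneg by simp

lemma bounded_linear_wop: "bounded_linear (wop d \<pi>)"
  by (rule bounded_linear_intro[where K = B])
     (auto intro!: ell2_eqI simp: coord_wop norm_wop algebra_simps norm_wop[unfolded mult.commute[of B]])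

end

section \<open>Power series in time\<close>

text \<open>Stated on a convex set so that it yields one-sided derivatives at the ends of a time
  interval. It serves twice, for power series in time and for the series in the amplitude. The
  M-test supplies the uniform convergence that \<open>has_derivative_series\<close> asks
  for.\<close>

lemma has_vector_derivative_series:
  fixes f :: "nat \<Rightarrow> real \<Rightarrow> 'a::banach"
  assumes S: "convex S"
    and der: "\<And>n x. x \<in> S \<Longrightarrow> (f n has_vector_derivative f' n x) (at x within S)"
    and bd: "\<And>n x. x \<in> S \<Longrightarrow> norm (f' n x) \<le> M n" "summable M"
    and sm: "\<And>x. x \<in> S \<Longrightarrow> summable (\<lambda>n. f n x)" and x: "x \<in> S"
  shows "((\<lambda>x. \<Sum>n. f n x) has_vector_derivative (\<Sum>n. f' n x)) (at x within S)"
proof -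
  have u: "uniform_limit S (\<lambda>n x. \<Sum>i<n. f' i x) (\<lambda>x. suminf (\<lambda>i. f' i x)) sequentially"
    by (rule Weierstrass_m_test) (use bd in auto)
  have "\<exists>g. \<forall>x\<in>S. (\<lambda>n. f n x) sums g x \<and>
      (g has_derivative (\<lambda>h. h *\<^sub>R (\<Sum>n. f' n x))) (at x within S)"
  proof (rule has_derivative_series[OF S])
    show "(f n has_derivative (\<lambda>h. h *\<^sub>R f' n x)) (at x within S)" if "x \<in> S" for n x
      using der[OF that] by (simp add: has_vector_derivative_def)
    show "\<forall>\<^sub>F n in sequentially. \<forall>x\<in>S. \<forall>h.
        norm ((\<Sum>i<n. h *\<^sub>R f' i x) - h *\<^sub>R (\<Sum>n. f' n x)) \<le> e * norm h" if "e > 0" for e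
      using uniform_limitD[OF u that]
    proof eventually_elim
      case (elim n)
      have "norm ((\<Sum>i<n. h *\<^sub>R f' i x) - h *\<^sub>R (\<Sum>n. f' n x)) \<le> e * norm h" if "x \<in> S" for x h
      proof -
        have "norm ((\<Sum>i<n. h *\<^sub>R f' i x) - h *\<^sub>R (\<Sum>n. f' n x)) =
            \<bar>h\<bar> * norm ((\<Sum>i<n. f' i x) - (\<Sum>n. f' n x))"
          by (simp add: scaleR_right.sum[symmetric] scaleR_right_diff_distrib[symmetric])
        also have "\<dots> \<le> \<bar>h\<bar> * e"
          using elim that by (intro mult_left_mono) (auto simp: dist_norm less_imp_le)
        finally show ?thesis by (simp add: mult.commute)
      qed
      then show ?case by blast
    qed
    show "(\<lambda>n. f n x) sums (\<Sum>n. f n x)" using sm[OF x] by (rule summable_sums)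
  qed (use x in auto)
  then obtain g where g: "\<And>x. x \<in> S \<Longrightarrow> (\<lambda>n. f n x) sums g x"
      "\<And>x. x \<in> S \<Longrightarrow> (g has_derivative (\<lambda>h. h *\<^sub>R (\<Sum>n. f' n x))) (at x within S)"
    by blast
  have eq: "(\<Sum>n. f n y) = g y" if "y \<in> S" for y
    using g(1)[OF that] by (simp add: sums_iff)
  show ?thesis
    unfolding has_vector_derivative_def
    by (rule has_derivative_transform[OF x eq g(2)[OF x]])
qed

text \<open>Absolute convergence makes the double family summable over all index pairs, and its sum
  may then be computed along rows or along antidiagonals.\<close>

lemma bilinear_Cauchy_product:
  fixes P :: "'a::banach \<Rightarrow> 'b::banach \<Rightarrow> 'c::banach"
  assumes P: "bounded_bilinear P"
    and a: "summable (\<lambda>n. norm (a n))" and b: "summable (\<lambda>n. norm (b n))"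
  shows "(\<lambda>n. \<Sum>i\<le>n. P (a i) (b (n - i))) sums P (\<Sum>n. a n) (\<Sum>n. b n)"
    and "summable (\<lambda>n. norm (\<Sum>i\<le>n. P (a i) (b (n - i))))"
proof -
  obtain K where K: "K > 0" "\<And>x y. norm (P x y) \<le> norm x * norm y * K"
    using bounded_bilinear.pos_bounded[OF P] by blast
  have a': "(\<lambda>n. norm (a n)) summable_on UNIV" and b': "(\<lambda>n. norm (b n)) summable_on UNIV"
    using a b by (auto simp: summable_on_UNIV_nonneg_real_iff)
  have sa: "(a has_sum (\<Sum>n. a n)) UNIV" and sb: "(b has_sum (\<Sum>n. b n)) UNIV"
    using norm_summable_imp_has_sum[OF a] norm_summable_imp_has_sum[OF b]
      summable_norm_cancel[OF a] summable_norm_cancel[OF b] by (auto simp: sums_iff)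
  define f where "f = (\<lambda>(i, j). P (a i) (b j))"
  have "(\<lambda>(i, j). norm (a i) * norm (b j)) summable_on UNIV \<times> UNIV"
    by (rule summable_on_SigmaI[where g = "\<lambda>i. norm (a i) * (\<Sum>\<^sub>\<infinity>n. norm (b n))"])
       (auto intro!: has_sum_cmult_right has_sum_infsum b' summable_on_cmult_left a')
  then have "(\<lambda>x. (\<lambda>(i, j). norm (a i) * norm (b j)) x * K) summable_on UNIV \<times> UNIV"
    by (rule summable_on_cmult_left)
  then have nf: "(\<lambda>x. norm (f x)) summable_on UNIV \<times> UNIV"
    by (rule summable_on_comparison_test) (auto simp: f_def K(2))
  obtain T where f: "(f has_sum T) (UNIV \<times> UNIV)"
    using abs_summable_summable[OF nf] by (auto simp: summable_on_def)
  have "((\<lambda>i. P (a i) (\<Sum>n. b n)) has_sum T) UNIV"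
    by (rule has_sum_SigmaD[OF f])
       (use has_sum_bounded_linear[OF bounded_bilinear.bounded_linear_right[OF P] sb] in \<open>simp add: f_def\<close>)
  moreover have "((\<lambda>i. P (a i) (\<Sum>n. b n)) has_sum P (\<Sum>n. a n) (\<Sum>n. b n)) UNIV"
    using has_sum_bounded_linear[OF bounded_bilinear.bounded_linear_left[OF P] sa] by simp
  ultimately have eq: "T = P (\<Sum>n. a n) (\<Sum>n. b n)"
    by (rule has_sum_unique)
  define h where "h = (\<lambda>(n, i). (i, n - i :: nat))"
  have bij: "bij_betw h (SIGMA n:UNIV. {..n}) (UNIV \<times> UNIV)"
    by (rule bij_betwI[where g = "\<lambda>(i, j). (i + j, i)"]) (auto simp: h_def)
  have f2: "((\<lambda>x. f (h x)) has_sum T) (SIGMA n:UNIV. {..n})"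
    using f has_sum_reindex_bij_betw[OF bij, of f] by simp
  have nf2: "(\<lambda>x. norm (f (h x))) summable_on (SIGMA n:UNIV. {..n})"
    using nf summable_on_reindex_bij_betw[OF bij, of "\<lambda>x. norm (f x)"] by simp
  have "((\<lambda>n. \<Sum>i\<le>n. P (a i) (b (n - i))) has_sum T) UNIV"
    by (rule has_sum_SigmaD[OF f2]) (auto simp: f_def h_def)
  then show "(\<lambda>n. \<Sum>i\<le>n. P (a i) (b (n - i))) sums P (\<Sum>n. a n) (\<Sum>n. b n)"
    unfolding eq by (rule has_sum_imp_sums)
  have "(\<lambda>n. \<Sum>i\<le>n. norm (P (a i) (b (n - i)))) summable_on UNIV"
    by (rule has_sum_imp_summable[OF has_sum_SigmaD[OF has_sum_infsum[OF nf2]]])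
       (auto simp: f_def h_def)
  then have "summable (\<lambda>n. \<Sum>i\<le>n. norm (P (a i) (b (n - i))))"
    by (rule summable_on_imp_summable)
  then show "summable (\<lambda>n. norm (\<Sum>i\<le>n. P (a i) (b (n - i))))"
    by (rule summable_comparison_test'[of _ 0]) (auto intro: sum_norm_le norm_sum)
qed

text \<open>Taylor coefficients of an entire vector-valued function. Linear equations with bounded
  operators are solved inside this class by comparing coefficients, which replaces Duhamel
  integrals.\<close>

definition entire :: "(nat \<Rightarrow> 'a::real_normed_vector) \<Rightarrow> bool" where
  "entire a \<longleftrightarrow> (\<forall>R\<ge>0. summable (\<lambda>m. norm (a m) * R ^ m))"

definition curve :: "(nat \<Rightarrow> 'a::real_normed_vector) \<Rightarrow> real \<Rightarrow> 'a" where
  "curve a t = (\<Sum>m. t ^ m *\<^sub>R a m)"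

lemma entire_summable_norm: "entire a \<Longrightarrow> summable (\<lambda>m. norm (t ^ m *\<^sub>R a m))"
  unfolding entire_def by (auto simp: power_abs mult.commute dest!: spec[of _ "\<bar>t\<bar>"])

lemma entire_summable:
  fixes a :: "nat \<Rightarrow> 'a::banach"
  shows "entire a \<Longrightarrow> summable (\<lambda>m. t ^ m *\<^sub>R a m)"
  by (rule summable_norm_cancel[OF entire_summable_norm])

lemma entire_diffs:
  assumes "entire a"
  shows "entire (\<lambda>m. real (Suc m) *\<^sub>R a (Suc m))"
  unfolding entire_def
proof (intro allI impI)
  fix R :: real assume "R \<ge> 0"
  \<comment> \<open>The doubled radius absorbs the factor \<open>Suc m\<close>, which is at most
    \<open>2 ^ Suc m\<close>; the added 1 absorbs the shift of the exponent.\<close>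
  define S where "S = 2 * (R + 1)"
  have "summable (\<lambda>m. norm (a (Suc m)) * S ^ Suc m)"
    using assms \<open>R \<ge> 0\<close> unfolding entire_def S_def
    by (subst summable_Suc_iff) auto
  then show "summable (\<lambda>m. norm (real (Suc m) *\<^sub>R a (Suc m)) * R ^ m)"
  proof (rule summable_comparison_test'[of _ 0])
    fix m :: nat
    have "real (Suc m) \<le> 2 ^ Suc m"
      using of_nat_less_two_power[of "Suc m", where 'a = real] by linarith
    moreover have "R ^ m \<le> (R + 1) ^ Suc m"
      using \<open>R \<ge> 0\<close> power_mono[of R "R + 1" m] mult_mono[of 1 "R + 1" "R ^ m" "(R + 1) ^ m"] by auto
    ultimately have "real (Suc m) * R ^ m \<le> S ^ Suc m"
      unfolding S_def power_mult_distrib using \<open>R \<ge> 0\<close> by (intro mult_mono) auto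
    then show "norm (norm (real (Suc m) *\<^sub>R a (Suc m)) * R ^ m) \<le> norm (a (Suc m)) * S ^ Suc m"
      using \<open>R \<ge> 0\<close> mult_left_mono[of "real (Suc m) * R ^ m" "S ^ Suc m" "norm (a (Suc m))"]
      by (simp add: mult_ac)
  qed
qed

lemma curve_deriv:
  fixes a :: "nat \<Rightarrow> 'a::banach"
  assumes a: "entire a"
  shows "(curve a has_vector_derivative curve (\<lambda>m. real (Suc m) *\<^sub>R a (Suc m)) t) (at t)"
proof -
  define R where "R = \<bar>t\<bar> + 1"
  define f' where "f' = (\<lambda>m (t::real). (real m * t ^ (m - 1)) *\<^sub>R a m)"
  have sd: "summable (\<lambda>m. norm (real (Suc m) *\<^sub>R a (Suc m)) * R ^ m)"
    using entire_diffs[OF a] by (auto simp: entire_def R_def)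
  have "((\<lambda>t. \<Sum>m. t ^ m *\<^sub>R a m) has_vector_derivative (\<Sum>m. f' m t)) (at t within {-R<..<R})"
  proof (rule has_vector_derivative_series[where M = "\<lambda>m. norm (real m *\<^sub>R a m) * R ^ (m - 1)"])
    show "((\<lambda>t. t ^ m *\<^sub>R a m) has_vector_derivative f' m x) (at x within {-R<..<R})" for m x
      unfolding f'_def by (auto intro!: derivative_eq_intros)
    show "norm (f' m x) \<le> norm (real m *\<^sub>R a m) * R ^ (m - 1)" if "x \<in> {-R<..<R}" for m x
    proof -
      have "\<bar>x\<bar> ^ (m - 1) \<le> R ^ (m - 1)" using that by (intro power_mono) auto
      then show ?thesis
        using mult_left_mono[of "\<bar>x\<bar> ^ (m - 1)" "R ^ (m - 1)" "real m * norm (a m)"]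
        by (simp add: f'_def abs_mult power_abs mult_ac)
    qed
    show "summable (\<lambda>m. norm (real m *\<^sub>R a m) * R ^ (m - 1))"
      using sd by (subst summable_Suc_iff[symmetric]) simp
    show "summable (\<lambda>m. x ^ m *\<^sub>R a m)" for x by (rule entire_summable[OF a])
  qed (auto simp: R_def)
  then have "((\<lambda>t. \<Sum>m. t ^ m *\<^sub>R a m) has_vector_derivative (\<Sum>m. f' m t)) (at t)"
    by (subst (asm) at_within_open) (auto simp: R_def)
  moreover have "(\<Sum>m. f' m t) = curve (\<lambda>m. real (Suc m) *\<^sub>R a (Suc m)) t"
  proof -
    have eq: "f' (Suc m) t = t ^ m *\<^sub>R (real (Suc m) *\<^sub>R a (Suc m))" for m
      by (simp add: f'_def mult.commute)
    have "summable (\<lambda>m. f' (Suc m) t)"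
      unfolding eq by (rule entire_summable[OF entire_diffs[OF a]])
    then have "summable (\<lambda>m. f' m t)" by (subst (asm) summable_Suc_iff)
    then have "(\<Sum>m. f' (Suc m) t) = (\<Sum>m. f' m t) - f' 0 t" by (rule suminf_split_head)
    then show ?thesis unfolding curve_def eq by (simp add: f'_def)
  qed
  ultimately show ?thesis unfolding curve_def[abs_def] by simp
qed

lemma curve_0 [simp]: "curve a 0 = a 0"
  unfolding curve_def using powser_sums_zero_iff[of "\<lambda>_. 0"] 
  by (subst suminf_finite[of "{0}"]) (auto simp: power_0_left)

lemma entire_bounded_linear:
  assumes "entire a" "bounded_linear L"
  shows "entire (\<lambda>m. L (a m))"
  unfolding entire_def
proof (intro allI impI)
  fix R :: real assume R: "R \<ge> 0"
  obtain K where K: "\<And>x. norm (L x) \<le> norm x * K"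
    using bounded_linear.bounded[OF assms(2)] by blast
  have "summable (\<lambda>m. K * (norm (a m) * R ^ m))"
    using assms(1) R by (intro summable_mult) (auto simp: entire_def)
  moreover have "norm (norm (L (a m)) * R ^ m) \<le> K * (norm (a m) * R ^ m)" for m
    using R mult_right_mono[OF K[of "a m"] zero_le_power[OF R, of m]] by (simp add: mult_ac)
  ultimately show "summable (\<lambda>m. norm (L (a m)) * R ^ m)"
    by (rule summable_comparison_test'[of _ 0])
qed

lemma curve_bounded_linear:
  fixes a :: "nat \<Rightarrow> 'a::banach"
  assumes "entire a" "bounded_linear L"
  shows "L (curve a t) = curve (\<lambda>m. L (a m)) t"
  unfolding curve_def bounded_linear.suminf[OF assms(2) entire_summable[OF assms(1)]]
  by (simp add: linear_simps(5)[OF assms(2)])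

lemma entire_add: "entire a \<Longrightarrow> entire b \<Longrightarrow> entire (\<lambda>m. a m + b m)"
  unfolding entire_def
proof (intro allI impI)
  fix R :: real
  assume *: "\<forall>R\<ge>0. summable (\<lambda>m. norm (a m) * R ^ m)" "\<forall>R\<ge>0. summable (\<lambda>m. norm (b m) * R ^ m)"
    and R: "R \<ge> 0"
  have "summable (\<lambda>m. norm (a m) * R ^ m + norm (b m) * R ^ m)"
    using * R by (intro summable_add) auto
  then show "summable (\<lambda>m. norm (a m + b m) * R ^ m)"
    by (rule summable_comparison_test'[of _ 0])
       (use R in \<open>auto simp: distrib_right[symmetric] intro!: mult_right_mono norm_triangle_ineq\<close>)
qed

lemma curve_add:
  fixes a b :: "nat \<Rightarrow> 'a::banach"
  assumes "entire a" "entire b"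
  shows "curve (\<lambda>m. a m + b m) t = curve a t + curve b t"
  unfolding curve_def scaleR_add_right
  by (rule suminf_add[symmetric]) (intro entire_summable assms)+

lemma entire_0: "entire (\<lambda>_. 0)"
  by (simp add: entire_def)

lemma entire_sum: "(\<And>i. i \<in> I \<Longrightarrow> entire (a i)) \<Longrightarrow> entire (\<lambda>m. \<Sum>i\<in>I. a i m)"
  by (induction I rule: infinite_finite_induct) (auto intro!: entire_add entire_0)

lemma curve_sum:
  fixes a :: "'i \<Rightarrow> nat \<Rightarrow> 'a::banach"
  assumes "\<And>i. i \<in> I \<Longrightarrow> entire (a i)"
  shows "curve (\<lambda>m. \<Sum>i\<in>I. a i m) t = (\<Sum>i\<in>I. curve (a i) t)"
  unfolding curve_def scaleR_sum_right
  by (rule suminf_sum) (intro entire_summable assms)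

lemma entire_product:
  fixes P :: "'a::banach \<Rightarrow> 'b::banach \<Rightarrow> 'c::banach"
  assumes P: "bounded_bilinear P" and "entire a" "entire b"
  shows "entire (\<lambda>m. \<Sum>p\<le>m. P (a p) (b (m - p)))"
    and "curve (\<lambda>m. \<Sum>p\<le>m. P (a p) (b (m - p))) t = P (curve a t) (curve b t)"
proof -
  have eq: "(\<Sum>p\<le>m. P (t ^ p *\<^sub>R a p) (t ^ (m - p) *\<^sub>R b (m - p))) =
      t ^ m *\<^sub>R (\<Sum>p\<le>m. P (a p) (b (m - p)))" for m and t :: real
    unfolding scaleR_sum_right
    by (intro sum.cong refl)
       (simp add: bounded_bilinear.scaleR_left[OF P] bounded_bilinear.scaleR_right[OF P]
          power_add[symmetric])
  show "entire (\<lambda>m. \<Sum>p\<le>m. P (a p) (b (m - p)))"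
    unfolding entire_def
  proof (intro allI impI)
    fix R :: real assume "R \<ge> 0"
    show "summable (\<lambda>m. norm (\<Sum>p\<le>m. P (a p) (b (m - p))) * R ^ m)"
      using bilinear_Cauchy_product(2)[OF P entire_summable_norm[OF assms(2), of R]
        entire_summable_norm[OF assms(3), of R]] \<open>R \<ge> 0\<close>
      unfolding eq by (simp add: mult.commute)
  qed
  show "curve (\<lambda>m. \<Sum>p\<le>m. P (a p) (b (m - p))) t = P (curve a t) (curve b t)"
    using bilinear_Cauchy_product(1)[OF P entire_summable_norm[OF assms(2), of t]
        entire_summable_norm[OF assms(3), of t]]
    unfolding eq by (simp add: curve_def sums_iff)
qed

text \<open>Summing the recursion bounds the partial sums beyond \<open>M\<close> by
  \<open>2 * \<alpha> M\<close> plus twice those of \<open>\<beta>\<close>. The subtracted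
  \<open>2 * \<alpha> (n + M)\<close> in \<open>bd\<close> is what lets the induction close.\<close>

lemma summable_contraction_recursion:
  fixes \<alpha> \<beta> :: "nat \<Rightarrow> real"
  assumes nn: "\<And>m. \<alpha> m \<ge> 0" and \<beta>: "summable \<beta>" "\<And>m. \<beta> m \<ge> 0"
    and rec: "\<And>m. m \<ge> M \<Longrightarrow> \<alpha> (Suc m) \<le> \<alpha> m / 2 + \<beta> m"
  shows "summable \<alpha>"
proof -
  have bd: "(\<Sum>i<n. \<alpha> (i + M)) \<le> 2 * \<alpha> M + 2 * (\<Sum>i<n. \<beta> (i + M)) - 2 * \<alpha> (n + M)" for n
  proof (induction n)
    case (Suc n)
    then show ?case using rec[of "n + M"] by (simp add: field_simps)
  qed simp
  have bound: "(\<Sum>i<n. norm (\<alpha> (i + M))) \<le> 2 * \<alpha> M + 2 * (\<Sum>i. \<beta> (i + M))" for n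
  proof -
    have "(\<Sum>i<n. \<beta> (i + M)) \<le> (\<Sum>i. \<beta> (i + M))"
      using \<beta> by (intro sum_le_suminf) (auto simp: summable_iff_shift)
    moreover have "(\<Sum>i<n. norm (\<alpha> (i + M))) = (\<Sum>i<n. \<alpha> (i + M))"
      using nn by (intro sum.cong) auto
    ultimately show ?thesis using bd[of n] nn[of "n + M"] by linarith
  qed
  have "summable (\<lambda>i. norm (\<alpha> (i + M)))"
    by (rule summableI_nonneg_bounded[OF _ bound]) simp
  then show ?thesis using nn by (simp add: summable_iff_shift)
qed

text \<open>The division by \<open>Suc m\<close> beats the operator norm: at radius \<open>R\<close>
  the ratio \<open>R * K / Suc m\<close> is at most one half once \<open>m\<close> exceeds
  \<open>2 * R * K\<close>. This is solvability of a bounded linear equation with entire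
  forcing.\<close>

lemma entire_forced_recursion:
  assumes L: "bounded_linear L" and q: "entire q"
    and rec: "\<And>m. a (Suc m) = (1 / real (Suc m)) *\<^sub>R (L (a m) + q m)"
  shows "entire a"
  unfolding entire_def
proof (intro allI impI)
  fix R :: real assume R: "R \<ge> 0"
  obtain K where K: "K \<ge> 0" "\<And>x. norm (L x) \<le> norm x * K"
    using bounded_linear.nonneg_bounded[OF L] by blast
  show "summable (\<lambda>m. norm (a m) * R ^ m)"
  proof (rule summable_contraction_recursion[where M = "nat \<lceil>2 * R * K\<rceil>" and
        \<beta> = "\<lambda>m. R * (norm (q m) * R ^ m)"])
    show "summable (\<lambda>m. R * (norm (q m) * R ^ m))"
      using q R by (intro summable_mult) (auto simp: entire_def)
    show "norm (a (Suc m)) * R ^ Suc m \<le> norm (a m) * R ^ m / 2 + R * (norm (q m) * R ^ m)"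
      if "m \<ge> nat \<lceil>2 * R * K\<rceil>" for m
    proof -
      have m: "2 * R * K \<le> real (Suc m)" using that by linarith
      have "norm (a (Suc m)) \<le> (1 / real (Suc m)) * (norm (a m) * K + norm (q m))"
        unfolding rec norm_scaleR using norm_triangle_ineq[of "L (a m)" "q m"] K(2)[of "a m"]
        by (intro mult_mono) auto
      then have "norm (a (Suc m)) * R ^ Suc m \<le>
          (1 / real (Suc m)) * (norm (a m) * K + norm (q m)) * R ^ Suc m"
        using R by (intro mult_right_mono) auto
      also have "\<dots> = (R * K / real (Suc m)) * (norm (a m) * R ^ m) +
          (1 / real (Suc m)) * (R * (norm (q m) * R ^ m))"
        by (simp only: power_Suc divide_inverse distrib_left distrib_right mult_ac mult_1_left)
      also have "\<dots> \<le> (1 / 2) * (norm (a m) * R ^ m) + 1 * (R * (norm (q m) * R ^ m))"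
        using m R by (intro add_mono mult_right_mono) (auto simp: field_simps)
      finally show ?thesis by simp
    qed
  qed (use R in auto)
qed

section \<open>Degree expansion of a quadratic evolution equation\<close>

text \<open>Multiplying by the integrating factor \<open>exp (- a * t)\<close> and subtracting the
  particular solution leaves a nonincreasing function. As \<open>c > a\<close>, the forcing dictates
  the growth.\<close>

lemma exp_forced_gronwall:
  fixes f :: "real \<Rightarrow> real"
  assumes der: "\<And>t. (f has_real_derivative f' t) (at t)"
    and le: "\<And>t. t \<ge> 0 \<Longrightarrow> f' t \<le> a * f t + b * exp (c * t)"
    and "f 0 \<le> 0" "c > a" "b \<ge> 0" "t \<ge> 0"
  shows "f t \<le> b / (c - a) * exp (c * t)"
proof -
  define h where "h t = exp (- a * t) * f t - b / (c - a) * exp ((c - a) * t)" for t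
  define h' where "h' t = exp (- a * t) * (f' t - a * f t) - b * exp ((c - a) * t)" for t
  have "(h has_real_derivative exp (- a * x) * (- a) * f x + f' x * exp (- a * x) -
      b / (c - a) * (exp ((c - a) * x) * (c - a))) (at x)" for x
    unfolding h_def by (rule derivative_eq_intros der refl | simp)+
  moreover have "exp (- a * x) * (- a) * f x + f' x * exp (- a * x) -
      b / (c - a) * (exp ((c - a) * x) * (c - a)) = h' x" for x
  proof -
    have "b / (c - a) * (exp ((c - a) * x) * (c - a)) = b * exp ((c - a) * x)"
      using \<open>c > a\<close> by simp
    then show ?thesis unfolding h'_def by (simp add: algebra_simps)
  qed
  ultimately have "(h has_real_derivative h' x) (at x)" for x by metis
  moreover have "h' x \<le> 0" if "x \<ge> 0" for x
  proof -
    have "exp (- a * x) * (f' x - a * f x) \<le> exp (- a * x) * (b * exp (c * x))"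
      using le[OF that] by (intro mult_left_mono) auto
    also have "\<dots> = b * (exp (- a * x) * exp (c * x))"
      by (simp only: mult_ac)
    also have "exp (- a * x) * exp (c * x) = exp ((c - a) * x)"
      by (simp add: mult_exp_exp left_diff_distrib)
    finally show ?thesis by (simp add: h'_def)
  qed
  ultimately have "h t \<le> h 0"
    using DERIV_nonpos_imp_nonincreasing[OF \<open>t \<ge> 0\<close>, of h] by metis
  also have "h 0 = f 0 - b / (c - a)" by (simp add: h_def)
  also have "\<dots> \<le> 0"
  proof -
    have "b / (c - a) \<ge> 0" using assms(4,5) by (intro divide_nonneg_pos) auto
    then show ?thesis using assms(3) by linarith
  qed
  finally have "exp (- a * t) * f t \<le> b / (c - a) * exp ((c - a) * t)" by (simp add: h_def)
  then have "exp (a * t) * (exp (- a * t) * f t) \<le> exp (a * t) * (b / (c - a) * exp ((c - a) * t))"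
    by (intro mult_left_mono) auto
  moreover have "exp (a * t) * exp (- a * t) = 1" "exp (a * t) * exp ((c - a) * t) = exp (c * t)"
    by (simp_all add: mult_exp_exp left_diff_distrib)
  ultimately show ?thesis by (metis mult.assoc mult.left_commute mult_1)
qed

text \<open>Inverse squares are stable under convolution: from (a + b)^2 <= 2 (a^2 + b^2), a product
  of two inverse squares is at most 2 / j^2 times their sum, and each of the two resulting sums is
  at most 2. This is why the bounds on \<open>V j\<close> will carry a factor 1 / j^2.\<close>

lemma inverse_squares_convolution:
  assumes "j \<ge> 2"
  shows "(\<Sum>i\<in>{1..<j}. 1 / (real i)\<^sup>2 * (1 / (real (j - i))\<^sup>2)) \<le> 8 / (real j)\<^sup>2"
proof -
  have basel: "(\<Sum>i\<in>{1..<Suc n}. 1 / (real i)\<^sup>2) \<le> 2 - 1 / real n" if "n \<ge> 1" for n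
    using that
  proof (induction n rule: dec_induct)
    case (step n)
    have "1 / (real (Suc n))\<^sup>2 \<le> 1 / real n - 1 / real (Suc n)"
    proof -
      have "1 / (real (Suc n))\<^sup>2 \<le> 1 / (real n * real (Suc n))"
        using step by (intro divide_left_mono) (auto simp: power2_eq_square)
      also have "\<dots> = 1 / real n - 1 / real (Suc n)"
        using step by (simp add: field_simps)
      finally show ?thesis .
    qed
    then show ?case using step by simp
  qed simp
  have le2: "(\<Sum>i\<in>{1..<j}. 1 / (real i)\<^sup>2) \<le> 2"
  proof -
    have "Suc (j - 1) = j" "j - 1 \<ge> 1" using assms by auto
    then have "(\<Sum>i\<in>{1..<j}. 1 / (real i)\<^sup>2) \<le> 2 - 1 / real (j - 1)" using basel[of "j - 1"] by simp
    also have "\<dots> \<le> 2" by simp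
    finally show ?thesis .
  qed
  have refl: "(\<Sum>i\<in>{1..<j}. 1 / (real (j - i))\<^sup>2) = (\<Sum>i\<in>{1..<j}. 1 / (real i)\<^sup>2)"
    by (rule sum.reindex_bij_witness[where i = "\<lambda>i. j - i" and j = "\<lambda>i. j - i"]) auto
  have "1 / (real i)\<^sup>2 * (1 / (real (j - i))\<^sup>2) \<le>
      2 / (real j)\<^sup>2 * (1 / (real i)\<^sup>2 + 1 / (real (j - i))\<^sup>2)" if "i \<in> {1..<j}" for i
  proof -
    define a b where "a = real i" and "b = real (j - i)"
    have ab: "a > 0" "b > 0" "real j = a + b" using that by (auto simp: a_def b_def of_nat_diff)
    have abj: "real j = a + b" by (rule ab(3))
    have "(a + b)\<^sup>2 \<le> 2 * (a\<^sup>2 + b\<^sup>2)"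
      using sum_squares_bound[of a b] by (simp add: power2_sum)
    then have "2 * (a\<^sup>2 + b\<^sup>2) / (a + b)\<^sup>2 \<ge> 1"
      using ab by (subst le_divide_eq_1_pos) auto
    then have "1 * (1 / a\<^sup>2 * (1 / b\<^sup>2)) \<le>
        2 * (a\<^sup>2 + b\<^sup>2) / (a + b)\<^sup>2 * (1 / a\<^sup>2 * (1 / b\<^sup>2))"
      by (intro mult_right_mono) auto
    also have "\<dots> = 2 / (a + b)\<^sup>2 * ((a\<^sup>2 + b\<^sup>2) * (1 / a\<^sup>2 * (1 / b\<^sup>2)))"
      by simp
    also have "(a\<^sup>2 + b\<^sup>2) * (1 / a\<^sup>2 * (1 / b\<^sup>2)) = 1 / a\<^sup>2 + 1 / b\<^sup>2"
      using ab by (simp add: add_divide_distrib)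
    finally show ?thesis unfolding abj a_def b_def by simp
  qed
  then have "(\<Sum>i\<in>{1..<j}. 1 / (real i)\<^sup>2 * (1 / (real (j - i))\<^sup>2)) \<le>
      (\<Sum>i\<in>{1..<j}. 2 / (real j)\<^sup>2 * (1 / (real i)\<^sup>2 + 1 / (real (j - i))\<^sup>2))"
    by (intro sum_mono)
  also have "\<dots> = 2 / (real j)\<^sup>2 * (2 * (\<Sum>i\<in>{1..<j}. 1 / (real i)\<^sup>2))"
    unfolding sum_distrib_left[symmetric] sum.distrib refl by simp
  also have "\<dots> \<le> 2 / (real j)\<^sup>2 * (2 * 2)"
    using le2 by (intro mult_left_mono) auto
  finally show ?thesis by simp
qed

text \<open>
  \<open>V j\<close> is the coefficient of \<open>\<epsilon>^j\<close> in the solution of \<open>u' = L u + B u u\<close> with \<open>u 0 = \<epsilon> v\<close>, and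
  \<open>co j m\<close> is the \<open>m\<close>-th Taylor coefficient of \<open>V j\<close> in time. The operators carry the degree \<open>j\<close>
  because \<open>V j\<close> is measured in a norm that depends on \<open>j\<close>; the price of the lost derivative is the
  factor \<open>i + j\<close> in \<open>B_bound\<close>, which the time integral of \<open>exp (j \<Lambda> t)\<close> compensates.
\<close>

locale graded_evolution =
  fixes L :: "nat \<Rightarrow> 'a::banach \<Rightarrow> 'a" and B :: "nat \<Rightarrow> nat \<Rightarrow> 'a \<Rightarrow> 'a \<Rightarrow> 'a"
    and N :: "'a \<Rightarrow> 'a \<Rightarrow> real" and \<Lambda> \<gamma> c K C :: real and v :: 'a and S :: "'a set"
  assumes L: "\<And>j. j \<ge> 1 \<Longrightarrow> bounded_linear (L j)"
    and B: "\<And>i j. i \<ge> 1 \<Longrightarrow> j \<ge> 1 \<Longrightarrow> bounded_bilinear (B i j)"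
    and B_bound: "\<And>i j x y. i \<ge> 1 \<Longrightarrow> j \<ge> 1 \<Longrightarrow>
        norm (B i j x y) \<le> C * real (i + j) * norm x * norm y"
    and N: "bounded_bilinear N" "\<And>x y. N x y = N y x"
    and N_bounds: "c > 0" "\<And>x. c * (norm x)\<^sup>2 \<le> N x x" "\<And>x y. \<bar>N x y\<bar> \<le> K * norm x * norm y"
    and dissipative: "\<And>j x. j \<ge> 1 \<Longrightarrow> N x (L j x) \<le> \<gamma> * N x x"
    and rate: "0 \<le> \<gamma>" "\<gamma> < 2 * \<Lambda>" "0 \<le> C" "0 \<le> K"
    and v: "L 1 v = \<Lambda> *\<^sub>R v"
    and S: "subspace S" "closed S" "v \<in> S" "\<And>j x. j \<ge> 1 \<Longrightarrow> x \<in> S \<Longrightarrow> L j x \<in> S"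
      "\<And>i j x y. i \<ge> 1 \<Longrightarrow> j \<ge> 1 \<Longrightarrow> x \<in> S \<Longrightarrow> y \<in> S \<Longrightarrow> B i j x y \<in> S"
begin

function co :: "nat \<Rightarrow> nat \<Rightarrow> 'a" where
  "co j 0 = (if j = 1 then v else 0)"
| "co j (Suc m) = (1 / real (Suc m)) *\<^sub>R (L j (co j m) +
     (\<Sum>i\<in>{1..<j}. \<Sum>p\<le>m. B i (j - i) (co i p) (co (j - i) (m - p))))"
  by pat_completeness auto
termination
  by (relation "measures [fst, snd]") auto

definition V :: "nat \<Rightarrow> real \<Rightarrow> 'a" where
  "V j = curve (co j)"

lemma entire_co: "j \<ge> 1 \<Longrightarrow> entire (co j)"
proof (induction j rule: less_induct)
  case (less j)
  show ?case
  proof (rule entire_forced_recursion[OF L[OF less.prems]])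
    show "entire (\<lambda>m. \<Sum>i\<in>{1..<j}. \<Sum>p\<le>m. B i (j - i) (co i p) (co (j - i) (m - p)))"
      by (intro entire_sum entire_product B less.IH) auto
  qed simp
qed

definition forcing :: "nat \<Rightarrow> real \<Rightarrow> 'a" where
  "forcing j t = (\<Sum>i\<in>{1..<j}. B i (j - i) (V i t) (V (j - i) t))"

lemma V_deriv:
  assumes "j \<ge> 1"
  shows "(V j has_vector_derivative L j (V j t) + forcing j t) (at t)"
proof -
  let ?q = "\<lambda>m. \<Sum>i\<in>{1..<j}. \<Sum>p\<le>m. B i (j - i) (co i p) (co (j - i) (m - p))"
  have e: "entire (co i)" if "i \<ge> 1" for i using entire_co that .
  have q: "entire ?q"
    by (intro entire_sum entire_product B e) auto
  have fq: "forcing j t = curve ?q t"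
  proof -
    have "curve ?q t = (\<Sum>i\<in>{1..<j}. curve (\<lambda>m. \<Sum>p\<le>m. B i (j - i) (co i p) (co (j - i) (m - p))) t)"
      by (intro curve_sum entire_product B e) auto
    also have "\<dots> = (\<Sum>i\<in>{1..<j}. B i (j - i) (curve (co i) t) (curve (co (j - i)) t))"
      by (intro sum.cong refl entire_product B e) auto
    finally show ?thesis by (simp add: forcing_def V_def)
  qed
  have "curve (\<lambda>m. real (Suc m) *\<^sub>R co j (Suc m)) t = curve (\<lambda>m. L j (co j m) + ?q m) t"
    by simp
  also have "\<dots> = L j (V j t) + forcing j t"
    unfolding fq V_def curve_bounded_linear[OF e[OF assms] L[OF assms]]
    by (rule curve_add[OF entire_bounded_linear[OF e[OF assms] L[OF assms]] q])
  finally show ?thesis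
    using curve_deriv[OF e[OF assms], of t] by (simp add: V_def del: co.simps)
qed

lemma V_0: "V j 0 = (if j = 1 then v else 0)"
  by (simp add: V_def)

lemma co_in_S: "j \<ge> 1 \<Longrightarrow> co j m \<in> S"
proof (induction j m rule: co.induct)
  case (1 j)
  then show ?case using S(1,3) by (auto simp: subspace_0)
next
  case (2 j m)
  then show ?case
    using S by (auto intro!: subspace_mul subspace_add subspace_sum)
qed

lemma V_in_S: "j \<ge> 1 \<Longrightarrow> V j t \<in> S"
  unfolding V_def curve_def
proof -
  assume j: "j \<ge> 1"
  have "(\<lambda>n. \<Sum>m<n. t ^ m *\<^sub>R co j m) \<longlonglongrightarrow> (\<Sum>m. t ^ m *\<^sub>R co j m)"
    by (rule summable_LIMSEQ[OF entire_summable[OF entire_co[OF j]]])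
  then show "(\<Sum>m. t ^ m *\<^sub>R co j m) \<in> S"
    by (rule closed_sequentially[OF S(2), rotated])
       (auto intro!: subspace_sum subspace_mul S co_in_S j)
qed

text \<open>In degree 1 the forcing sum is empty and \<open>v\<close> is an eigenvector, so this
  term is exactly the linear solution.\<close>

lemma V_1: "V 1 t = exp (\<Lambda> * t) *\<^sub>R v"
proof -
  have "co 1 m = (\<Lambda> ^ m / fact m) *\<^sub>R v" for m
    by (induction m) (auto simp: linear_simps(5)[OF L[of 1, simplified]] v[simplified] field_simps)
  then have "V 1 t = (\<Sum>m. ((\<Lambda> * t) ^ m /\<^sub>R fact m) *\<^sub>R v)"
    by (simp add: V_def curve_def power_mult_distrib divide_inverse mult_ac)
  also have "\<dots> = exp (\<Lambda> * t) *\<^sub>R v"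
    unfolding exp_def
    by (rule bounded_linear.suminf[OF bounded_linear_scaleR_left, symmetric])
       (rule summable_exp_generic)
  finally show ?thesis .
qed

text \<open>Energy estimate with zero initial data. Young's inequality with parameter
  \<open>\<eta> = j * (\<Lambda> - \<gamma> / 2)\<close> splits off the forcing, and for
  \<open>j >= 2\<close> the rate of the squared forcing exceeds that of the energy by at least
  \<open>\<eta>\<close>. The resulting factor \<open>1 / \<eta>\<^sup>2\<close> for the squared norm
  is the gain \<open>1 / j\<close> that offsets the lost derivative.\<close>

lemma V_bound_step:
  assumes j: "j \<ge> 2" and q: "q \<ge> 0" "\<And>t. t \<ge> 0 \<Longrightarrow> norm (forcing j t) \<le> q * exp (j * \<Lambda> * t)"
    and t: "t \<ge> 0"
  shows "norm (V j t) \<le> K * q / (c * j * (\<Lambda> - \<gamma> / 2)) * exp (j * \<Lambda> * t)"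
proof -
  define \<beta> where "\<beta> = \<Lambda> - \<gamma> / 2"
  have \<beta>: "\<beta> > 0" using rate by (simp add: \<beta>_def)
  define \<eta> where "\<eta> = real j * \<beta>"
  have \<eta>: "\<eta> > 0" using \<beta> j by (simp add: \<eta>_def)
  define f' where "f' t = 2 * N (V j t) (L j (V j t) + forcing j t)" for t
  have "((\<lambda>t. N (V j t) (V j t)) has_vector_derivative f' t) (at t)" for t
    using bounded_bilinear.has_vector_derivative[OF N(1) V_deriv V_deriv, of j j t] j
    by (simp add: f'_def N(2))
  then have der: "((\<lambda>t. N (V j t) (V j t)) has_real_derivative f' t) (at t)" for t
    by (simp add: has_real_derivative_iff_has_vector_derivative)
  have "N (V j t) (V j t) \<le> (K\<^sup>2 * q\<^sup>2 / (\<eta> * c)) / (2 * j * \<Lambda> - (2 * \<gamma> + \<eta>)) * exp (2 * j * \<Lambda> * t)"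
  proof (rule exp_forced_gronwall[OF der])
    fix t :: real assume t: "t \<ge> 0"
    define x y where "x = norm (V j t)" and "y = norm (forcing j t)"
    have xy: "x \<ge> 0" "y \<ge> 0" by (auto simp: x_def y_def)
    have "N (V j t) (forcing j t) \<le> K * x * y"
      using N_bounds(3)[of "V j t" "forcing j t"] by (simp add: x_def y_def)
    moreover have "2 * (K * x * y) \<le> \<eta> * (c * x\<^sup>2) + K\<^sup>2 * y\<^sup>2 / (\<eta> * c)"
    proof -
      have pos: "\<eta> * c > 0" using \<eta> N_bounds(1) by simp
      have "0 \<le> (\<eta> * c * x - K * y)\<^sup>2 / (\<eta> * c)" using pos by simp
      also have "\<dots> = \<eta> * (c * x\<^sup>2) + K\<^sup>2 * y\<^sup>2 / (\<eta> * c) - 2 * (K * x * y)"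
      proof -
        have "(\<eta> * c * x - K * y)\<^sup>2 = \<eta> * c * (\<eta> * (c * x\<^sup>2)) + K\<^sup>2 * y\<^sup>2 - \<eta> * c * (2 * (K * x * y))"
          by (simp add: power2_diff power_mult_distrib) (simp add: power2_eq_square)
        moreover have "\<eta> \<noteq> 0" "c \<noteq> 0" using pos by auto
        ultimately show ?thesis by (simp add: add_divide_distrib diff_divide_distrib)
      qed
      finally show ?thesis by simp
    qed
    moreover have "\<eta> * (c * x\<^sup>2) \<le> \<eta> * N (V j t) (V j t)"
      using N_bounds(2)[of "V j t"] \<eta> by (intro mult_left_mono) (auto simp: x_def)
    moreover have "K\<^sup>2 * y\<^sup>2 / (\<eta> * c) \<le> K\<^sup>2 * q\<^sup>2 / (\<eta> * c) * exp (2 * j * \<Lambda> * t)"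
    proof -
      have "y\<^sup>2 \<le> (q * exp (j * \<Lambda> * t))\<^sup>2"
        using q(2)[OF t] by (intro power_mono) (auto simp: y_def)
      also have "\<dots> = q\<^sup>2 * exp (2 * j * \<Lambda> * t)"
        by (simp add: power_mult_distrib exp_double[symmetric] mult_ac)
      finally have "K\<^sup>2 / (\<eta> * c) * y\<^sup>2 \<le> K\<^sup>2 / (\<eta> * c) * (q\<^sup>2 * exp (2 * j * \<Lambda> * t))"
        using \<eta> N_bounds(1) by (intro mult_left_mono) auto
      then show ?thesis by simp
    qed
    moreover have "N (V j t) (L j (V j t)) \<le> \<gamma> * N (V j t) (V j t)"
      using dissipative j by simp
    ultimately show "f' t \<le> (2 * \<gamma> + \<eta>) * N (V j t) (V j t) + K\<^sup>2 * q\<^sup>2 / (\<eta> * c) * exp (2 * j * \<Lambda> * t)"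
      by (simp add: f'_def bounded_bilinear.add_right[OF N(1)] algebra_simps)
  next
    show "N (V j 0) (V j 0) \<le> 0"
      using j by (simp add: V_0 bounded_bilinear.zero_left[OF N(1)])
    have "real j * \<gamma> \<ge> 2 * \<gamma>" using j rate by (intro mult_right_mono) auto
    then show "2 * \<gamma> + \<eta> < 2 * j * \<Lambda>"
      using \<eta> by (simp add: \<eta>_def \<beta>_def algebra_simps)
    show "K\<^sup>2 * q\<^sup>2 / (\<eta> * c) \<ge> 0" using \<eta> N_bounds(1) by simp
  qed (rule t)
  also have "\<dots> \<le> (K\<^sup>2 * q\<^sup>2 / (\<eta> * c)) / \<eta> * exp (2 * j * \<Lambda> * t)"
  proof -
    have "real j * \<gamma> \<ge> 2 * \<gamma>" using j rate by (intro mult_right_mono) auto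
    then have "\<eta> \<le> 2 * j * \<Lambda> - (2 * \<gamma> + \<eta>)" by (simp add: \<eta>_def \<beta>_def algebra_simps)
    then show ?thesis
      using \<eta> N_bounds(1) by (intro mult_right_mono divide_left_mono) auto
  qed
  finally have "c * (norm (V j t))\<^sup>2 \<le> K\<^sup>2 * q\<^sup>2 / (\<eta> * c) / \<eta> * exp (2 * j * \<Lambda> * t)"
    using N_bounds(2)[of "V j t"] by linarith
  also have "\<dots> = c * (K * q / (c * \<eta>) * exp (j * \<Lambda> * t))\<^sup>2"
    using \<eta> N_bounds(1)
    by (simp add: power_mult_distrib power_divide exp_double[symmetric] mult_ac field_simps power2_eq_square)
       (simp add: mult_exp_exp)
  finally have "(norm (V j t))\<^sup>2 \<le> (K * q / (c * \<eta>) * exp (j * \<Lambda> * t))\<^sup>2"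
    using N_bounds(1) by simp
  then have "norm (V j t) \<le> K * q / (c * \<eta>) * exp (j * \<Lambda> * t)"
    by (rule power2_le_imp_le) (use q \<eta> N_bounds(1) rate in simp)
  then show ?thesis by (simp add: \<eta>_def \<beta>_def mult_ac)
qed

text \<open>Induction with the sharper bound \<open>\<alpha> * D ^ j / j\<^sup>2\<close>. Products
  of two such bounds reproduce it with the extra factor \<open>8 * \<kappa> * \<alpha>\<close>, the
  \<open>j\<close> of the lost derivative cancelling against the one gained in
  \<open>V_bound_step\<close>. The constant \<open>\<alpha>\<close> makes this factor at most 1, and
  \<open>D\<close> is then fixed by degree 1.\<close>

lemma V_bound:
  obtains D where "D > 0" "\<And>j t. j \<ge> 1 \<Longrightarrow> t \<ge> 0 \<Longrightarrow> norm (V j t) \<le> D ^ j * exp (j * \<Lambda> * t)"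
proof -
  define \<kappa> where "\<kappa> = K * C / (c * (\<Lambda> - \<gamma> / 2))"
  have \<kappa>: "\<kappa> \<ge> 0" using rate N_bounds(1) by (simp add: \<kappa>_def)
  define \<alpha> where "\<alpha> = 1 / (8 * \<kappa> + 1)"
  have \<alpha>: "\<alpha> > 0" "\<alpha> \<le> 1" "8 * \<kappa> * \<alpha> \<le> 1" using \<kappa> by (auto simp: \<alpha>_def field_simps)
  define D where "D = (norm v + 1) / \<alpha>"
  have D: "D > 0" using \<alpha> by (simp add: D_def add_nonneg_pos)
  have *: "norm (V j t) \<le> \<alpha> * D ^ j / (real j)\<^sup>2 * exp (j * \<Lambda> * t)" if "j \<ge> 1" "t \<ge> 0" for j t
    using that
  proof (induction j arbitrary: t rule: less_induct)
    case (less j)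
    show ?case
    proof (cases "j = 1")
      case True
      then show ?thesis using \<alpha> by (simp add: V_1[simplified] D_def)
    next
      case False
      then have j: "j \<ge> 2" using less.prems by simp
      define q where "q = C * real j * (\<alpha>\<^sup>2 * D ^ j * (8 / (real j)\<^sup>2))"
      have "norm (forcing j t) \<le> q * exp (j * \<Lambda> * t)" if t: "t \<ge> 0" for t
      proof -
        have "norm (B i (j - i) (V i t) (V (j - i) t)) \<le> C * real j * (\<alpha>\<^sup>2 * D ^ j * (1 / (real i)\<^sup>2 *
            (1 / (real (j - i))\<^sup>2))) * exp (j * \<Lambda> * t)" if i: "i \<in> {1..<j}" for i
        proof -
          have "norm (B i (j - i) (V i t) (V (j - i) t)) \<le>
              C * real j * (norm (V i t) * norm (V (j - i) t))"
          proof -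
            have "i + (j - i) = j" "i \<ge> 1" "j - i \<ge> 1" using i by auto
            then show ?thesis
              using B_bound[of i "j - i" "V i t" "V (j - i) t"] by (simp only: mult.assoc)
          qed
          also have "\<dots> \<le> C * real j * ((\<alpha> * D ^ i / (real i)\<^sup>2 * exp (i * \<Lambda> * t)) *
              (\<alpha> * D ^ (j - i) / (real (j - i))\<^sup>2 * exp (real (j - i) * \<Lambda> * t)))"
            using i rate less.IH[of i t] less.IH[of "j - i" t] t \<alpha> D
            by (intro mult_left_mono mult_mono) auto
          also have "\<dots> = C * real j * (\<alpha>\<^sup>2 * (D ^ i * D ^ (j - i)) * (1 / (real i)\<^sup>2 *
            (1 / (real (j - i))\<^sup>2))) * (exp (i * \<Lambda> * t) * exp (real (j - i) * \<Lambda> * t))"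
            by (simp add: power2_eq_square)
          also have "D ^ i * D ^ (j - i) = D ^ j" using i by (simp add: power_add[symmetric])
          also have "exp (i * \<Lambda> * t) * exp (real (j - i) * \<Lambda> * t) = exp (j * \<Lambda> * t)"
            using i by (simp add: mult_exp_exp of_nat_diff algebra_simps)
          finally show ?thesis .
        qed
        then have "norm (forcing j t) \<le> (\<Sum>i\<in>{1..<j}. C * real j * (\<alpha>\<^sup>2 * D ^ j * (1 / (real i)\<^sup>2 *
            (1 / (real (j - i))\<^sup>2))) * exp (j * \<Lambda> * t))"
          unfolding forcing_def by (intro sum_norm_le)
        also have "\<dots> = C * real j * (\<alpha>\<^sup>2 * D ^ j * (\<Sum>i\<in>{1..<j}. 1 / (real i)\<^sup>2 *
            (1 / (real (j - i))\<^sup>2))) * exp (j * \<Lambda> * t)"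
          by (simp only: sum_distrib_left sum_distrib_right)
        also have "\<dots> \<le> q * exp (j * \<Lambda> * t)"
          unfolding q_def using inverse_squares_convolution[OF j] rate D
          by (intro mult_right_mono mult_left_mono) auto
        finally show ?thesis .
      qed
      then have "norm (V j t) \<le> K * q / (c * j * (\<Lambda> - \<gamma> / 2)) * exp (j * \<Lambda> * t)"
        using less.prems rate D by (intro V_bound_step[OF j]) (auto simp: q_def)
      also have "K * q / (c * j * (\<Lambda> - \<gamma> / 2)) = (8 * \<kappa> * \<alpha>) * (\<alpha> * D ^ j / (real j)\<^sup>2)"
        using j by (simp add: q_def \<kappa>_def power2_eq_square) (simp only: mult_ac)
      also have "\<dots> \<le> 1 * (\<alpha> * D ^ j / (real j)\<^sup>2)"
        using \<alpha> D by (intro mult_right_mono) auto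
      finally show ?thesis by simp
    qed
  qed
  have "norm (V j t) \<le> D ^ j * exp (j * \<Lambda> * t)" if "j \<ge> 1" "t \<ge> 0" for j t
  proof -
    have "\<alpha> * D ^ j / (real j)\<^sup>2 \<le> 1 * D ^ j / 1"
      using \<alpha> D that by (intro frac_le mult_right_mono) auto
    then show ?thesis
      using *[OF that] by (smt (verit) exp_gt_zero mult_right_mono div_by_1 mult_1)
  qed
  then show ?thesis using that D by blast
qed

end

section \<open>Weighted sequence spaces: convolutions, energy form, and solution of the equation for
  the coefficients\<close>

section \<open>Weighted convolutions and the energy form\<close>

lemma inner_wop:
  assumes "bij \<pi>" "\<And>i. \<bar>d i\<bar> \<le> B"
  shows "inner (wop d \<pi> x) y = inner x (wop (d \<circ> inv \<pi>) (inv \<pi>) y)"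
proof -
  have b': "bij (inv \<pi>)" using assms(1) by (rule bij_imp_bij_inv)
  have c1: "coord (wop d \<pi> x) i = d i * coord x (\<pi> i)" for i
    by (rule coord_wop) (use assms in \<open>auto simp: bij_is_inj\<close>)
  have c2: "coord (wop (d \<circ> inv \<pi>) (inv \<pi>) y) i = d (inv \<pi> i) * coord y (inv \<pi> i)" for i
    by (subst coord_wop) (use assms b' in \<open>auto simp: bij_is_inj\<close>)
  show ?thesis
    unfolding inner_ell2_def c1 c2
    by (subst infsum_reindex_bij_betw[OF assms(1), symmetric])
       (simp add: inv_f_f[OF bij_is_inj[OF assms(1)]] mult_ac)
qed

definition conv :: "('a::ab_group_add \<Rightarrow> 'a \<Rightarrow> real) \<Rightarrow> 'a ell2 \<Rightarrow> 'a ell2 \<Rightarrow> 'a ell2" where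
  "conv \<kappa> x y = of_coord (\<lambda>\<zeta>. \<Sum>\<^sub>\<infinity>\<eta>. \<kappa> \<eta> (\<zeta> - \<eta>) * coord x \<eta> * coord y (\<zeta> - \<eta>))"

text \<open>The convolution is a sum of shifted copies of \<open>y\<close> whose norms are
  controlled by \<open>x \<eta> * p \<eta>\<close>. These are absolutely summable by Cauchy-Schwarz,
  so the sum converges in norm.\<close>

lemma conv_left_weighted:
  fixes \<kappa> :: "'a::ab_group_add \<Rightarrow> 'a \<Rightarrow> real"
  assumes bd: "\<And>\<eta> \<xi>. \<bar>\<kappa> \<eta> \<xi>\<bar> \<le> C * coord p \<eta>" and C: "C \<ge> 0"
  shows "\<exists>z. (\<forall>\<zeta>. ((\<lambda>\<eta>. \<kappa> \<eta> (\<zeta> - \<eta>) * coord x \<eta> * coord y (\<zeta> - \<eta>)) has_sum coord z \<zeta>) UNIV) \<and>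
     norm z \<le> C * norm p * norm x * norm y"
proof -
  define T where "T \<eta> = coord x \<eta> *\<^sub>R wop (\<lambda>\<zeta>. \<kappa> \<eta> (\<zeta> - \<eta>)) (\<lambda>\<zeta>. \<zeta> - \<eta>) y" for \<eta>
  have inj: "inj (\<lambda>\<zeta>. \<zeta> - \<eta>)" for \<eta> :: 'a by (auto simp: inj_def)
  have coordT: "coord (T \<eta>) \<zeta> = \<kappa> \<eta> (\<zeta> - \<eta>) * coord x \<eta> * coord y (\<zeta> - \<eta>)" for \<eta> \<zeta>
    by (simp add: T_def coord_wop[OF inj bd])
  have pa: "\<bar>coord p \<eta>\<bar> \<le> norm (coord p \<eta>)" for \<eta> by simp
  have p: "C * coord p \<eta> \<ge> 0" for \<eta> using bd[of \<eta> 0] by (meson abs_ge_zero order_trans)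
  have nT: "norm (T \<eta>) \<le> C * norm y * \<bar>coord x \<eta> * coord p \<eta>\<bar>" for \<eta>
  proof -
    have "norm (T \<eta>) \<le> \<bar>coord x \<eta>\<bar> * (C * coord p \<eta> * norm y)"
      unfolding T_def norm_scaleR by (intro mult_left_mono norm_wop inj bd) auto
    also have "C * coord p \<eta> \<le> C * \<bar>coord p \<eta>\<bar>" using C by (intro mult_left_mono) auto
    then have "\<bar>coord x \<eta>\<bar> * (C * coord p \<eta> * norm y) \<le> \<bar>coord x \<eta>\<bar> * (C * \<bar>coord p \<eta>\<bar> * norm y)"
      using C by (intro mult_left_mono mult_right_mono) auto
    finally show ?thesis by (simp add: abs_mult mult_ac)
  qed
  have xp: "(\<lambda>\<eta>. \<bar>coord x \<eta> * coord p \<eta>\<bar>) summable_on UNIV"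
    using summable_on_iff_abs_summable_on_real[THEN iffD1, OF ell2_inner_summable[of x p]]
    unfolding real_norm_def .
  have sT: "(\<lambda>\<eta>. norm (T \<eta>)) summable_on UNIV"
    by (rule summable_on_comparison_test[OF summable_on_cmult_right[OF xp]]) (use nT in auto)
  then have hs: "(T has_sum (\<Sum>\<^sub>\<infinity>\<eta>. T \<eta>)) UNIV"
    using abs_summable_summable by (intro has_sum_infsum) blast
  have "norm (\<Sum>\<^sub>\<infinity>\<eta>. T \<eta>) \<le> (\<Sum>\<^sub>\<infinity>\<eta>. C * norm y * \<bar>coord x \<eta> * coord p \<eta>\<bar>)"
    using norm_infsum_bound[OF sT] infsum_mono[OF sT summable_on_cmult_right[OF xp] nT]
    by (meson UNIV_I order_trans)
  also have "\<dots> = C * norm y * (\<Sum>\<^sub>\<infinity>\<eta>. \<bar>coord x \<eta> * coord p \<eta>\<bar>)"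
    by (rule infsum_cmult_right')
  also have "(\<Sum>\<^sub>\<infinity>\<eta>. \<bar>coord x \<eta> * coord p \<eta>\<bar>) \<le> norm x * norm p"
  proof (rule infsum_le_finite_sums[OF xp])
    fix F :: "'a set" assume F: "finite F"
    have "(\<Sum>\<eta>\<in>F. \<bar>coord x \<eta> * coord p \<eta>\<bar>) \<le> L2_set (coord x) F * L2_set (coord p) F"
      using L2_set_mult_ineq[of "coord x" "coord p" F] by (simp add: abs_mult)
    also have "\<dots> \<le> norm x * norm p"
      using ell2_norm_sq_finite[OF F]
      by (intro mult_mono) (auto simp: L2_set_def real_sqrt_le_iff' intro!: real_le_lsqrt sum_nonneg)
    finally show "(\<Sum>\<eta>\<in>F. \<bar>coord x \<eta> * coord p \<eta>\<bar>) \<le> norm x * norm p" .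
  qed
  then have "C * norm y * (\<Sum>\<^sub>\<infinity>\<eta>. \<bar>coord x \<eta> * coord p \<eta>\<bar>) \<le> C * norm y * (norm x * norm p)"
    using C by (intro mult_left_mono) auto
  finally have n: "norm (\<Sum>\<^sub>\<infinity>\<eta>. T \<eta>) \<le> C * norm p * norm x * norm y" by (simp add: mult_ac)
  have "((\<lambda>\<eta>. coord (T \<eta>) \<zeta>) has_sum coord (\<Sum>\<^sub>\<infinity>\<eta>. T \<eta>) \<zeta>) UNIV" for \<zeta>
    by (rule has_sum_bounded_linear[OF bounded_linear_coord hs])
  then show ?thesis unfolding coordT using n by blast
qed

text \<open>The kernel is split by the partition of unity \<open>q\<close>. Each part is dominated
  by one of the two weights alone and is treated as a sum of shifts of the other factor.\<close>

lemma conv_weighted: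
  fixes \<kappa> :: "'a::ab_group_add \<Rightarrow> 'a \<Rightarrow> real"
  assumes bd: "\<And>\<eta> \<xi>. \<bar>\<kappa> \<eta> \<xi>\<bar> \<le> C * (coord p \<eta> + coord p \<xi>)" and p: "\<And>\<eta>. coord p \<eta> > 0" and C: "C \<ge> 0"
  shows "((\<lambda>\<eta>. \<kappa> \<eta> (\<zeta> - \<eta>) * coord x \<eta> * coord y (\<zeta> - \<eta>)) has_sum coord (conv \<kappa> x y) \<zeta>) UNIV"
    and "norm (conv \<kappa> x y) \<le> 2 * C * norm p * norm x * norm y"
proof -
  define q where "q \<eta> \<xi> = coord p \<eta> / (coord p \<eta> + coord p \<xi>)" for \<eta> \<xi>
  have q1: "\<bar>\<kappa> \<eta> \<xi> * q \<eta> \<xi>\<bar> \<le> C * coord p \<eta>" for \<eta> \<xi>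
  proof -
    have pp: "coord p \<eta> + coord p \<xi> > 0" using p[of \<eta>] p[of \<xi>] by simp
    have "\<bar>\<kappa> \<eta> \<xi>\<bar> * q \<eta> \<xi> \<le> C * (coord p \<eta> + coord p \<xi>) * q \<eta> \<xi>"
      using bd pp p[of \<eta>] by (intro mult_right_mono) (auto simp: q_def)
    also have "\<dots> = C * coord p \<eta>" using pp by (simp add: q_def)
    finally show ?thesis using pp p[of \<eta>] by (simp add: abs_mult q_def)
  qed
  have q2: "\<bar>\<kappa> \<eta> \<xi> * q \<xi> \<eta>\<bar> \<le> C * coord p \<xi>" for \<eta> \<xi>
  proof -
    have pp: "coord p \<eta> + coord p \<xi> > 0" using p[of \<eta>] p[of \<xi>] by simp
    have "\<bar>\<kappa> \<eta> \<xi>\<bar> * q \<xi> \<eta> \<le> C * (coord p \<eta> + coord p \<xi>) * q \<xi> \<eta>"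
      using bd pp p[of \<xi>] by (intro mult_right_mono) (auto simp: q_def)
    also have "\<dots> = C * coord p \<xi>" using pp by (simp add: q_def add.commute)
    finally show ?thesis using pp p[of \<xi>] by (simp add: abs_mult q_def add.commute)
  qed
  have q12: "q \<eta> \<xi> + q \<xi> \<eta> = 1" for \<eta> \<xi>
    using p[of \<eta>] p[of \<xi>] by (simp add: q_def add.commute add_divide_distrib[symmetric])
  obtain z1 where z1: "\<And>\<zeta>. ((\<lambda>\<eta>. \<kappa> \<eta> (\<zeta> - \<eta>) * q \<eta> (\<zeta> - \<eta>) * coord x \<eta> * coord y (\<zeta> - \<eta>))
      has_sum coord z1 \<zeta>) UNIV" "norm z1 \<le> C * norm p * norm x * norm y"
    using conv_left_weighted[of "\<lambda>\<eta> \<xi>. \<kappa> \<eta> \<xi> * q \<eta> \<xi>", OF q1 C] by blast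
  obtain z2 where z2: "\<And>\<zeta>. ((\<lambda>\<xi>. \<kappa> (\<zeta> - \<xi>) \<xi> * q \<xi> (\<zeta> - \<xi>) * coord y \<xi> * coord x (\<zeta> - \<xi>))
      has_sum coord z2 \<zeta>) UNIV" "norm z2 \<le> C * norm p * norm y * norm x"
    using conv_left_weighted[of "\<lambda>\<eta> \<xi>. \<kappa> \<xi> \<eta> * q \<eta> \<xi>", OF q2 C] by blast
  have z2': "((\<lambda>\<eta>. \<kappa> \<eta> (\<zeta> - \<eta>) * q (\<zeta> - \<eta>) \<eta> * coord y (\<zeta> - \<eta>) * coord x \<eta>)
      has_sum coord z2 \<zeta>) UNIV" for \<zeta>
    using z2(1)[of \<zeta>]
    by (subst (asm) has_sum_reindex_bij_witness[where S = UNIV and T = UNIV and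
          i = "\<lambda>\<xi>. \<zeta> - \<xi>" and j = "\<lambda>\<xi>. \<zeta> - \<xi>" and
          h = "\<lambda>\<eta>. \<kappa> \<eta> (\<zeta> - \<eta>) * q (\<zeta> - \<eta>) \<eta> * coord y (\<zeta> - \<eta>) * coord x \<eta>" and
          s' = "coord z2 \<zeta>"]) auto
  have main: "((\<lambda>\<eta>. \<kappa> \<eta> (\<zeta> - \<eta>) * coord x \<eta> * coord y (\<zeta> - \<eta>)) has_sum coord (z1 + z2) \<zeta>) UNIV" for \<zeta>
  proof -
    have "\<kappa> \<eta> (\<zeta> - \<eta>) * q \<eta> (\<zeta> - \<eta>) * coord x \<eta> * coord y (\<zeta> - \<eta>) +
        \<kappa> \<eta> (\<zeta> - \<eta>) * q (\<zeta> - \<eta>) \<eta> * coord y (\<zeta> - \<eta>) * coord x \<eta> =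
      \<kappa> \<eta> (\<zeta> - \<eta>) * coord x \<eta> * coord y (\<zeta> - \<eta>) * (q \<eta> (\<zeta> - \<eta>) + q (\<zeta> - \<eta>) \<eta>)" for \<eta>
      by (simp add: algebra_simps)
    then show ?thesis using has_sum_add[OF z1(1)[of \<zeta>] z2'[of \<zeta>]] by (simp add: q12)
  qed
  have "conv \<kappa> x y = z1 + z2"
    unfolding conv_def infsumI[OF main] by (rule coord_inverse)
  moreover have "norm (z1 + z2) \<le> 2 * C * norm p * norm x * norm y"
    using norm_triangle_ineq[of z1 z2] z1(2) z2(2) by (simp add: mult_ac)
  ultimately show "((\<lambda>\<eta>. \<kappa> \<eta> (\<zeta> - \<eta>) * coord x \<eta> * coord y (\<zeta> - \<eta>)) has_sum coord (conv \<kappa> x y) \<zeta>) UNIV"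
    "norm (conv \<kappa> x y) \<le> 2 * C * norm p * norm x * norm y" using main by auto
qed

lemma bounded_bilinear_conv:
  fixes \<kappa> :: "'a::ab_group_add \<Rightarrow> 'a \<Rightarrow> real"
  assumes bd: "\<And>\<eta> \<xi>. \<bar>\<kappa> \<eta> \<xi>\<bar> \<le> C * (coord p \<eta> + coord p \<xi>)" and p: "\<And>\<eta>. coord p \<eta> > 0" and C: "C \<ge> 0"
  shows "bounded_bilinear (conv \<kappa>)"
proof
  note hs = conv_weighted(1)[OF bd p C]
  fix a a' b b' :: "'a ell2" and r :: real
  show "conv \<kappa> (a + a') b = conv \<kappa> a b + conv \<kappa> a' b"
    by (intro ell2_eqI has_sum_unique[OF hs])
       (use has_sum_add[OF hs[of _ a b] hs[of _ a' b]] in \<open>simp add: algebra_simps\<close>)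
  show "conv \<kappa> a (b + b') = conv \<kappa> a b + conv \<kappa> a b'"
    by (intro ell2_eqI has_sum_unique[OF hs])
       (use has_sum_add[OF hs[of _ a b] hs[of _ a b']] in \<open>simp add: algebra_simps\<close>)
  show "conv \<kappa> (r *\<^sub>R a) b = r *\<^sub>R conv \<kappa> a b"
    by (intro ell2_eqI has_sum_unique[OF hs])
       (use has_sum_cmult_right[OF hs[of _ a b], of r] in \<open>simp add: algebra_simps\<close>)
  show "conv \<kappa> a (r *\<^sub>R b) = r *\<^sub>R conv \<kappa> a b"
    by (intro ell2_eqI has_sum_unique[OF hs])
       (use has_sum_cmult_right[OF hs[of _ a b], of r] in \<open>simp add: algebra_simps\<close>)
  show "\<exists>K. \<forall>a b. norm (conv \<kappa> a b) \<le> norm a * norm b * K"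
    using conv_weighted(2)[OF bd p C] by (intro exI[of _ "2 * C * norm p"]) (simp add: mult_ac)
qed

text \<open>Abstract form of the linearisation: f' = c D g and g' = - E A f, with \<open>E\<close>
  adjoint to \<open>D\<close> and \<open>A\<close> symmetric but indefinite. Eliminating f gives g''
  = - c E A D g, whose potential energy \<open>lower\<close> bounds from below.\<close>

locale energy =
  fixes D E A :: "'a::real_inner \<Rightarrow> 'a" and c d \<Lambda> \<eta> :: real
  assumes D: "bounded_linear D" and E: "bounded_linear E" and A: "bounded_linear A"
    and adj: "\<And>x y. inner (D x) y = inner x (E y)"
    and sym: "\<And>x y. inner (A x) y = inner x (A y)"
    and c: "c > 0" and d: "d > 0" "\<And>x. norm (D x) \<le> d * norm x" and \<Lambda>: "\<Lambda> > 0" and \<eta>: "\<eta> > 0"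
    and lower: "\<And>g. - (\<Lambda>\<^sup>2 * (norm g)\<^sup>2) \<le> c * inner (A (D g)) (D g)"
begin

text \<open>Chosen so that \<open>sqrt \<theta> * c * d = \<eta> * \<Lambda>\<close>: the last term
  of \<open>N\<close> then controls the first component at a cost of at most \<open>\<eta>\<close>
  in the growth rate.\<close>

definition \<theta> :: real where "\<theta> = (\<eta> * \<Lambda> / (c * d))\<^sup>2"

definition gen :: "'a \<times> 'a \<Rightarrow> 'a \<times> 'a" where
  "gen x = (c *\<^sub>R D (snd x), - E (A (fst x)))"

text \<open>The conserved energy of g'' = - c E A D g, with kinetic part E A f, plus 2 \<Lambda>^2
  times the squared norm of g, which makes it coercive in g, plus a small multiple of the squared
  norm of f.\<close>

definition N :: "'a \<times> 'a \<Rightarrow> 'a \<times> 'a \<Rightarrow> real" where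
  "N x y = inner (E (A (fst x))) (E (A (fst y))) + 2 * \<Lambda>\<^sup>2 * inner (snd x) (snd y) +
     c * inner (A (D (snd x))) (D (snd y)) + \<theta> * inner (fst x) (fst y)"

lemma \<theta>_pos: "\<theta> > 0"
  using c d \<Lambda> \<eta> by (simp add: \<theta>_def)

lemma N_sym: "N x y = N y x"
proof -
  have "inner (A (D (snd x))) (D (snd y)) = inner (A (D (snd y))) (D (snd x))"
    by (metis sym inner_commute)
  then show ?thesis by (simp only: N_def inner_commute[of "fst x"] inner_commute[of "snd x"]
      inner_commute[of "E (A (fst x))"])
qed

lemma N_bounded: "\<exists>K\<ge>0. \<forall>x y. \<bar>N x y\<bar> \<le> K * norm x * norm y"
proof -
  obtain e where e: "e \<ge> 0" "\<And>x. norm (E (A x)) \<le> norm x * e"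
    using bounded_linear.nonneg_bounded[OF bounded_linear_compose[OF E A]] by blast
  obtain a where a: "a \<ge> 0" "\<And>x. norm (A (D x)) \<le> norm x * a"
    using bounded_linear.nonneg_bounded[OF bounded_linear_compose[OF A D]] by blast
  have fs: "norm (fst x) \<le> norm x" "norm (snd x) \<le> norm x" for x :: "'a \<times> 'a"
    by (cases x; simp add: norm_fst_le norm_snd_le)+
  have cs: "\<bar>inner u v\<bar> \<le> (r * norm x) * (t * norm y)"
    if "norm u \<le> r * norm x" "norm v \<le> t * norm y" for u v and x y :: "'a \<times> 'a" and r t
  proof -
    have "norm u * norm v \<le> (r * norm x) * (t * norm y)"
      using that order_trans[OF norm_ge_zero that(1)] by (intro mult_mono) auto
    then show ?thesis using Cauchy_Schwarz_ineq2[of u v] by linarith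
  qed
  have EA: "norm (E (A (fst x))) \<le> e * norm x" "norm (A (D (snd x))) \<le> a * norm x"
    "norm (D (snd x)) \<le> d * norm x" for x
    using order_trans[OF e(2) mult_right_mono[OF fs(1)[of x] e(1)]]
      order_trans[OF a(2) mult_right_mono[OF fs(2)[of x] a(1)]]
      order_trans[OF d(2) mult_left_mono[OF fs(2)[of x] less_imp_le[OF d(1)]]]
    by (simp_all add: mult.commute)
  have "\<bar>N x y\<bar> \<le> (e * e + 2 * \<Lambda>\<^sup>2 + c * (a * d) + \<theta>) * norm x * norm y" for x y
  proof -
    have "\<bar>N x y\<bar> \<le> \<bar>inner (E (A (fst x))) (E (A (fst y)))\<bar> + 2 * \<Lambda>\<^sup>2 * \<bar>inner (snd x) (snd y)\<bar> +
       c * \<bar>inner (A (D (snd x))) (D (snd y))\<bar> + \<theta> * \<bar>inner (fst x) (fst y)\<bar>"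
      unfolding N_def using c \<theta>_pos
      by (intro order_trans[OF abs_triangle_ineq] add_mono) (auto simp: abs_mult)
    also have "\<dots> \<le> (e * norm x) * (e * norm y) + 2 * \<Lambda>\<^sup>2 * ((1 * norm x) * (1 * norm y)) +
       c * ((a * norm x) * (d * norm y)) + \<theta> * ((1 * norm x) * (1 * norm y))"
      using c \<theta>_pos fs EA by (intro add_mono mult_left_mono cs) auto
    finally show ?thesis by (simp add: algebra_simps)
  qed
  then show ?thesis
    using e a d c \<theta>_pos by (intro exI[of _ "e * e + 2 * \<Lambda>\<^sup>2 + c * (a * d) + \<theta>"]) auto
qed

lemma bounded_bilinear_N: "bounded_bilinear N"
proof
  note lin = linear_simps[OF D] linear_simps[OF E] linear_simps[OF A]
  fix a a' b b' :: "'a \<times> 'a" and r :: real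
  show "N (a + a') b = N a b + N a' b" "N a (b + b') = N a b + N a b'"
    by (simp_all add: N_def lin inner_add_left inner_add_right algebra_simps)
  show "N (r *\<^sub>R a) b = r *\<^sub>R N a b" "N a (r *\<^sub>R b) = r *\<^sub>R N a b"
    by (simp_all add: N_def lin algebra_simps)
  show "\<exists>K. \<forall>a b. norm (N a b) \<le> norm a * norm b * K"
    using N_bounded by (auto simp: mult_ac)
qed

lemma N_ge: "norm (E (A (fst x))) ^ 2 + \<Lambda>\<^sup>2 * norm (snd x) ^ 2 + \<theta> * norm (fst x) ^ 2 \<le> N x x"
  using lower[of "snd x"] by (simp add: N_def power2_norm_eq_inner[symmetric])

lemma N_coercive: "min (\<Lambda>\<^sup>2) \<theta> * (norm x)\<^sup>2 \<le> N x x"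
proof -
  have "(norm x)\<^sup>2 = (norm (fst x))\<^sup>2 + (norm (snd x))\<^sup>2"
    by (cases x) (simp add: norm_Pair)
  then have "min (\<Lambda>\<^sup>2) \<theta> * (norm x)\<^sup>2 =
      min (\<Lambda>\<^sup>2) \<theta> * (norm (snd x))\<^sup>2 + min (\<Lambda>\<^sup>2) \<theta> * (norm (fst x))\<^sup>2"
    by (simp add: distrib_left)
  also have "\<dots> \<le> \<Lambda>\<^sup>2 * norm (snd x) ^ 2 + \<theta> * norm (fst x) ^ 2"
    by (intro add_mono mult_right_mono) auto
  also have "\<dots> \<le> N x x" using N_ge[of x] zero_le_power2[of "norm (E (A (fst x)))"] by linarith
  finally show ?thesis .
qed

text \<open>In \<^term>\<open>N x (gen x)\<close> the two indefinite contributions of \<^term>\<open>c * inner (A (D g)) (D g)\<close> cancel.\<close>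

lemma N_gen: "N x (gen x) \<le> (\<Lambda> + \<eta>) * N x x"
proof -
  obtain f g where x: "x = (f, g)" by fastforce
  define u where "u = E (A f)"
  have "inner (E (A f)) (E (A (D g))) = inner (A (D g)) (D u)"
    unfolding u_def by (metis adj inner_commute)
  then have "N x (gen x) = - 2 * \<Lambda>\<^sup>2 * inner g u + \<theta> * c * inner f (D g)"
    by (simp add: x N_def gen_def linear_simps[OF A] linear_simps[OF E] linear_simps[OF D] u_def algebra_simps)
  \<comment> \<open>The first term is paid for by the kinetic part and the norm of \<open>g\<close>
    at rate \<open>\<Lambda>\<close>, the second by the norms of \<open>f\<close> and
    \<open>g\<close> at rate \<open>\<eta>\<close>.\<close>
  also have "\<dots> \<le> \<Lambda> * (norm u ^ 2 + \<Lambda>\<^sup>2 * norm g ^ 2) + \<eta> * (\<theta> * norm f ^ 2 + \<Lambda>\<^sup>2 * norm g ^ 2)"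
  proof (rule add_mono)
    have "- (inner g u) \<le> norm g * norm u"
      using Cauchy_Schwarz_ineq2[of g u] by linarith
    then have "2 * \<Lambda>\<^sup>2 * (- (inner g u)) \<le> 2 * \<Lambda>\<^sup>2 * (norm g * norm u)"
      by (intro mult_left_mono) auto
    also have "\<dots> = \<Lambda> * (2 * norm u * (\<Lambda> * norm g))" by (simp add: power2_eq_square)
    also have "\<dots> \<le> \<Lambda> * (norm u ^ 2 + (\<Lambda> * norm g)\<^sup>2)"
      using \<Lambda> by (intro mult_left_mono sum_squares_bound) auto
    finally show "- 2 * \<Lambda>\<^sup>2 * inner g u \<le> \<Lambda> * (norm u ^ 2 + \<Lambda>\<^sup>2 * norm g ^ 2)"
      by (simp add: power_mult_distrib)
    define \<sigma> where "\<sigma> = \<eta> * \<Lambda> / (c * d)"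
    have \<sigma>: "\<sigma> > 0" "\<theta> = \<sigma>\<^sup>2" "\<sigma> * (c * d) = \<eta> * \<Lambda>" using c d \<Lambda> \<eta> by (auto simp: \<sigma>_def \<theta>_def)
    have "inner f (D g) \<le> norm f * (d * norm g)"
      using Cauchy_Schwarz_ineq2[of f "D g"] mult_left_mono[OF d(2)[of g], of "norm f"] by auto
    then have "\<theta> * c * inner f (D g) \<le> \<theta> * c * (norm f * (d * norm g))"
      using \<theta>_pos c by (intro mult_left_mono) auto
    also have "\<dots> = \<sigma> * (\<sigma> * (c * d)) * norm f * norm g" by (simp add: \<sigma> power2_eq_square)
    also have "\<dots> = \<eta> * ((\<sigma> * norm f) * (\<Lambda> * norm g))" unfolding \<sigma>(3) by simp
    also have "(\<sigma> * norm f) * (\<Lambda> * norm g) \<le> (\<sigma> * norm f)\<^sup>2 + (\<Lambda> * norm g)\<^sup>2"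
    proof -
      have "0 \<le> (\<sigma> * norm f) * (\<Lambda> * norm g)" using \<sigma> \<Lambda> by simp
      then show ?thesis using sum_squares_bound[of "\<sigma> * norm f" "\<Lambda> * norm g"] by linarith
    qed
    then have "\<eta> * ((\<sigma> * norm f) * (\<Lambda> * norm g)) \<le> \<eta> * ((\<sigma> * norm f)\<^sup>2 + (\<Lambda> * norm g)\<^sup>2)"
      using \<eta> by (intro mult_left_mono) auto
    finally show "\<theta> * c * inner f (D g) \<le> \<eta> * (\<theta> * norm f ^ 2 + \<Lambda>\<^sup>2 * norm g ^ 2)"
      by (simp add: \<sigma>(2) power_mult_distrib)
  qed
  also have "\<dots> \<le> \<Lambda> * N x x + \<eta> * N x x"
  proof -
    have n: "norm u ^ 2 + \<Lambda>\<^sup>2 * norm g ^ 2 + \<theta> * norm f ^ 2 \<le> N x x"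
      using N_ge[of x] by (simp add: x u_def)
    have nn: "0 \<le> norm u ^ 2" "0 \<le> \<theta> * norm f ^ 2" using \<theta>_pos by auto
    have "norm u ^ 2 + \<Lambda>\<^sup>2 * norm g ^ 2 \<le> N x x" "\<theta> * norm f ^ 2 + \<Lambda>\<^sup>2 * norm g ^ 2 \<le> N x x"
      using n nn by linarith+
    then show ?thesis using \<Lambda> \<eta> by (intro add_mono mult_left_mono) auto
  qed
  finally show ?thesis by (simp add: distrib_right)
qed

end

section \<open>Weights of analytic type\<close>

text \<open>For \<open>j = 1\<close> the exponential part is \<open>exp (2 * \<kappa> * x)\<close>;
  as \<open>j\<close> grows the denominator tends to \<open>exp (\<kappa> * x)\<close>. The radius
  of analyticity thus shrinks from \<open>2 * \<kappa>\<close> towards \<open>\<kappa>\<close>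
  without falling below it. The square is a reserve that makes convolutions summable.\<close>

definition gevrey :: "real \<Rightarrow> nat \<Rightarrow> real \<Rightarrow> real" where
  "gevrey \<kappa> j x = (1 + \<kappa> * x)\<^sup>2 * exp (2 * \<kappa> * x) / (1 + \<kappa> * x / real j) ^ (j - 1)"

lemma power2_sum_le: "(u + v)\<^sup>2 \<le> 2 * (u\<^sup>2 + v\<^sup>2)" for u v :: real
  using sum_squares_bound[of u v] by (simp add: power2_sum)

lemma exp_div_mono:
  fixes x y :: real
  assumes "0 \<le> x" "x \<le> y"
  shows "exp x / (1 + x) \<le> exp y / (1 + y)"
proof -
  have "(1 + y) \<le> (1 + x) * (1 + (y - x))" using assms by (simp add: algebra_simps mult_left_mono)
  also have "\<dots> \<le> (1 + x) * exp (y - x)"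
    using assms exp_ge_add_one_self[of "y - x"] by (intro mult_left_mono) auto
  finally have "exp x * (1 + y) \<le> exp x * ((1 + x) * exp (y - x))" by (intro mult_left_mono) auto
  also have "\<dots> = exp y * (1 + x)" by (simp add: exp_diff)
  finally show ?thesis using assms by (simp add: divide_simps)
qed

context
  fixes \<kappa> :: real
  assumes \<kappa>: "\<kappa> > 0"
begin

text \<open>One of the two exponentials is spread over \<open>j\<close> equal factors, of which
  \<open>j - 1\<close> are paired with the denominators; every factor is then increasing in
  \<open>x\<close>.\<close>

lemma gevrey_alt:
  assumes "j \<ge> 1"
  shows "gevrey \<kappa> j x = (1 + \<kappa> * x)\<^sup>2 * exp (\<kappa> * x) * exp (\<kappa> * x / j) *
    (exp (\<kappa> * x / j) / (1 + \<kappa> * x / j)) ^ (j - 1)"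
proof -
  have "exp (\<kappa> * x) = exp (\<kappa> * x / j) * exp (\<kappa> * x / j) ^ (j - 1)"
  proof -
    have "exp (\<kappa> * x) = exp (\<kappa> * x / j) ^ Suc (j - 1)"
      using assms by (simp add: exp_of_nat_mult[symmetric] del: power_Suc)
    then show ?thesis by simp
  qed
  moreover have "exp (2 * \<kappa> * x) = exp (\<kappa> * x) * exp (\<kappa> * x)"
    by (simp add: mult_exp_exp)
  ultimately show ?thesis by (simp add: gevrey_def power_divide)
qed

lemma gevrey_pos: "x \<ge> 0 \<Longrightarrow> gevrey \<kappa> j x > 0"
  using \<kappa> by (auto simp: gevrey_def intro!: divide_pos_pos mult_pos_pos zero_less_power add_pos_nonneg)

lemma gevrey_mono:
  assumes "j \<ge> 1" "0 \<le> x" "x \<le> y"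
  shows "gevrey \<kappa> j x \<le> gevrey \<kappa> j y"
proof -
  have "\<kappa> * x \<le> \<kappa> * y" "\<kappa> * x / j \<le> \<kappa> * y / j" "0 \<le> \<kappa> * x"
    using assms \<kappa> by (auto intro: divide_right_mono)
  then show ?thesis
    unfolding gevrey_alt[OF assms(1)] using assms \<kappa>
    by (intro mult_mono power_mono exp_div_mono divide_nonneg_nonneg zero_le_power) auto
qed

text \<open>The square and the exponential contribute \<open>exp (2 * \<kappa>)\<close> each, and
  the denominator only helps. For small \<open>\<kappa>\<close> the weight is nearly constant over
  unit steps, uniformly in \<open>j\<close>.\<close>

lemma gevrey_step:
  assumes "j \<ge> 1" "0 \<le> x" "x \<le> y" "y \<le> x + 1"
  shows "gevrey \<kappa> j y \<le> exp (4 * \<kappa>) * gevrey \<kappa> j x"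
proof -
  have le: "0 \<le> \<kappa> * x" "\<kappa> * x \<le> \<kappa> * y" "\<kappa> * y \<le> \<kappa> * x + \<kappa>"
    using assms \<kappa> mult_left_mono[of y "x + 1" \<kappa>] by (auto simp: algebra_simps)
  have "1 + \<kappa> * y \<le> (1 + \<kappa> * x) * (1 + \<kappa>)"
    using le \<kappa> assms by (simp add: algebra_simps) (smt (verit) mult_nonneg_nonneg)
  also have "\<dots> \<le> (1 + \<kappa> * x) * exp \<kappa>"
    using le by (intro mult_left_mono exp_ge_add_one_self[of \<kappa>]) auto
  finally have "(1 + \<kappa> * y)\<^sup>2 \<le> ((1 + \<kappa> * x) * exp \<kappa>)\<^sup>2"
    using le by (intro power_mono) auto
  then have 1: "(1 + \<kappa> * y)\<^sup>2 \<le> (1 + \<kappa> * x)\<^sup>2 * exp (2 * \<kappa>)"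
    by (simp add: power_mult_distrib exp_double[symmetric])
  have 2: "exp (2 * \<kappa> * y) \<le> exp (2 * \<kappa> * x) * exp (2 * \<kappa>)"
    using le by (simp add: mult_exp_exp)
  have p: "(1 + \<kappa> * x / j) ^ (j - 1) \<le> (1 + \<kappa> * y / j) ^ (j - 1)"
    using le by (intro power_mono add_mono divide_right_mono) auto
  have "gevrey \<kappa> j y \<le> ((1 + \<kappa> * x)\<^sup>2 * exp (2 * \<kappa>)) * (exp (2 * \<kappa> * x) * exp (2 * \<kappa>)) /
      (1 + \<kappa> * x / j) ^ (j - 1)"
    unfolding gevrey_def using le 1 2 p
    by (intro frac_le mult_mono zero_less_power add_pos_nonneg) auto
  also have "\<dots> = exp (4 * \<kappa>) * gevrey \<kappa> j x"
  proof -
    have "exp (4 * \<kappa>) = exp (2 * \<kappa>) * exp (2 * \<kappa>)" by (simp add: mult_exp_exp)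
    then show ?thesis by (simp add: gevrey_def)
  qed
  finally show ?thesis .
qed

text \<open>A floor common to all \<open>j\<close>, which allows all degrees to be summed in one
  space.\<close>

lemma gevrey_ge_exp:
  assumes "j \<ge> 1" "0 \<le> x"
  shows "exp (\<kappa> * x) \<le> gevrey \<kappa> j x"
proof -
  have 0: "0 \<le> \<kappa> * x" using assms \<kappa> by simp
  have "1 \<le> exp (\<kappa> * x / j) / (1 + \<kappa> * x / j)"
    using exp_ge_add_one_self[of "\<kappa> * x / j"] 0 by (simp add: divide_simps add_pos_nonneg)
  then have "1 \<le> (exp (\<kappa> * x / j) / (1 + \<kappa> * x / j)) ^ (j - 1)" by (rule one_le_power)
  then have "1 * exp (\<kappa> * x) * 1 * 1 \<le> gevrey \<kappa> j x"
    unfolding gevrey_alt[OF assms(1)] using 0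
    by (intro mult_mono) auto
  then show ?thesis by simp
qed

text \<open>
  The weight grows by the factor \<open>j\<close> exactly where a derivative is lost: this is the discrete form
  of shrinking the radius of analyticity with the degree \<open>j = a + b\<close> of the expansion.
\<close>

lemma gevrey_product:
  assumes ab: "a \<ge> 1" "b \<ge> 1" and xy: "x \<ge> 0" "y \<ge> 0" "0 \<le> z" "z \<le> x + y" and l: "l \<ge> 0"
  shows "gevrey \<kappa> (a + b) z * (1 + l * y) \<le> 2 * exp 1 * (1 + l / \<kappa>) * real (a + b) *
    (1 / (1 + \<kappa> * x)\<^sup>2 + 1 / (1 + \<kappa> * y)\<^sup>2) * (gevrey \<kappa> a x * gevrey \<kappa> b y)"
proof -
  define j where "j = a + b"
  define p q r where "p = 1 + \<kappa> * x / a" and "q = 1 + \<kappa> * y / b" and "r = 1 + \<kappa> * (x + y) / j"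
  have pos: "p \<ge> 1" "q \<ge> 1" "r \<ge> 1" using xy \<kappa> by (auto simp: p_def q_def r_def)
  define X Y where "X = (1 + \<kappa> * x)\<^sup>2" and "Y = (1 + \<kappa> * y)\<^sup>2"
  have \<kappa>xy: "0 \<le> \<kappa> * x" "0 \<le> \<kappa> * y" using xy \<kappa> by auto
  have XY: "X > 0" "Y > 0" using \<kappa>xy by (auto simp: X_def Y_def intro!: zero_less_power)
  \<comment> \<open>The denominators are compared through s / r <= exp (s / r - 1); the exponents
    add up because \<open>a * p + b * q = j * r\<close>. The factor \<open>q\<close> is kept with
    exponent \<open>b\<close>, one more than the weight of \<open>y\<close> contains: this spare
    \<open>q\<close> absorbs the derivative.\<close>
  have expo: "p ^ (a - 1) * q ^ b \<le> exp 1 * r ^ (j - 1)"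
  proof -
    have le: "s / r \<le> exp (s / r - 1)" for s
      using exp_ge_add_one_self[of "s / r - 1"] by simp
    have "(p / r) ^ (a - 1) * (q / r) ^ b \<le> exp (p / r - 1) ^ (a - 1) * exp (q / r - 1) ^ b"
      using pos le by (intro mult_mono power_mono) auto
    also have "\<dots> = exp (real (a - 1) * (p / r - 1) + real b * (q / r - 1))"
      by (simp add: exp_of_nat_mult[symmetric] mult_exp_exp)
    also have "\<dots> \<le> exp 1"
    proof -
      have "real (a - 1) * p + real b * q \<le> real a * p + real b * q"
        using pos by (intro add_mono mult_right_mono) auto
      also have "\<dots> = real j * r" using ab by (simp add: p_def q_def r_def j_def field_simps)
      finally have "(real (a - 1) * p + real b * q) / r \<le> real j"
        using pos by (simp add: divide_simps)
      then show ?thesis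
        using ab by (simp add: j_def right_diff_distrib add_divide_distrib of_nat_diff)
    qed
    finally have "(p ^ (a - 1) * q ^ b) / r ^ (j - 1) \<le> exp 1"
      using ab by (simp add: power_divide j_def power_add[symmetric])
    then show ?thesis using pos by (simp add: divide_simps)
  qed
  \<comment> \<open>Writing \<open>y\<close> as \<open>b / \<kappa>\<close> times
    \<open>\<kappa> * y / b\<close> shows where the loss \<open>a + b\<close> comes from.\<close>
  have loss: "1 + l * y \<le> real j * (1 + l / \<kappa>) * q"
  proof -
    have "1 * 1 \<le> real j * q" using ab pos by (intro mult_mono) (auto simp: j_def)
    moreover have "l * y \<le> real j * (l / \<kappa>) * q"
    proof -
      have "l * y = real b * (l / \<kappa>) * (\<kappa> * y / b)" using ab \<kappa> by simp
      also have "\<dots> \<le> real j * (l / \<kappa>) * q"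
        using \<kappa>xy l \<kappa> by (intro mult_mono) (auto simp: j_def q_def)
      finally show ?thesis .
    qed
    ultimately show ?thesis by (simp add: algebra_simps)
  qed
  \<comment> \<open>Splitting the square spends only one of \<open>X\<close> and \<open>Y\<close>;
    the unspent one leaves the decay \<open>1 / X + 1 / Y\<close> that \<open>conv_weighted\<close>
    asks for.\<close>
  have P: "(1 + \<kappa> * (x + y))\<^sup>2 \<le> 2 * (X * Y * (1 / X + 1 / Y))"
  proof -
    have "(1 + \<kappa> * (x + y))\<^sup>2 \<le> ((1 + \<kappa> * x) + (1 + \<kappa> * y))\<^sup>2"
      using \<kappa>xy by (intro power_mono) (auto simp: algebra_simps)
    also have "\<dots> \<le> 2 * (X + Y)"
      unfolding X_def Y_def by (rule power2_sum_le)
    also have "X + Y = X * Y * (1 / X + 1 / Y)" using XY by (simp add: field_simps)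
    finally show ?thesis .
  qed
  have "gevrey \<kappa> j z * (1 + l * y) \<le> gevrey \<kappa> j (x + y) * (real j * (1 + l / \<kappa>) * q)"
    using gevrey_mono[of j z "x + y"] ab xy loss l gevrey_pos[of "x + y" j]
    by (intro mult_mono) (auto simp: j_def)
  also have "\<dots> = real j * (1 + l / \<kappa>) * ((1 + \<kappa> * (x + y))\<^sup>2 * exp (2 * \<kappa> * (x + y))) * (q / r ^ (j - 1))"
    by (simp add: gevrey_def r_def)
  also have "\<dots> \<le> real j * (1 + l / \<kappa>) * (2 * (X * Y * (1 / X + 1 / Y)) * exp (2 * \<kappa> * (x + y))) *
      (exp 1 / (p ^ (a - 1) * q ^ (b - 1)))"
  proof (intro mult_mono P mult_left_mono mult_right_mono)
    have "q * (p ^ (a - 1) * q ^ (b - 1)) \<le> exp 1 * r ^ (j - 1)"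
      using expo ab by (simp add: power_eq_if mult_ac split: if_splits)
    then show "q / r ^ (j - 1) \<le> exp 1 / (p ^ (a - 1) * q ^ (b - 1))"
      using pos by (simp add: divide_simps)
  qed (use l \<kappa> pos XY in auto)
  also have "\<dots> = 2 * exp 1 * (1 + l / \<kappa>) * real j * (1 / X + 1 / Y) *
      ((X * exp (2 * \<kappa> * x) / p ^ (a - 1)) * (Y * exp (2 * \<kappa> * y) / q ^ (b - 1)))"
  proof -
    have "exp (2 * \<kappa> * (x + y)) = exp (2 * \<kappa> * x) * exp (2 * \<kappa> * y)"
      by (simp add: mult_exp_exp distrib_left)
    then show ?thesis by (simp only: divide_inverse inverse_mult_distrib mult_ac)
  qed
  finally show ?thesis by (simp add: gevrey_def X_def Y_def p_def q_def j_def)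
qed

text \<open>Same purpose, with a fixed weight on the factors and none on the product. The cube of
  \<open>1 + \<kappa> * y\<close> is at most \<open>27 * exp (\<kappa> * y)\<close>: one power pays
  for the derivative, two for the decay.\<close>

lemma exp_product:
  assumes xy: "x \<ge> 0" "y \<ge> 0" and l: "l \<ge> 0"
  shows "1 + l * y \<le> 27 * (1 + l / \<kappa>) * (1 / (1 + \<kappa> * x)\<^sup>2 + 1 / (1 + \<kappa> * y)\<^sup>2) *
    (exp (\<kappa> * x) * exp (\<kappa> * y))"
proof -
  have \<kappa>xy: "0 \<le> \<kappa> * x" "0 \<le> \<kappa> * y" using xy \<kappa> by auto
  define Y where "Y = 1 + \<kappa> * y"
  have Y: "Y \<ge> 1" using \<kappa>xy by (simp add: Y_def)
  have "Y \<le> 3 * exp (\<kappa> * y / 3)"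
    using exp_ge_add_one_self[of "\<kappa> * y / 3"] unfolding Y_def by linarith
  then have "Y ^ 3 \<le> (3 * exp (\<kappa> * y / 3)) ^ 3" using Y by (intro power_mono) auto
  also have "\<dots> = 27 * exp (\<kappa> * y)" by (simp add: power_mult_distrib exp_of_nat_mult[symmetric])
  finally have "Y * Y\<^sup>2 \<le> 27 * exp (\<kappa> * y)" by (simp add: power3_eq_cube power2_eq_square mult_ac)
  then have "Y \<le> 27 * exp (\<kappa> * y) / Y\<^sup>2" using Y by (simp add: pos_le_divide_eq)
  moreover have "1 + l * y \<le> (1 + l / \<kappa>) * Y"
    using \<kappa> l \<kappa>xy xy by (simp add: Y_def algebra_simps)
  moreover have "(1 + l / \<kappa>) \<ge> 0" using l \<kappa> by simp
  ultimately have "1 + l * y \<le> (1 + l / \<kappa>) * (27 * exp (\<kappa> * y) / Y\<^sup>2)"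
    by (meson mult_left_mono order_trans)
  also have "\<dots> = 27 * (1 + l / \<kappa>) * (0 + 1 / Y\<^sup>2) * (1 * exp (\<kappa> * y))" by simp
  also have "\<dots> \<le> 27 * (1 + l / \<kappa>) * (1 / (1 + \<kappa> * x)\<^sup>2 + 1 / Y\<^sup>2) * (exp (\<kappa> * x) * exp (\<kappa> * y))"
    using l \<kappa> \<kappa>xy by (intro mult_mono add_mono) auto
  finally show ?thesis by (simp add: Y_def)
qed

end

lemma summable_on_int_inverse_square:
  assumes "\<kappa> > 0"
  shows "(\<lambda>m::int. 1 / (1 + \<kappa> * \<bar>real_of_int m\<bar>)\<^sup>2) summable_on UNIV"
proof -
  define \<mu> where "\<mu> = min 1 \<kappa>"
  have \<mu>: "\<mu> > 0" "\<mu> \<le> 1" "\<mu> \<le> \<kappa>" using assms by (auto simp: \<mu>_def)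
  have nat: "(\<lambda>n::nat. 1 / (1 + \<kappa> * real n)\<^sup>2) summable_on UNIV"
  proof -
    have "summable (\<lambda>n::nat. 1 / real (Suc n) ^ 2)"
      using inverse_power_summable[of 2, where 'a = real]
      by (subst summable_Suc_iff) (simp add: inverse_eq_divide)
    then have "summable (\<lambda>n::nat. 1 / \<mu>\<^sup>2 * (1 / real (Suc n) ^ 2))" by (rule summable_mult)
    then have "summable (\<lambda>n::nat. 1 / (1 + \<kappa> * real n)\<^sup>2)"
    proof (rule summable_comparison_test'[of _ 0])
      fix n :: nat
      have "\<mu> * real n \<le> \<kappa> * real n" using \<mu> by (intro mult_right_mono) auto
      then have "\<mu> * real (Suc n) \<le> 1 + \<kappa> * real n" using \<mu> by (simp add: algebra_simps)
      then have "(\<mu> * real (Suc n))\<^sup>2 \<le> (1 + \<kappa> * real n)\<^sup>2" using \<mu> by (intro power_mono) auto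
      then have "1 / (1 + \<kappa> * real n)\<^sup>2 \<le> 1 / (\<mu> * real (Suc n))\<^sup>2"
        using \<mu> \<open>\<mu> * real (Suc n) \<le> 1 + \<kappa> * real n\<close> mult_pos_pos[of \<mu> "real (Suc n)"]
        by (intro divide_left_mono mult_pos_pos zero_less_power) linarith+
      then show "norm (1 / (1 + \<kappa> * real n)\<^sup>2) \<le> 1 / \<mu>\<^sup>2 * (1 / real (Suc n) ^ 2)"
        by (simp add: power_mult_distrib)
    qed
    then show ?thesis by (subst summable_on_UNIV_nonneg_real_iff) auto
  qed
  have U: "(UNIV :: int set) = range int \<union> range (\<lambda>n. - int n)"
    by (auto simp: image_iff) (metis nonneg_int_cases nonpos_int_cases linear)
  have "(\<lambda>m::int. 1 / (1 + \<kappa> * \<bar>real_of_int m\<bar>)\<^sup>2) summable_on range int"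
    using nat by (subst summable_on_reindex) (auto simp: o_def)
  moreover have "(\<lambda>m::int. 1 / (1 + \<kappa> * \<bar>real_of_int m\<bar>)\<^sup>2) summable_on range (\<lambda>n. - int n)"
    using nat by (subst summable_on_reindex) (auto simp: o_def inj_def)
  ultimately show ?thesis unfolding U by (rule summable_on_union)
qed

lemma summable_on_product_real:
  fixes f :: "'a \<Rightarrow> real" and g :: "'b \<Rightarrow> real"
  assumes "f summable_on UNIV" "g summable_on UNIV" "\<And>x. f x \<ge> 0" "\<And>x. g x \<ge> 0"
  shows "(\<lambda>x. f (fst x) * g (snd x)) summable_on UNIV"
proof -
  have "(\<lambda>x. f (fst x) * g (snd x)) summable_on UNIV \<times> UNIV"
    by (rule summable_on_SigmaI[where g = "\<lambda>x. f x * infsum g UNIV"])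
       (use assms in \<open>auto intro!: has_sum_cmult_right has_sum_infsum summable_on_cmult_left\<close>)
  then show ?thesis by simp
qed

definition sz :: "int \<times> int \<Rightarrow> real" where
  "sz \<xi> = \<bar>of_int (fst \<xi>)\<bar> + \<bar>of_int (snd \<xi>)\<bar>"

text \<open>The weight \<open>p\<close> for \<open>conv_weighted\<close>. Its square is dominated by
  a product of inverse squares in one variable each, hence it is square-summable on the plane
  lattice.\<close>

definition decay :: "real \<Rightarrow> (int \<times> int) ell2" where
  "decay \<kappa> = of_coord (\<lambda>\<xi>. 1 / (1 + \<kappa> * sz \<xi>)\<^sup>2)"

lemma sz_nonneg [simp]: "sz \<xi> \<ge> 0"
  by (simp add: sz_def)

lemma sz_add: "sz (\<eta> + \<xi>) \<le> sz \<eta> + sz \<xi>"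
  by (simp add: sz_def)

lemma decay_summable:
  assumes "\<kappa> > 0"
  shows "(\<lambda>\<xi>. (1 / (1 + \<kappa> * sz \<xi>)\<^sup>2)\<^sup>2) summable_on UNIV"
proof (rule summable_on_comparison_test)
  show "(\<lambda>\<xi>. 1 / (1 + \<kappa> * \<bar>real_of_int (fst \<xi>)\<bar>)\<^sup>2 * (1 / (1 + \<kappa> * \<bar>real_of_int (snd \<xi>)\<bar>)\<^sup>2)) summable_on UNIV"
    by (rule summable_on_product_real) (auto intro: summable_on_int_inverse_square assms)
  fix \<xi> :: "int \<times> int"
  have "1 / (1 + \<kappa> * sz \<xi>)\<^sup>2 \<le> 1 / (1 + \<kappa> * \<bar>real_of_int (fst \<xi>)\<bar>)\<^sup>2"
    "1 / (1 + \<kappa> * sz \<xi>)\<^sup>2 \<le> 1 / (1 + \<kappa> * \<bar>real_of_int (snd \<xi>)\<bar>)\<^sup>2"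
    using assms
    by (auto intro!: divide_left_mono power_mono mult_left_mono mult_pos_pos zero_less_power add_pos_nonneg
        simp: sz_def)
  then have "1 / (1 + \<kappa> * sz \<xi>)\<^sup>2 * (1 / (1 + \<kappa> * sz \<xi>)\<^sup>2) \<le>
      1 / (1 + \<kappa> * \<bar>real_of_int (fst \<xi>)\<bar>)\<^sup>2 * (1 / (1 + \<kappa> * \<bar>real_of_int (snd \<xi>)\<bar>)\<^sup>2)"
    by (intro mult_mono) auto
  then show "(1 / (1 + \<kappa> * sz \<xi>)\<^sup>2)\<^sup>2 \<le>
      1 / (1 + \<kappa> * \<bar>real_of_int (fst \<xi>)\<bar>)\<^sup>2 * (1 / (1 + \<kappa> * \<bar>real_of_int (snd \<xi>)\<bar>)\<^sup>2)"
    by (simp only: power2_eq_square)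
qed simp

lemma coord_decay: "\<kappa> > 0 \<Longrightarrow> coord (decay \<kappa>) \<xi> = 1 / (1 + \<kappa> * sz \<xi>)\<^sup>2"
  unfolding decay_def using of_coord_inverse'[OF decay_summable] by simp

section \<open>The linearised operator on Fourier coefficients\<close>

text \<open>An index \<open>(m, n)\<close> stands for the wave vector \<open>(k * m, n)\<close>:
  functions that are \<open>2 * pi / k\<close>-periodic in the first variable have no other
  frequencies.\<close>

type_synonym freq = "int \<times> int"

definition sh :: "int \<Rightarrow> freq \<Rightarrow> freq" where
  "sh a \<xi> = (fst \<xi> + a, snd \<xi>)"

lemma bij_sh: "bij (sh a)"
  by (rule bij_betwI[where g = "sh (- a)"]) (auto simp: sh_def)

lemma inv_sh: "inv (sh a) = sh (- a)"
  by (rule inv_unique_comp) (auto simp: sh_def fun_eq_iff)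

lemma sh_simps [simp]: "fst (sh a \<xi>) = fst \<xi> + a" "snd (sh a \<xi>) = snd \<xi>"
  "sh a (sh b \<xi>) = sh (a + b) \<xi>" "sh 0 \<xi> = \<xi>"
  by (auto simp: sh_def)

lemma sz_sh: "\<bar>sz (sh 1 \<xi>) - sz \<xi>\<bar> \<le> 1" "\<bar>sz (sh (- 1) \<xi>) - sz \<xi>\<bar> \<le> 1"
  by (auto simp: sz_def)

text \<open>Multiplication by the cosine of k x1 shifts the first index by one, so conjugating the
  linear operator with such a weight perturbs it by O(\<rho>).\<close>

definition slow_weight :: "(freq \<Rightarrow> real) \<Rightarrow> real \<Rightarrow> bool" where
  "slow_weight w \<rho> \<longleftrightarrow> (\<forall>\<xi>. w \<xi> > 0) \<and>
     (\<forall>\<xi>. \<forall>s\<in>{1, -1}. \<bar>w \<xi> / w (sh s \<xi>) - 1\<bar> \<le> \<rho>)"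

lemma slow_weightI:
  fixes w :: "freq \<Rightarrow> real"
  assumes "\<And>x. x \<ge> 0 \<Longrightarrow> u x > 0"
    and "\<And>x y. 0 \<le> x \<Longrightarrow> x \<le> y \<Longrightarrow> y \<le> x + 1 \<Longrightarrow> u x \<le> u y \<and> u y \<le> (1 + \<rho>) * u x"
  shows "slow_weight (\<lambda>\<xi>. u (sz \<xi>)) \<rho>"
  unfolding slow_weight_def
proof (intro conjI allI ballI)
  fix \<xi> :: freq and s :: int assume s: "s \<in> {1, -1}"
  define x y where "x = sz \<xi>" and "y = sz (sh s \<xi>)"
  have xy: "x \<ge> 0" "y \<ge> 0" "\<bar>y - x\<bar> \<le> 1" using s sz_sh[of \<xi>] by (auto simp: x_def y_def)
  have pos: "u x > 0" "u y > 0" using assms(1) xy by auto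
  have "\<bar>u x / u y - 1\<bar> \<le> \<rho>"
  proof (cases "x \<le> y")
    case True
    then have le: "u x \<le> u y" "u y \<le> (1 + \<rho>) * u x" using assms(2)[of x y] xy by auto
    then have "\<rho> * u x \<ge> 0" "u y - u x \<le> \<rho> * u x" by (auto simp: algebra_simps)
    moreover have "\<rho> \<ge> 0" using \<open>\<rho> * u x \<ge> 0\<close> pos by (simp add: zero_le_mult_iff)
    then have "\<rho> * u x \<le> \<rho> * u y" using le by (intro mult_left_mono) auto
    ultimately have "\<bar>u x - u y\<bar> \<le> \<rho> * u y" using le by linarith
    then show ?thesis using pos by (simp add: diff_divide_eq_iff pos_divide_le_eq abs_div_pos[symmetric]
        divide_diff_eq_iff)
  next
    case False
    then have "u y \<le> u x" "u x \<le> (1 + \<rho>) * u y" using assms(2)[of y x] xy by auto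
    then have "\<bar>u x - u y\<bar> \<le> \<rho> * u y" by (simp add: algebra_simps)
    then show ?thesis using pos by (simp add: pos_divide_le_eq abs_div_pos[symmetric] divide_diff_eq_iff)
  qed
  then show "\<bar>u (sz \<xi>) / u (sz (sh s \<xi>)) - 1\<bar> \<le> \<rho>" by (simp add: x_def y_def)
qed (use assms in auto)

lemma slow_weight_one: "slow_weight (\<lambda>_. 1) 0"
  by (simp add: slow_weight_def)

lemma slow_weight_gevrey: "\<kappa> > 0 \<Longrightarrow> j \<ge> 1 \<Longrightarrow> slow_weight (\<lambda>\<xi>. gevrey \<kappa> j (sz \<xi>)) (exp (4 * \<kappa>) - 1)"
  by (rule slow_weightI) (auto intro: gevrey_pos gevrey_mono gevrey_step)

locale wave =
  fixes k :: nat
  assumes k: "k \<ge> 1"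
begin

text \<open>Length of the wave vector \<open>(k * m, n)\<close>; its square is the symbol of minus
  the Laplacian.\<close>

definition rad :: "freq \<Rightarrow> real" where
  "rad \<xi> = sqrt ((real k * of_int (fst \<xi>))\<^sup>2 + (of_int (snd \<xi>))\<^sup>2)"

definition cc :: real where "cc = 1 + (real k)\<^sup>2"

text \<open>Symbol of the operator A_k.\<close>

definition asym :: "freq \<Rightarrow> real" where
  "asym \<xi> = 1 - cc / (1 + (rad \<xi>)\<^sup>2)"

text \<open>
  With \<open>F = \<Sum> f \<xi> ek \<xi>\<close> and \<open>\<omega> = \<Sum> rad \<xi> g \<xi> ek \<xi>\<close> the operator \<open>lin_op k\<close> acts on \<open>(f, g)\<close> as \<open>Lop 1\<close>;
  \<open>Lop w\<close> is its conjugate by multiplication with the weight \<open>w\<close>. Since division by \<open>0\<close> gives \<open>0\<close>, the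
  factor \<open>1 / rad\<close> also encodes the mean-zero condition.
\<close>

definition Aop :: "freq ell2 \<Rightarrow> freq ell2" where
  "Aop = wop asym id"

text \<open>\<open>Dco\<close> and \<open>Eco\<close> are the coefficients of - k cos(k x1) times
  the second derivative in the centred basis, divided by \<open>rad\<close> at the source or at the
  target. Centring makes them real; the ratio of weights expresses the conjugation.\<close>

definition Dco :: "(freq \<Rightarrow> real) \<Rightarrow> int \<Rightarrow> freq \<Rightarrow> real" where
  "Dco w s \<xi> = real k * of_int (snd \<xi>) / 2 / rad (sh s \<xi>) * (w \<xi> / w (sh s \<xi>))"

definition Eco :: "(freq \<Rightarrow> real) \<Rightarrow> int \<Rightarrow> freq \<Rightarrow> real" where
  "Eco w s \<xi> = real k * of_int (snd \<xi>) / 2 / rad \<xi> * (w \<xi> / w (sh s \<xi>))"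

definition Dop :: "(freq \<Rightarrow> real) \<Rightarrow> freq ell2 \<Rightarrow> freq ell2" where
  "Dop w g = wop (Dco w (- 1)) (sh (- 1)) g - wop (Dco w 1) (sh 1) g"

definition Eop :: "(freq \<Rightarrow> real) \<Rightarrow> freq ell2 \<Rightarrow> freq ell2" where
  "Eop w f = wop (Eco w 1) (sh 1) f - wop (Eco w (- 1)) (sh (- 1)) f"

definition Lop :: "(freq \<Rightarrow> real) \<Rightarrow> freq ell2 \<times> freq ell2 \<Rightarrow> freq ell2 \<times> freq ell2" where
  "Lop w x = (cc *\<^sub>R Dop w (snd x), - Eop w (Aop (fst x)))"

lemma rad_nonneg [simp]: "rad \<xi> \<ge> 0"
  by (simp add: rad_def)

lemma rad_reflect [simp]: "rad (- m, n) = rad (m, n)" "rad (m, - n) = rad (m, n)"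
  by (simp_all add: rad_def)

lemma rad_ge: "\<bar>of_int (snd \<xi>)\<bar> \<le> rad \<xi>" "real k * \<bar>of_int (fst \<xi>)\<bar> \<le> rad \<xi>"
  unfolding rad_def by (rule real_le_rsqrt; simp add: power_mult_distrib)+

lemma rad_le: "rad \<xi> \<le> real k * sz \<xi>"
proof -
  have k1: "real k \<ge> 1" using k by simp
  have "(rad \<xi>)\<^sup>2 = (real k * \<bar>of_int (fst \<xi>)\<bar>)\<^sup>2 + \<bar>of_int (snd \<xi>)\<bar>\<^sup>2"
    by (simp add: rad_def power_mult_distrib)
  also have "\<dots> \<le> (real k * \<bar>of_int (fst \<xi>)\<bar> + \<bar>of_int (snd \<xi>)\<bar>)\<^sup>2"
    by (simp add: power2_sum)
  finally have "rad \<xi> \<le> real k * \<bar>of_int (fst \<xi>)\<bar> + \<bar>of_int (snd \<xi>)\<bar>"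
    by (rule power2_le_imp_le) simp
  also have "\<dots> \<le> real k * \<bar>of_int (fst \<xi>)\<bar> + real k * \<bar>of_int (snd \<xi>)\<bar>"
    using k1 mult_right_mono[of 1 "real k" "\<bar>real_of_int (snd \<xi>)\<bar>"] by simp
  finally show ?thesis by (simp add: sz_def distrib_left)
qed

lemma cc_ge: "cc \<ge> 1"
  by (simp add: cc_def)

lemma asym_bound: "\<bar>asym \<xi>\<bar> \<le> cc"
proof -
  have "1 + (rad \<xi>)\<^sup>2 \<ge> 1" by simp
  then have "cc / (1 + (rad \<xi>)\<^sup>2) \<le> cc / 1" "cc / (1 + (rad \<xi>)\<^sup>2) \<ge> 0"
    using cc_ge by (intro frac_le divide_nonneg_nonneg; linarith)+
  then show ?thesis using cc_ge unfolding asym_def abs_le_iff by linarith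
qed

lemma coord_Aop: "coord (Aop x) \<xi> = asym \<xi> * coord x \<xi>"
  unfolding Aop_def by (subst coord_wop) (auto intro: asym_bound)

lemma norm_Aop: "norm (Aop x) \<le> cc * norm x"
  unfolding Aop_def by (rule norm_wop) (auto intro: asym_bound)

lemma bounded_linear_Aop: "bounded_linear Aop"
  unfolding Aop_def by (rule bounded_linear_wop) (auto intro: asym_bound)

lemma inner_Aop: "inner (Aop x) y = inner x (Aop y)"
  by (simp add: inner_ell2_def coord_Aop mult_ac)

text \<open>The derivative in the second variable is compensated by \<open>1 / rad\<close>; this
  makes the linear operator bounded in these variables.\<close>

lemma ratio_bound: "\<bar>real k * of_int n / 2 / rad (m, n)\<bar> \<le> real k / 2"
proof (cases "rad (m, n) = 0")
  case False
  then have "rad (m, n) > 0" using rad_nonneg[of "(m, n)"] by linarith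
  then have "\<bar>of_int n\<bar> / rad (m, n) \<le> 1" using rad_ge(1)[of "(m, n)"] by simp
  then have "real k / 2 * (\<bar>of_int n\<bar> / rad (m, n)) \<le> real k / 2 * 1" by (intro mult_left_mono) auto
  then show ?thesis by (simp add: abs_mult)
qed simp

lemma Dco_one: "\<bar>Dco (\<lambda>_. 1) s \<xi>\<bar> \<le> real k / 2" and Eco_one: "\<bar>Eco (\<lambda>_. 1) s \<xi>\<bar> \<le> real k / 2"
  using ratio_bound[of "snd \<xi>" "fst \<xi> + s"] ratio_bound[of "snd \<xi>" "fst \<xi>"]
  by (auto simp: Dco_def Eco_def sh_def)

context
  fixes w :: "freq \<Rightarrow> real" and \<rho> :: real
  assumes w: "slow_weight w \<rho>"
begin

lemma w_ratio: "s \<in> {1, -1} \<Longrightarrow> \<bar>w \<xi> / w (sh s \<xi>) - 1\<bar> \<le> \<rho>"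
  using w unfolding slow_weight_def by blast

lemma rho_nonneg: "\<rho> \<ge> 0"
  using w_ratio[of 1 0] by simp

lemma Dco_diff: "s \<in> {1, -1} \<Longrightarrow> \<bar>Dco w s \<xi> - Dco (\<lambda>_. 1) s \<xi>\<bar> \<le> real k / 2 * \<rho>"
proof -
  assume s: "s \<in> {1, -1}"
  have "\<bar>Dco w s \<xi> - Dco (\<lambda>_. 1) s \<xi>\<bar> =
      \<bar>real k * of_int (snd \<xi>) / 2 / rad (sh s \<xi>)\<bar> * \<bar>w \<xi> / w (sh s \<xi>) - 1\<bar>"
    by (simp only: Dco_def abs_mult[symmetric]) (simp add: right_diff_distrib)
  also have "\<dots> \<le> real k / 2 * \<rho>"
    using ratio_bound[of "snd \<xi>" "fst \<xi> + s"]
    by (intro mult_mono w_ratio s) (simp_all add: sh_def)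
  finally show ?thesis .
qed

lemma Eco_diff: "s \<in> {1, -1} \<Longrightarrow> \<bar>Eco w s \<xi> - Eco (\<lambda>_. 1) s \<xi>\<bar> \<le> real k / 2 * \<rho>"
proof -
  assume s: "s \<in> {1, -1}"
  have "\<bar>Eco w s \<xi> - Eco (\<lambda>_. 1) s \<xi>\<bar> =
      \<bar>real k * of_int (snd \<xi>) / 2 / rad \<xi>\<bar> * \<bar>w \<xi> / w (sh s \<xi>) - 1\<bar>"
    by (simp only: Eco_def abs_mult[symmetric]) (simp add: right_diff_distrib)
  also have "\<dots> \<le> real k / 2 * \<rho>"
    using ratio_bound[of "snd \<xi>" "fst \<xi>"]
    by (intro mult_mono w_ratio s) simp_all
  finally show ?thesis .
qed

lemma Dco_bound: "s \<in> {1, -1} \<Longrightarrow> \<bar>Dco w s \<xi>\<bar> \<le> real k / 2 * (1 + \<rho>)"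
  using Dco_diff[of s \<xi>] Dco_one[of s \<xi>] unfolding distrib_left by linarith

lemma Eco_bound: "s \<in> {1, -1} \<Longrightarrow> \<bar>Eco w s \<xi>\<bar> \<le> real k / 2 * (1 + \<rho>)"
  using Eco_diff[of s \<xi>] Eco_one[of s \<xi>] unfolding distrib_left by linarith

lemma coord_Dop: "coord (Dop w g) \<xi> = Dco w (- 1) \<xi> * coord g (sh (- 1) \<xi>) - Dco w 1 \<xi> * coord g (sh 1 \<xi>)"
  unfolding Dop_def coord_simps
  by (subst (1 2) coord_wop[OF bij_is_inj[OF bij_sh] Dco_bound]) auto

lemma coord_Eop: "coord (Eop w g) \<xi> = Eco w 1 \<xi> * coord g (sh 1 \<xi>) - Eco w (- 1) \<xi> * coord g (sh (- 1) \<xi>)"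
  unfolding Eop_def coord_simps
  by (subst (1 2) coord_wop[OF bij_is_inj[OF bij_sh] Eco_bound]) auto

lemma bounded_linear_Dop: "bounded_linear (Dop w)"
  unfolding Dop_def[abs_def]
  by (intro bounded_linear_sub bounded_linear_wop[OF bij_is_inj[OF bij_sh] Dco_bound]) auto

lemma bounded_linear_Eop: "bounded_linear (Eop w)"
  unfolding Eop_def[abs_def]
  by (intro bounded_linear_sub bounded_linear_wop[OF bij_is_inj[OF bij_sh] Eco_bound]) auto

lemma bounded_linear_Lop: "bounded_linear (Lop w)"
  unfolding Lop_def[abs_def]
  by (intro bounded_linear_Pair bounded_linear_scaleR_right[THEN bounded_linear_compose]
      bounded_linear_minus bounded_linear_compose[OF bounded_linear_Dop]
      bounded_linear_compose[OF bounded_linear_Eop] bounded_linear_compose[OF bounded_linear_Aop]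
      bounded_linear_fst bounded_linear_snd)

end

lemma norm_Dop_one: "norm (Dop (\<lambda>_. 1) g) \<le> real k * norm g"
proof -
  have "norm (wop (Dco (\<lambda>_. 1) s) (sh s) g) \<le> real k / 2 * norm g" for s
    by (rule norm_wop[OF bij_is_inj[OF bij_sh] Dco_one])
  then show ?thesis
    unfolding Dop_def using norm_triangle_ineq4[of "wop (Dco (\<lambda>_. 1) (- 1)) (sh (- 1)) g"]
    by (smt (verit) field_sum_of_halves mult_left_mono left_diff_distrib distrib_right)
qed

lemma norm_difference:
  assumes w: "slow_weight w \<rho>"
  shows "norm (Dop w g - Dop (\<lambda>_. 1) g) \<le> real k * \<rho> * norm g"
    and "norm (Eop w g - Eop (\<lambda>_. 1) g) \<le> real k * \<rho> * norm g"
proof -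
  define D' where "D' s = wop (\<lambda>\<xi>. Dco w s \<xi> - Dco (\<lambda>_. 1) s \<xi>) (sh s) g" for s
  define E' where "E' s = wop (\<lambda>\<xi>. Eco w s \<xi> - Eco (\<lambda>_. 1) s \<xi>) (sh s) g" for s
  have n: "norm (D' s) \<le> real k / 2 * \<rho> * norm g" "norm (E' s) \<le> real k / 2 * \<rho> * norm g"
    if "s \<in> {1, -1}" for s
    unfolding D'_def E'_def
    by (intro norm_wop bij_is_inj[OF bij_sh] Dco_diff[OF w that] Eco_diff[OF w that])+
  have c: "coord (D' s) \<xi> = (Dco w s \<xi> - Dco (\<lambda>_. 1) s \<xi>) * coord g (sh s \<xi>)"
    "coord (E' s) \<xi> = (Eco w s \<xi> - Eco (\<lambda>_. 1) s \<xi>) * coord g (sh s \<xi>)"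
    if "s \<in> {1, -1}" for s \<xi>
    unfolding D'_def E'_def
    by (rule coord_wop[OF bij_is_inj[OF bij_sh] Dco_diff[OF w that]],
        rule coord_wop[OF bij_is_inj[OF bij_sh] Eco_diff[OF w that]])
  have "Dop w g - Dop (\<lambda>_. 1) g = D' (- 1) - D' 1"
    by (rule ell2_eqI) (simp add: c coord_Dop[OF w] coord_Dop[OF slow_weight_one] algebra_simps)
  moreover have "Eop w g - Eop (\<lambda>_. 1) g = E' 1 - E' (- 1)"
    by (rule ell2_eqI) (simp add: c coord_Eop[OF w] coord_Eop[OF slow_weight_one] algebra_simps)
  ultimately show "norm (Dop w g - Dop (\<lambda>_. 1) g) \<le> real k * \<rho> * norm g"
    "norm (Eop w g - Eop (\<lambda>_. 1) g) \<le> real k * \<rho> * norm g"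
    using n[of 1] n[of "-1"] norm_triangle_ineq4[of "D' (- 1)" "D' 1"]
      norm_triangle_ineq4[of "E' 1" "E' (- 1)"] by auto
qed

lemma inner_Dop: "inner (Dop (\<lambda>_. 1) x) y = inner x (Eop (\<lambda>_. 1) y)"
proof -
  have 1: "Dco (\<lambda>_. 1) s \<circ> sh (- s) = Eco (\<lambda>_. 1) (- s)" for s
    by (auto simp: Dco_def Eco_def fun_eq_iff)
  have "inner (wop (Dco (\<lambda>_. 1) s) (sh s) x) y = inner x (wop (Eco (\<lambda>_. 1) (- s)) (sh (- s)) y)" for s
    using inner_wop[OF bij_sh[of s] Dco_one[of s]] by (simp only: inv_sh 1)
  from this[of 1] this[of "-1"] show ?thesis
    by (simp add: Dop_def Eop_def inner_diff_left inner_diff_right)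
qed

text \<open>The bound is linear in \<open>\<rho>\<close>, hence small for small
  \<open>\<kappa>\<close> and uniform over all degrees: one energy form, built for the unweighted
  operator, serves every weight.\<close>

lemma norm_Lop_diff:
  assumes w: "slow_weight w \<rho>"
  shows "norm (Lop w x - Lop (\<lambda>_. 1) x) \<le> 2 * cc * real k * \<rho> * norm x"
proof -
  obtain f g where x: "x = (f, g)" by fastforce
  have \<rho>: "\<rho> \<ge> 0" by (rule rho_nonneg[OF w])
  have "norm (Lop w x - Lop (\<lambda>_. 1) x) \<le>
      norm (cc *\<^sub>R (Dop w g - Dop (\<lambda>_. 1) g)) + norm (Eop w (Aop f) - Eop (\<lambda>_. 1) (Aop f))"
    using norm_Pair_le[of "cc *\<^sub>R (Dop w g - Dop (\<lambda>_. 1) g)" "- (Eop w (Aop f) - Eop (\<lambda>_. 1) (Aop f))"]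
    by (simp add: Lop_def x scaleR_right_diff_distrib norm_minus_commute)
  also have "\<dots> \<le> cc * (real k * \<rho> * norm g) + real k * \<rho> * (cc * norm f)"
    using norm_difference(1)[OF w, of g] cc_ge \<rho>
      order_trans[OF norm_difference(2)[OF w, of "Aop f"] mult_left_mono[OF norm_Aop[of f], of "real k * \<rho>"]]
    by (intro add_mono) (simp_all add: mult_left_mono)
  also have "\<dots> \<le> cc * (real k * \<rho> * norm x) + real k * \<rho> * (cc * norm x)"
    unfolding x using cc_ge \<rho> norm_fst_le[of f g] norm_snd_le[of g f]
    by (intro add_mono mult_left_mono) auto
  finally show ?thesis by (simp add: algebra_simps)
qed

end

section \<open>The nonlinearity on Fourier coefficients\<close>

definition even_weight :: "(freq \<Rightarrow> real) \<Rightarrow> bool" where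
  "even_weight w \<longleftrightarrow> (\<forall>m n. w (- m, n) = w (m, n) \<and> w (m, - n) = w (m, n))"

lemma even_weight_sz: "even_weight (\<lambda>\<xi>. u (sz \<xi>))"
  by (simp add: even_weight_def sz_def)

definition parity :: "real \<Rightarrow> freq ell2 \<Rightarrow> bool" where
  "parity \<sigma> x \<longleftrightarrow> (\<forall>m n. coord x (- m, n) = \<sigma> * coord x (m, n) \<and> coord x (m, - n) = \<sigma> * coord x (m, n))"

text \<open>The reflections of \<open>X_sym\<close> in both variables become parities in both
  indices, even for the flux and odd for the vorticity; dividing by the even function
  \<open>rad\<close> preserves them.\<close>

definition sym_space :: "(freq ell2 \<times> freq ell2) set" where
  "sym_space = {x. parity 1 (fst x) \<and> parity (- 1) (snd x)}"

lemma subspace_sym_space: "subspace sym_space"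
  by (auto simp: sym_space_def parity_def subspace_def algebra_simps)

lemma closed_sym_space: "closed sym_space"
proof -
  have c: "continuous_on UNIV (\<lambda>x. coord (fst x) i)" "continuous_on UNIV (\<lambda>x. coord (snd x) i)"
    for i :: freq and x :: "freq ell2 \<times> freq ell2"
    by (auto intro!: continuous_intros bounded_linear.continuous_on[OF bounded_linear_coord])
  have "sym_space = (\<Inter>m. \<Inter>n. {x. coord (fst x) (- m, n) = coord (fst x) (m, n)} \<inter>
      {x. coord (fst x) (m, - n) = coord (fst x) (m, n)} \<inter>
      {x. coord (snd x) (- m, n) = - coord (snd x) (m, n)} \<inter>
      {x. coord (snd x) (m, - n) = - coord (snd x) (m, n)})"
    by (auto simp: sym_space_def parity_def)
  also have "closed \<dots>"
    by (intro closed_INT ballI closed_Int closed_Collect_eq c continuous_on_minus)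
  finally show ?thesis .
qed

context wave
begin

text \<open>The symbols of the three products in the nonlinearity, in the variables \<open>(f, g)\<close> of \<open>Lop\<close>.\<close>

definition br :: "freq \<Rightarrow> freq \<Rightarrow> real" where
  "br \<eta> \<xi> = real k * (of_int (snd \<eta>) * of_int (fst \<xi>) - of_int (fst \<eta>) * of_int (snd \<xi>))"

definition kF :: "freq \<Rightarrow> freq \<Rightarrow> real" where "kF \<eta> \<xi> = br \<eta> \<xi> / rad \<eta>"

definition kG :: "freq \<Rightarrow> freq \<Rightarrow> real" where "kG \<eta> \<xi> = br \<eta> \<xi> * rad \<xi> / (rad \<eta> * rad (\<eta> + \<xi>))"

definition kH :: "freq \<Rightarrow> freq \<Rightarrow> real" where "kH \<eta> \<xi> = br \<eta> \<xi> / ((1 + (rad \<eta>)\<^sup>2) * rad (\<eta> + \<xi>))"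

lemma br_le: "\<bar>br \<eta> \<xi>\<bar> \<le> rad \<eta> * rad \<xi>"
proof -
  define a b c d :: real where "a = real k * of_int (fst \<eta>)" and "b = of_int (snd \<eta>)"
    and "c = real k * of_int (fst \<xi>)" and "d = of_int (snd \<xi>)"
  have "br \<eta> \<xi> = b * c - a * d" by (simp add: br_def a_def b_def c_def d_def algebra_simps)
  moreover have "rad \<eta> * rad \<xi> = sqrt ((a\<^sup>2 + b\<^sup>2) * (c\<^sup>2 + d\<^sup>2))"
    by (simp add: rad_def a_def b_def c_def d_def real_sqrt_mult)
  moreover have "(b * c - a * d)\<^sup>2 \<le> (a\<^sup>2 + b\<^sup>2) * (c\<^sup>2 + d\<^sup>2)"
  proof -
    have "(a\<^sup>2 + b\<^sup>2) * (c\<^sup>2 + d\<^sup>2) = (b * c - a * d)\<^sup>2 + (a * c + b * d)\<^sup>2"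
      by (simp add: power2_eq_square algebra_simps)
    then show ?thesis by simp
  qed
  then have "\<bar>b * c - a * d\<bar> \<le> sqrt ((a\<^sup>2 + b\<^sup>2) * (c\<^sup>2 + d\<^sup>2))" by (intro real_le_rsqrt) simp
  ultimately show ?thesis by simp
qed

text \<open>\<open>br\<close> is a cross product, so adding \<open>\<eta>\<close> to the second
  argument changes nothing. The bound by \<open>rad (\<eta> + \<xi>)\<close> that follows cancels
  the denominators of \<open>kG\<close> and \<open>kH\<close>.\<close>

lemma br_add: "br \<eta> (\<eta> + \<xi>) = br \<eta> \<xi>"
  by (simp add: br_def algebra_simps)

lemma br_le': "\<bar>br \<eta> \<xi>\<bar> \<le> rad \<eta> * rad (\<eta> + \<xi>)"
  using br_le[of \<eta> "\<eta> + \<xi>"] by (simp only: br_add)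

text \<open>Only one derivative is lost, and it always falls on the second factor. Where a
  denominator vanishes the quotient is 0 by convention, which satisfies the bounds.\<close>

lemma kernel_bounds:
  "\<bar>kF \<eta> \<xi>\<bar> \<le> 1 + real k * sz \<xi>" "\<bar>kG \<eta> \<xi>\<bar> \<le> 1 + real k * sz \<xi>" "\<bar>kH \<eta> \<xi>\<bar> \<le> 1 + real k * sz \<xi>"
proof -
  have div: "\<bar>u / v\<bar> \<le> t" if "\<bar>u\<bar> \<le> v * t" "v \<ge> 0" "t \<ge> 0" for u v t :: real
    using that by (cases "v = 0") (auto simp: pos_divide_le_eq mult.commute)
  have le: "rad \<xi> \<le> 1 + real k * sz \<xi>" using rad_le[of \<xi>] by simp
  show "\<bar>kF \<eta> \<xi>\<bar> \<le> 1 + real k * sz \<xi>"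
    unfolding kF_def
    by (rule div) (use br_le[of \<eta> \<xi>] mult_left_mono[OF le, of "rad \<eta>"] in auto)
  have "\<bar>br \<eta> \<xi> * rad \<xi>\<bar> \<le> rad \<eta> * rad (\<eta> + \<xi>) * (1 + real k * sz \<xi>)"
    unfolding abs_mult using br_le'[of \<eta> \<xi>] le by (intro mult_mono) auto
  then show "\<bar>kG \<eta> \<xi>\<bar> \<le> 1 + real k * sz \<xi>"
    unfolding kG_def by (rule div) auto
  have "rad \<eta> \<le> 1 + (rad \<eta>)\<^sup>2"
    using sum_squares_bound[of "rad \<eta>" 1] rad_nonneg[of \<eta>] unfolding mult_1_right one_power2 by linarith
  then have "rad \<eta> * rad (\<eta> + \<xi>) \<le> (1 + (rad \<eta>)\<^sup>2) * rad (\<eta> + \<xi>) * (1 + real k * sz \<xi>)"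
    using mult_mono[of "rad \<eta> * rad (\<eta> + \<xi>)" "(1 + (rad \<eta>)\<^sup>2) * rad (\<eta> + \<xi>)" 1 "1 + real k * sz \<xi>"]
    by (simp add: mult_right_mono)
  then show "\<bar>kH \<eta> \<xi>\<bar> \<le> 1 + real k * sz \<xi>"
    unfolding kH_def by (intro div) (use br_le'[of \<eta> \<xi>] in auto)
qed

definition wk :: "(freq \<Rightarrow> real) \<Rightarrow> (freq \<Rightarrow> real) \<Rightarrow> (freq \<Rightarrow> real) \<Rightarrow> (freq \<Rightarrow> freq \<Rightarrow> real) \<Rightarrow> freq \<Rightarrow> freq \<Rightarrow> real" where
  "wk w1 w2 w3 \<kappa> \<eta> \<xi> = w3 (\<eta> + \<xi>) / (w1 \<eta> * w2 \<xi>) * \<kappa> \<eta> \<xi>"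

definition Bop where
  "Bop w1 w2 w3 x y = (conv (wk w1 w2 w3 kF) (snd x) (fst y),
     conv (wk w1 w2 w3 kG) (snd x) (snd y) - conv (wk w1 w2 w3 kH) (fst x) (fst y))"

text \<open>The condition of \<open>conv_weighted\<close> for a kernel that loses one derivative,
  with the factors measured in \<open>w1\<close>, \<open>w2\<close> and the product in
  \<open>w3\<close>.\<close>

definition admissible where
  "admissible w1 w2 w3 C p \<longleftrightarrow> C \<ge> 0 \<and> (\<forall>\<xi>. w1 \<xi> > 0 \<and> w2 \<xi> > 0 \<and> w3 \<xi> > 0 \<and> coord p \<xi> > 0) \<and>
     (\<forall>\<eta> \<xi>. w3 (\<eta> + \<xi>) * (1 + real k * sz \<xi>) \<le> C * (coord p \<eta> + coord p \<xi>) * (w1 \<eta> * w2 \<xi>))"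

context
  fixes w1 w2 w3 :: "freq \<Rightarrow> real" and C :: real and p :: "freq ell2"
  assumes adm: "admissible w1 w2 w3 C p"
begin

lemma adm_pos: "C \<ge> 0" "w1 \<xi> > 0" "w2 \<xi> > 0" "w3 \<xi> > 0" "coord p \<xi> > 0"
  using adm unfolding admissible_def by blast+

lemma wk_bound:
  assumes "\<And>\<eta> \<xi>. \<bar>\<kappa> \<eta> \<xi>\<bar> \<le> 1 + real k * sz \<xi>"
  shows "\<bar>wk w1 w2 w3 \<kappa> \<eta> \<xi>\<bar> \<le> C * (coord p \<eta> + coord p \<xi>)"
proof -
  have pos: "w1 \<eta> * w2 \<xi> > 0" "w3 (\<eta> + \<xi>) > 0" using adm_pos by auto
  have "\<bar>wk w1 w2 w3 \<kappa> \<eta> \<xi>\<bar> = w3 (\<eta> + \<xi>) * \<bar>\<kappa> \<eta> \<xi>\<bar> / (w1 \<eta> * w2 \<xi>)"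
    using pos by (simp add: wk_def abs_mult abs_of_pos[OF pos(1), unfolded abs_mult])
  also have "\<dots> \<le> w3 (\<eta> + \<xi>) * (1 + real k * sz \<xi>) / (w1 \<eta> * w2 \<xi>)"
    using pos assms by (intro divide_right_mono mult_left_mono) auto
  also have "\<dots> \<le> C * (coord p \<eta> + coord p \<xi>)"
    using adm unfolding admissible_def pos_divide_le_eq[OF pos(1)] by blast
  finally show ?thesis .
qed

lemmas wk_bounds = wk_bound[OF kernel_bounds(1)] wk_bound[OF kernel_bounds(2)] wk_bound[OF kernel_bounds(3)]

lemma bounded_bilinear_wk:
  "bounded_bilinear (conv (wk w1 w2 w3 kF))" "bounded_bilinear (conv (wk w1 w2 w3 kG))"
  "bounded_bilinear (conv (wk w1 w2 w3 kH))"
  by (rule bounded_bilinear_conv[OF _ adm_pos(5,1)], rule wk_bounds)+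

lemma norm_Bop: "norm (Bop w1 w2 w3 x y) \<le> 6 * C * norm p * norm x * norm y"
proof -
  obtain f g f' g' where xy: "x = (f, g)" "y = (f', g')" by fastforce
  have n: "norm f \<le> norm x" "norm g \<le> norm x" "norm f' \<le> norm y" "norm g' \<le> norm y"
    by (auto simp: xy norm_fst_le norm_snd_le)
  have b: "norm (conv (wk w1 w2 w3 \<kappa>) u v) \<le> 2 * C * norm p * norm x * norm y"
    if "\<And>\<eta> \<xi>. \<bar>wk w1 w2 w3 \<kappa> \<eta> \<xi>\<bar> \<le> C * (coord p \<eta> + coord p \<xi>)" "norm u \<le> norm x" "norm v \<le> norm y"
    for \<kappa> u v
  proof -
    have "norm (conv (wk w1 w2 w3 \<kappa>) u v) \<le> 2 * C * norm p * norm u * norm v"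
      by (rule conv_weighted(2)[OF that(1) adm_pos(5,1)])
    also have "\<dots> \<le> 2 * C * norm p * norm x * norm y"
      using that adm_pos(1) by (intro mult_mono) auto
    finally show ?thesis .
  qed
  have "norm (Bop w1 w2 w3 x y) \<le> norm (conv (wk w1 w2 w3 kF) g f') +
      (norm (conv (wk w1 w2 w3 kG) g g') + norm (conv (wk w1 w2 w3 kH) f f'))"
    unfolding Bop_def xy fst_conv snd_conv
    by (intro order_trans[OF norm_Pair_le] add_mono norm_triangle_ineq4 order_refl)
  also have "\<dots> \<le> 2 * C * norm p * norm x * norm y +
      (2 * C * norm p * norm x * norm y + 2 * C * norm p * norm x * norm y)"
    by (intro add_mono b wk_bounds n)
  finally show ?thesis by (simp add: algebra_simps)
qed

lemma bounded_bilinear_Bop: "bounded_bilinear (Bop w1 w2 w3)"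
proof
  note b = bounded_bilinear_wk
  fix a a' b b' and r :: real
  show "Bop w1 w2 w3 (a + a') b = Bop w1 w2 w3 a b + Bop w1 w2 w3 a' b"
    by (simp add: Bop_def b[THEN bounded_bilinear.add_left])
  show "Bop w1 w2 w3 a (b + b') = Bop w1 w2 w3 a b + Bop w1 w2 w3 a b'"
    by (simp add: Bop_def b[THEN bounded_bilinear.add_right])
  show "Bop w1 w2 w3 (r *\<^sub>R a) b = r *\<^sub>R Bop w1 w2 w3 a b"
    by (simp add: Bop_def b[THEN bounded_bilinear.scaleR_left] scaleR_diff_right)
  show "Bop w1 w2 w3 a (r *\<^sub>R b) = r *\<^sub>R Bop w1 w2 w3 a b"
    by (simp add: Bop_def b[THEN bounded_bilinear.scaleR_right] scaleR_diff_right)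
  show "\<exists>K. \<forall>a b. norm (Bop w1 w2 w3 a b) \<le> norm a * norm b * K"
    using norm_Bop by (intro exI[of _ "6 * C * norm p"]) (simp add: mult_ac)
qed

lemma Bop_has_sum:
  shows "((\<lambda>\<eta>. wk w1 w2 w3 kF \<eta> (\<zeta> - \<eta>) * coord (snd x) \<eta> * coord (fst y) (\<zeta> - \<eta>))
      has_sum coord (fst (Bop w1 w2 w3 x y)) \<zeta>) UNIV"
    and "((\<lambda>\<eta>. wk w1 w2 w3 kG \<eta> (\<zeta> - \<eta>) * coord (snd x) \<eta> * coord (snd y) (\<zeta> - \<eta>) -
       wk w1 w2 w3 kH \<eta> (\<zeta> - \<eta>) * coord (fst x) \<eta> * coord (fst y) (\<zeta> - \<eta>))
      has_sum coord (snd (Bop w1 w2 w3 x y)) \<zeta>) UNIV"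
proof -
  note hs = conv_weighted(1)[OF _ adm_pos(5,1)]
  show "((\<lambda>\<eta>. wk w1 w2 w3 kF \<eta> (\<zeta> - \<eta>) * coord (snd x) \<eta> * coord (fst y) (\<zeta> - \<eta>))
      has_sum coord (fst (Bop w1 w2 w3 x y)) \<zeta>) UNIV"
    unfolding Bop_def fst_conv by (rule hs[OF wk_bounds(1)])
  have "((\<lambda>\<eta>. - (wk w1 w2 w3 kH \<eta> (\<zeta> - \<eta>) * coord (fst x) \<eta> * coord (fst y) (\<zeta> - \<eta>)))
      has_sum - coord (conv (wk w1 w2 w3 kH) (fst x) (fst y)) \<zeta>) UNIV"
    unfolding has_sum_uminus minus_minus by (rule hs[OF wk_bounds(3)])
  from has_sum_add[OF hs[OF wk_bounds(2)] this]
  show "((\<lambda>\<eta>. wk w1 w2 w3 kG \<eta> (\<zeta> - \<eta>) * coord (snd x) \<eta> * coord (snd y) (\<zeta> - \<eta>) -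
       wk w1 w2 w3 kH \<eta> (\<zeta> - \<eta>) * coord (fst x) \<eta> * coord (fst y) (\<zeta> - \<eta>))
      has_sum coord (snd (Bop w1 w2 w3 x y)) \<zeta>) UNIV"
    unfolding Bop_def snd_conv coord_simps by simp
qed

lemma conv_reflection:
  assumes bd: "\<And>\<eta> \<xi>. \<bar>\<kappa> \<eta> \<xi>\<bar> \<le> C * (coord p \<eta> + coord p \<xi>)"
    and R: "\<And>\<eta> \<xi>. R (\<eta> - \<xi>) = R \<eta> - R \<xi>" "\<And>\<eta>. R (R \<eta>) = \<eta>"
    and sg: "\<And>\<eta> \<xi>. \<kappa> (R \<eta>) (R \<xi>) = \<sigma> * \<kappa> \<eta> \<xi>" "\<And>\<eta>. coord x (R \<eta>) = \<sigma>1 * coord x \<eta>"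
      "\<And>\<eta>. coord y (R \<eta>) = \<sigma>2 * coord y \<eta>"
  shows "coord (conv \<kappa> x y) (R \<zeta>) = \<sigma> * \<sigma>1 * \<sigma>2 * coord (conv \<kappa> x y) \<zeta>"
proof -
  note hs = conv_weighted(1)[OF bd adm_pos(5,1)]
  have bij: "bij_betw R UNIV UNIV" by (rule bij_betwI[where g = R]) (auto simp: R)
  have "((\<lambda>\<eta>. \<kappa> (R \<eta>) (R \<zeta> - R \<eta>) * coord x (R \<eta>) * coord y (R \<zeta> - R \<eta>))
      has_sum coord (conv \<kappa> x y) (R \<zeta>)) UNIV"
    by (subst has_sum_reindex_bij_betw[OF bij]) (rule hs)
  moreover have "\<kappa> (R \<eta>) (R \<zeta> - R \<eta>) * coord x (R \<eta>) * coord y (R \<zeta> - R \<eta>) =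
      \<sigma> * \<sigma>1 * \<sigma>2 * (\<kappa> \<eta> (\<zeta> - \<eta>) * coord x \<eta> * coord y (\<zeta> - \<eta>))" for \<eta>
    unfolding R(1)[symmetric] sg by simp
  moreover note has_sum_cmult_right[OF hs[of \<zeta> x y], of "\<sigma> * \<sigma>1 * \<sigma>2"]
  ultimately show ?thesis using has_sum_unique by (metis (no_types, lifting) has_sum_cong)
qed

text \<open>The cross product \<open>br\<close> changes sign under each reflection while
  \<open>rad\<close> and the weights are invariant; counting signs makes the first component even
  and the second odd.\<close>

lemma Bop_sym_space:
  assumes ev: "even_weight w1" "even_weight w2" "even_weight w3"
    and xy: "x \<in> sym_space" "y \<in> sym_space"
  shows "Bop w1 w2 w3 x y \<in> sym_space"
proof -
  define R1 R2 :: "freq \<Rightarrow> freq" where "R1 = (\<lambda>\<xi>. (- fst \<xi>, snd \<xi>))" and "R2 = (\<lambda>\<xi>. (fst \<xi>, - snd \<xi>))"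
  have main: "coord (fst (Bop w1 w2 w3 x y)) (R \<zeta>) = coord (fst (Bop w1 w2 w3 x y)) \<zeta> \<and>
      coord (snd (Bop w1 w2 w3 x y)) (R \<zeta>) = - coord (snd (Bop w1 w2 w3 x y)) \<zeta>"
    if "R = R1 \<or> R = R2" for R \<zeta>
  proof -
    have R: "\<And>\<eta> \<xi>. R (\<eta> - \<xi>) = R \<eta> - R \<xi>" "\<And>\<eta>. R (R \<eta>) = \<eta>" "\<And>\<eta> \<xi>. R \<eta> + R \<xi> = R (\<eta> + \<xi>)"
      using that by (auto simp: R1_def R2_def)
    have wR: "w1 (R \<xi>) = w1 \<xi>" "w2 (R \<xi>) = w2 \<xi>" "w3 (R \<xi>) = w3 \<xi>" "rad (R \<xi>) = rad \<xi>" for \<xi>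
      using that ev by (cases \<xi>; auto simp: R1_def R2_def even_weight_def)+
    have brR: "br (R \<eta>) (R \<xi>) = - 1 * br \<eta> \<xi>" for \<eta> \<xi>
      using that by (auto simp: R1_def R2_def br_def algebra_simps)
    have kR: "wk w1 w2 w3 kF (R \<eta>) (R \<xi>) = - 1 * wk w1 w2 w3 kF \<eta> \<xi>"
      "wk w1 w2 w3 kG (R \<eta>) (R \<xi>) = - 1 * wk w1 w2 w3 kG \<eta> \<xi>"
      "wk w1 w2 w3 kH (R \<eta>) (R \<xi>) = - 1 * wk w1 w2 w3 kH \<eta> \<xi>" for \<eta> \<xi>
      by (simp_all add: wk_def kF_def kG_def kH_def R(3) wR brR)
    have fR: "coord (fst x) (R \<eta>) = 1 * coord (fst x) \<eta>" "coord (snd x) (R \<eta>) = - 1 * coord (snd x) \<eta>"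
      "coord (fst y) (R \<eta>) = 1 * coord (fst y) \<eta>" "coord (snd y) (R \<eta>) = - 1 * coord (snd y) \<eta>" for \<eta>
      using that xy by (cases \<eta>; auto simp: R1_def R2_def sym_space_def parity_def)+
    show ?thesis
      using conv_reflection[where R = R and \<zeta> = \<zeta>, OF wk_bounds(1) R(1,2) kR(1) fR(2,3)]
        conv_reflection[where R = R and \<zeta> = \<zeta>, OF wk_bounds(2) R(1,2) kR(2) fR(2,4)]
        conv_reflection[where R = R and \<zeta> = \<zeta>, OF wk_bounds(3) R(1,2) kR(3) fR(1,3)]
      by (simp add: Bop_def)
  qed
  show ?thesis
    using main[of R1] main[of R2] by (force simp: sym_space_def parity_def R1_def R2_def)
qed

end

text \<open>Each block is a difference of opposite shifts, which reverses parity in the first index,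
  times \<open>n\<close>, which reverses it in the second.\<close>

lemma Lop_sym_space:
  assumes w: "slow_weight w \<rho>" and ev: "even_weight w" and x: "x \<in> sym_space"
  shows "Lop w x \<in> sym_space"
proof -
  have e: "w (- m, n) = w (m, n)" "w (m, - n) = w (m, n)" "w (- m - 1, n) = w (m + 1, n)"
    "w (- m + 1, n) = w (m - 1, n)" "w (1 - m, n) = w (m - 1, n)"
    "rad (- m - 1, n) = rad (m + 1, n)" "rad (1 - m, n) = rad (m - 1, n)"
    "asym (- m - 1, n) = asym (m + 1, n)" "asym (1 - m, n) = asym (m - 1, n)" 
    "rad (- m, n) = rad (m, n)" "rad (m, - n) = rad (m, n)" "asym (m, - n) = asym (m, n)" for m n
    using ev[unfolded even_weight_def, rule_format, of "m + 1" n]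
      ev[unfolded even_weight_def, rule_format, of "m - 1" n]
      ev[unfolded even_weight_def, rule_format, of m n]
    by (auto simp: rad_def asym_def power2_eq_square algebra_simps minus_diff_commute)
  have f: "coord (fst x) (- m - 1, n) = coord (fst x) (m + 1, n)" "coord (fst x) (1 - m, n) = coord (fst x) (m - 1, n)"
    "coord (fst x) (m, - n) = coord (fst x) (m, n)"
    "coord (snd x) (- m - 1, n) = - coord (snd x) (m + 1, n)" "coord (snd x) (1 - m, n) = - coord (snd x) (m - 1, n)"
    "coord (snd x) (m, - n) = - coord (snd x) (m, n)" for m n
  proof -
    have p: "coord (fst x) (- a, b) = coord (fst x) (a, b)" "coord (snd x) (- a, b) = - coord (snd x) (a, b)"
      "coord (fst x) (m, - n) = coord (fst x) (m, n)" "coord (snd x) (m, - n) = - coord (snd x) (m, n)" for a b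
      using x by (auto simp: sym_space_def parity_def)
    show "coord (fst x) (- m - 1, n) = coord (fst x) (m + 1, n)" "coord (fst x) (1 - m, n) = coord (fst x) (m - 1, n)"
      "coord (fst x) (m, - n) = coord (fst x) (m, n)"
      "coord (snd x) (- m - 1, n) = - coord (snd x) (m + 1, n)" "coord (snd x) (1 - m, n) = - coord (snd x) (m - 1, n)"
      "coord (snd x) (m, - n) = - coord (snd x) (m, n)"
      using p(1,2)[of "m + 1" n] p(1,2)[of "m - 1" n] p(3,4) by simp_all
  qed
  show ?thesis
    unfolding sym_space_def parity_def mem_Collect_eq Lop_def fst_conv snd_conv coord_simps
      coord_Dop[OF w] coord_Eop[OF w] coord_Aop Dco_def Eco_def sh_def
    by (simp add: e f)
qed

end

section \<open>Change of weights\<close>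

context wave
begin

definition W :: "real \<Rightarrow> nat \<Rightarrow> freq \<Rightarrow> real" where
  "W \<kappa> j \<xi> = gevrey \<kappa> j (sz \<xi>)"

definition ew :: "real \<Rightarrow> freq \<Rightarrow> real" where
  "ew \<kappa> \<xi> = exp (\<kappa> * sz \<xi>)"

abbreviation one :: "freq \<Rightarrow> real" where
  "one \<equiv> (\<lambda>_. 1)"

text \<open>Passage between two encodings of the same Fourier coefficients, stored times
  \<open>w\<close> and times \<open>w'\<close>. For w' below w it is the embedding of the smaller
  space into the larger.\<close>

definition chg :: "(freq \<Rightarrow> real) \<Rightarrow> (freq \<Rightarrow> real) \<Rightarrow> freq ell2 \<times> freq ell2 \<Rightarrow> freq ell2 \<times> freq ell2" where
  "chg w w' x = (wop (\<lambda>\<xi>. w' \<xi> / w \<xi>) id (fst x), wop (\<lambda>\<xi>. w' \<xi> / w \<xi>) id (snd x))"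

context
  fixes w w' :: "freq \<Rightarrow> real"
  assumes le: "\<And>\<xi>. w' \<xi> \<le> w \<xi>" and pos: "\<And>\<xi>. w \<xi> > 0" "\<And>\<xi>. w' \<xi> > 0"
begin

lemma chg_ratio: "\<bar>w' \<xi> / w \<xi>\<bar> \<le> 1"
  using le[of \<xi>] pos(1)[of \<xi>] pos(2)[of \<xi>] by (simp add: abs_le_iff divide_le_eq)

lemma coord_chg:
  "coord (fst (chg w w' x)) \<xi> = w' \<xi> / w \<xi> * coord (fst x) \<xi>"
  "coord (snd (chg w w' x)) \<xi> = w' \<xi> / w \<xi> * coord (snd x) \<xi>"
  by (simp_all add: chg_def coord_wop[OF inj_on_id chg_ratio])

lemma norm_chg: "norm (chg w w' x) \<le> norm x"
proof -
  have n: "norm (wop (\<lambda>\<xi>. w' \<xi> / w \<xi>) id y) \<le> norm y" for y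
    using norm_wop[OF inj_on_id chg_ratio] by simp
  show ?thesis
    unfolding chg_def by (cases x) (auto simp: norm_Pair intro!: add_mono power_mono n)
qed

lemma bounded_linear_chg: "bounded_linear (chg w w')"
  unfolding chg_def[abs_def]
  by (intro bounded_linear_Pair bounded_linear_compose[OF bounded_linear_wop[OF inj_on_id chg_ratio]]
      bounded_linear_fst bounded_linear_snd)

lemma chg_sym_space:
  assumes "even_weight w" "even_weight w'" "x \<in> sym_space"
  shows "chg w w' x \<in> sym_space"
  using assms by (auto simp: sym_space_def parity_def even_weight_def coord_chg)

text \<open>All \<open>Lop w\<close> encode one and the same operator, so the embeddings intertwine
  them exactly; \<open>chg_Bop\<close> says this of the products.\<close>

lemma chg_Lop:
  assumes "slow_weight w \<rho>" "slow_weight w' \<rho>'"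
  shows "chg w w' (Lop w x) = Lop w' (chg w w' x)"
proof (rule prod_eqI; rule ell2_eqI)
  fix \<xi>
  have nz: "w \<zeta> \<noteq> 0" "w' \<zeta> \<noteq> 0" for \<zeta> using pos[of \<zeta>] by simp_all
  have D: "w' \<xi> / w \<xi> * (Dco w s \<xi> * y) = Dco w' s \<xi> * (w' (sh s \<xi>) / w (sh s \<xi>) * y)"
    "w' \<xi> / w \<xi> * (Eco w s \<xi> * y) = Eco w' s \<xi> * (w' (sh s \<xi>) / w (sh s \<xi>) * y)" for s y
    using nz by (simp_all add: Dco_def Eco_def)
  show "coord (fst (chg w w' (Lop w x))) \<xi> = coord (fst (Lop w' (chg w w' x))) \<xi>"
    using D(1)[of 1 "coord (snd x) (sh 1 \<xi>)"] D(1)[of "-1" "coord (snd x) (sh (- 1) \<xi>)"]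
    by (simp add: coord_chg Lop_def coord_Dop[OF assms(1)] coord_Dop[OF assms(2)] right_diff_distrib mult.left_commute[of _ cc])
  show "coord (snd (chg w w' (Lop w x))) \<xi> = coord (snd (Lop w' (chg w w' x))) \<xi>"
    using D(2)[of 1 "asym (sh 1 \<xi>) * coord (fst x) (sh 1 \<xi>)"]
      D(2)[of "-1" "asym (sh (- 1) \<xi>) * coord (fst x) (sh (- 1) \<xi>)"]
    by (simp add: coord_chg Lop_def coord_Eop[OF assms(1)] coord_Eop[OF assms(2)] coord_Aop
        right_diff_distrib mult_ac)
qed

end

lemma chg_trans:
  assumes "\<And>\<xi>. w' \<xi> \<le> w \<xi>" "\<And>\<xi>. w'' \<xi> \<le> w' \<xi>" "\<And>\<xi>. w'' \<xi> > 0"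
  shows "chg w' w'' (chg w w' x) = chg w w'' x"
proof -
  have pos: "w' \<xi> > 0" "w \<xi> > 0" for \<xi>
    using assms(1)[of \<xi>] assms(2)[of \<xi>] assms(3)[of \<xi>] by linarith+
  have le: "w'' \<xi> \<le> w \<xi>" for \<xi> using assms(1,2) order_trans by blast
  have "w'' \<xi> / w' \<xi> * (w' \<xi> / w \<xi> * y) = w'' \<xi> / w \<xi> * y" for \<xi> y
    using pos[of \<xi>] by simp
  then show ?thesis
    using assms pos le
    by (intro prod_eqI; intro ell2_eqI) (simp_all only: coord_chg[of w'' w'] coord_chg[of w' w] coord_chg[of w'' w])
qed

lemma chg_Bop:
  assumes adm: "admissible w1 w2 w3 C p" "admissible w1' w2' w3' C' p'"
    and le: "\<And>\<xi>. w1' \<xi> \<le> w1 \<xi>" "\<And>\<xi>. w2' \<xi> \<le> w2 \<xi>" "\<And>\<xi>. w3' \<xi> \<le> w3 \<xi>"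
  shows "chg w3 w3' (Bop w1 w2 w3 x y) = Bop w1' w2' w3' (chg w1 w1' x) (chg w2 w2' y)"
proof (rule prod_eqI; rule ell2_eqI)
  fix \<zeta>
  note pos = adm_pos[OF adm(1)] adm_pos[OF adm(2)]
  note cs = coord_chg[OF le(1) pos(2) pos(7)] coord_chg[OF le(2) pos(3) pos(8)]
    coord_chg[OF le(3) pos(4) pos(9)]
  have nz: "w1 \<xi> \<noteq> 0" "w2 \<xi> \<noteq> 0" "w3 \<xi> \<noteq> 0" "w1' \<xi> \<noteq> 0" "w2' \<xi> \<noteq> 0" "w3' \<xi> \<noteq> 0" for \<xi>
    using pos(2-4,7-9)[of \<xi>] by auto
  have K: "w3' \<zeta> / w3 \<zeta> * (wk w1 w2 w3 \<kappa> \<eta> (\<zeta> - \<eta>) * a * b) =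
     wk w1' w2' w3' \<kappa> \<eta> (\<zeta> - \<eta>) * (w1' \<eta> / w1 \<eta> * a) * (w2' (\<zeta> - \<eta>) / w2 (\<zeta> - \<eta>) * b)"
    for \<kappa> \<eta> a b
    using nz by (simp add: wk_def)
  show "coord (fst (chg w3 w3' (Bop w1 w2 w3 x y))) \<zeta> =
      coord (fst (Bop w1' w2' w3' (chg w1 w1' x) (chg w2 w2' y))) \<zeta>"
    using has_sum_cmult_right[OF Bop_has_sum(1)[OF adm(1), of \<zeta> x y], of "w3' \<zeta> / w3 \<zeta>"]
      Bop_has_sum(1)[OF adm(2), of \<zeta> "chg w1 w1' x" "chg w2 w2' y"]
    unfolding cs K by (rule has_sum_unique)
  show "coord (snd (chg w3 w3' (Bop w1 w2 w3 x y))) \<zeta> =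
      coord (snd (Bop w1' w2' w3' (chg w1 w1' x) (chg w2 w2' y))) \<zeta>"
    using has_sum_cmult_right[OF Bop_has_sum(2)[OF adm(1), of \<zeta> x y], of "w3' \<zeta> / w3 \<zeta>"]
      Bop_has_sum(2)[OF adm(2), of \<zeta> "chg w1 w1' x" "chg w2 w2' y"]
    unfolding cs right_diff_distrib K by (rule has_sum_unique)
qed

context
  fixes \<kappa> :: real
  assumes \<kappa>: "\<kappa> > 0"
begin

lemma slow_W: "j \<ge> 1 \<Longrightarrow> slow_weight (W \<kappa> j) (exp (4 * \<kappa>) - 1)"
  using slow_weight_gevrey[OF \<kappa>] by (simp add: W_def[abs_def])

lemma even_weights: "even_weight (W \<kappa> j)" "even_weight (ew \<kappa>)" "even_weight one"
  unfolding W_def[abs_def] ew_def[abs_def] by (rule even_weight_sz, rule even_weight_sz) (simp add: even_weight_def)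

lemma weights_pos: "W \<kappa> j \<xi> > 0" "ew \<kappa> \<xi> > 0"
  using gevrey_pos[OF \<kappa>] by (auto simp: W_def ew_def)

lemma weights_le: "j \<ge> 1 \<Longrightarrow> ew \<kappa> \<xi> \<le> W \<kappa> j \<xi>" "1 \<le> ew \<kappa> \<xi>" "j \<ge> 1 \<Longrightarrow> 1 \<le> W \<kappa> j \<xi>"
proof -
  show 1: "ew \<kappa> \<xi> \<le> W \<kappa> j \<xi>" if "j \<ge> 1"
    using gevrey_ge_exp[OF \<kappa> that, of "sz \<xi>"] by (simp add: W_def ew_def)
  show 2: "1 \<le> ew \<kappa> \<xi>" using \<kappa> by (simp add: ew_def)
  show "1 \<le> W \<kappa> j \<xi>" if "j \<ge> 1" using 1[OF that] 2 by linarith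
qed

lemma sz_pos: "1 + \<kappa> * sz \<xi> > 0"
  using \<kappa> by (simp add: add_pos_nonneg)

lemma admissible_W:
  assumes "i \<ge> 1" "j \<ge> 1"
  shows "admissible (W \<kappa> i) (W \<kappa> j) (W \<kappa> (i + j)) (2 * exp 1 * (1 + real k / \<kappa>) * real (i + j)) (decay \<kappa>)"
  unfolding admissible_def coord_decay[OF \<kappa>]
proof (intro conjI allI)
  show "W \<kappa> (i + j) (\<eta> + \<xi>) * (1 + real k * sz \<xi>) \<le> 2 * exp 1 * (1 + real k / \<kappa>) * real (i + j) *
      (1 / (1 + \<kappa> * sz \<eta>)\<^sup>2 + 1 / (1 + \<kappa> * sz \<xi>)\<^sup>2) * (W \<kappa> i \<eta> * W \<kappa> j \<xi>)" for \<eta> \<xi>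
    unfolding W_def by (rule gevrey_product[OF \<kappa> assms]) (auto simp: sz_add)
qed (use weights_pos \<kappa> sz_pos in \<open>auto intro!: zero_less_power simp: less_imp_neq[symmetric]\<close>)

lemma admissible_ew: "admissible (ew \<kappa>) (ew \<kappa>) one (27 * (1 + real k / \<kappa>)) (decay \<kappa>)"
  unfolding admissible_def coord_decay[OF \<kappa>]
proof (intro conjI allI)
  show "1 * (1 + real k * sz \<xi>) \<le> 27 * (1 + real k / \<kappa>) *
      (1 / (1 + \<kappa> * sz \<eta>)\<^sup>2 + 1 / (1 + \<kappa> * sz \<xi>)\<^sup>2) * (ew \<kappa> \<eta> * ew \<kappa> \<xi>)" for \<eta> \<xi>
    unfolding ew_def mult_1 by (rule exp_product[OF \<kappa>]) auto
qed (use weights_pos \<kappa> sz_pos in \<open>auto intro!: zero_less_power simp: less_imp_neq[symmetric]\<close>)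

end

text \<open>On the vorticity component the square of \<open>Lop one\<close> is minus
  \<open>cc\<close> times \<open>Eop one (Aop (Dop one g))\<close>; the condition bounds its
  quadratic form by \<open>\<Lambda>\<^sup>2\<close>.\<close>

definition spectral_bound :: "real \<Rightarrow> bool" where
  "spectral_bound \<Lambda> \<longleftrightarrow> (\<forall>g. - (\<Lambda>\<^sup>2 * (norm g)\<^sup>2) \<le> cc * inner (Aop (Dop one g)) (Dop one g))"

text \<open>The weight parameter and all constants are fixed before the eigenvector
  \<open>v\<close>. The energy form allows the rate \<open>\<Lambda> + \<Lambda> / 4\<close>, the
  weights add at most \<open>\<Lambda> / 4\<close>, and the total stays below
  \<open>2 * \<Lambda>\<close>.\<close>

lemma graded_evolution_exists:
  assumes \<Lambda>: "\<Lambda> > 0" and sb: "spectral_bound \<Lambda>"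
  shows "\<exists>\<kappa>>0. \<exists>N c K C \<gamma>. \<forall>v\<in>sym_space. Lop (W \<kappa> 1) v = \<Lambda> *\<^sub>R v \<longrightarrow>
     graded_evolution (\<lambda>j. Lop (W \<kappa> j)) (\<lambda>i j. Bop (W \<kappa> i) (W \<kappa> j) (W \<kappa> (i + j))) N \<Lambda> \<gamma> c K C v sym_space"
proof -
  have k0: "real k > 0" using k by simp
  interpret en: energy "Dop one" "Eop one" Aop cc "real k" \<Lambda> "\<Lambda> / 4"
  proof (rule energy.intro)
    show "bounded_linear (Dop one)" "bounded_linear (Eop one)" "bounded_linear Aop"
      by (rule bounded_linear_Dop[OF slow_weight_one] bounded_linear_Eop[OF slow_weight_one]
          bounded_linear_Aop)+
    show "inner (Dop one x) y = inner x (Eop one y)" for x y by (rule inner_Dop)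
    show "inner (Aop x) y = inner x (Aop y)" for x y by (rule inner_Aop)
    show "norm (Dop one x) \<le> real k * norm x" for x by (rule norm_Dop_one)
    show "- (\<Lambda>\<^sup>2 * (norm g)\<^sup>2) \<le> cc * inner (Aop (Dop one g)) (Dop one g)" for g
      using sb by (simp only: spectral_bound_def)
    show "0 < cc" using cc_ge by linarith
  qed (use \<Lambda> k0 in simp_all)
  have gen: "en.gen = Lop one" by (simp add: en.gen_def Lop_def fun_eq_iff)
  obtain K where K: "K \<ge> 0" "\<And>x y. \<bar>en.N x y\<bar> \<le> K * norm x * norm y"
    using en.N_bounded by blast
  define c where "c = min (\<Lambda>\<^sup>2) en.\<theta>"
  have c: "c > 0" using \<Lambda> en.\<theta>_pos by (simp add: c_def)
  define q where "q = K * (2 * cc * real k) + 1"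
  have q: "q > 0" using K cc_ge k0 by (simp add: q_def add_nonneg_pos)
  \<comment> \<open>Makes the perturbation by the weights, estimated through the bound
    \<open>K\<close> and the coercivity \<open>c\<close> of the form, cost at most
    \<open>\<Lambda> / 4\<close>; the summand 1 in \<open>q\<close> keeps the quotient meaningful.
    Then \<open>\<kappa>\<close> is solved from
    \<open>exp (4 * \<kappa>) - 1 = \<rho>\<close>.\<close>
  define \<rho> where "\<rho> = \<Lambda> / 4 * c / q"
  have \<rho>: "\<rho> > 0" using \<Lambda> c q by (simp add: \<rho>_def)
  define \<kappa> where "\<kappa> = ln (1 + \<rho>) / 4"
  have \<kappa>: "\<kappa> > 0" using \<rho> by (simp add: \<kappa>_def)
  have e: "exp (4 * \<kappa>) - 1 = \<rho>" using \<rho> by (simp add: \<kappa>_def)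
  have diss: "en.N x (Lop (W \<kappa> j) x) \<le> (3 / 2 * \<Lambda>) * en.N x x" if j: "j \<ge> 1" for j x
  proof -
    let ?d = "Lop (W \<kappa> j) x - Lop one x"
    have "en.N x ?d \<le> K * norm x * norm ?d" using K(2)[of x ?d] by linarith
    also have "\<dots> \<le> K * norm x * (2 * cc * real k * \<rho> * norm x)"
      using norm_Lop_diff[OF slow_W[OF \<kappa> j], of x] K(1) unfolding e by (intro mult_left_mono) auto
    also have "\<dots> = (q - 1) * \<rho> * (norm x)\<^sup>2" by (simp add: q_def power2_eq_square)
    also have "\<dots> \<le> q * \<rho> * (norm x)\<^sup>2" using \<rho> by (intro mult_right_mono) auto
    also have "\<dots> = \<Lambda> / 4 * (c * (norm x)\<^sup>2)" using q by (simp add: \<rho>_def)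
    also have "\<dots> \<le> \<Lambda> / 4 * en.N x x"
      using en.N_coercive[of x] \<Lambda> by (intro mult_left_mono) (auto simp: c_def)
    finally have d: "en.N x ?d \<le> \<Lambda> / 4 * en.N x x" .
    have "en.N x (Lop (W \<kappa> j) x) = en.N x (en.gen x) + en.N x ?d"
      unfolding gen by (simp add: bounded_bilinear.add_right[OF en.bounded_bilinear_N, symmetric])
    then show ?thesis using d en.N_gen[of x] by (simp add: algebra_simps)
  qed
  define C where "C = 12 * exp 1 * (1 + real k / \<kappa>) * norm (decay \<kappa>)"
  have "graded_evolution (\<lambda>j. Lop (W \<kappa> j)) (\<lambda>i j. Bop (W \<kappa> i) (W \<kappa> j) (W \<kappa> (i + j)))
      en.N \<Lambda> (3 / 2 * \<Lambda>) c K C v sym_space" if v: "v \<in> sym_space" "Lop (W \<kappa> 1) v = \<Lambda> *\<^sub>R v" for v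
  proof (rule graded_evolution.intro)
    fix i j :: nat and x y
    show "bounded_linear (Lop (W \<kappa> j))" if "j \<ge> 1" by (rule bounded_linear_Lop[OF slow_W[OF \<kappa> that]])
    show "Lop (W \<kappa> j) x \<in> sym_space" if "j \<ge> 1" "x \<in> sym_space"
      by (rule Lop_sym_space[OF slow_W[OF \<kappa> that(1)] even_weights(1)[OF \<kappa>] that(2)])
    assume ij: "i \<ge> 1" "j \<ge> 1"
    note adm = admissible_W[OF \<kappa> ij]
    show "bounded_bilinear (Bop (W \<kappa> i) (W \<kappa> j) (W \<kappa> (i + j)))" by (rule bounded_bilinear_Bop[OF adm])
    show "norm (Bop (W \<kappa> i) (W \<kappa> j) (W \<kappa> (i + j)) x y) \<le> C * real (i + j) * norm x * norm y"
    proof -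
      have eq: "6 * (2 * e * q * r) * d * a * b = (12 * e * q * d) * r * a * b" for e q r d a b :: real
        by simp
      show ?thesis using norm_Bop[OF adm, of x y] unfolding C_def eq .
    qed
    show "Bop (W \<kappa> i) (W \<kappa> j) (W \<kappa> (i + j)) x y \<in> sym_space" if "x \<in> sym_space" "y \<in> sym_space"
      by (rule Bop_sym_space[OF adm _ _ _ that]) (rule even_weights(1)[OF \<kappa>])+
  qed (use v \<Lambda> K c diss en.N_coercive \<kappa> in \<open>auto simp: C_def c_def en.N_sym subspace_sym_space
        closed_sym_space intro: en.bounded_bilinear_N\<close>)
  then show ?thesis using \<kappa> by blast
qed

end

section \<open>Analytic solutions of the perturbation equation\<close>

context wave
begin

text \<open>Sums \<open>\<epsilon> ^ j\<close> times \<open>V j\<close> in the common weight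
  \<open>ew \<kappa>\<close>. Time derivatives cost an extra factor of order j^2, crudely absorbed
  by \<open>4 ^ j\<close>; the bound 1/8 then leaves the differentiated series convergent at ratio
  1/2. The equation is stated after passing to weight one because the product loses a
  derivative.\<close>

lemma analytic_solution:
  assumes \<kappa>: "\<kappa> > 0" and v: "v \<in> sym_space" and \<Lambda>: "\<Lambda> > 0"
    and ge: "graded_evolution (\<lambda>j. Lop (W \<kappa> j)) (\<lambda>i j. Bop (W \<kappa> i) (W \<kappa> j) (W \<kappa> (i + j))) N \<Lambda> \<gamma> c K C v sym_space"
  shows "\<exists>D>0. \<forall>\<epsilon> T. 0 < \<epsilon> \<and> 0 < T \<and> D * \<epsilon> * exp (\<Lambda> * T) \<le> 1 / 8 \<longrightarrow> (\<exists>u u'.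
     u 0 = \<epsilon> *\<^sub>R chg (W \<kappa> 1) (ew \<kappa>) v \<and> continuous_on {0..T} u' \<and> (\<forall>t\<in>{0..T}.
       u t \<in> sym_space \<and> u' t \<in> sym_space \<and>
       (u has_vector_derivative u' t) (at t within {0..T}) \<and>
       chg (ew \<kappa>) one (u' t) = Lop one (chg (ew \<kappa>) one (u t)) + Bop (ew \<kappa>) (ew \<kappa>) one (u t) (u t) \<and>
       norm (u t - (\<epsilon> * exp (\<Lambda> * t)) *\<^sub>R chg (W \<kappa> 1) (ew \<kappa>) v) \<le> 2 * (D * \<epsilon> * exp (\<Lambda> * t))\<^sup>2))"
proof -
  interpret ge: graded_evolution "\<lambda>j. Lop (W \<kappa> j)" "\<lambda>i j. Bop (W \<kappa> i) (W \<kappa> j) (W \<kappa> (i + j))"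
    N \<Lambda> \<gamma> c K C v sym_space by (rule ge)
  obtain D where D: "D > 0" "\<And>j t. j \<ge> 1 \<Longrightarrow> t \<ge> 0 \<Longrightarrow> norm (ge.V j t) \<le> D ^ j * exp (j * \<Lambda> * t)"
    using ge.V_bound by blast
  define I where "I j = chg (W \<kappa> j) (ew \<kappa>)" for j
  note wl = weights_le[OF \<kappa>] weights_pos[OF \<kappa>]
  have I: "bounded_linear (I j)" "norm (I j x) \<le> norm x" "x \<in> sym_space \<Longrightarrow> I j x \<in> sym_space"
    if "j \<ge> 1" for j x
    unfolding I_def using wl that even_weights[OF \<kappa>]
    by (auto intro!: bounded_linear_chg norm_chg chg_sym_space)
  obtain lb0 where lb0: "lb0 \<ge> 0" "\<And>x. norm (Lop one x) \<le> norm x * lb0"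
    using bounded_linear.nonneg_bounded[OF bounded_linear_Lop[OF slow_weight_one]] by blast
  define lb where "lb = 2 * cc * real k * (exp (4 * \<kappa>) - 1) + lb0"
  have lb: "lb \<ge> 0" "norm (Lop (W \<kappa> j) x) \<le> lb * norm x" if "j \<ge> 1" for j x
  proof -
    show "lb \<ge> 0" using cc_ge \<kappa> lb0 by (simp add: lb_def)
    have "norm (Lop (W \<kappa> j) x) \<le> norm (Lop (W \<kappa> j) x - Lop one x) + norm (Lop one x)"
      by (metis diff_add_cancel norm_triangle_ineq)
    then show "norm (Lop (W \<kappa> j) x) \<le> lb * norm x"
      using norm_Lop_diff[OF slow_W[OF \<kappa> that], of x] lb0(2)[of x] by (simp add: lb_def algebra_simps)
  qed
  define V' where "V' j t = Lop (W \<kappa> j) (ge.V j t) + ge.forcing j t" for j t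
  have V'_bound: "norm (V' j t) \<le> (lb + C) * 4 ^ j * (D ^ j * exp (j * \<Lambda> * t))" if j: "j \<ge> 1" and t: "t \<ge> 0" for j t
  proof -
    have "norm (Bop (W \<kappa> i) (W \<kappa> (j - i)) (W \<kappa> (i + (j - i))) (ge.V i t) (ge.V (j - i) t)) \<le>
        C * real j * (D ^ j * exp (j * \<Lambda> * t))" if i: "i \<in> {1..<j}" for i
    proof -
      have ij: "i \<ge> 1" "j - i \<ge> 1" "i + (j - i) = j" using i by auto
      have "norm (Bop (W \<kappa> i) (W \<kappa> (j - i)) (W \<kappa> (i + (j - i))) (ge.V i t) (ge.V (j - i) t)) \<le>
         C * real j * (norm (ge.V i t) * norm (ge.V (j - i) t))"
        using ge.B_bound[OF ij(1,2), of "ge.V i t" "ge.V (j - i) t"] by (simp only: ij(3) mult.assoc)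
      also have "\<dots> \<le> C * real j * ((D ^ i * exp (i * \<Lambda> * t)) * (D ^ (j - i) * exp (real (j - i) * \<Lambda> * t)))"
        using D(1) ge.rate by (intro mult_left_mono mult_mono D(2) ij t) auto
      also have "(D ^ i * exp (i * \<Lambda> * t)) * (D ^ (j - i) * exp (real (j - i) * \<Lambda> * t)) =
          D ^ (i + (j - i)) * exp (real (i + (j - i)) * \<Lambda> * t)"
        unfolding power_add of_nat_add distrib_right exp_add by (simp only: mult_ac)
      finally show ?thesis by (simp only: ij(3))
    qed
    then have "norm (ge.forcing j t) \<le> (\<Sum>i\<in>{1..<j}. C * real j * (D ^ j * exp (j * \<Lambda> * t)))"
      unfolding ge.forcing_def by (intro sum_norm_le) simp
    also have "\<dots> \<le> (real j * real j) * (C * (D ^ j * exp (j * \<Lambda> * t)))"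
    proof -
      have "real (j - 1) * (C * real j * (D ^ j * exp (j * \<Lambda> * t))) \<le> real j * (C * real j * (D ^ j * exp (j * \<Lambda> * t)))"
        using ge.rate D by (intro mult_right_mono) auto
      then show ?thesis by (simp add: mult_ac)
    qed
    also have "\<dots> \<le> 4 ^ j * (C * (D ^ j * exp (j * \<Lambda> * t)))"
    proof (rule mult_right_mono)
      have "real j \<le> 2 ^ j" using of_nat_less_two_power[of j, where 'a = real] by simp
      then have "real j * real j \<le> 2 ^ j * 2 ^ j" by (intro mult_mono) auto
      then show "real j * real j \<le> 4 ^ j" by (simp add: power_mult_distrib[symmetric])
    qed (use ge.rate D in simp)
    finally have f: "norm (ge.forcing j t) \<le> 4 ^ j * (C * (D ^ j * exp (j * \<Lambda> * t)))" .
    have "norm (Lop (W \<kappa> j) (ge.V j t)) \<le> lb * (D ^ j * exp (j * \<Lambda> * t))"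
      using lb(2)[OF j, of "ge.V j t"] mult_left_mono[OF D(2)[OF j t] lb(1)[OF j]] by linarith
    also have "\<dots> \<le> 4 ^ j * (lb * (D ^ j * exp (j * \<Lambda> * t)))"
      using lb(1)[OF j] D(1) mult_right_mono[of 1 "4 ^ j" "lb * (D ^ j * exp (j * \<Lambda> * t))"] by simp
    finally show ?thesis
      unfolding V'_def using f norm_triangle_ineq[of "Lop (W \<kappa> j) (ge.V j t)" "ge.forcing j t"]
      by (simp add: algebra_simps)
  qed
  have "\<exists>u u'.
     u 0 = \<epsilon> *\<^sub>R chg (W \<kappa> 1) (ew \<kappa>) v \<and> continuous_on {0..T} u' \<and> (\<forall>t\<in>{0..T}.
       u t \<in> sym_space \<and> u' t \<in> sym_space \<and>
       (u has_vector_derivative u' t) (at t within {0..T}) \<and>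
       chg (ew \<kappa>) one (u' t) = Lop one (chg (ew \<kappa>) one (u t)) + Bop (ew \<kappa>) (ew \<kappa>) one (u t) (u t) \<and>
       norm (u t - (\<epsilon> * exp (\<Lambda> * t)) *\<^sub>R chg (W \<kappa> 1) (ew \<kappa>) v) \<le> 2 * (D * \<epsilon> * exp (\<Lambda> * t))\<^sup>2)"
    if \<epsilon>: "0 < \<epsilon>" and T: "0 < T" and small: "D * \<epsilon> * exp (\<Lambda> * T) \<le> 1 / 8" for \<epsilon> T
  proof -
    define a where "a j t = (if j = 0 then 0 else \<epsilon> ^ j *\<^sub>R I j (ge.V j t))" for j t
    define a' where "a' j t = (if j = 0 then 0 else \<epsilon> ^ j *\<^sub>R I j (V' j t))" for j t
    define z where "z t = D * \<epsilon> * exp (\<Lambda> * t)" for t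
    have z: "0 \<le> z t" "z t \<le> 1 / 8" if "t \<in> {0..T}" for t
    proof -
      show "0 \<le> z t" using D \<epsilon> by (simp add: z_def)
      have "z t \<le> z T" unfolding z_def using D \<epsilon> \<Lambda> that by (intro mult_left_mono) auto
      then show "z t \<le> 1 / 8" using small by (simp add: z_def)
    qed
    have zpow: "\<epsilon> ^ j * (D ^ j * exp (j * \<Lambda> * t)) = z t ^ j" for j t
      by (simp add: z_def power_mult_distrib exp_of_nat_mult[symmetric] mult_ac)
    have a_bound: "norm (a j t) \<le> z t ^ j" if "t \<in> {0..T}" for j t
    proof (cases "j = 0")
      case False
      then have j: "j \<ge> 1" by simp
      have "norm (a j t) \<le> \<epsilon> ^ j * (D ^ j * exp (j * \<Lambda> * t))"
        using False \<epsilon> order_trans[OF I(2)[OF j] D(2)[OF j]] that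
        by (auto simp: a_def intro!: mult_left_mono)
      then show ?thesis by (simp only: zpow)
    qed (simp add: a_def)
    have a'_bound: "norm (a' j t) \<le> (lb + C) * (1 / 2) ^ j" if t: "t \<in> {0..T}" for j t
    proof (cases "j = 0")
      case True
      then show ?thesis using lb(1)[of 1] ge.rate by (simp add: a'_def)
    next
      case False
      then have j: "j \<ge> 1" by simp
      have "norm (a' j t) \<le> \<epsilon> ^ j * ((lb + C) * 4 ^ j * (D ^ j * exp (j * \<Lambda> * t)))"
      proof -
        have "norm (a' j t) = \<epsilon> ^ j * norm (I j (V' j t))" using False \<epsilon> by (simp add: a'_def)
        moreover have "t \<ge> 0" "0 \<le> \<epsilon> ^ j" using t \<epsilon> by auto
        ultimately show ?thesis by (simp only: mult_left_mono[OF order_trans[OF I(2)[OF j] V'_bound[OF j]]])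
      qed
      also have "\<dots> = (lb + C) * (4 ^ j * (\<epsilon> ^ j * (D ^ j * exp (j * \<Lambda> * t))))" by (simp only: mult_ac)
      also have "\<dots> = (lb + C) * (4 * z t) ^ j" by (simp only: zpow power_mult_distrib)
      also have "\<dots> \<le> (lb + C) * (1 / 2) ^ j"
        using z[OF t] lb(1)[of 1] ge.rate by (intro mult_left_mono power_mono) auto
      finally show ?thesis .
    qed
    have zsum: "summable (\<lambda>j. z t ^ j)" if "t \<in> {0..T}" for t
      using z[OF that] by (intro summable_geometric) auto
    have sM: "summable (\<lambda>j. (lb + C) * (1 / 2) ^ j)"
      by (intro summable_mult summable_geometric) simp
    have na: "summable (\<lambda>j. norm (a j t))" if "t \<in> {0..T}" for t
      by (rule summable_comparison_test'[OF zsum[OF that], of 0]) (use a_bound[OF that] in simp)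
    have na': "summable (\<lambda>j. norm (a' j t))" if "t \<in> {0..T}" for t
      by (rule summable_comparison_test'[OF sM, of 0]) (use a'_bound[OF that] in simp)
    define u where "u t = (\<Sum>j. a j t)" for t
    define u' where "u' t = (\<Sum>j. a' j t)" for t
    have der_a: "((\<lambda>t. a j t) has_vector_derivative a' j t) (at t within S)" for j t S
    proof (cases "j = 0")
      case False
      then have j: "j \<ge> 1" by simp
      have "((\<lambda>t. I j (ge.V j t)) has_vector_derivative I j (V' j t)) (at t within S)"
        unfolding V'_def
        by (rule bounded_linear.has_vector_derivative[OF I(1)[OF j]
              has_vector_derivative_at_within[OF ge.V_deriv[OF j]]])
      then show ?thesis
        using False bounded_linear.has_vector_derivative[OF bounded_linear_scaleR_right]
        by (simp add: a_def a'_def)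
    qed (simp add: a_def a'_def)
    have der: "(u has_vector_derivative u' t) (at t within {0..T})" if "t \<in> {0..T}" for t
      unfolding u_def[abs_def] u'_def
      by (rule has_vector_derivative_series[OF _ der_a a'_bound sM])
         (use that summable_norm_cancel[OF na] in auto)
    have contV: "continuous_on UNIV (ge.V j)" if "j \<ge> 1" for j
      by (intro continuous_at_imp_continuous_on ballI has_vector_derivative_continuous[OF ge.V_deriv[OF that]])
    have conta': "continuous_on {0..T} (a' j)" for j
    proof (cases "j = 0")
      case False
      then have j: "j \<ge> 1" by simp
      have c: "continuous_on {0..T} (ge.V i)" if "i \<ge> 1" for i
        by (rule continuous_on_subset[OF contV[OF that]]) simp
      have "continuous_on {0..T} (\<lambda>t. ge.forcing j t)"
        unfolding ge.forcing_def
        by (intro continuous_on_sum bounded_bilinear.continuous_on[OF ge.B] c) auto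
      then have "continuous_on {0..T} (\<lambda>t. I j (V' j t))"
        unfolding V'_def
        by (intro bounded_linear.continuous_on[OF I(1)[OF j]] continuous_on_add
            bounded_linear.continuous_on[OF ge.L[OF j]] c j)
      then show ?thesis using False by (simp add: a'_def[abs_def] continuous_on_scaleR)
    qed (simp add: a'_def[abs_def])
    have cont: "continuous_on {0..T} u'"
      unfolding u'_def[abs_def]
    proof (rule uniform_limit_theorem)
      show "uniform_limit {0..T} (\<lambda>n t. \<Sum>j<n. a' j t) (\<lambda>t. \<Sum>j. a' j t) sequentially"
        by (rule Weierstrass_m_test[OF a'_bound sM])
      show "\<forall>\<^sub>F n in sequentially. continuous_on {0..T} (\<lambda>t. \<Sum>j<n. a' j t)"
        by (intro always_eventually allI continuous_on_sum conta')
    qed simp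
    have closed_sum: "(\<Sum>j. b j) \<in> sym_space" if "summable b" "\<And>j. b j \<in> sym_space" for b :: "nat \<Rightarrow> _"
      by (rule closed_sequentially[OF ge.S(2) _ summable_LIMSEQ[OF that(1)]])
         (auto intro: subspace_sum[OF ge.S(1)] that)
    have aS: "a j t \<in> sym_space" "a' j t \<in> sym_space" for j t
    proof -
      have "V' j t \<in> sym_space" if "j \<ge> 1"
        unfolding V'_def ge.forcing_def using that
        by (intro subspace_add[OF ge.S(1)] subspace_sum[OF ge.S(1)] ge.S(4,5) ge.V_in_S) auto
      then show "a j t \<in> sym_space" "a' j t \<in> sym_space"
        by (auto simp: a_def a'_def subspace_0[OF ge.S(1)]
            intro!: subspace_mul[OF ge.S(1)] I(3) ge.V_in_S)
    qed
    have eqn: "chg (ew \<kappa>) one (u' t) = Lop one (chg (ew \<kappa>) one (u t)) + Bop (ew \<kappa>) (ew \<kappa>) one (u t) (u t)"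
      if t: "t \<in> {0..T}" for t
    proof -
      let ?J = "chg (ew \<kappa>) one"
      have J: "bounded_linear ?J" using wl by (intro bounded_linear_chg) auto
      note Jl = linear_simps[OF J]
      have JI: "?J (I j x) = chg (W \<kappa> j) one x" if "j \<ge> 1" for j x
        unfolding I_def using wl that by (intro chg_trans) auto
      note Bb = bounded_bilinear_Bop[OF admissible_ew[OF \<kappa>]]
      \<comment> \<open>The coefficient of \<open>\<epsilon> ^ j\<close> in the equation, with the
        powers of \<open>\<epsilon>\<close> absorbed into \<open>a\<close>. Extending the sum to
        \<open>i = 0\<close> and \<open>i = j\<close> adds only zeros, as \<open>a 0\<close>
        vanishes, and makes it a Cauchy product.\<close>
      have coeff: "?J (a' j t) = Lop one (?J (a j t)) + (\<Sum>i\<le>j. Bop (ew \<kappa>) (ew \<kappa>) one (a i t) (a (j - i) t))" for j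
      proof (cases "j = 0")
        case True
        then show ?thesis
          by (simp add: a_def a'_def linear_simps[OF bounded_linear_Lop[OF slow_weight_one]] Jl
              bounded_bilinear.zero_left[OF Bb])
      next
        case False
        then have j: "j \<ge> 1" by simp
        let ?R = "chg (W \<kappa> j) one"
        have R: "bounded_linear ?R" using wl j by (intro bounded_linear_chg) auto
        have "?R (V' j t) = Lop one (?R (ge.V j t)) +
            (\<Sum>i\<in>{1..<j}. Bop (ew \<kappa>) (ew \<kappa>) one (I i (ge.V i t)) (I (j - i) (ge.V (j - i) t)))"
        proof -
          have "?R (Lop (W \<kappa> j) (ge.V j t)) = Lop one (?R (ge.V j t))"
            using wl j by (intro chg_Lop[OF _ _ _ slow_W[OF \<kappa> j] slow_weight_one]) auto
          moreover have "?R (ge.forcing j t) =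
              (\<Sum>i\<in>{1..<j}. Bop (ew \<kappa>) (ew \<kappa>) one (I i (ge.V i t)) (I (j - i) (ge.V (j - i) t)))"
            unfolding ge.forcing_def linear_sum[OF bounded_linear.linear[OF R]]
          proof (rule sum.cong[OF refl])
            fix i assume i: "i \<in> {1..<j}"
            then have ij: "i \<ge> 1" "j - i \<ge> 1" "i + (j - i) = j" by auto
            have "chg (W \<kappa> (i + (j - i))) one (Bop (W \<kappa> i) (W \<kappa> (j - i)) (W \<kappa> (i + (j - i))) (ge.V i t) (ge.V (j - i) t)) =
               Bop (ew \<kappa>) (ew \<kappa>) one (I i (ge.V i t)) (I (j - i) (ge.V (j - i) t))"
              unfolding I_def using wl ij
              by (intro chg_Bop[OF admissible_W[OF \<kappa> ij(1,2)] admissible_ew[OF \<kappa>]]) auto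
            then show "?R (Bop (W \<kappa> i) (W \<kappa> (j - i)) (W \<kappa> (i + (j - i))) (ge.V i t) (ge.V (j - i) t)) =
               Bop (ew \<kappa>) (ew \<kappa>) one (I i (ge.V i t)) (I (j - i) (ge.V (j - i) t))"
              by (simp only: ij(3))
          qed
          ultimately show ?thesis unfolding V'_def by (simp add: linear_simps[OF R])
        qed
        then have "?J (a' j t) = \<epsilon> ^ j *\<^sub>R Lop one (?R (ge.V j t)) + \<epsilon> ^ j *\<^sub>R
            (\<Sum>i\<in>{1..<j}. Bop (ew \<kappa>) (ew \<kappa>) one (I i (ge.V i t)) (I (j - i) (ge.V (j - i) t)))"
          using False by (simp add: a'_def Jl JI[OF j] scaleR_add_right)
        also have "\<epsilon> ^ j *\<^sub>R Lop one (?R (ge.V j t)) = Lop one (?J (a j t))"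
          using False by (simp add: a_def Jl JI[OF j] linear_simps[OF bounded_linear_Lop[OF slow_weight_one]])
        also have "\<epsilon> ^ j *\<^sub>R (\<Sum>i\<in>{1..<j}. Bop (ew \<kappa>) (ew \<kappa>) one (I i (ge.V i t)) (I (j - i) (ge.V (j - i) t))) =
            (\<Sum>i\<in>{1..<j}. Bop (ew \<kappa>) (ew \<kappa>) one (a i t) (a (j - i) t))"
          unfolding scaleR_sum_right
          by (intro sum.cong refl)
             (auto simp: a_def bounded_bilinear.scaleR_left[OF Bb] bounded_bilinear.scaleR_right[OF Bb]
               power_add[symmetric])
        also have "\<dots> = (\<Sum>i\<le>j. Bop (ew \<kappa>) (ew \<kappa>) one (a i t) (a (j - i) t))"
          by (rule sum.mono_neutral_left)
             (auto simp: a_def bounded_bilinear.zero_left[OF Bb] bounded_bilinear.zero_right[OF Bb] not_less_eq_eq)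
        finally show ?thesis .
      qed
      have L1: "bounded_linear (\<lambda>x. Lop one (?J x))"
        by (rule bounded_linear_compose[OF bounded_linear_Lop[OF slow_weight_one] J])
      note sa = summable_norm_cancel[OF na[OF t]]
      note cp = bilinear_Cauchy_product[OF Bb na[OF t] na[OF t]]
      have "?J (u' t) = (\<Sum>j. ?J (a' j t))"
        unfolding u'_def by (rule bounded_linear.suminf[OF J summable_norm_cancel[OF na'[OF t]]])
      also have "\<dots> = (\<Sum>j. Lop one (?J (a j t))) + (\<Sum>j. \<Sum>i\<le>j. Bop (ew \<kappa>) (ew \<kappa>) one (a i t) (a (j - i) t))"
        unfolding coeff by (rule suminf_add[symmetric, OF bounded_linear.summable[OF L1 sa] sums_summable[OF cp(1)]])
      also have "(\<Sum>j. Lop one (?J (a j t))) = Lop one (?J (u t))"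
        unfolding u_def by (rule bounded_linear.suminf[OF L1 sa, symmetric])
      also have "(\<Sum>j. \<Sum>i\<le>j. Bop (ew \<kappa>) (ew \<kappa>) one (a i t) (a (j - i) t)) = Bop (ew \<kappa>) (ew \<kappa>) one (u t) (u t)"
        unfolding u_def by (rule sums_unique[symmetric, OF cp(1)])
      finally show ?thesis .
    qed
    have V1: "ge.V (Suc 0) t = exp (\<Lambda> * t) *\<^sub>R v" for t using ge.V_1 by simp
    have a1: "a 1 t = (\<epsilon> * exp (\<Lambda> * t)) *\<^sub>R chg (W \<kappa> 1) (ew \<kappa>) v" for t
      using linear_simps(5)[OF I(1)[of 1]] by (simp add: a_def V1 I_def)
    \<comment> \<open>The term of degree 0 is zero and that of degree 1 is the linear solution; the
      rest is dominated by a geometric series starting at \<open>(z t)\<^sup>2\<close>.\<close>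
    have rem: "norm (u t - (\<epsilon> * exp (\<Lambda> * t)) *\<^sub>R chg (W \<kappa> 1) (ew \<kappa>) v) \<le> 2 * (z t)\<^sup>2" if t: "t \<in> {0..T}" for t
    proof -
      have sa: "summable (\<lambda>j. a j t)" by (rule summable_norm_cancel[OF na[OF t]])
      have "u t = (\<Sum>j. a (j + 2) t) + (\<Sum>j<2. a j t)"
        unfolding u_def by (rule suminf_split_initial_segment[OF sa])
      then have "u t - (\<epsilon> * exp (\<Lambda> * t)) *\<^sub>R chg (W \<kappa> 1) (ew \<kappa>) v = (\<Sum>j. a (j + 2) t)"
        unfolding a1[symmetric] by (simp add: numeral_2_eq_2 a_def)
      also have "norm \<dots> \<le> (\<Sum>j. (z t)\<^sup>2 * z t ^ j)"
      proof -
        have s2: "summable (\<lambda>j. norm (a (j + 2) t))" using na[OF t] by (subst summable_iff_shift)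
        have "norm (\<Sum>j. a (j + 2) t) \<le> (\<Sum>j. norm (a (j + 2) t))" by (rule summable_norm[OF s2])
        also have "\<dots> \<le> (\<Sum>j. (z t)\<^sup>2 * z t ^ j)"
        proof (rule suminf_le[OF _ s2 summable_mult[OF zsum[OF t]]])
          fix j show "norm (a (j + 2) t) \<le> (z t)\<^sup>2 * z t ^ j"
            using a_bound[OF t, of "j + 2"] by (simp only: power_add mult.commute)
        qed
        finally show ?thesis .
      qed
      also have "\<dots> = (z t)\<^sup>2 * (1 / (1 - z t))"
        using z[OF t] by (subst suminf_mult[OF zsum[OF t]]) (simp add: suminf_geometric)
      also have "\<dots> \<le> (z t)\<^sup>2 * 2"
        using z[OF t] by (intro mult_left_mono) (auto simp: divide_simps)
      finally show ?thesis by simp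
    qed
    have "a j 0 = (if j = 1 then \<epsilon> *\<^sub>R chg (W \<kappa> 1) (ew \<kappa>) v else 0)" for j
      using linear_simps(3)[OF I(1)[of j]] by (auto simp: a_def ge.V_0 I_def)
    then have u0: "u 0 = \<epsilon> *\<^sub>R chg (W \<kappa> 1) (ew \<kappa>) v"
      unfolding u_def by (subst suminf_finite[of "{1}"]) auto
    show ?thesis
      using u0 cont der eqn rem aS closed_sum[OF summable_norm_cancel[OF na]] closed_sum[OF summable_norm_cancel[OF na']]
      unfolding z_def u_def[abs_def, symmetric] u'_def[abs_def, symmetric]
      by (intro exI[of _ u] exI[of _ u']) (auto simp: u_def u'_def)
  qed
  then show ?thesis using D(1) by blast
qed

end

section \<open>Spectral theory of the linearised operator, row by row\<close>

section \<open>The top eigenvalue of a rank-one perturbation\<close>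

text \<open>Lax-Milgram by contraction: the step \<open>t = \<mu> / q\<^sup>2\<close> turns the map
  from \<open>x\<close> to \<open>x\<close> minus \<open>t\<close> times the residual into a
  contraction with constant \<open>sqrt (1 - (\<mu> / q)\<^sup>2)\<close>.\<close>

lemma coercive_solve:
  fixes T :: "'a::{real_inner, complete_space} \<Rightarrow> 'a"
  assumes T: "bounded_linear T" and pos: "\<And>x. 0 \<le> inner (T x) x" and \<mu>: "\<mu> > 0"
  shows "\<exists>y. \<mu> *\<^sub>R y + T y = b"
proof -
  obtain K where K: "K > 0" "\<And>x. norm (T x) \<le> norm x * K"
    using bounded_linear.pos_bounded[OF T] by blast
  define R where "R x = \<mu> *\<^sub>R x + T x" for x
  have R: "bounded_linear R"
    unfolding R_def[abs_def] by (intro bounded_linear_add T bounded_linear_scaleR_right)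
  define q where "q = \<mu> + K"
  have q: "q > 0" "\<mu> \<le> q" using \<mu> K by (auto simp: q_def)
  have nR: "norm (R x) \<le> q * norm x" for x
    unfolding R_def q_def using K(2)[of x] \<mu> norm_triangle_ineq[of "\<mu> *\<^sub>R x" "T x"]
    by (simp add: algebra_simps)
  have iR: "\<mu> * (norm x)\<^sup>2 \<le> inner (R x) x" for x
    using pos[of x] by (simp add: R_def inner_add_left power2_norm_eq_inner)
  define t where "t = \<mu> / q\<^sup>2"
  have t: "t > 0" using \<mu> q by (simp add: t_def)
  define \<Phi> where "\<Phi> x = x - t *\<^sub>R (R x - b)" for x
  define L where "L = sqrt (1 - (\<mu> / q)\<^sup>2)"
  have L: "0 \<le> L" "L < 1" using \<mu> q by (auto simp: L_def abs_le_square_iff[symmetric] power_divide)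
  have "dist (\<Phi> x) (\<Phi> y) \<le> L * dist x y" for x y
  proof -
    define d where "d = x - y"
    have eq: "\<Phi> x - \<Phi> y = d - t *\<^sub>R R d"
      by (simp add: \<Phi>_def d_def linear_simps[OF R] algebra_simps)
    have "(norm (\<Phi> x - \<Phi> y))\<^sup>2 = (norm d)\<^sup>2 - 2 * t * inner (R d) d + t\<^sup>2 * (norm (R d))\<^sup>2"
      unfolding eq power2_norm_eq_inner
      using inner_commute[of d "R d"] by (simp add: inner_diff_left inner_diff_right power2_eq_square right_diff_distrib)
    also have "\<dots> \<le> (norm d)\<^sup>2 - 2 * t * (\<mu> * (norm d)\<^sup>2) + t\<^sup>2 * (q * norm d)\<^sup>2"
      using t iR[of d] nR[of d] by (intro add_mono diff_mono mult_left_mono power_mono) auto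
    also have "\<dots> = (norm d)\<^sup>2 - 2 * (t * \<mu>) * (norm d)\<^sup>2 + (t\<^sup>2 * q\<^sup>2) * (norm d)\<^sup>2"
      by (simp add: power_mult_distrib)
    also have "t\<^sup>2 * q\<^sup>2 = (\<mu> / q)\<^sup>2" using q by (simp add: t_def power_divide power2_eq_square)
    also have "t * \<mu> = (\<mu> / q)\<^sup>2" by (simp add: t_def power_divide power2_eq_square)
    also have "(norm d)\<^sup>2 - 2 * (\<mu> / q)\<^sup>2 * (norm d)\<^sup>2 + (\<mu> / q)\<^sup>2 * (norm d)\<^sup>2 =
        (1 - (\<mu> / q)\<^sup>2) * (norm d)\<^sup>2"
      by (simp only: left_diff_distrib)
    also have "\<dots> = (L * norm d)\<^sup>2"
      using L q \<mu> by (simp add: L_def power_mult_distrib abs_le_square_iff[symmetric] power_divide)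
    finally show ?thesis
      using L by (simp add: dist_norm d_def power2_le_iff_abs_le)
  qed
  then obtain y where "\<Phi> y = y"
    using banach_fix_type[OF L, of \<Phi>] by auto
  then have "R y = b" using t by (simp add: \<Phi>_def)
  then show ?thesis by (auto simp: R_def)
qed

text \<open>
  A rank-one perturbation of a nonpositive operator has at most one positive eigenvalue. Its top is
  attained without compactness: at the supremum \<open>\<mu>\<close> of the numerical range, \<open>\<mu> + T\<close> is still
  coercive, and the candidate \<open>(\<mu> + T)\<inverse> p\<close> fails to be an eigenvector only if the supremum is not sharp.
\<close>

lemma rank_one_top_eigenvalue:
  fixes T :: "'a::{real_inner, complete_space} \<Rightarrow> 'a"
  assumes T: "bounded_linear T" and sym: "\<And>x y. inner (T x) y = inner x (T y)"
    and pos: "\<And>x. 0 \<le> inner (T x) x" and w: "inner (T w) w < (inner p w)\<^sup>2"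
  shows "\<exists>\<mu>>0. (\<exists>y. y \<noteq> 0 \<and> inner p y *\<^sub>R p - T y = \<mu> *\<^sub>R y) \<and>
     (\<forall>x. (inner p x)\<^sup>2 - inner (T x) x \<le> \<mu> * (norm x)\<^sup>2) \<and>
     (\<forall>\<mu>' y. \<mu>' > 0 \<longrightarrow> y \<noteq> 0 \<longrightarrow> inner p y *\<^sub>R p - T y = \<mu>' *\<^sub>R y \<longrightarrow> \<mu>' = \<mu>)"
proof -
  define q where "q x = (inner p x)\<^sup>2 - inner (T x) x" for x
  \<comment> \<open>The nonnegative upper bounds of the quadratic form. The candidate eigenvalue is
    their infimum, so that the existence of a maximiser is not presupposed.\<close>
  define S where "S = {m. 0 \<le> m \<and> (\<forall>x. q x \<le> m * (norm x)\<^sup>2)}"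
  have S0: "(norm p)\<^sup>2 \<in> S"
  proof -
    have "q x \<le> (norm p)\<^sup>2 * (norm x)\<^sup>2" for x
      using pos[of x] Cauchy_Schwarz_ineq[of p x] by (simp add: q_def power2_norm_eq_inner)
    then show ?thesis by (simp add: S_def)
  qed
  define \<mu> where "\<mu> = Inf S"
  have bdd: "bdd_below S" by (auto simp: S_def intro: bdd_belowI[of _ 0])
  have w0: "w \<noteq> 0" using w linear_simps(3)[OF T] by auto
  have qw: "q w > 0" using w by (simp add: q_def)
  have "q w / (norm w)\<^sup>2 \<le> m" if "m \<in> S" for m
    using that w0 by (auto simp: S_def divide_le_eq)
  then have "q w / (norm w)\<^sup>2 \<le> \<mu>"
    unfolding \<mu>_def using S0 by (intro cInf_greatest) auto
  then have \<mu>: "\<mu> > 0" using qw w0 by (smt (verit) divide_pos_pos zero_less_norm_iff zero_less_power)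
  have top: "q x \<le> \<mu> * (norm x)\<^sup>2" for x
  proof (cases "x = 0")
    case False
    then have "q x / (norm x)\<^sup>2 \<le> m" if "m \<in> S" for m
      using that by (auto simp: S_def divide_le_eq)
    then have "q x / (norm x)\<^sup>2 \<le> \<mu>"
      unfolding \<mu>_def using S0 by (intro cInf_greatest) auto
    then show ?thesis using False by (simp add: divide_le_eq)
  qed (simp add: q_def linear_simps(3)[OF T])
  obtain y where y: "\<mu> *\<^sub>R y + T y = p" using coercive_solve[OF T pos \<mu>] by blast
  \<comment> \<open>\<open>y\<close> is an eigenvector for \<open>\<mu>\<close> exactly when this
    number is 1. Evaluating the form at \<open>y\<close> gives \<theta> at most 1, and the rest
    excludes \<theta> < 1.\<close>
  define \<theta> where "\<theta> = inner p y"
  have \<theta>eq: "\<theta> = \<mu> * (norm y)\<^sup>2 + inner (T y) y"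
    unfolding \<theta>_def y[symmetric] by (simp add: inner_add_left power2_norm_eq_inner)
  have \<theta>0: "\<theta> \<ge> 0" using \<theta>eq \<mu> pos[of y] by simp
  have "\<theta>\<^sup>2 - inner (T y) y \<le> \<mu> * (norm y)\<^sup>2" using top[of y] by (simp add: q_def \<theta>_def)
  then have "\<theta>\<^sup>2 \<le> \<theta>" using \<theta>eq by simp
  then have \<theta>1: "\<theta> \<le> 1" using \<theta>0 by (cases "\<theta> = 0") (auto simp: power2_eq_square)
  \<comment> \<open>Cauchy-Schwarz for the positive form of \<mu> + T, in which pairing with
    \<open>y\<close> is pairing with \<open>p\<close>.\<close>
  have cs: "(inner p x)\<^sup>2 \<le> \<theta> * (\<mu> * (norm x)\<^sup>2 + inner (T x) x)" for x
  proof -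
    define f where "f u v = \<mu> * inner u v + inner (T u) v" for u v :: 'a
    have fp: "f u u \<ge> 0" for u using pos[of u] \<mu> by (simp add: f_def)
    have fs: "f u v = f v u" for u v unfolding f_def by (metis sym inner_commute)
    have px: "inner p x = f y x" unfolding y[symmetric] by (simp add: f_def inner_add_left)
    have \<theta>f: "\<theta> = f y y" using \<theta>eq by (simp add: f_def power2_norm_eq_inner)
    have quad: "0 \<le> f x x - 2 * s * f y x + s\<^sup>2 * f y y" for s
    proof -
      have "0 \<le> f (x - s *\<^sub>R y) (x - s *\<^sub>R y)" by (rule fp)
      also have "\<dots> = f x x - s * f y x - s * f x y + s\<^sup>2 * f y y"
        by (simp add: f_def linear_simps[OF T] inner_diff_left inner_diff_right power2_eq_square algebra_simps)
      finally show ?thesis using fs[of x y] by simp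
    qed
    have "(f y x)\<^sup>2 \<le> f y y * f x x"
    proof (cases "f y y = 0")
      case True
      then have "2 * s * f y x \<le> f x x" for s using quad[of s] by simp
      from this[of "(f x x + 1) / (2 * f y x)"] have "f y x = 0" by (cases "f y x = 0") auto
      then show ?thesis using True by simp
    next
      case False
      then have fy: "f y y > 0" using fp[of y] by simp
      have "0 \<le> f x x - (f y x)\<^sup>2 / f y y"
        using quad[of "f y x / f y y"] fy by (simp add: power2_eq_square field_simps)
      then show ?thesis using fy by (simp add: divide_le_eq mult.commute)
    qed
    then show ?thesis unfolding px \<theta>f by (simp add: f_def power2_norm_eq_inner)
  qed
  have \<theta>: "\<theta> = 1"
  proof (rule ccontr)
    assume "\<theta> \<noteq> 1"
    then have lt: "\<theta> < 1" using \<theta>1 by simp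
    \<comment> \<open>If \<theta> < 1, the inequality \<open>cs\<close> improves the optimal bound
      \<open>\<mu>\<close> to \<open>\<theta> * \<mu>\<close>.\<close>
    have "\<theta> * \<mu> \<in> S"
      unfolding S_def
    proof (intro CollectI conjI allI)
      show "0 \<le> \<theta> * \<mu>" using \<theta>0 \<mu> by simp
      fix x
      have "\<theta> * inner (T x) x \<le> inner (T x) x" using pos[of x] \<theta>1 by (simp add: mult_left_le_one_le \<theta>0)
      then show "q x \<le> \<theta> * \<mu> * (norm x)\<^sup>2" using cs[of x] by (simp add: q_def algebra_simps)
    qed
    then have "\<mu> \<le> \<theta> * \<mu>" unfolding \<mu>_def using bdd by (rule cInf_lower)
    then show False using lt \<mu> by simp
  qed
  have "y \<noteq> 0" using \<theta> by (auto simp: \<theta>_def)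
  moreover have "inner p y *\<^sub>R p - T y = \<mu> *\<^sub>R y"
    using \<theta> y by (simp add: \<theta>_def algebra_simps)
  moreover have "\<mu>' = \<mu>" if z: "\<mu>' > 0" "z \<noteq> 0" "inner p z *\<^sub>R p - T z = \<mu>' *\<^sub>R z" for \<mu>' z
  proof (rule ccontr)
    assume ne: "\<mu>' \<noteq> \<mu>"
    define s where "s = inner p z"
    have e: "s *\<^sub>R p = \<mu>' *\<^sub>R z + T z" using z(3) by (simp add: s_def algebra_simps)
    have s0: "s\<^sup>2 = \<mu>' * (norm z)\<^sup>2 + inner (T z) z"
    proof -
      have "s\<^sup>2 = inner (s *\<^sub>R p) z" by (simp add: s_def power2_eq_square)
      then show ?thesis unfolding e by (simp add: inner_add_left power2_norm_eq_inner)
    qed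
    have sy: "s = inner (s *\<^sub>R p) y" using \<theta> by (simp add: \<theta>_def)
    have 1: "s = \<mu>' * inner y z + inner (T y) z"
    proof -
      have "inner (T z) y = inner (T y) z" by (metis sym inner_commute)
      then show ?thesis using sy unfolding e inner_add_left by (simp add: inner_commute[of z y])
    qed
    have 2: "s = \<mu> * inner y z + inner (T y) z"
      unfolding s_def y[symmetric] by (simp add: inner_add_left)
    \<comment> \<open>Eigenvectors of distinct eigenvalues are orthogonal; the nonnegative form of
      \<open>T\<close> at \<open>s *\<^sub>R y - z\<close> then comes out negative.\<close>
    have yz: "inner y z = 0" using 1 2 ne by simp
    then have Tyz: "inner (T y) z = s" using 1 by simp
    have "0 \<le> inner (T (s *\<^sub>R y - z)) (s *\<^sub>R y - z)" by (rule pos)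
    also have "\<dots> = s\<^sup>2 * inner (T y) y - 2 * s * inner (T y) z + inner (T z) z"
      using sym[of z y] by (simp add: linear_simps[OF T] inner_diff_left inner_diff_right power2_eq_square
          inner_commute algebra_simps)
    also have "\<dots> = - (s\<^sup>2 * \<mu> * (norm y)\<^sup>2) - \<mu>' * (norm z)\<^sup>2"
    proof -
      have e12: "inner (T y) y = 1 - \<mu> * (norm y)\<^sup>2" "inner (T z) z = s\<^sup>2 - \<mu>' * (norm z)\<^sup>2"
        using \<theta>eq \<theta> s0 by auto
      show ?thesis unfolding Tyz e12 by (simp add: power2_eq_square algebra_simps)
    qed
    finally have "\<mu>' * (norm z)\<^sup>2 \<le> - (s\<^sup>2 * \<mu> * (norm y)\<^sup>2)" by linarith
    moreover have "\<mu>' * (norm z)\<^sup>2 > 0" "s\<^sup>2 * \<mu> * (norm y)\<^sup>2 \<ge> 0" using z \<mu> by auto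
    ultimately show False by linarith
  qed
  ultimately show ?thesis using \<mu> top unfolding q_def by blast
qed

section \<open>Growth rates of the rows\<close>

definition unit_vec :: "'a \<Rightarrow> 'a ell2" where
  "unit_vec i = of_coord (\<lambda>j. if j = i then 1 else 0)"

lemma coord_unit_vec: "coord (unit_vec i) j = (if j = i then 1 else 0)"
  unfolding unit_vec_def
  by (subst of_coord_inverse') (auto intro!: finite_nonzero_values_imp_summable_on)

lemma inner_unit_vec: "inner (unit_vec i) x = coord x i"
  unfolding inner_ell2_def coord_unit_vec
  by (subst infsum_cong_neutral[where T = "{i}" and g = "\<lambda>_. coord x i"]) auto

definition flip :: "freq ell2 \<Rightarrow> freq ell2" where
  "flip = wop (\<lambda>_. 1) (\<lambda>\<xi>. (fst \<xi>, - snd \<xi>))"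

lemma coord_flip: "coord (flip x) \<xi> = coord x (fst \<xi>, - snd \<xi>)"
  unfolding flip_def by (subst coord_wop[where B = 1]) (auto simp: inj_def prod_eq_iff)

lemma odd_int_cases:
  fixes m :: int
  assumes "even m" "m \<noteq> 0"
  shows "m \<ge> 2 \<or> m \<le> - 2"
  using assms by presburger

context wave
begin

lemma rad_sq: "(rad \<xi>)\<^sup>2 = (real k)\<^sup>2 * (of_int (fst \<xi>))\<^sup>2 + (of_int (snd \<xi>))\<^sup>2"
  by (simp add: rad_def power_mult_distrib)

text \<open>A_k is negative only on wave vectors shorter than \<open>k\<close>; in this lattice
  these are the \<open>(0, n)\<close> with \<open>n\<close> below \<open>k\<close> in absolute
  value.\<close>

lemma asym_nonneg:
  assumes "fst \<xi> \<noteq> 0 \<or> int k \<le> \<bar>snd \<xi>\<bar>"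
  shows "0 \<le> asym \<xi>"
proof -
  have "(real k)\<^sup>2 \<le> (rad \<xi>)\<^sup>2"
  proof (cases "fst \<xi> = 0")
    case False
    then have "1 \<le> \<bar>real_of_int (fst \<xi>)\<bar>" by linarith
    then have "1 \<le> (real_of_int (fst \<xi>))\<^sup>2" using power_mono[of 1 "\<bar>real_of_int (fst \<xi>)\<bar>" 2] by simp
    then have "(real k)\<^sup>2 * 1 \<le> (real k)\<^sup>2 * (of_int (fst \<xi>))\<^sup>2" by (intro mult_left_mono) auto
    then show ?thesis unfolding rad_sq using zero_le_power2[of "real_of_int (snd \<xi>)"] by linarith
  next
    case True
    then have "real k \<le> \<bar>real_of_int (snd \<xi>)\<bar>" using assms by linarith
    then have "(real k)\<^sup>2 \<le> (real_of_int (snd \<xi>))\<^sup>2" using power_mono[of "real k" _ 2] by fastforce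
    then show ?thesis using True by (simp add: rad_sq)
  qed
  moreover have "1 + (rad \<xi>)\<^sup>2 > 0" by (simp add: add_pos_nonneg)
  ultimately show ?thesis by (simp add: asym_def cc_def pos_divide_le_eq)
qed

lemma asym_neg: "n \<noteq> 0 \<Longrightarrow> \<bar>n\<bar> < int k \<Longrightarrow> asym (0, n) < 0"
proof -
  assume n: "n \<noteq> 0" "\<bar>n\<bar> < int k"
  have "\<bar>real_of_int n\<bar> < real k" using n by linarith
  then have "\<bar>real_of_int n\<bar>\<^sup>2 < (real k)\<^sup>2" by (intro power_strict_mono) auto
  moreover have "1 + (real_of_int n)\<^sup>2 > 0" by (simp add: add_pos_nonneg)
  ultimately show ?thesis by (simp add: asym_def cc_def rad_sq pos_less_divide_eq)
qed

lemma asym_le1: "asym \<xi> \<le> 1"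
proof -
  have "0 \<le> cc / (1 + (rad \<xi>)\<^sup>2)" using cc_ge by (intro divide_nonneg_nonneg) auto
  then show ?thesis by (simp add: asym_def)
qed

text \<open>
  \<open>Mrow n\<close> is the square of the linearisation on the vorticity of row \<open>n\<close>. For \<open>\<bar>n\<bar> < k\<close> the symbol \<open>asym\<close> is
  negative only at \<open>(0, n)\<close>, so that \<open>Mrow n\<close> is a rank-one perturbation of a nonpositive operator.
\<close>

definition Arow :: "int \<Rightarrow> freq ell2 \<Rightarrow> freq ell2" where
  "Arow n = wop (\<lambda>\<xi>. if snd \<xi> = n then asym \<xi> else 0) id"

definition Mrow :: "int \<Rightarrow> freq ell2 \<Rightarrow> freq ell2" where
  "Mrow n y = - (cc *\<^sub>R Eop one (Arow n (Dop one y)))"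

lemma coord_Arow: "coord (Arow n x) \<xi> = (if snd \<xi> = n then asym \<xi> * coord x \<xi> else 0)"
  unfolding Arow_def by (subst coord_wop[where B = cc]) (use asym_bound cc_ge in \<open>auto simp: order_trans[OF _ cc_ge]\<close>)

lemma coord_Dop1: "coord (Dop one g) (m, n) =
    real k * of_int n / 2 * (coord g (m - 1, n) / rad (m - 1, n) - coord g (m + 1, n) / rad (m + 1, n))"
  by (simp add: coord_Dop[OF slow_weight_one] Dco_def sh_def right_diff_distrib)

lemma coord_Eop1: "coord (Eop one f) (m, n) =
    real k * of_int n / 2 / rad (m, n) * (coord f (m + 1, n) - coord f (m - 1, n))"
  by (simp add: coord_Eop[OF slow_weight_one] Eco_def sh_def right_diff_distrib)

text \<open>However small the negative weight \<open>a\<close> at \<open>(0, n)\<close>, it can win.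
  The profile \<open>\<phi>\<close> on odd sites is odd, jumps by 2 across the origin and decays
  linearly over about \<open>2 * N\<close> sites on each side. Its difference \<open>\<psi>\<close>
  is therefore 2 at the origin and at most \<open>1 / N\<close> elsewhere, and the squares elsewhere
  sum to O(1/N).\<close>

lemma row_test_vector:
  assumes n: "n \<noteq> 0" and a: "a > 0"
  shows "\<exists>w. (\<Sum>\<^sub>\<infinity>\<xi>. (if snd \<xi> = n \<and> fst \<xi> \<noteq> 0 then (coord (Dop one w) \<xi>)\<^sup>2 else 0)) <
    a * (coord (Dop one w) (0, n))\<^sup>2"
proof -
  \<comment> \<open>The sum outside the origin will be at most \<open>8 * b\<^sup>2 / N\<close>, to
    be compared with \<open>4 * b\<^sup>2 * a\<close>.\<close>
  define N where "N = nat \<lceil>2 / a\<rceil> + 1"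
  have N: "N \<ge> 1" "real N > 2 / a" by (auto simp: N_def) linarith
  define h :: "int \<Rightarrow> real" where "h t = max 0 (1 - (of_int t - 1) / (2 * real N))" for t
  define \<phi> :: "int \<Rightarrow> real" where "\<phi> m = (if odd m then - sgn (of_int m) * h \<bar>m\<bar> else 0)" for m
  define M where "M = 2 * int N + 1"
  have h0: "h t = 0" if "t \<ge> M" for t
  proof -
    have "of_int t \<ge> 2 * real N + 1" using that unfolding M_def by linarith
    then show ?thesis using N by (simp add: h_def field_simps)
  qed
  have hd: "\<bar>h t - h (t + 2)\<bar> \<le> 1 / real N" for t
  proof -
    have "(of_int (t + 2) - 1) / (2 * real N) = (of_int t - 1) / (2 * real N) + 1 / real N"
      using N by (simp add: field_simps)
    moreover have "\<bar>max 0 (1 - s) - max 0 (1 - (s + d))\<bar> \<le> d" if "d \<ge> 0" for s d :: real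
      using that by (auto simp: max_def)
    from this[of "1 / real N"] have "\<bar>max 0 (1 - s) - max 0 (1 - (s + 1 / real N))\<bar> \<le> 1 / real N" for s
      by simp
    ultimately show ?thesis unfolding h_def by metis
  qed
  define \<psi> where "\<psi> m = \<phi> (m - 1) - \<phi> (m + 1)" for m
  have \<psi>0: "\<psi> 0 = 2" by (simp add: \<psi>_def \<phi>_def h_def)
  have \<psi>: "\<bar>\<psi> m\<bar> \<le> 1 / real N" if m: "m \<noteq> 0" for m
  proof (cases "even m")
    case True
    from odd_int_cases[OF True m] show ?thesis
    proof
      assume "m \<ge> 2"
      then have "\<psi> m = h (m + 1) - h (m - 1)" using True by (simp add: \<psi>_def \<phi>_def)
      then show ?thesis using hd[of "m - 1"] by (simp add: abs_minus_commute add.commute)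
    next
      assume "m \<le> - 2"
      then have "\<psi> m = h (1 - m) - h (- m - 1)" using True by (simp add: \<psi>_def \<phi>_def)
      then show ?thesis using hd[of "- m - 1"] by (simp add: abs_minus_commute)
    qed
  qed (simp add: \<psi>_def \<phi>_def)
  have \<psi>z: "\<psi> m = 0" if "\<bar>m\<bar> > M" for m
    using that h0 by (simp add: \<psi>_def \<phi>_def)
  \<comment> \<open>The factor \<open>rad\<close> undoes the division inside
    \<open>Dop\<close>.\<close>
  define f where "f = (\<lambda>\<xi>. if snd \<xi> = n \<and> \<bar>fst \<xi>\<bar> \<le> M then rad \<xi> * \<phi> (fst \<xi>) else 0)"
  have fin: "finite {\<xi>. f \<xi> \<noteq> 0}"
    by (rule finite_subset[of _ "{- M..M} \<times> {n}"]) (auto simp: f_def split: if_splits)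
  have cf: "coord (of_coord f) = f"
    by (rule of_coord_inverse') (auto intro!: finite_nonzero_values_imp_summable_on finite_subset[OF _ fin])
  have fq: "f (m, n) / rad (m, n) = \<phi> m" for m
  proof -
    have "rad (m, n) \<noteq> 0" using rad_ge(1)[of "(m, n)"] n by auto
    moreover have "\<phi> m = 0" if "\<bar>m\<bar> > M" using that h0 by (simp add: \<phi>_def)
    ultimately show ?thesis by (auto simp: f_def)
  qed
  define b where "b = real k * of_int n / 2"
  have b: "b \<noteq> 0" using n k by (simp add: b_def)
  have D: "coord (Dop one (of_coord f)) (m, n) = b * \<psi> m" for m
    by (simp only: coord_Dop1 cf fq b_def \<psi>_def)
  have "(\<Sum>\<^sub>\<infinity>\<xi>. (if snd \<xi> = n \<and> fst \<xi> \<noteq> 0 then (coord (Dop one (of_coord f)) \<xi>)\<^sup>2 else 0)) =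
      (\<Sum>\<^sub>\<infinity>\<xi>\<in>({- M..M} - {0}) \<times> {n}. (b * \<psi> (fst \<xi>))\<^sup>2)"
  proof (rule infsum_cong_neutral)
    fix \<xi> :: freq assume "\<xi> \<in> UNIV - ({- M..M} - {0}) \<times> {n}"
    then have "snd \<xi> \<noteq> n \<or> fst \<xi> = 0 \<or> \<bar>fst \<xi>\<bar> > M" by (cases \<xi>) auto
    then show "(if snd \<xi> = n \<and> fst \<xi> \<noteq> 0 then (coord (Dop one (of_coord f)) \<xi>)\<^sup>2 else 0) = 0"
      using D[of "fst \<xi>"] \<psi>z[of "fst \<xi>"] by (cases \<xi>) auto
  next
    fix \<xi> :: freq assume "\<xi> \<in> UNIV \<inter> ({- M..M} - {0}) \<times> {n}"
    then show "(if snd \<xi> = n \<and> fst \<xi> \<noteq> 0 then (coord (Dop one (of_coord f)) \<xi>)\<^sup>2 else 0) = (b * \<psi> (fst \<xi>))\<^sup>2"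
      using D[of "fst \<xi>"] by (cases \<xi>) auto
  qed auto
  also have "\<dots> = (\<Sum>\<xi>\<in>({- M..M} - {0}) \<times> {n}. (b * \<psi> (fst \<xi>))\<^sup>2)"
    by (rule infsum_finite) simp
  also have "\<dots> \<le> (\<Sum>\<xi>\<in>({- M..M} - {0}) \<times> {n}. b\<^sup>2 * (1 / real N)\<^sup>2)"
  proof (rule sum_mono)
    fix \<xi> assume "\<xi> \<in> ({- M..M} - {0}) \<times> {n}"
    then have "fst \<xi> \<noteq> 0" by (cases \<xi>) simp
    then have "\<bar>\<psi> (fst \<xi>)\<bar> \<le> 1 / real N" by (rule \<psi>)
    then have "(\<psi> (fst \<xi>))\<^sup>2 \<le> (1 / real N)\<^sup>2" by (metis abs_le_square_iff abs_of_nonneg abs_ge_zero order_trans)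
    then show "(b * \<psi> (fst \<xi>))\<^sup>2 \<le> b\<^sup>2 * (1 / real N)\<^sup>2"
      by (simp add: power_mult_distrib mult_left_mono)
  qed
  also have "\<dots> = real (4 * N + 2) * (b\<^sup>2 * (1 / real N)\<^sup>2)"
  proof -
    have "card ({- M..M} - {0}) = 4 * N + 2"
      by (subst card_Diff_singleton) (auto simp: M_def nat_add_distrib nat_mult_distrib)
    then show ?thesis by (simp add: card_cartesian_product)
  qed
  also have "\<dots> \<le> (8 * real N) * (b\<^sup>2 * (1 / real N)\<^sup>2)"
    using N by (intro mult_right_mono) auto
  also have "\<dots> = 4 * b\<^sup>2 * (2 / real N)" using N by (simp add: power2_eq_square)
  also have "\<dots> < 4 * b\<^sup>2 * a"
    using b a N by (intro mult_strict_left_mono) (auto simp: field_simps)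
  also have "\<dots> = a * (coord (Dop one (of_coord f)) (0, n))\<^sup>2"
    by (simp add: D \<psi>0 power_mult_distrib)
  finally show ?thesis by blast
qed

text \<open>\<open>Arow n\<close> is split into its negative entry at \<open>(0, n)\<close>, which
  gives the rank-one part through \<open>p\<close>, and the nonnegative rest \<open>P\<close>. As
  \<open>asym\<close> is at most 1, the form of \<open>P\<close> is bounded by the sum estimated in
  \<open>row_test_vector\<close>.\<close>

lemma row_rate_exists:
  assumes n: "n \<noteq> 0" "\<bar>n\<bar> < int k"
  shows "\<exists>\<mu>>0. (\<exists>y. y \<noteq> 0 \<and> Mrow n y = \<mu> *\<^sub>R y) \<and> (\<forall>x. inner (Mrow n x) x \<le> \<mu> * (norm x)\<^sup>2) \<and>
     (\<forall>\<mu>' y. \<mu>' > 0 \<longrightarrow> y \<noteq> 0 \<longrightarrow> Mrow n y = \<mu>' *\<^sub>R y \<longrightarrow> \<mu>' = \<mu>)"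
proof -
  define a where "a = - asym (0, n)"
  have a: "a > 0" using asym_neg[OF n] by (simp add: a_def)
  define P where "P = wop (\<lambda>\<xi>. if snd \<xi> = n \<and> fst \<xi> \<noteq> 0 then asym \<xi> else 0) id"
  have Pb: "\<bar>if snd \<xi> = n \<and> fst \<xi> \<noteq> 0 then asym \<xi> else 0\<bar> \<le> cc" for \<xi>
    using asym_bound[of \<xi>] cc_ge by auto
  have cP: "coord (P x) \<xi> = (if snd \<xi> = n \<and> fst \<xi> \<noteq> 0 then asym \<xi> * coord x \<xi> else 0)" for x \<xi>
    unfolding P_def coord_wop[OF inj_on_id Pb] by simp
  have P: "bounded_linear P" unfolding P_def by (rule bounded_linear_wop[OF inj_on_id Pb])
  define T where "T x = cc *\<^sub>R Eop one (P (Dop one x))" for x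
  define p where "p = sqrt (cc * a) *\<^sub>R Eop one (unit_vec (0, n))"
  have T: "bounded_linear T"
    unfolding T_def[abs_def]
    by (intro bounded_linear_compose[OF bounded_linear_scaleR_right]
        bounded_linear_compose[OF bounded_linear_Eop[OF slow_weight_one]]
        bounded_linear_compose[OF P] bounded_linear_Dop[OF slow_weight_one])
  have iT: "inner (T x) y = cc * inner (P (Dop one x)) (Dop one y)" for x y
    unfolding T_def by (metis inner_Dop inner_commute inner_scaleR_left)
  have ip: "inner p x = sqrt (cc * a) * coord (Dop one x) (0, n)" for x
    unfolding p_def by (metis inner_Dop inner_commute inner_scaleR_left inner_unit_vec)
  have Psym: "inner (P x) y = inner x (P y)" for x y
    unfolding inner_ell2_def cP by (intro infsum_cong) auto
  have Ppos: "0 \<le> inner (P x) x" for x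
    unfolding inner_ell2_def cP using asym_nonneg
    by (intro infsum_nonneg) (auto simp: mult.assoc intro!: mult_nonneg_nonneg)
  obtain w where w: "(\<Sum>\<^sub>\<infinity>\<xi>. (if snd \<xi> = n \<and> fst \<xi> \<noteq> 0 then (coord (Dop one w) \<xi>)\<^sup>2 else 0)) <
    a * (coord (Dop one w) (0, n))\<^sup>2"
    using row_test_vector[OF n(1) a] by blast
  have "inner (P (Dop one w)) (Dop one w) \<le>
      (\<Sum>\<^sub>\<infinity>\<xi>. (if snd \<xi> = n \<and> fst \<xi> \<noteq> 0 then (coord (Dop one w) \<xi>)\<^sup>2 else 0))"
    unfolding inner_ell2_def
  proof (rule infsum_mono)
    show "(\<lambda>\<xi>. coord (P (Dop one w)) \<xi> * coord (Dop one w) \<xi>) summable_on UNIV"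
      by (rule ell2_inner_summable)
    show "(\<lambda>\<xi>. if snd \<xi> = n \<and> fst \<xi> \<noteq> 0 then (coord (Dop one w) \<xi>)\<^sup>2 else 0) summable_on UNIV"
      by (rule summable_on_comparison_test[OF coord_sq_summable[of "Dop one w"]]) auto
    show "coord (P (Dop one w)) \<xi> * coord (Dop one w) \<xi> \<le>
        (if snd \<xi> = n \<and> fst \<xi> \<noteq> 0 then (coord (Dop one w) \<xi>)\<^sup>2 else 0)" for \<xi>
      using mult_right_mono[OF asym_le1[of \<xi>], of "(coord (Dop one w) \<xi>)\<^sup>2"]
      by (simp add: cP power2_eq_square mult.assoc)
  qed
  then have "cc * inner (P (Dop one w)) (Dop one w) < cc * (a * (coord (Dop one w) (0, n))\<^sup>2)"
    using w cc_ge by (intro mult_strict_left_mono) auto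
  then have tw: "inner (T w) w < (inner p w)\<^sup>2"
    unfolding iT ip using a cc_ge by (simp add: power_mult_distrib)
  have Tsym: "inner (T x) y = inner x (T y)" for x y
    by (metis iT Psym inner_commute)
  have Tpos: "0 \<le> inner (T x) x" for x
    unfolding iT using Ppos cc_ge by (intro mult_nonneg_nonneg) auto
  have M: "inner p x *\<^sub>R p - T x = Mrow n x" for x
  proof -
    have 1: "Arow n z = P z - (a * coord z (0, n)) *\<^sub>R unit_vec (0, n)" for z
      by (rule ell2_eqI) (auto simp: coord_Arow cP coord_unit_vec a_def prod_eq_iff)
    have "inner p x *\<^sub>R p = (cc * a * coord (Dop one x) (0, n)) *\<^sub>R Eop one (unit_vec (0, n))"
      unfolding ip using a cc_ge by (simp add: p_def)
    then show ?thesis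
      unfolding Mrow_def T_def 1
      by (simp add: linear_simps[OF bounded_linear_Eop[OF slow_weight_one]] scaleR_diff_right)
  qed
  have "(inner p x)\<^sup>2 - inner (T x) x = inner (Mrow n x) x" for x
    unfolding M[symmetric] by (simp add: inner_diff_left power2_eq_square)
  then show ?thesis
    using rank_one_top_eigenvalue[OF T Tsym Tpos tw] unfolding M by simp
qed

text \<open>The square of a growth rate, since \<open>Mrow\<close> is the square of the linear
  operator.\<close>

definition row_rate :: "int \<Rightarrow> real" where
  "row_rate n = (THE \<mu>. \<mu> > 0 \<and> (\<exists>y. y \<noteq> 0 \<and> Mrow n y = \<mu> *\<^sub>R y))"

lemma row_rate:
  assumes n: "n \<noteq> 0" "\<bar>n\<bar> < int k"
  shows "row_rate n > 0" "\<exists>y. y \<noteq> 0 \<and> Mrow n y = row_rate n *\<^sub>R y"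
    "\<And>x. inner (Mrow n x) x \<le> row_rate n * (norm x)\<^sup>2"
    "\<And>\<mu> y. \<mu> > 0 \<Longrightarrow> y \<noteq> 0 \<Longrightarrow> Mrow n y = \<mu> *\<^sub>R y \<Longrightarrow> \<mu> = row_rate n"
proof -
  obtain \<mu> where \<mu>: "\<mu> > 0" "\<exists>y. y \<noteq> 0 \<and> Mrow n y = \<mu> *\<^sub>R y" "\<forall>x. inner (Mrow n x) x \<le> \<mu> * (norm x)\<^sup>2"
     "\<forall>\<mu>' y. \<mu>' > 0 \<longrightarrow> y \<noteq> 0 \<longrightarrow> Mrow n y = \<mu>' *\<^sub>R y \<longrightarrow> \<mu>' = \<mu>"
    using row_rate_exists[OF n] by blast
  have "row_rate n = \<mu>"
    unfolding row_rate_def by (rule the_equality) (use \<mu> in blast)+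
  then show "row_rate n > 0" "\<exists>y. y \<noteq> 0 \<and> Mrow n y = row_rate n *\<^sub>R y"
    "\<And>x. inner (Mrow n x) x \<le> row_rate n * (norm x)\<^sup>2"
    "\<And>\<mu> y. \<mu> > 0 \<Longrightarrow> y \<noteq> 0 \<Longrightarrow> Mrow n y = \<mu> *\<^sub>R y \<Longrightarrow> \<mu> = row_rate n"
    using \<mu> by auto
qed

text \<open>Reflecting the second index changes the sign of both \<open>Dop\<close> and
  \<open>Eop\<close>, hence intertwines \<open>Mrow n\<close> and \<open>Mrow (- n)\<close>.\<close>

lemma row_rate_minus:
  assumes n: "n \<noteq> 0" "\<bar>n\<bar> < int k"
  shows "row_rate (- n) = row_rate n"
proof -
  obtain y where y: "y \<noteq> 0" "Mrow n y = row_rate n *\<^sub>R y" using row_rate(2)[OF n] by blast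
  have r: "rad (m, - l) = rad (m, l)" "asym (m, - l) = asym (m, l)" for m l
    by (simp_all add: rad_def asym_def)
  have fl: "Dop one (flip x) = - flip (Dop one x)" "Eop one (flip x) = - flip (Eop one x)"
    "Arow (- n) (flip x) = flip (Arow n x)" "flip (- x) = - flip x" "flip (c *\<^sub>R x) = c *\<^sub>R flip x" for x c
  proof -
    show "Dop one (flip x) = - flip (Dop one x)"
      by (intro ell2_eqI; clarsimp simp: coord_Dop1 coord_flip r)
    show "Eop one (flip x) = - flip (Eop one x)"
      by (intro ell2_eqI; clarsimp simp: coord_Eop1 coord_flip r)
    show "Arow (- n) (flip x) = flip (Arow n x)"
      by (intro ell2_eqI; clarsimp simp: coord_Arow coord_flip r)
  qed (auto intro!: ell2_eqI simp: coord_flip)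
  have neg: "Eop one (- x) = - Eop one x" "Arow (- n) (- x) = - Arow (- n) x" for x
    by (auto intro!: ell2_eqI simp: coord_Arow linear_simps[OF bounded_linear_Eop[OF slow_weight_one]])
  have "Mrow (- n) (flip y) = flip (Mrow n y)"
    by (simp add: Mrow_def fl neg)
  also have "\<dots> = row_rate n *\<^sub>R flip y"
    by (rule ell2_eqI) (simp add: y(2) coord_flip)
  finally have e: "Mrow (- n) (flip y) = row_rate n *\<^sub>R flip y" .
  have "flip y \<noteq> 0"
  proof
    assume "flip y = 0"
    then have "coord y (m, l) = 0" for m l using coord_flip[of y "(m, - l)"] by simp
    then have "y = 0" by (intro ell2_eqI) auto
    then show False using y by simp
  qed
  then show ?thesis using row_rate(4)[of "- n" "row_rate n" "flip y"] row_rate(1)[OF n] n e by simp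
qed

text \<open>The operators preserve rows, so the form splits over \<open>n\<close>. It vanishes for
  \<open>n = 0\<close> and is nonnegative once the absolute value of \<open>n\<close> reaches
  \<open>k\<close>; the finitely many remaining rows are controlled by their row rates.\<close>

lemma spectral_boundI:
  assumes le: "\<And>n. 1 \<le> n \<Longrightarrow> n < int k \<Longrightarrow> row_rate n \<le> \<Lambda>\<^sup>2"
  shows "spectral_bound \<Lambda>"
  unfolding spectral_bound_def
proof
  fix g
  define z where "z = Dop one g"
  define F where "F = {n. n \<noteq> 0 \<and> \<bar>n\<bar> < int k}"
  have F: "finite F" by (rule finite_subset[of _ "{- int k..int k}"]) (auto simp: F_def)
  define q where "q \<xi> = asym \<xi> * (coord z \<xi>)\<^sup>2" for \<xi>
  have sq: "q summable_on A" for A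
    using summable_on_subset_banach[OF ell2_inner_summable[of "Aop z" z]]
    by (simp add: q_def[abs_def] coord_Aop power2_eq_square mult.assoc)
  have sg: "(\<lambda>\<xi>. (coord g \<xi>)\<^sup>2) summable_on A" for A
    using summable_on_subset_banach[OF coord_sq_summable[of g]] by blast
  define R where "R n = {\<xi> :: freq. snd \<xi> = n}" for n
  have row: "- (\<Lambda>\<^sup>2 * (\<Sum>\<^sub>\<infinity>\<xi>\<in>R n. (coord g \<xi>)\<^sup>2)) \<le> cc * (\<Sum>\<^sub>\<infinity>\<xi>\<in>R n. q \<xi>)" if n: "n \<in> F" for n
  proof -
    have n': "n \<noteq> 0" "\<bar>n\<bar> < int k" using n by (auto simp: F_def)
    have rr: "row_rate n \<le> \<Lambda>\<^sup>2"
      using le[of n] le[of "- n"] row_rate_minus[OF n'] n' by (cases "n > 0") auto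
    define h where "h = wop (\<lambda>\<xi>. if snd \<xi> = n then 1 else 0) id g"
    have ch: "coord h \<xi> = (if snd \<xi> = n then coord g \<xi> else 0)" for \<xi>
      unfolding h_def by (subst coord_wop[where B = 1]) auto
    have "- inner (Mrow n h) h = cc * inner (Arow n (Dop one h)) (Dop one h)"
      unfolding Mrow_def by (metis inner_Dop inner_commute inner_scaleR_left inner_minus_left minus_minus)
    also have "inner (Arow n (Dop one h)) (Dop one h) = (\<Sum>\<^sub>\<infinity>\<xi>\<in>R n. q \<xi>)"
      unfolding inner_ell2_def
      by (rule infsum_cong_neutral) (auto simp: R_def coord_Arow q_def z_def coord_Dop1 ch power2_eq_square)
    finally have "- (cc * (\<Sum>\<^sub>\<infinity>\<xi>\<in>R n. q \<xi>)) \<le> row_rate n * (norm h)\<^sup>2"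
      using row_rate(3)[OF n', of h] by simp
    also have "\<dots> \<le> \<Lambda>\<^sup>2 * (norm h)\<^sup>2" using rr by (intro mult_right_mono) auto
    also have "(norm h)\<^sup>2 = (\<Sum>\<^sub>\<infinity>\<xi>\<in>R n. (coord g \<xi>)\<^sup>2)"
      unfolding ell2_norm_sq by (rule infsum_cong_neutral) (auto simp: R_def ch)
    finally show ?thesis by simp
  qed
  define U where "U = (\<Union>n\<in>F. R n)"
  have sumU: "(\<Sum>n\<in>F. infsum f (R n)) = infsum f U" if "\<And>A. f summable_on A" for f :: "freq \<Rightarrow> real"
    unfolding U_def using F that by (intro sum_infsum) (auto simp: R_def)
  have "- (\<Lambda>\<^sup>2 * (norm g)\<^sup>2) \<le> - (\<Lambda>\<^sup>2 * (\<Sum>\<^sub>\<infinity>\<xi>\<in>U. (coord g \<xi>)\<^sup>2))"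
  proof -
    have "(\<Sum>\<^sub>\<infinity>\<xi>\<in>U. (coord g \<xi>)\<^sup>2) \<le> (norm g)\<^sup>2"
      unfolding ell2_norm_sq by (intro infsum_mono_neutral sg) auto
    then show ?thesis by (simp add: mult_left_mono)
  qed
  also have "\<dots> = (\<Sum>n\<in>F. - (\<Lambda>\<^sup>2 * (\<Sum>\<^sub>\<infinity>\<xi>\<in>R n. (coord g \<xi>)\<^sup>2)))"
    unfolding sumU[OF sg, symmetric] by (simp add: sum_distrib_left sum_negf)
  also have "\<dots> \<le> (\<Sum>n\<in>F. cc * (\<Sum>\<^sub>\<infinity>\<xi>\<in>R n. q \<xi>))" by (intro sum_mono row)
  also have "\<dots> = cc * infsum q U" unfolding sumU[OF sq, symmetric] by (simp add: sum_distrib_left)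
  also have "\<dots> \<le> cc * infsum q UNIV"
  proof -
    have "q \<xi> \<ge> 0" if "\<xi> \<notin> U" for \<xi>
    proof -
      obtain m n where \<xi>: "\<xi> = (m, n)" by fastforce
      show ?thesis
      proof (cases "n = 0")
        case True
        then show ?thesis by (simp add: q_def z_def \<xi> coord_Dop1)
      next
        case False
        then have "int k \<le> \<bar>n\<bar>" using that by (auto simp: U_def R_def F_def \<xi>)
        then show ?thesis using asym_nonneg[of \<xi>] by (simp add: q_def \<xi>)
      qed
    qed
    then have "infsum q U \<le> infsum q UNIV" by (intro infsum_mono_neutral sq) auto
    then show ?thesis using cc_ge by (intro mult_left_mono) auto
  qed
  also have "infsum q UNIV = inner (Aop z) z"
    by (simp add: inner_ell2_def q_def[abs_def] coord_Aop power2_eq_square mult.assoc)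
  finally show "- (\<Lambda>\<^sup>2 * (norm g)\<^sup>2) \<le> cc * inner (Aop (Dop one g)) (Dop one g)" by (simp add: z_def)
qed

end

section \<open>Decay and uniqueness of eigensequences\<close>

context wave
begin

text \<open>The eigenvalue equation of \<open>Lop one\<close>, written for arbitrary families so
  that it can be stated before any decay is known.\<close>

definition eig :: "real \<Rightarrow> (freq \<Rightarrow> real) \<Rightarrow> (freq \<Rightarrow> real) \<Rightarrow> bool" where
  "eig l f g \<longleftrightarrow> (\<forall>m n.
     l * f (m, n) = cc * (real k * of_int n / 2 * (g (m - 1, n) / rad (m - 1, n) - g (m + 1, n) / rad (m + 1, n))) \<and>
     l * g (m, n) = real k * of_int n / 2 / rad (m, n) *
        (asym (m - 1, n) * f (m - 1, n) - asym (m + 1, n) * f (m + 1, n)))"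

lemma eigD:
  assumes "eig l f g"
  shows "l * f (m, n) = cc * (real k * of_int n / 2 * (g (m - 1, n) / rad (m - 1, n) - g (m + 1, n) / rad (m + 1, n)))"
    "l * g (m, n) = real k * of_int n / 2 / rad (m, n) *
        (asym (m - 1, n) * f (m - 1, n) - asym (m + 1, n) * f (m + 1, n))"
  using assms by (auto simp: eig_def)

text \<open>The equation for \<open>f\<close> carries a factor 1 / \<open>rad\<close>. Inserting the
  equation for \<open>g\<close> bounds \<open>f\<close> at \<open>m\<close> by its values at
  distance at most 2, with a factor tending to 0 as m grows; iterating outwards in steps of 2 beats
  any exponential rate. In the second index \<open>rows\<close> confines the support.\<close>

lemma eig_decay:
  assumes e: "eig l f g" and l: "l > 0" and B: "\<And>\<xi>. \<bar>f \<xi>\<bar> \<le> B"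
    and rows: "\<And>m n. int k \<le> \<bar>n\<bar> \<Longrightarrow> f (m, n) = 0 \<and> g (m, n) = 0" and \<beta>: "\<beta> > 0"
  shows "\<exists>C\<ge>0. \<forall>\<xi>. \<bar>f \<xi>\<bar> \<le> C * exp (- \<beta> * sz \<xi>) \<and> \<bar>g \<xi>\<bar> \<le> C * exp (- \<beta> * sz \<xi>)"
proof -
  have B0: "B \<ge> 0" using B[of 0] by linarith
  define K where "K = real k / 2 * cc / l"
  have K: "K \<ge> 0" using l cc_ge by (simp add: K_def)
  have gf: "\<bar>g (m, n)\<bar> \<le> K * (\<bar>f (m - 1, n)\<bar> + \<bar>f (m + 1, n)\<bar>)" for m n
  proof -
    have "l * \<bar>g (m, n)\<bar> = \<bar>l * g (m, n)\<bar>" using l by (simp add: abs_mult)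
    also have "\<dots> = \<bar>real k * of_int n / 2 / rad (m, n)\<bar> *
        \<bar>asym (m - 1, n) * f (m - 1, n) - asym (m + 1, n) * f (m + 1, n)\<bar>"
      unfolding eigD(2)[OF e] by (simp only: abs_mult)
    also have "\<dots> \<le> real k / 2 * (cc * \<bar>f (m - 1, n)\<bar> + cc * \<bar>f (m + 1, n)\<bar>)"
      by (intro mult_mono ratio_bound order_trans[OF abs_triangle_ineq4] add_mono)
         (auto simp: abs_mult intro!: mult_right_mono asym_bound)
    finally show ?thesis using l by (simp add: K_def field_simps)
  qed
  define K' where "K' = cc * (real k / 2) * K / l * real k"
  have K': "K' \<ge> 0" using K l cc_ge by (simp add: K'_def)
  have ff: "\<bar>f (m, n)\<bar> \<le> K' / \<bar>of_int p\<bar> * (\<bar>f (m - 2, n)\<bar> + 2 * \<bar>f (m, n)\<bar> + \<bar>f (m + 2, n)\<bar>)"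
    if p: "p \<ge> 1" "\<bar>m\<bar> \<ge> p + 1" for m n p
  proof (cases "int k \<le> \<bar>n\<bar>")
    case True
    then show ?thesis using rows K' by simp
  next
    case False
    have r: "of_int p \<le> rad (m - 1, n)" "of_int p \<le> rad (m + 1, n)"
    proof -
      have "1 \<le> real k" using k by simp
      then have "\<bar>of_int j\<bar> \<le> rad (j, n)" for j :: int
        using rad_ge(2)[of "(j, n)"] mult_right_mono[of 1 "real k" "\<bar>real_of_int j\<bar>"] by simp
      from this[of "m - 1"] this[of "m + 1"] p
      show "of_int p \<le> rad (m - 1, n)" "of_int p \<le> rad (m + 1, n)" by linarith+
    qed
    have p0: "real_of_int p > 0" using p by simp
    define S where "S = \<bar>f (m - 2, n)\<bar> + 2 * \<bar>f (m, n)\<bar> + \<bar>f (m + 2, n)\<bar>"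
    have q: "\<bar>g (j, n) / rad (j, n)\<bar> \<le> \<bar>g (j, n)\<bar> / of_int p" if "of_int p \<le> rad (j, n)" for j
      using that p0 by (auto intro!: divide_left_mono mult_pos_pos)
    have "l * \<bar>f (m, n)\<bar> = \<bar>l * f (m, n)\<bar>" using l by (simp add: abs_mult)
    also have "\<dots> = cc * (real k / 2 * \<bar>of_int n\<bar> * \<bar>g (m - 1, n) / rad (m - 1, n) - g (m + 1, n) / rad (m + 1, n)\<bar>)"
      unfolding eigD(1)[OF e] using cc_ge by (simp add: abs_mult)
    also have "\<dots> \<le> cc * (real k / 2 * real k * (\<bar>g (m - 1, n)\<bar> / of_int p + \<bar>g (m + 1, n)\<bar> / of_int p))"
      using cc_ge False
      by (intro mult_mono mult_left_mono order_trans[OF abs_triangle_ineq4] add_mono q r) auto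
    also have "\<dots> \<le> cc * (real k / 2 * real k * (K * (\<bar>f (m - 2, n)\<bar> + \<bar>f (m, n)\<bar>) / of_int p +
        K * (\<bar>f (m, n)\<bar> + \<bar>f (m + 2, n)\<bar>) / of_int p))"
      using gf[of "m - 1" n] gf[of "m + 1" n] cc_ge p0
      by (intro mult_left_mono add_mono divide_right_mono) (auto simp: algebra_simps)
    also have "\<dots> = cc * (real k / 2 * real k * (K * S / of_int p))"
      by (simp add: S_def algebra_simps add_divide_distrib)
    also have "\<dots> = l * (K' / of_int p * S)" using l by (simp add: K'_def)
    finally have "\<bar>f (m, n)\<bar> \<le> K' / of_int p * S" using l by (simp only: mult_le_cancel_left_pos)
    then show ?thesis using p0 by (simp add: S_def)
  qed
  define q where "q = exp (- 2 * \<beta>)"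
  \<comment> \<open>Beyond distance \<open>p\<close> the factor, counted over the four neighbouring
    terms, is at most \<open>q = exp (- 2 * \<beta>)\<close>, the gain wanted per step of 2.\<close>
  define p where "p = \<lceil>4 * K' / q\<rceil> + 1"
  have q: "q > 0" by (simp add: q_def)
  have p: "p \<ge> 1" "4 * K' / of_int p \<le> q"
  proof -
    have "4 * K' / q \<ge> 0" using K' q by simp
    then show p1: "p \<ge> 1" by (simp add: p_def)
    have "4 * K' / q \<le> of_int p" unfolding p_def by linarith
    then show "4 * K' / of_int p \<le> q" using q p1 by (simp add: field_simps)
  qed
  have step: "\<forall>m n. \<bar>m\<bar> \<ge> p + 1 + 2 * int j \<longrightarrow> \<bar>f (m, n)\<bar> \<le> B * q ^ j" for j
  proof (induction j)
    case (Suc j)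
    show ?case
    proof (intro allI impI)
      fix m n assume m: "p + 1 + 2 * int (Suc j) \<le> \<bar>m\<bar>"
      have "\<bar>f (m, n)\<bar> \<le> K' / \<bar>of_int p\<bar> * (\<bar>f (m - 2, n)\<bar> + 2 * \<bar>f (m, n)\<bar> + \<bar>f (m + 2, n)\<bar>)"
        using p m by (intro ff) auto
      also have "\<dots> \<le> K' / \<bar>of_int p\<bar> * (B * q ^ j + 2 * (B * q ^ j) + B * q ^ j)"
        using Suc m K' by (intro mult_left_mono add_mono) auto
      also have "\<dots> = (4 * K' / of_int p) * (B * q ^ j)" using p by simp
      also have "\<dots> \<le> q * (B * q ^ j)" using p B0 q by (intro mult_right_mono) auto
      finally show "\<bar>f (m, n)\<bar> \<le> B * q ^ Suc j" by (simp add: mult_ac)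
    qed
  qed (use B in simp)
  \<comment> \<open>The first exponential covers the sites where no iteration has started and the
    rounding of the number of steps; the second covers the row index, which also enters
    \<open>sz\<close>.\<close>
  define C0 where "C0 = B * exp (\<beta> * (of_int p + 3)) * exp (\<beta> * real k)"
  have C0: "C0 \<ge> 0" using B0 by (simp add: C0_def)
  have fdec: "\<bar>f \<xi>\<bar> \<le> C0 * exp (- \<beta> * sz \<xi>)" for \<xi>
  proof -
    obtain m n where \<xi>: "\<xi> = (m, n)" by fastforce
    show ?thesis
    proof (cases "int k \<le> \<bar>n\<bar>")
      case True
      then show ?thesis using rows C0 by (simp add: \<xi>)
    next
      case False
      have main: "\<bar>f (m, n)\<bar> \<le> B * exp (\<beta> * (of_int p + 3)) * exp (- \<beta> * \<bar>of_int m\<bar>)"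
      proof (cases "\<bar>m\<bar> \<ge> p + 1")
        case True
        define j where "j = nat ((\<bar>m\<bar> - p - 1) div 2)"
        have j: "p + 1 + 2 * int j \<le> \<bar>m\<bar>" "\<bar>m\<bar> \<le> p + 3 + 2 * int j" using True by (auto simp: j_def)
        have "q ^ j = exp (real j * (- 2 * \<beta>))" unfolding q_def by (rule exp_of_nat_mult[symmetric])
        also have "\<dots> \<le> exp (\<beta> * (of_int p + 3) + - \<beta> * \<bar>of_int m\<bar>)"
        proof -
          have "\<bar>real_of_int m\<bar> \<le> of_int p + 3 + 2 * real j" using j(2) by linarith
          then have "\<beta> * \<bar>real_of_int m\<bar> \<le> \<beta> * (of_int p + 3 + 2 * real j)"
            using \<beta> by (intro mult_left_mono) auto
          then show ?thesis by (simp add: algebra_simps)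
        qed
        finally have "B * q ^ j \<le> B * exp (\<beta> * (of_int p + 3) + - \<beta> * \<bar>of_int m\<bar>)"
          using B0 by (intro mult_left_mono) auto
        moreover have "\<bar>f (m, n)\<bar> \<le> B * q ^ j" using step[of j] j(1) by blast
        ultimately show ?thesis unfolding exp_add mult.assoc by linarith
      next
        case False
        then have "\<beta> * \<bar>real_of_int m\<bar> \<le> \<beta> * (of_int p + 3)" using \<beta> by (intro mult_left_mono) linarith+
        then have "1 \<le> exp (\<beta> * (of_int p + 3)) * exp (- \<beta> * \<bar>of_int m\<bar>)" by (simp add: mult_exp_exp)
        then have "B * 1 \<le> B * (exp (\<beta> * (of_int p + 3)) * exp (- \<beta> * \<bar>of_int m\<bar>))"
          using B0 by (intro mult_left_mono)
        then show ?thesis using B[of "(m, n)"] by (simp only: mult.assoc mult_1_right)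
      qed
      have "exp (- \<beta> * \<bar>of_int m\<bar>) \<le> exp (\<beta> * real k) * exp (- \<beta> * sz \<xi>)"
      proof -
        have "\<bar>real_of_int n\<bar> \<le> real k" using False by linarith
        then have "\<beta> * \<bar>real_of_int n\<bar> \<le> \<beta> * real k" using \<beta> by (intro mult_left_mono) auto
        then show ?thesis by (simp add: mult_exp_exp sz_def \<xi> algebra_simps)
      qed
      then have "B * exp (\<beta> * (of_int p + 3)) * exp (- \<beta> * \<bar>of_int m\<bar>) \<le>
          B * exp (\<beta> * (of_int p + 3)) * (exp (\<beta> * real k) * exp (- \<beta> * sz \<xi>))"
        using B0 by (intro mult_left_mono) auto
      then show ?thesis using main by (simp add: C0_def \<xi> mult.assoc)
    qed
  qed
  define C where "C = max C0 (2 * K * C0 * exp \<beta>)"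
  have gdec: "\<bar>g \<xi>\<bar> \<le> 2 * K * C0 * exp \<beta> * exp (- \<beta> * sz \<xi>)" for \<xi>
  proof -
    obtain m n where \<xi>: "\<xi> = (m, n)" by fastforce
    have s: "exp (- \<beta> * sz (m', n)) \<le> exp \<beta> * exp (- \<beta> * sz \<xi>)" if "\<bar>m\<bar> \<le> \<bar>m'\<bar> + 1" for m'
    proof -
      have "sz \<xi> \<le> sz (m', n) + 1" using that by (simp add: sz_def \<xi>)
      then have "\<beta> * sz \<xi> \<le> \<beta> * (sz (m', n) + 1)" using \<beta> by (intro mult_left_mono) auto
      then show ?thesis by (simp add: mult_exp_exp algebra_simps)
    qed
    have "\<bar>g \<xi>\<bar> \<le> K * (C0 * exp (- \<beta> * sz (m - 1, n)) + C0 * exp (- \<beta> * sz (m + 1, n)))"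
      using gf[of m n] fdec[of "(m - 1, n)"] fdec[of "(m + 1, n)"] K unfolding \<xi>
      by (meson add_mono mult_left_mono order_trans)
    also have "\<dots> \<le> K * (C0 * (exp \<beta> * exp (- \<beta> * sz \<xi>)) + C0 * (exp \<beta> * exp (- \<beta> * sz \<xi>)))"
      using K C0 s[of "m - 1"] s[of "m + 1"] by (intro mult_left_mono add_mono) auto
    finally show ?thesis by (simp add: algebra_simps)
  qed
  have "C \<ge> 0" using C0 by (simp add: C_def)
  moreover have "\<bar>f \<xi>\<bar> \<le> C * exp (- \<beta> * sz \<xi>)" "\<bar>g \<xi>\<bar> \<le> C * exp (- \<beta> * sz \<xi>)" for \<xi>
  proof -
    have "C0 * exp (- \<beta> * sz \<xi>) \<le> C * exp (- \<beta> * sz \<xi>)"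
      "2 * K * C0 * exp \<beta> * exp (- \<beta> * sz \<xi>) \<le> C * exp (- \<beta> * sz \<xi>)"
      by (intro mult_right_mono; simp add: C_def)+
    then show "\<bar>f \<xi>\<bar> \<le> C * exp (- \<beta> * sz \<xi>)" "\<bar>g \<xi>\<bar> \<le> C * exp (- \<beta> * sz \<xi>)"
      using fdec[of \<xi>] gdec[of \<xi>] by linarith+
  qed
  ultimately show ?thesis by blast
qed

text \<open>The rate 6 leaves room: \<open>W \<kappa> 1\<close> is at most
  \<open>exp (4 * \<kappa> * sz \<xi>)\<close>, and the remaining
  \<open>exp (- 2 * \<kappa> * sz \<xi>)\<close> lies below the square-summable
  \<open>decay \<kappa>\<close>.\<close>

lemma eig_vector:
  assumes e: "eig l f g" and \<kappa>: "\<kappa> > 0"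
    and dec: "\<And>\<xi>. \<bar>f \<xi>\<bar> \<le> C * exp (- (6 * \<kappa>) * sz \<xi>) \<and> \<bar>g \<xi>\<bar> \<le> C * exp (- (6 * \<kappa>) * sz \<xi>)"
  shows "\<exists>v. (\<forall>\<xi>. coord (fst v) \<xi> = W \<kappa> 1 \<xi> * f \<xi> \<and> coord (snd v) \<xi> = W \<kappa> 1 \<xi> * g \<xi>) \<and>
     Lop (W \<kappa> 1) v = l *\<^sub>R v"
proof -
  have "\<bar>f 0\<bar> \<le> C" using dec[of 0] by (simp add: sz_def)
  then have C: "C \<ge> 0" by linarith
  have c: "coord (of_coord (\<lambda>\<xi>. W \<kappa> 1 \<xi> * h \<xi>)) = (\<lambda>\<xi>. W \<kappa> 1 \<xi> * h \<xi>)"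
    if h: "\<And>\<xi>. \<bar>h \<xi>\<bar> \<le> C * exp (- (6 * \<kappa>) * sz \<xi>)" for h
  proof (rule of_coord_inverse')
    have "(\<lambda>\<xi>. (C * coord (decay \<kappa>) \<xi>)\<^sup>2) summable_on UNIV"
      by (rule sq_summable_scale[OF coord_sq_summable])
    then show "(\<lambda>\<xi>. (W \<kappa> 1 \<xi> * h \<xi>)\<^sup>2) summable_on UNIV"
    proof (rule summable_on_comparison_test)
      fix \<xi>
      define x where "x = \<kappa> * sz \<xi>"
      have x: "x \<ge> 0" using \<kappa> by (simp add: x_def)
      have ex: "(1 + x)\<^sup>2 \<le> exp (2 * x)"
        using power_mono[OF exp_ge_add_one_self[of x], of 2] x by (simp add: exp_double)
      have "\<bar>W \<kappa> 1 \<xi> * h \<xi>\<bar> \<le> ((1 + x)\<^sup>2 * exp (2 * x)) * (C * exp (- 6 * x))"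
        unfolding abs_mult using h[of \<xi>]
        by (intro mult_mono) (auto simp: W_def gevrey_def x_def mult_ac)
      also have "\<dots> \<le> (exp (2 * x) * exp (2 * x)) * (C * exp (- 6 * x))"
        using ex C by (intro mult_right_mono) auto
      also have "\<dots> = C * exp (- (2 * x))" by (simp add: mult_exp_exp mult.left_commute)
      also have "\<dots> \<le> C * (1 / (1 + x)\<^sup>2)"
        using ex x C by (intro mult_left_mono) (auto simp: exp_minus inverse_eq_divide intro!: divide_left_mono)
      finally have "\<bar>W \<kappa> 1 \<xi> * h \<xi>\<bar> \<le> \<bar>C * coord (decay \<kappa>) \<xi>\<bar>"
        using C by (simp add: coord_decay[OF \<kappa>] x_def)
      then show "(W \<kappa> 1 \<xi> * h \<xi>)\<^sup>2 \<le> (C * coord (decay \<kappa>) \<xi>)\<^sup>2" by (simp only: abs_le_square_iff)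
    qed simp
  qed
  define v where "v = (of_coord (\<lambda>\<xi>. W \<kappa> 1 \<xi> * f \<xi>), of_coord (\<lambda>\<xi>. W \<kappa> 1 \<xi> * g \<xi>))"
  have cv: "coord (fst v) \<xi> = W \<kappa> 1 \<xi> * f \<xi>" "coord (snd v) \<xi> = W \<kappa> 1 \<xi> * g \<xi>" for \<xi>
    using c[of f] c[of g] dec by (simp_all add: v_def)
  have nz: "W \<kappa> 1 \<xi> \<noteq> 0" for \<xi> using weights_pos(1)[OF \<kappa>, of 1 \<xi>] by simp
  note sw = slow_W[OF \<kappa>, of 1, OF order_refl, unfolded One_nat_def]
  have "Lop (W \<kappa> 1) v = l *\<^sub>R v"
  proof (rule prod_eqI; rule ell2_eqI)
    fix \<xi> :: freq
    obtain m n where \<xi>: "\<xi> = (m, n)" by fastforce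
    show "coord (fst (Lop (W \<kappa> 1) v)) \<xi> = coord (fst (l *\<^sub>R v)) \<xi>"
    proof -
      have "coord (fst (l *\<^sub>R v)) \<xi> = W \<kappa> 1 \<xi> * (l * f (m, n))" by (simp add: cv \<xi>)
      then show ?thesis unfolding eigD(1)[OF e] using nz
        by (simp add: Lop_def coord_Dop[OF sw] cv[unfolded One_nat_def] Dco_def sh_def \<xi> right_diff_distrib mult_ac)
    qed
    show "coord (snd (Lop (W \<kappa> 1) v)) \<xi> = coord (snd (l *\<^sub>R v)) \<xi>"
    proof -
      have "coord (snd (l *\<^sub>R v)) \<xi> = W \<kappa> 1 \<xi> * (l * g (m, n))" by (simp add: cv \<xi>)
      then show ?thesis unfolding eigD(2)[OF e] using nz
        by (simp add: Lop_def coord_Eop[OF sw] coord_Aop cv[unfolded One_nat_def] Eco_def sh_def \<xi> right_diff_distrib mult_ac)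
    qed
  qed
  then show ?thesis using cv by blast
qed

text \<open>Row \<open>n\<close> of \<open>g\<close> is an eigenvector of \<open>Mrow n\<close> with
  eigenvalue \<open>l * l\<close>; it is nonzero because \<open>g\<close> determines
  \<open>f\<close> through the first equation.\<close>

lemma eig_unique:
  assumes e: "eig l f g" and l: "l > 0" and g: "(\<lambda>\<xi>. (g \<xi>)\<^sup>2) summable_on UNIV"
    and n: "n \<noteq> 0" "\<bar>n\<bar> < int k" and nz: "f (m, n) \<noteq> 0 \<or> g (m, n) \<noteq> 0"
  shows "l = sqrt (row_rate n)"
proof -
  define y where "y = of_coord (\<lambda>\<xi>. if snd \<xi> = n then g \<xi> else 0)"
  have cy: "coord y \<xi> = (if snd \<xi> = n then g \<xi> else 0)" for \<xi>
    unfolding y_def by (subst of_coord_inverse') (auto intro: summable_on_comparison_test[OF g])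
  have "y \<noteq> 0"
  proof
    assume y0: "y = 0"
    have g0: "g (j, n) = 0" for j using cy[of "(j, n)"] by (simp add: y0)
    then show False using nz eigD(1)[OF e, of m n] l by simp
  qed
  moreover have "Mrow n y = (l * l) *\<^sub>R y"
  proof (rule ell2_eqI)
    fix \<xi> :: freq
    obtain j i where \<xi>: "\<xi> = (j, i)" by fastforce
    have D: "cc * coord (Dop one y) (a, n) = l * f (a, n)" for a
      unfolding coord_Dop1 cy using eigD(1)[OF e, of a n] by simp
    show "coord (Mrow n y) \<xi> = coord ((l * l) *\<^sub>R y) \<xi>"
    proof (cases "i = n")
      case True
      have "coord (Mrow n y) \<xi> = real k * of_int n / 2 / rad (j, n) *
          (asym (j - 1, n) * (cc * coord (Dop one y) (j - 1, n)) - asym (j + 1, n) * (cc * coord (Dop one y) (j + 1, n)))"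
        by (simp add: Mrow_def coord_Eop1 coord_Arow \<xi> True right_diff_distrib mult_ac)
      also have "\<dots> = l * (l * g (j, n))"
        unfolding D eigD(2)[OF e] by (simp add: right_diff_distrib mult_ac)
      finally show ?thesis by (simp add: cy \<xi> True)
    next
      case False
      then show ?thesis by (simp add: Mrow_def coord_Eop1 coord_Arow \<xi> cy)
    qed
  qed
  ultimately have "l * l = row_rate n" using row_rate(4)[OF n, of "l * l" y] l by simp
  then show ?thesis using l by (metis abs_of_pos real_sqrt_mult_self real_sqrt_abs2)
qed

text \<open>An eigenvector of \<open>Mrow n\<close> solves the equations on one row. Projecting
  \<open>f\<close> to its even part on even \<open>m\<close> and \<open>g\<close> to its odd part on
  odd \<open>m\<close> is compatible with them and gives the shape of a branch. Row
  \<open>- n\<close> is filled in by parity.\<close>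

lemma eig_exists:
  assumes n: "1 \<le> n" "n < int k"
  shows "\<exists>a b :: int \<Rightarrow> real. (\<forall>m. a (- m) = a m \<and> b (- m) = - b m \<and> (odd m \<longrightarrow> a m = 0) \<and> (even m \<longrightarrow> b m = 0)) \<and>
     b 1 \<noteq> 0 \<and> (\<exists>B. \<forall>m. \<bar>a m\<bar> \<le> B) \<and>
     eig (sqrt (row_rate n)) (\<lambda>(m, i). if \<bar>i\<bar> = n then a m else 0)
       (\<lambda>(m, i). if i = n then b m else if i = - n then - b m else 0)"
proof -
  have n': "n \<noteq> 0" "\<bar>n\<bar> < int k" using n by auto
  obtain y where y: "y \<noteq> 0" "Mrow n y = row_rate n *\<^sub>R y" using row_rate(2)[OF n'] by blast
  define \<mu> where "\<mu> = row_rate n"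
  have \<mu>: "\<mu> > 0" using row_rate(1)[OF n'] by (simp add: \<mu>_def)
  define z where "z = Dop one y"
  define la where "la = sqrt \<mu>"
  have la: "la > 0" "la * la = \<mu>" using \<mu> by (auto simp: la_def)
  define f where "f m = cc / la * coord z (m, n)" for m
  define g where "g m = coord y (m, n)" for m
  have e1: "la * f m = cc * (real k * of_int n / 2 * (g (m - 1) / rad (m - 1, n) - g (m + 1) / rad (m + 1, n)))" for m
    using la by (simp add: f_def z_def coord_Dop1 g_def)
  have e2: "la * g m = real k * of_int n / 2 / rad (m, n) * (asym (m - 1, n) * f (m - 1) - asym (m + 1, n) * f (m + 1))" for m
  proof -
    have "la * (la * g m) = coord (Mrow n y) (m, n)"
      unfolding y(2) mult.assoc[symmetric] la(2) by (simp add: g_def \<mu>_def)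
    also have "\<dots> = la * (real k * of_int n / 2 / rad (m, n) * (asym (m - 1, n) * f (m - 1) - asym (m + 1, n) * f (m + 1)))"
      using la(1) by (simp add: Mrow_def coord_Eop1 coord_Arow f_def z_def[symmetric] right_diff_distrib mult_ac)
    finally show ?thesis using la(1) mult_left_cancel[of la] by blast
  qed
  \<comment> \<open>Otherwise the form of \<open>Arow n\<close> at \<open>z\<close> would be
    nonnegative, contradicting the positive eigenvalue. Up to a factor this entry is the difference
    of \<open>g\<close> at -1 and 1, so it also shows that the projection does not vanish.\<close>
  have "coord z (0, n) \<noteq> 0"
  proof
    assume z0: "coord z (0, n) = 0"
    have "0 \<le> inner (Arow n z) z"
      unfolding inner_ell2_def coord_Arow
    proof (rule infsum_nonneg)
      fix \<xi> :: freq
      show "0 \<le> (if snd \<xi> = n then asym \<xi> * coord z \<xi> else 0) * coord z \<xi>"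
      proof (cases "fst \<xi> = 0")
        case True
        then show ?thesis using z0 by (cases \<xi>) auto
      next
        case False
        then show ?thesis using asym_nonneg[of \<xi>] by (simp add: mult.assoc)
      qed
    qed
    then have "0 \<le> cc * inner (Arow n z) z" using cc_ge by simp
    also have "cc * inner (Arow n z) z = - inner (Mrow n y) y"
      unfolding Mrow_def z_def by (metis inner_Dop inner_commute inner_scaleR_left inner_minus_left minus_minus)
    also have "\<dots> = - (\<mu> * (norm y)\<^sup>2)" by (simp add: y(2) \<mu>_def power2_norm_eq_inner)
    finally have "\<mu> * (norm y)\<^sup>2 \<le> 0" by simp
    moreover have "\<mu> * (norm y)\<^sup>2 > 0" using \<mu> y(1) by simp
    ultimately show False by linarith
  qed
  have r: "rad (- m, n) = rad (m, n)" "asym (- m, n) = asym (m, n)" "rad (m, - n) = rad (m, n)" "asym (m, - n) = asym (m, n)" for m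
    by (simp_all add: rad_def asym_def)
  have g1: "g 1 \<noteq> g (- 1)"
    using \<open>coord z (0, n) \<noteq> 0\<close> r(1)[of 1] by (auto simp: z_def coord_Dop1 g_def)
  define a where "a m = (if even m then (f m + f (- m)) / 2 else 0)" for m
  define b where "b m = (if odd m then (g m - g (- m)) / 2 else 0)" for m
  have sym: "a (- m) = a m \<and> b (- m) = - b m \<and> (odd m \<longrightarrow> a m = 0) \<and> (even m \<longrightarrow> b m = 0)" for m
    by (auto simp: a_def b_def minus_divide_left)
  have b1: "b 1 \<noteq> 0" using g1 by (simp add: b_def)
  define Z where "Z = cc / la * norm z"
  have bd: "\<bar>a m\<bar> \<le> Z" for m
  proof -
    have "\<bar>f j\<bar> \<le> Z" for j
      using la cc_ge mult_left_mono[OF abs_coord_le[of z "(j, n)"], of "cc / la"]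
      by (simp add: f_def abs_mult Z_def)
    from this[of m] this[of "- m"] have "\<bar>f m + f (- m)\<bar> \<le> Z * 2" "0 \<le> Z" by linarith+
    then show ?thesis by (simp add: a_def)
  qed
  have rm: "rad (- m - 1, n) = rad (m + 1, n)" "rad (- m + 1, n) = rad (m - 1, n)"
    "asym (- m - 1, n) = asym (m + 1, n)" "asym (- m + 1, n) = asym (m - 1, n)" for m
    using r(1)[of "m + 1"] r(1)[of "m - 1"] r(2)[of "m + 1"] r(2)[of "m - 1"]
    by (simp_all add: algebra_simps minus_diff_commute)
  have E1: "la * a m = cc * (real k * of_int n / 2 * (b (m - 1) / rad (m - 1, n) - b (m + 1) / rad (m + 1, n)))" for m
  proof (cases "even m")
    case True
    have "la * a m = (la * f m + la * f (- m)) / 2" using True by (simp add: a_def distrib_left)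
    then show ?thesis
      unfolding e1 rm using True
      by (simp add: b_def diff_divide_distrib add_divide_distrib algebra_simps minus_diff_commute)
  qed (simp add: a_def b_def)
  have E2: "la * b m = real k * of_int n / 2 / rad (m, n) * (asym (m - 1, n) * a (m - 1) - asym (m + 1, n) * a (m + 1))" for m
  proof (cases "odd m")
    case True
    have "la * b m = (la * g m - la * g (- m)) / 2" using True by (simp add: b_def right_diff_distrib)
    then show ?thesis
      unfolding e2 rm r using True
      by (simp add: a_def diff_divide_distrib add_divide_distrib algebra_simps minus_diff_commute)
  qed (simp add: a_def b_def)
  have "eig la (\<lambda>(m, i). if \<bar>i\<bar> = n then a m else 0) (\<lambda>(m, i). if i = n then b m else if i = - n then - b m else 0)"
    unfolding eig_def
  proof (intro allI conjI)
    fix m i :: int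
    have ri: "rad (j, - i) = rad (j, i)" "asym (j, - i) = asym (j, i)" for j
      by (simp_all add: rad_def asym_def)
    show "la * (case (m, i) of (m, i) \<Rightarrow> if \<bar>i\<bar> = n then a m else 0) =
       cc * (real k * of_int i / 2 * ((case (m - 1, i) of (m, i) \<Rightarrow> if i = n then b m else if i = - n then - b m else 0) / rad (m - 1, i) -
          (case (m + 1, i) of (m, i) \<Rightarrow> if i = n then b m else if i = - n then - b m else 0) / rad (m + 1, i)))"
      using E1[of m] n by (auto simp: ri right_diff_distrib abs_if)
    show "la * (case (m, i) of (m, i) \<Rightarrow> if i = n then b m else if i = - n then - b m else 0) =
       real k * of_int i / 2 / rad (m, i) * (asym (m - 1, i) * (case (m - 1, i) of (m, i) \<Rightarrow> if \<bar>i\<bar> = n then a m else 0) -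
          asym (m + 1, i) * (case (m + 1, i) of (m, i) \<Rightarrow> if \<bar>i\<bar> = n then a m else 0))"
      using E2[of m] n by (auto simp: ri right_diff_distrib abs_if)
  qed
  then show ?thesis using sym b1 bd unfolding la_def \<mu>_def by blast
qed

end

section \<open>From coefficients to functions: Fourier series, Sobolev norms, strong solutions, the
  equilibrium\<close>

section \<open>Absolutely convergent Fourier series\<close>

lemma cis_integral_zero:
  fixes j :: int
  assumes "j \<noteq> 0"
  shows "(LINT y:{0..2*pi}|lborel. cis (of_int j * y)) = 0"
proof -
  define F where "F z = exp (\<i> * of_int j * z) / (\<i> * of_int j)" for z :: complex
  have cis: "cis (of_int j * y) = exp (\<i> * of_int j * of_real y)" for y
    by (simp add: cis_conv_exp mult_ac)
  have "(F has_field_derivative exp (\<i> * of_int j * z)) (at z)" for z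
    unfolding F_def using assms by (auto intro!: derivative_eq_intros)
  then have "((\<lambda>y. F (of_real y)) has_vector_derivative cis (of_int j * y)) (at y within S)" for y S
    unfolding cis by (rule has_vector_derivative_real_field)
  then have "((\<lambda>y. cis (of_int j * y)) has_integral (F (of_real (2 * pi)) - F (of_real 0))) {0..2*pi}"
    by (intro fundamental_theorem_of_calculus) auto
  moreover have "F (of_real (2 * pi)) = F (of_real 0)"
  proof -
    have "exp (\<i> * of_int j * of_real (2 * pi)) = 1"
      using exp_eq_1[of "\<i> * of_int j * of_real (2 * pi)"] by (auto intro!: exI[of _ j])
    then show ?thesis by (simp add: F_def)
  qed
  ultimately have "((\<lambda>y. cis (of_int j * y)) has_integral 0) {0..2*pi}" by simp
  moreover have "set_integrable lborel {0..2*pi} (\<lambda>y. cis (of_int j * y))"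
    by (intro borel_integrable_atLeastAtMost' continuous_intros)
  ultimately show ?thesis
    by (simp add: set_borel_integral_eq_integral(2) integral_unique)
qed

lemma indicator_cell: "indicator cell (x, y) = (indicator {0..2*pi} x * indicator {0..2*pi} y :: real)"
  by (auto simp: cell_def indicator_def)

lemma cell_cbox: "cell = cbox (0, 0) (2*pi, 2*pi)"
  by (simp add: cell_def cbox_Pair_eq)

lemma cell_sets [measurable, simp]: "cell \<in> sets borel"
  by (simp add: cell_cbox)

lemma measure_cell: "measure lborel cell = (2*pi)\<^sup>2"
  by (simp add: cell_cbox content_Pair power2_eq_square)

lemma product_integral_zero:
  fixes g h :: "real \<Rightarrow> complex"
  assumes "(LINT y:{0..2*pi}|lborel. h y) = 0"
  shows "(LINT p:cell|lborel. g (fst p) * h (snd p)) = 0" "(LINT p:cell|lborel. h (fst p) * g (snd p)) = 0"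
proof -
  define G H where "G = (\<lambda>x. indicator {0..2*pi} x *\<^sub>R g x)" and "H = (\<lambda>x. indicator {0..2*pi} x *\<^sub>R h x)"
  have H: "(LINT y|lborel. H y) = 0" using assms by (simp add: H_def set_lebesgue_integral_def)
  have eq1: "(LINT p:cell|lborel. g (fst p) * h (snd p)) = (LINT p|(lborel \<Otimes>\<^sub>M lborel). G (fst p) * H (snd p))"
    unfolding set_lebesgue_integral_def lborel_prod[symmetric]
    by (intro arg_cong2[where f = lebesgue_integral] ext refl)
       (auto simp: G_def H_def indicator_cell)
  have eq2: "(LINT p:cell|lborel. h (fst p) * g (snd p)) = (LINT p|(lborel \<Otimes>\<^sub>M lborel). H (fst p) * G (snd p))"
    unfolding set_lebesgue_integral_def lborel_prod[symmetric]
    by (intro arg_cong2[where f = lebesgue_integral] ext refl)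
       (auto simp: G_def H_def indicator_cell)
  \<comment> \<open>Fubini if the product is integrable; otherwise the integral is 0 by convention.
    The profiles of a branch will enter here as arbitrary measurable functions.\<close>
  show "(LINT p:cell|lborel. g (fst p) * h (snd p)) = 0"
  proof (cases "integrable (lborel \<Otimes>\<^sub>M lborel) (\<lambda>p. G (fst p) * H (snd p))")
    case True
    from lborel_pair.integral_fst'[OF True] show ?thesis unfolding eq1 by (simp add: H)
  qed (simp add: eq1 not_integrable_integral_eq)
  show "(LINT p:cell|lborel. h (fst p) * g (snd p)) = 0"
  proof (cases "integrable (lborel \<Otimes>\<^sub>M lborel) (\<lambda>(x, y). H x * G y)")
    case True
    from lborel_pair.integral_snd[OF True] show ?thesis
      unfolding eq2 by (simp add: H split_beta' mult.commute)
  next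
    case False
    then show ?thesis unfolding eq2 by (simp add: split_beta' not_integrable_integral_eq)
  qed
qed

lemma fourier_char_simps:
  "fourier_char \<xi> (x, y) = cis (of_int (fst \<xi>) * x) * cis (of_int (snd \<xi>) * y)"
  "norm (fourier_char \<xi> p) = 1"
  "cnj (fourier_char \<xi> p) = fourier_char (- \<xi>) p"
  "fourier_char (\<xi> + \<eta>) p = fourier_char \<xi> p * fourier_char \<eta> p"
  by (auto simp: fourier_char_def cis_mult cis_cnj algebra_simps)

lemma continuous_fourier_char: "continuous_on S (fourier_char \<xi>)"
  unfolding fourier_char_def[abs_def] by (intro continuous_intros)

lemma fourier_coeff_char: "fourier_coeff (fourier_char \<xi>) \<eta> = (if \<xi> = \<eta> then 1 else 0)"
proof (cases "\<xi> = \<eta>")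
  case True
  have "fourier_char \<xi> x * cnj (fourier_char \<xi> x) = 1" for x
    using complex_norm_square[of "fourier_char \<xi> x"] by (simp add: fourier_char_simps)
  then have "fourier_coeff (fourier_char \<xi>) \<xi> = (LINT x:cell|lborel. 1) / of_real ((2*pi)^2)"
    by (simp add: fourier_coeff_def)
  also have "(LINT x:cell|lborel. 1) = (of_real ((2*pi)\<^sup>2) :: complex)"
    by (simp add: set_lebesgue_integral_def measure_cell scaleR_conv_of_real)
  finally show ?thesis using True by simp
next
  case False
  define i j where "i = fst \<xi> - fst \<eta>" and "j = snd \<xi> - snd \<eta>"
  have eq: "fourier_char \<xi> p * cnj (fourier_char \<eta> p) = cis (of_int i * fst p) * cis (of_int j * snd p)" for p
    by (cases p) (simp add: fourier_char_def cis_cnj cis_mult i_def j_def algebra_simps)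
  have "(LINT p:cell|lborel. fourier_char \<xi> p * cnj (fourier_char \<eta> p)) = 0"
  proof (cases "j = 0")
    case True
    then have "i \<noteq> 0" using False by (auto simp: i_def j_def prod_eq_iff)
    then show ?thesis unfolding eq by (intro product_integral_zero(2) cis_integral_zero)
  next
    case False
    then show ?thesis unfolding eq by (intro product_integral_zero(1) cis_integral_zero)
  qed
  then show ?thesis using False by (simp add: fourier_coeff_def)
qed

instance bcontfun :: (metric_space, banach) banach ..

definition trig :: "(int \<times> int \<Rightarrow> complex) \<Rightarrow> scalar" where
  "trig c x = (\<Sum>\<^sub>\<infinity>\<xi>. c \<xi> * fourier_char \<xi> x)"

abbreviation abs_summable :: "('a \<Rightarrow> 'b::real_normed_vector) \<Rightarrow> bool" where
  "abs_summable c \<equiv> (\<lambda>\<xi>. norm (c \<xi>)) summable_on UNIV"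

lemma set_integrable_cell_continuous:
  fixes f :: "real \<times> real \<Rightarrow> 'a::euclidean_space"
  assumes "continuous_on UNIV f"
  shows "set_integrable lborel cell f"
  unfolding cell_cbox set_integrable_def
  by (rule borel_integrable_compact) (auto intro: continuous_on_subset[OF assms])

lemma fourier_coeff_bounded:
  assumes "continuous_on UNIV f" "\<And>x. norm (f x) \<le> B"
  shows "norm (fourier_coeff f \<eta>) \<le> B"
proof -
  have B: "B \<ge> 0" using assms(2)[of 0] norm_ge_zero order_trans by blast
  have i: "set_integrable lborel cell (\<lambda>x. f x * cnj (fourier_char \<eta> x))"
    by (intro set_integrable_cell_continuous continuous_on_mult assms continuous_on_cnj continuous_fourier_char)
  have "norm (LINT x:cell|lborel. f x * cnj (fourier_char \<eta> x)) \<le> (LINT x:cell|lborel. norm (f x * cnj (fourier_char \<eta> x)))"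
    by (rule set_integral_norm_bound[OF i])
  also have "\<dots> \<le> (LINT x:cell|lborel. B)"
    by (intro set_integral_mono set_integrable_norm[OF i] set_integrable_cell_continuous continuous_on_const)
       (simp add: norm_mult fourier_char_simps assms(2))
  also have "\<dots> = B * (2*pi)\<^sup>2"
    by (simp add: set_lebesgue_integral_def measure_cell)
  finally show ?thesis by (simp add: fourier_coeff_def norm_divide norm_power divide_le_eq)
qed

lemma fourier_coeff_add:
  assumes "set_integrable lborel cell (\<lambda>x. f x * cnj (fourier_char \<eta> x))"
    "set_integrable lborel cell (\<lambda>x. g x * cnj (fourier_char \<eta> x))"
  shows "fourier_coeff (\<lambda>x. f x + g x) \<eta> = fourier_coeff f \<eta> + fourier_coeff g \<eta>"
  using set_integral_add(2)[OF assms] by (simp add: fourier_coeff_def distrib_right add_divide_distrib)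

lemma fourier_coeff_cmult: "fourier_coeff (\<lambda>x. a * f x) \<eta> = a * fourier_coeff f \<eta>"
  by (simp add: fourier_coeff_def mult.assoc)

lemma abs_summable_product_bounded:
  fixes c e :: "'a \<Rightarrow> complex"
  assumes "abs_summable c" "\<And>x. norm (e x) \<le> 1"
  shows "(\<lambda>x. c x * e x) summable_on UNIV"
  by (rule abs_summable_summable, rule summable_on_comparison_test[OF assms(1)])
     (auto simp: norm_mult assms(2) mult_left_le)

lemma abs_summable_square:
  fixes c :: "'a \<Rightarrow> complex"
  assumes c: "abs_summable c"
  shows "(\<lambda>\<xi>. (norm (c \<xi>))\<^sup>2) summable_on UNIV"
proof (rule summable_on_comparison_test[OF summable_on_cmult_right[OF c, of "\<Sum>\<^sub>\<infinity>\<xi>. norm (c \<xi>)"]])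
  fix \<xi>
  have "sum (\<lambda>\<xi>. norm (c \<xi>)) {\<xi>} \<le> (\<Sum>\<^sub>\<infinity>\<xi>. norm (c \<xi>))" by (rule finite_sum_le_infsum[OF c]) simp_all
  then show "(norm (c \<xi>))\<^sup>2 \<le> (\<Sum>\<^sub>\<infinity>\<xi>. norm (c \<xi>)) * norm (c \<xi>)"
    by (simp add: power2_eq_square mult_right_mono)
qed simp

context
  fixes c :: "int \<times> int \<Rightarrow> complex"
  assumes c: "abs_summable c"
begin

lemma trig_has_sum: "((\<lambda>\<xi>. c \<xi> * fourier_char \<xi> x) has_sum trig c x) UNIV"
  unfolding trig_def
  by (intro has_sum_infsum abs_summable_product_bounded c) (simp add: fourier_char_simps)

text \<open>The series is summed in the Banach space of bounded continuous functions, where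
  evaluation and each Fourier coefficient are bounded linear functionals and may be taken term by
  term.\<close>

lemma trig_props:
  shows "continuous_on UNIV (trig c)" "\<And>\<eta>. fourier_coeff (trig c) \<eta> = c \<eta>"
proof -
  define e :: "int \<times> int \<Rightarrow> (real \<times> real) \<Rightarrow>\<^sub>C complex" where
    "e \<xi> = Bcontfun (\<lambda>x. c \<xi> * fourier_char \<xi> x)" for \<xi>
  have ae: "apply_bcontfun (e \<xi>) = (\<lambda>x. c \<xi> * fourier_char \<xi> x)" for \<xi>
    unfolding e_def
    by (intro Bcontfun_inverse bcontfun_normI[where b = "norm (c \<xi>)"] continuous_intros continuous_fourier_char)
       (simp add: norm_mult fourier_char_simps)
  have ne: "norm (e \<xi>) \<le> norm (c \<xi>)" for \<xi>
    by (rule norm_bound) (simp add: ae norm_mult fourier_char_simps)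
  have "(\<lambda>\<xi>. norm (e \<xi>)) summable_on UNIV"
    by (rule summable_on_comparison_test[OF c]) (use ne in auto)
  then have hs: "(e has_sum (\<Sum>\<^sub>\<infinity>\<xi>. e \<xi>)) UNIV"
    by (rule has_sum_infsum[OF abs_summable_summable])
  define S where "S = (\<Sum>\<^sub>\<infinity>\<xi>. e \<xi>)"
  have S: "apply_bcontfun S = trig c"
  proof
    fix x
    have bl: "bounded_linear (\<lambda>f :: (real \<times> real) \<Rightarrow>\<^sub>C complex. apply_bcontfun f x)"
      by (rule bounded_linear_intro[where K = 1]) (auto simp: norm_bounded)
    from has_sum_bounded_linear[OF bl hs] have "((\<lambda>\<xi>. c \<xi> * fourier_char \<xi> x) has_sum apply_bcontfun S x) UNIV"
      by (simp add: ae S_def o_def)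
    then show "apply_bcontfun S x = trig c x" using trig_has_sum has_sum_unique by blast
  qed
  show "continuous_on UNIV (trig c)" unfolding S[symmetric] by simp
  fix \<eta>
  have i: "set_integrable lborel cell (\<lambda>x. apply_bcontfun f x * cnj (fourier_char \<eta> x))" for f
    by (intro set_integrable_cell_continuous continuous_on_mult continuous_on_cnj continuous_fourier_char) simp
  have bl: "bounded_linear (\<lambda>f :: (real \<times> real) \<Rightarrow>\<^sub>C complex. fourier_coeff (apply_bcontfun f) \<eta>)"
  proof (rule bounded_linear_intro[where K = 1])
    fix f g :: "(real \<times> real) \<Rightarrow>\<^sub>C complex" and r :: real
    show "fourier_coeff (apply_bcontfun (f + g)) \<eta> = fourier_coeff (apply_bcontfun f) \<eta> + fourier_coeff (apply_bcontfun g) \<eta>"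
      using fourier_coeff_add[OF i i] by (simp add: plus_bcontfun.rep_eq)
    show "fourier_coeff (apply_bcontfun (r *\<^sub>R f)) \<eta> = r *\<^sub>R fourier_coeff (apply_bcontfun f) \<eta>"
      using fourier_coeff_cmult[of "of_real r"] by (simp add: scaleR_bcontfun.rep_eq scaleR_conv_of_real)
    show "norm (fourier_coeff (apply_bcontfun f) \<eta>) \<le> norm f * 1"
      by (simp add: fourier_coeff_bounded norm_bounded)
  qed
  from has_sum_bounded_linear[OF bl hs]
  have "((\<lambda>\<xi>. c \<xi> * fourier_coeff (fourier_char \<xi>) \<eta>) has_sum fourier_coeff (trig c) \<eta>) UNIV"
    by (simp add: S[symmetric] S_def[symmetric] o_def ae fourier_coeff_cmult)
  moreover have "((\<lambda>\<xi>. c \<xi> * fourier_coeff (fourier_char \<xi>) \<eta>) has_sum c \<eta>) UNIV"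
    unfolding fourier_coeff_char by (rule has_sum_finite_neutralI[of "{\<eta>}"]) auto
  ultimately show "fourier_coeff (trig c) \<eta> = c \<eta>" using has_sum_unique by blast
qed

lemma trig_multiplier: "multiplier m (trig c) = trig (\<lambda>\<xi>. m \<xi> * c \<xi>)"
  by (rule ext) (simp add: multiplier_def trig_def trig_props(2))

lemma trig_periodic: "trig c (x + 2*pi, y) = trig c (x, y)" "trig c (x, y + 2*pi) = trig c (x, y)"
proof -
  have "cis (of_int m * (z + 2 * pi)) = cis (of_int m * z)" for m z
  proof -
    have "cis (of_int m * (2 * pi)) = 1"
      using cis_multiple_2pi[of "of_int m"] by (simp add: mult_ac)
    then show ?thesis by (simp add: distrib_left cis_mult[symmetric])
  qed
  then have "fourier_char \<xi> (x + 2 * pi, y) = fourier_char \<xi> (x, y)" "fourier_char \<xi> (x, y + 2 * pi) = fourier_char \<xi> (x, y)" for \<xi>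
    by (simp_all add: fourier_char_simps)
  then show "trig c (x + 2*pi, y) = trig c (x, y)" "trig c (x, y + 2*pi) = trig c (x, y)"
    by (simp_all add: trig_def)
qed

lemma trig_sobolev:
  assumes "(\<lambda>\<xi>. (1 + sqnorm \<xi>)^r * (norm (c \<xi>))^2) summable_on UNIV"
  shows "trig c \<in> sobolev r"
proof -
  have "trig c \<in> borel_measurable borel"
    by (rule borel_measurable_continuous_onI) (rule trig_props)
  moreover have "set_integrable lborel cell (\<lambda>x. (norm (trig c x))^2)"
    by (intro set_integrable_cell_continuous continuous_on_power continuous_on_norm trig_props)
  ultimately show ?thesis
    unfolding sobolev_def using assms trig_periodic by (simp add: trig_props)
qed

end

lemma fourier_coeff_cong_AE:
  assumes "AE x in lborel. u x = v x" "u \<in> borel_measurable borel" "v \<in> borel_measurable borel"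
  shows "fourier_coeff u \<xi> = fourier_coeff v \<xi>"
  unfolding fourier_coeff_def set_lebesgue_integral_def
proof (rule arg_cong2[where f = "(/)"], rule integral_cong_AE)
  have m: "(\<lambda>x. cnj (fourier_char \<xi> x)) \<in> borel_measurable borel"
    by (intro borel_measurable_continuous_onI continuous_on_cnj continuous_fourier_char)
  show "(\<lambda>x. indicat_real cell x *\<^sub>R (u x * cnj (fourier_char \<xi> x))) \<in> borel_measurable lborel"
    "(\<lambda>x. indicat_real cell x *\<^sub>R (v x * cnj (fourier_char \<xi> x))) \<in> borel_measurable lborel"
    using assms(2,3) m by (auto intro!: borel_measurable_scaleR borel_measurable_times borel_measurable_indicator)
qed (use assms(1) in auto)

lemma trig_unique:
  assumes "abs_summable c" "abs_summable d" "AE x in lborel. trig c x = trig d x"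
  shows "c = d"
proof
  fix \<xi>
  have "fourier_coeff (trig c) \<xi> = fourier_coeff (trig d) \<xi>"
    using assms by (intro fourier_coeff_cong_AE borel_measurable_continuous_onI trig_props)
  then show "c \<xi> = d \<xi>" by (simp add: trig_props assms)
qed

lemma trig_add:
  assumes "abs_summable c" "abs_summable d"
  shows "trig (\<lambda>\<xi>. c \<xi> + d \<xi>) x = trig c x + trig d x"
  using has_sum_add[OF trig_has_sum[OF assms(1)] trig_has_sum[OF assms(2)], of x x]
  by (auto simp: trig_def distrib_right intro: infsumI)

lemma trig_cmult: "trig (\<lambda>\<xi>. a * c \<xi>) x = a * trig c x"
  unfolding trig_def mult.assoc by (rule infsum_cmult_right')

lemma polynomial_le_exp:
  fixes \<kappa> :: real
  assumes "\<kappa> > 0"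
  shows "\<exists>C>0. \<forall>x\<ge>0. (1 + x) ^ p \<le> C * exp (\<kappa> * x)"
proof (cases "p = 0")
  case True
  then show ?thesis using assms by (intro exI[of _ 1]) auto
next
  case False
  define q where "q = \<kappa> / real p"
  define M where "M = max 1 (1 / q)"
  have q: "q > 0" using assms False by (simp add: q_def)
  have M: "M \<ge> 1" "M * q \<ge> 1" using q by (auto simp: M_def max_def field_simps)
  have "(1 + x) ^ p \<le> M ^ p * exp (\<kappa> * x)" if x: "x \<ge> 0" for x
  proof -
    have "1 + x \<le> M * (1 + q * x)"
      using M x mult_right_mono[OF M(2) x] by (simp add: algebra_simps)
    also have "\<dots> \<le> M * exp (q * x)"
      using M exp_ge_add_one_self[of "q * x"] by (intro mult_left_mono) auto
    finally have "(1 + x) ^ p \<le> (M * exp (q * x)) ^ p" using x by (intro power_mono) auto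
    also have "\<dots> = M ^ p * exp (\<kappa> * x)"
      using False by (simp add: power_mult_distrib exp_of_nat_mult[symmetric] q_def)
    finally show ?thesis .
  qed
  moreover have "M ^ p > 0" using M by simp
  ultimately show ?thesis by blast
qed

text \<open>Decay faster than any power of the frequency, a class stable under multipliers of
  polynomial growth and in particular under derivatives.\<close>

definition rapid :: "(freq \<Rightarrow> complex) \<Rightarrow> bool" where
  "rapid a \<longleftrightarrow> (\<forall>N. abs_summable (\<lambda>\<xi>. of_real ((1 + sz \<xi>) ^ N) * a \<xi>))"

lemma norm_sz_mult: "norm (of_real ((1 + sz \<xi>) ^ N) * z) = (1 + sz \<xi>) ^ N * norm z" for z :: complex
  by (simp only: norm_mult norm_of_real abs_of_nonneg zero_le_power add_nonneg_nonneg zero_le_one sz_nonneg)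

lemma rapid_summable: "rapid a \<Longrightarrow> abs_summable a"
  unfolding rapid_def by (drule spec[of _ 0]) simp

lemma rapid_mono:
  assumes "rapid a" "\<And>\<xi>. norm (b \<xi>) \<le> C * (1 + sz \<xi>) ^ M * norm (a \<xi>)"
  shows "rapid b"
  unfolding rapid_def
proof
  fix N
  have "(\<lambda>\<xi>. C * norm (of_real ((1 + sz \<xi>) ^ (N + M)) * a \<xi>)) summable_on UNIV"
    using assms(1) unfolding rapid_def by (intro summable_on_cmult_right) blast
  then show "abs_summable (\<lambda>\<xi>. of_real ((1 + sz \<xi>) ^ N) * b \<xi>)"
  proof (rule summable_on_comparison_test)
    fix \<xi>
    have "norm (of_real ((1 + sz \<xi>) ^ N) * b \<xi>) = (1 + sz \<xi>) ^ N * norm (b \<xi>)"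
      by (rule norm_sz_mult)
    also have "\<dots> \<le> (1 + sz \<xi>) ^ N * (C * (1 + sz \<xi>) ^ M * norm (a \<xi>))"
      by (intro mult_left_mono assms) (simp add: add_nonneg_nonneg)
    also have "\<dots> = C * norm (of_real ((1 + sz \<xi>) ^ (N + M)) * a \<xi>)"
      unfolding norm_sz_mult by (simp only: power_add mult_ac)
    finally show "norm (of_real ((1 + sz \<xi>) ^ N) * b \<xi>) \<le> C * norm (of_real ((1 + sz \<xi>) ^ (N + M)) * a \<xi>)" .
  qed simp
qed

lemma rapid_exp:
  assumes \<kappa>: "\<kappa> > 0" and le: "\<And>\<xi>. norm (a \<xi>) \<le> B * exp (- \<kappa> * sz \<xi>)"
  shows "rapid a"
  unfolding rapid_def
proof
  fix N
  have "norm (a 0) \<le> B" using le[of 0] by (simp add: sz_def)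
  then have B: "B \<ge> 0" using norm_ge_zero order_trans by blast
  obtain C where C: "C > 0" "\<And>x. x \<ge> 0 \<Longrightarrow> (1 + x) ^ (N + 4) \<le> C * exp (\<kappa> * x)"
    using polynomial_le_exp[OF \<kappa>] by blast
  have "(\<lambda>\<xi>. B * C * (1 / (1 + 1 * sz \<xi>)\<^sup>2)\<^sup>2) summable_on UNIV"
    by (intro summable_on_cmult_right decay_summable) simp
  then show "abs_summable (\<lambda>\<xi>. of_real ((1 + sz \<xi>) ^ N) * a \<xi>)"
  proof (rule summable_on_comparison_test)
    fix \<xi>
    define x where "x = sz \<xi>"
    have x: "x \<ge> 0" by (simp add: x_def)
    have "(1 + x) ^ N * exp (- \<kappa> * x) \<le> C * (1 / (1 + x) ^ 4)"
    proof -
      have "(1 + x) ^ N * (1 + x) ^ 4 * exp (- \<kappa> * x) \<le> C * exp (\<kappa> * x) * exp (- \<kappa> * x)"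
        using C(2)[OF x] by (intro mult_right_mono) (simp_all add: power_add)
      then have "(1 + x) ^ N * exp (- \<kappa> * x) * (1 + x) ^ 4 \<le> C"
        by (simp add: mult.assoc mult_exp_exp) (simp add: mult_ac)
      moreover have "(1 + x) ^ 4 > 0" using x by simp
      ultimately show ?thesis by (simp add: pos_le_divide_eq)
    qed
    then have "B * ((1 + x) ^ N * exp (- \<kappa> * x)) \<le> B * (C * (1 / (1 + x) ^ 4))"
      using B by (intro mult_left_mono)
    moreover have "norm (of_real ((1 + x) ^ N) * a \<xi>) \<le> (1 + x) ^ N * (B * exp (- \<kappa> * x))"
      using le[of \<xi>] unfolding x_def norm_sz_mult by (intro mult_left_mono) (simp_all add: add_nonneg_nonneg)
    ultimately show "norm (of_real ((1 + sz \<xi>) ^ N) * a \<xi>) \<le> B * C * (1 / (1 + 1 * sz \<xi>)\<^sup>2)\<^sup>2"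
      by (simp add: x_def power_divide mult_ac)
  qed simp
qed

context wave
begin

definition emb :: "freq \<Rightarrow> int \<times> int" where
  "emb \<xi> = (int k * fst \<xi>, snd \<xi>)"

text \<open>Moves the centre of the expansion to \<open>pi / (2 * k)\<close> in the first variable:
  \<open>ek \<xi>\<close> is this constant times the Fourier character of
  \<open>emb \<xi>\<close>.\<close>

definition phase :: "freq \<Rightarrow> complex" where
  "phase \<xi> = cis (- (pi / 2) * of_int (fst \<xi>))"

definition lift :: "(freq \<Rightarrow> complex) \<Rightarrow> int \<times> int \<Rightarrow> complex" where
  "lift a \<xi> = (if int k dvd fst \<xi> then phase (fst \<xi> div int k, snd \<xi>) * a (fst \<xi> div int k, snd \<xi>) else 0)"

text \<open>Fourier series on the lattice \<open>(k\<int>) \<times> \<int>\<close>, centred at \<open>x\<^sub>1 = \<pi>/(2k)\<close>, where the reflection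
  symmetries of \<open>X_sym\<close> become parities of the coefficients.\<close>

definition TS :: "(freq \<Rightarrow> complex) \<Rightarrow> scalar" where
  "TS a = trig (lift a)"

definition ek :: "freq \<Rightarrow> scalar" where
  "ek \<xi> x = cis (of_int (fst \<xi>) * (real k * fst x - pi / 2) + of_int (snd \<xi>) * snd x)"

lemma inj_emb: "inj emb"
  using k by (auto simp: inj_def emb_def prod_eq_iff)

lemma lift_emb: "lift a (emb \<xi>) = phase \<xi> * a \<xi>"
  using k by (simp add: lift_def emb_def phase_def)

lemma lift_outside: "\<xi> \<notin> range emb \<Longrightarrow> lift a \<xi> = 0"
proof (rule ccontr)
  assume "\<xi> \<notin> range emb" "lift a \<xi> \<noteq> 0"
  then have "int k dvd fst \<xi>" by (auto simp: lift_def split: if_splits)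
  then have "\<xi> = emb (fst \<xi> div int k, snd \<xi>)" by (simp add: emb_def prod_eq_iff)
  then show False using \<open>\<xi> \<notin> range emb\<close> by blast
qed

lemma norm_phase [simp]: "norm (phase \<xi>) = 1" "phase \<xi> \<noteq> 0"
  by (auto simp: phase_def cis_neq_zero)

lemma emb_has_sum:
  assumes "\<And>\<xi>. \<xi> \<notin> range emb \<Longrightarrow> F \<xi> = 0"
  shows "(F has_sum S) UNIV \<longleftrightarrow> ((\<lambda>\<xi>. F (emb \<xi>)) has_sum S) UNIV"
proof -
  have "(F has_sum S) UNIV \<longleftrightarrow> (F has_sum S) (range emb)"
    by (rule has_sum_cong_neutral) (use assms in auto)
  also have "\<dots> \<longleftrightarrow> ((F \<circ> emb) has_sum S) UNIV"
    by (rule has_sum_reindex[OF inj_emb])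
  finally show ?thesis by (simp add: o_def)
qed

lemma emb_summable:
  assumes "\<And>\<xi>. \<xi> \<notin> range emb \<Longrightarrow> F \<xi> = 0"
  shows "F summable_on UNIV \<longleftrightarrow> (\<lambda>\<xi>. F (emb \<xi>)) summable_on UNIV"
  by (simp add: summable_on_def emb_has_sum[of F, OF assms])

lemma emb_infsum:
  fixes F :: "int \<times> int \<Rightarrow> 'a::{topological_comm_monoid_add, t2_space}"
  assumes "\<And>\<xi>. \<xi> \<notin> range emb \<Longrightarrow> F \<xi> = 0"
  shows "infsum F UNIV = (\<Sum>\<^sub>\<infinity>\<xi>. F (emb \<xi>))"
  using emb_has_sum[of F, OF assms] emb_summable[of F, OF assms]
  by (metis has_sum_infsum infsumI infsum_not_exists)

lemma abs_summable_lift_iff: "abs_summable (lift a) \<longleftrightarrow> abs_summable a"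
  by (subst emb_summable) (auto simp: lift_outside lift_emb norm_mult)

lemmas abs_summable_lift = abs_summable_lift_iff[THEN iffD2]

lemma ek_emb: "phase \<xi> * fourier_char (emb \<xi>) x = ek \<xi> x"
  by (simp add: phase_def fourier_char_def emb_def ek_def cis_mult algebra_simps)

lemma ek_simps: "norm (ek \<xi> x) = 1" "ek (\<xi> + \<eta>) x = ek \<xi> x * ek \<eta> x" "cnj (ek \<xi> x) = ek (- \<xi>) x"
  "ek \<xi> (x1 + 2*pi / real k, y) = ek \<xi> (x1, y)" "ek (m, n) (pi / real k - x1, y) = ek (- m, n) (x1, y)"
  "ek (m, n) (x1, - y) = ek (m, - n) (x1, y)"
proof -
  show "norm (ek \<xi> x) = 1" "ek (\<xi> + \<eta>) x = ek \<xi> x * ek \<eta> x" "cnj (ek \<xi> x) = ek (- \<xi>) x"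
    by (simp_all add: ek_def cis_mult cis_cnj algebra_simps)
  have k0: "real k \<noteq> 0" using k by simp
  have "ek \<xi> (x1 + 2*pi / real k, y) = ek \<xi> (x1, y) * cis (2 * pi * of_int (fst \<xi>))"
    using k0 by (simp add: ek_def cis_mult algebra_simps)
  then show "ek \<xi> (x1 + 2*pi / real k, y) = ek \<xi> (x1, y)" by (simp add: cis_multiple_2pi)
  have "real k * (pi / real k - x1) - pi / 2 = - (real k * x1 - pi / 2)"
    using k0 by (simp add: algebra_simps)
  then show "ek (m, n) (pi / real k - x1, y) = ek (- m, n) (x1, y)"
    unfolding ek_def fst_conv snd_conv by (simp add: algebra_simps)
  show "ek (m, n) (x1, - y) = ek (m, - n) (x1, y)" by (simp add: ek_def)
qed

lemma TS_infsum: "TS a x = (\<Sum>\<^sub>\<infinity>\<xi>. a \<xi> * ek \<xi> x)"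
  unfolding TS_def trig_def
  by (subst emb_infsum) (auto simp: lift_outside lift_emb ek_emb[symmetric] mult_ac intro!: infsum_cong)

lemma TS_has_sum: "abs_summable a \<Longrightarrow> ((\<lambda>\<xi>. a \<xi> * ek \<xi> x) has_sum TS a x) UNIV"
  unfolding TS_infsum by (intro has_sum_infsum abs_summable_product_bounded) (auto simp: ek_simps)

lemma fourier_coeff_TS: "abs_summable a \<Longrightarrow> fourier_coeff (TS a) \<xi> = lift a \<xi>"
  unfolding TS_def by (rule trig_props(2)[OF abs_summable_lift])

lemma TS_multiplier: "abs_summable a \<Longrightarrow> multiplier \<mu> (TS a) = TS (\<lambda>\<xi>. \<mu> (emb \<xi>) * a \<xi>)"
  unfolding TS_def trig_multiplier[OF abs_summable_lift]
  by (rule arg_cong[where f = trig]) (auto simp: lift_def emb_def fun_eq_iff)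

lemma TS_add: "abs_summable a \<Longrightarrow> abs_summable b \<Longrightarrow> TS (\<lambda>\<xi>. a \<xi> + b \<xi>) x = TS a x + TS b x"
  using has_sum_add[OF TS_has_sum TS_has_sum, of a b x x]
  by (auto simp: TS_infsum distrib_right intro: infsumI)

lemma TS_cmult: "TS (\<lambda>\<xi>. c * a \<xi>) x = c * TS a x"
  unfolding TS_infsum mult.assoc by (rule infsum_cmult_right')

lemma TS_diff: "abs_summable a \<Longrightarrow> abs_summable b \<Longrightarrow> TS (\<lambda>\<xi>. a \<xi> - b \<xi>) x = TS a x - TS b x"
  using has_sum_add[OF TS_has_sum has_sum_cmult_right[OF TS_has_sum, of b "- 1"], of a x x]
  by (auto simp: TS_infsum left_diff_distrib intro: infsumI)

lemma TS_product:
  assumes a: "abs_summable a" and b: "abs_summable b"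
  shows "\<And>\<zeta>. ((\<lambda>\<eta>. a \<eta> * b (\<zeta> - \<eta>)) has_sum (\<Sum>\<^sub>\<infinity>\<eta>. a \<eta> * b (\<zeta> - \<eta>))) UNIV"
    and "abs_summable (\<lambda>\<zeta>. \<Sum>\<^sub>\<infinity>\<eta>. a \<eta> * b (\<zeta> - \<eta>))"
    and "TS a x * TS b x = TS (\<lambda>\<zeta>. \<Sum>\<^sub>\<infinity>\<eta>. a \<eta> * b (\<zeta> - \<eta>)) x"
proof -
  define h where "h = (\<lambda>(\<zeta>, \<eta>). (\<eta>, \<zeta> - \<eta> :: freq))"
  have bij: "bij_betw h UNIV UNIV" by (rule bij_betwI[where g = "\<lambda>(\<eta>, \<xi>). (\<eta> + \<xi>, \<eta>)"]) (auto simp: h_def)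
  have "(\<lambda>p. norm (a (fst p)) * norm (b (snd p))) summable_on UNIV"
    by (rule summable_on_product_real) (use a b in auto)
  then have ns: "(\<lambda>p. norm (a (snd p)) * norm (b (fst p - snd p))) summable_on UNIV"
    using summable_on_reindex_bij_betw[OF bij, of "\<lambda>p. norm (a (fst p)) * norm (b (snd p))"]
    by (simp add: h_def split_beta)
  then have ns': "(\<lambda>p. norm (a (snd p) * b (fst p - snd p))) summable_on UNIV \<times> UNIV"
    by (simp add: norm_mult)
  have row: "(\<lambda>\<eta>. norm (a \<eta> * b (\<zeta> - \<eta>))) summable_on UNIV" for \<zeta>
    using summable_on_SigmaD1[of "\<lambda>\<zeta> \<eta>. norm (a \<eta> * b (\<zeta> - \<eta>))" UNIV "\<lambda>_. UNIV" \<zeta>] ns' by (simp add: split_beta')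
  show r: "((\<lambda>\<eta>. a \<eta> * b (\<zeta> - \<eta>)) has_sum (\<Sum>\<^sub>\<infinity>\<eta>. a \<eta> * b (\<zeta> - \<eta>))) UNIV" for \<zeta>
    by (rule has_sum_infsum[OF abs_summable_summable[OF row]])
  have "(\<lambda>\<zeta>. \<Sum>\<^sub>\<infinity>\<eta>. norm (a \<eta> * b (\<zeta> - \<eta>))) summable_on UNIV"
    using summable_on_Sigma_banach[of "\<lambda>\<zeta> \<eta>. norm (a \<eta> * b (\<zeta> - \<eta>))" UNIV "\<lambda>_. UNIV"] ns' by (simp add: split_beta')
  then show s: "abs_summable (\<lambda>\<zeta>. \<Sum>\<^sub>\<infinity>\<eta>. a \<eta> * b (\<zeta> - \<eta>))"
    by (rule summable_on_comparison_test) (auto intro!: norm_infsum_bound row)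
  define F where "F = (\<lambda>p. (a (fst p) * ek (fst p) x) * (b (snd p) * ek (snd p) x))"
  have "(\<lambda>p. norm (F p)) summable_on UNIV"
    unfolding F_def norm_mult ek_simps mult_1_right
    by (rule summable_on_product_real) (use a b in auto)
  then obtain S where S: "(F has_sum S) (UNIV \<times> UNIV)" using abs_summable_summable by (auto simp: summable_on_def)
  have "((\<lambda>\<eta>. (a \<eta> * ek \<eta> x) * TS b x) has_sum S) UNIV"
    by (rule has_sum_SigmaD[OF S]) (auto simp: F_def intro!: has_sum_cmult_right TS_has_sum b)
  then have S1: "S = TS a x * TS b x"
    using has_sum_cmult_left[OF TS_has_sum[OF a], of x "TS b x"] has_sum_unique by blast
  have Sh: "((\<lambda>p. F (h p)) has_sum S) (UNIV \<times> UNIV)"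
    using S has_sum_reindex_bij_betw[OF bij, of F] by simp
  have "((\<lambda>\<zeta>. (\<Sum>\<^sub>\<infinity>\<eta>. a \<eta> * b (\<zeta> - \<eta>)) * ek \<zeta> x) has_sum S) UNIV"
  proof (rule has_sum_SigmaD[OF Sh])
    fix \<zeta>
    have "F (h (\<zeta>, \<eta>)) = (a \<eta> * b (\<zeta> - \<eta>)) * ek \<zeta> x" for \<eta>
      using ek_simps(2)[of \<eta> "\<zeta> - \<eta>" x] by (simp add: F_def h_def)
    then show "((\<lambda>\<eta>. F (h (\<zeta>, \<eta>))) has_sum (\<Sum>\<^sub>\<infinity>\<eta>. a \<eta> * b (\<zeta> - \<eta>)) * ek \<zeta> x) UNIV"
      using has_sum_cmult_left[OF r] by simp
  qed
  then show "TS a x * TS b x = TS (\<lambda>\<zeta>. \<Sum>\<^sub>\<infinity>\<eta>. a \<eta> * b (\<zeta> - \<eta>)) x"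
    using has_sum_unique[OF _ TS_has_sum[OF s]] S1 by blast
qed

lemma sqnorm_emb: "sqnorm (emb \<xi>) = (rad \<xi>)\<^sup>2"
  by (simp add: sqnorm_def emb_def rad_def power_mult_distrib)

lemma emb_zero: "emb \<xi> = (0, 0) \<longleftrightarrow> rad \<xi> = 0"
proof -
  have "emb \<xi> = (0, 0) \<longleftrightarrow> sqnorm (emb \<xi>) = 0" by (auto simp: sqnorm_def emb_def sum_power2_eq_zero_iff prod_eq_iff)
  then show ?thesis by (simp add: sqnorm_emb)
qed

lemma TS_d:
  assumes "rapid a"
  shows "d1 (TS a) = TS (\<lambda>\<xi>. \<i> * of_real (real k * of_int (fst \<xi>)) * a \<xi>)"
    "d2 (TS a) = TS (\<lambda>\<xi>. \<i> * of_int (snd \<xi>) * a \<xi>)"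
    "rapid (\<lambda>\<xi>. \<i> * of_real (real k * of_int (fst \<xi>)) * a \<xi>)"
    "rapid (\<lambda>\<xi>. \<i> * of_int (snd \<xi>) * a \<xi>)"
proof -
  note a = rapid_summable[OF assms]
  show "d1 (TS a) = TS (\<lambda>\<xi>. \<i> * of_real (real k * of_int (fst \<xi>)) * a \<xi>)"
    "d2 (TS a) = TS (\<lambda>\<xi>. \<i> * of_int (snd \<xi>) * a \<xi>)"
    by (simp_all add: d1_def d2_def TS_multiplier[OF a] emb_def)
  show "rapid (\<lambda>\<xi>. \<i> * of_real (real k * of_int (fst \<xi>)) * a \<xi>)"
  proof (rule rapid_mono[OF assms, where C = "real k" and M = 1])
    show "norm (\<i> * of_real (real k * of_int (fst \<xi>)) * a \<xi>) \<le> real k * (1 + sz \<xi>) ^ 1 * norm (a \<xi>)" for \<xi>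
      by (simp add: norm_mult mult_right_mono mult_left_mono sz_def)
  qed
  show "rapid (\<lambda>\<xi>. \<i> * of_int (snd \<xi>) * a \<xi>)"
  proof (rule rapid_mono[OF assms, where C = 1 and M = 1])
    show "norm (\<i> * of_int (snd \<xi>) * a \<xi>) \<le> 1 * (1 + sz \<xi>) ^ 1 * norm (a \<xi>)" for \<xi>
      by (simp add: norm_mult mult_right_mono sz_def)
  qed
qed

text \<open>Each derivative brings a factor i, so the symbol of the advection bracket is real; with
  the sign from i^2 it is the cross product \<open>br\<close>.\<close>

lemma advect_TS:
  assumes p: "rapid p" and q: "rapid q"
  shows "((\<lambda>\<eta>. of_real (br \<eta> (\<zeta> - \<eta>)) * p \<eta> * q (\<zeta> - \<eta>)) has_sum
      (\<Sum>\<^sub>\<infinity>\<eta>. of_real (br \<eta> (\<zeta> - \<eta>)) * p \<eta> * q (\<zeta> - \<eta>))) UNIV"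
    and "abs_summable (\<lambda>\<zeta>. \<Sum>\<^sub>\<infinity>\<eta>. of_real (br \<eta> (\<zeta> - \<eta>)) * p \<eta> * q (\<zeta> - \<eta>))"
    and "advect (TS p) (TS q) x = TS (\<lambda>\<zeta>. \<Sum>\<^sub>\<infinity>\<eta>. of_real (br \<eta> (\<zeta> - \<eta>)) * p \<eta> * q (\<zeta> - \<eta>)) x"
proof -
  define p1 p2 q1 q2 where "p1 = (\<lambda>\<xi>. \<i> * of_real (real k * of_int (fst \<xi>)) * p \<xi>)"
    and "p2 = (\<lambda>\<xi>. \<i> * of_int (snd \<xi>) * p \<xi>)"
    and "q1 = (\<lambda>\<xi>. \<i> * of_real (real k * of_int (fst \<xi>)) * q \<xi>)"
    and "q2 = (\<lambda>\<xi>. \<i> * of_int (snd \<xi>) * q \<xi>)"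
  note defs = p1_def p2_def q1_def q2_def
  have s: "abs_summable p1" "abs_summable p2" "abs_summable q1" "abs_summable q2"
    unfolding defs by (rule rapid_summable TS_d(3,4) p q)+
  have d: "d1 (TS p) = TS p1" "d2 (TS p) = TS p2" "d1 (TS q) = TS q1" "d2 (TS q) = TS q2"
    unfolding defs by (rule TS_d(1,2) p q)+
  define u v where "u \<zeta> = (\<Sum>\<^sub>\<infinity>\<eta>. p2 \<eta> * q1 (\<zeta> - \<eta>))" and "v \<zeta> = (\<Sum>\<^sub>\<infinity>\<eta>. p1 \<eta> * q2 (\<zeta> - \<eta>))" for \<zeta>
  have U: "((\<lambda>\<eta>. p2 \<eta> * q1 (\<zeta> - \<eta>)) has_sum u \<zeta>) UNIV" "abs_summable u" "TS p2 x * TS q1 x = TS u x"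
    and V: "((\<lambda>\<eta>. p1 \<eta> * q2 (\<zeta> - \<eta>)) has_sum v \<zeta>) UNIV" "abs_summable v" "TS p1 x * TS q2 x = TS v x" for \<zeta> x
    unfolding u_def[abs_def] v_def[abs_def] by (rule TS_product s)+
  have eq: "p1 \<eta> * q2 \<xi> - p2 \<eta> * q1 \<xi> = of_real (br \<eta> \<xi>) * p \<eta> * q \<xi>" for \<eta> \<xi>
    unfolding defs br_def by (simp add: algebra_simps)
  have hs: "((\<lambda>\<eta>. of_real (br \<eta> (\<zeta> - \<eta>)) * p \<eta> * q (\<zeta> - \<eta>)) has_sum (v \<zeta> - u \<zeta>)) UNIV" for \<zeta>
    using has_sum_add[OF V(1)[of \<zeta>] has_sum_cmult_right[OF U(1)[of \<zeta>], of "- 1"]]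
    by (simp add: eq)
  have J: "(\<Sum>\<^sub>\<infinity>\<eta>. of_real (br \<eta> (\<zeta> - \<eta>)) * p \<eta> * q (\<zeta> - \<eta>)) = v \<zeta> - u \<zeta>" for \<zeta>
    by (rule infsumI[OF hs])
  show "((\<lambda>\<eta>. of_real (br \<eta> (\<zeta> - \<eta>)) * p \<eta> * q (\<zeta> - \<eta>)) has_sum
      (\<Sum>\<^sub>\<infinity>\<eta>. of_real (br \<eta> (\<zeta> - \<eta>)) * p \<eta> * q (\<zeta> - \<eta>))) UNIV"
    unfolding J by (rule hs)
  have "(\<lambda>\<zeta>. norm (v \<zeta>) + norm (u \<zeta>)) summable_on UNIV"
    by (intro summable_on_add U(2) V(2))
  then show "abs_summable (\<lambda>\<zeta>. \<Sum>\<^sub>\<infinity>\<eta>. of_real (br \<eta> (\<zeta> - \<eta>)) * p \<eta> * q (\<zeta> - \<eta>))"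
    unfolding J by (rule summable_on_comparison_test) (auto intro: norm_triangle_ineq4)
  show "advect (TS p) (TS q) x = TS (\<lambda>\<zeta>. \<Sum>\<^sub>\<infinity>\<eta>. of_real (br \<eta> (\<zeta> - \<eta>)) * p \<eta> * q (\<zeta> - \<eta>)) x"
    unfolding J advect_def d by (simp add: U(3) V(3) TS_diff[OF V(2) U(2)])
qed

text \<open>In the centred variable - cos(k x1) is a sine, a difference of two shifts divided by 2i.
  The i of the derivative cancels this one, so the linear operator has real coefficients.\<close>

lemma cos_TS:
  assumes "abs_summable a"
  shows "- (real k * cos (real k * fst x)) *\<^sub>R TS a x =
     TS (\<lambda>\<xi>. of_real (real k / 2) * (a (sh (- 1) \<xi>) - a (sh 1 \<xi>)) / \<i>) x"
    and "abs_summable (\<lambda>\<xi>. of_real (real k / 2) * (a (sh (- 1) \<xi>) - a (sh 1 \<xi>)) / \<i>)"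
proof -
  define c where "c = of_real (real k / 2) / \<i>"
  have bij: "bij_betw (sh s) UNIV UNIV" for s using bij_sh by simp
  have sm: "abs_summable (\<lambda>\<xi>. a (sh s \<xi>))" for s
    using summable_on_reindex_bij_betw[OF bij, of "\<lambda>\<xi>. norm (a \<xi>)"] assms by simp
  have shift: "TS (\<lambda>\<xi>. a (sh s \<xi>)) x = ek (- s, 0) x * TS a x" for s
  proof -
    have e: "ek \<xi> x = ek (- s, 0) x * ek (sh s \<xi>) x" for \<xi>
      using ek_simps(2)[of "(- s, 0)" "sh s \<xi>" x] by (simp add: sh_def)
    have "TS (\<lambda>\<xi>. a (sh s \<xi>)) x = (\<Sum>\<^sub>\<infinity>\<xi>. ek (- s, 0) x * (a (sh s \<xi>) * ek (sh s \<xi>) x))"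
      unfolding TS_infsum by (rule infsum_cong) (subst e, simp)
    also have "\<dots> = ek (- s, 0) x * (\<Sum>\<^sub>\<infinity>\<xi>. a (sh s \<xi>) * ek (sh s \<xi>) x)" by (rule infsum_cmult_right')
    also have "(\<Sum>\<^sub>\<infinity>\<xi>. a (sh s \<xi>) * ek (sh s \<xi>) x) = TS a x"
      unfolding TS_infsum by (rule infsum_reindex_bij_betw[OF bij])
    finally show ?thesis .
  qed
  have ceq: "of_real (real k / 2) * (a (sh (- 1) \<xi>) - a (sh 1 \<xi>)) / \<i> = c * (a (sh (- 1) \<xi>) - a (sh 1 \<xi>))" for \<xi>
    by (simp add: c_def)
  have "TS (\<lambda>\<xi>. c * (a (sh (- 1) \<xi>) - a (sh 1 \<xi>))) x = c * (TS (\<lambda>\<xi>. a (sh (- 1) \<xi>)) x - TS (\<lambda>\<xi>. a (sh 1 \<xi>)) x)"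
    unfolding TS_cmult TS_diff[OF sm sm] ..
  also have "\<dots> = c * (ek (1, 0) x - ek (- 1, 0) x) * TS a x"
    unfolding shift by (simp add: algebra_simps)
  also have "c * (ek (1, 0) x - ek (- 1, 0) x) = - of_real (real k * cos (real k * fst x))"
  proof -
    have "cos (real k * fst x - pi / 2) = sin (real k * fst x)" "sin (real k * fst x - pi / 2) = - cos (real k * fst x)"
      by (simp_all add: cos_diff sin_diff)
    then show ?thesis
      by (simp add: c_def ek_def complex_eq_iff cos_minus[of "real k * fst x - pi / 2", symmetric])
         (simp add: cos_diff sin_diff cos_add sin_add)
  qed
  finally show "- (real k * cos (real k * fst x)) *\<^sub>R TS a x =
     TS (\<lambda>\<xi>. of_real (real k / 2) * (a (sh (- 1) \<xi>) - a (sh 1 \<xi>)) / \<i>) x"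
    unfolding ceq by (simp add: scaleR_conv_of_real)
  have "(\<lambda>\<xi>. norm c * (norm (a (sh (- 1) \<xi>)) + norm (a (sh 1 \<xi>)))) summable_on UNIV"
    by (intro summable_on_cmult_right summable_on_add sm)
  then show "abs_summable (\<lambda>\<xi>. of_real (real k / 2) * (a (sh (- 1) \<xi>) - a (sh 1 \<xi>)) / \<i>)"
    unfolding ceq by (rule summable_on_comparison_test)
       (auto simp: norm_mult norm_triangle_ineq4 intro!: mult_left_mono)
qed

end

section \<open>States given by Fourier coefficients\<close>

context wave
begin

definition RS :: "(freq \<Rightarrow> real) \<Rightarrow> (freq \<Rightarrow> real) \<Rightarrow> state" where
  "RS f g x = (TS (\<lambda>\<xi>. of_real (rad \<xi> * g \<xi>)) x, TS (\<lambda>\<xi>. of_real (f \<xi>)) x)"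

lemma vort_RS: "vort (RS f g) = TS (\<lambda>\<xi>. of_real (rad \<xi> * g \<xi>))"
  and flux_RS: "flux (RS f g) = TS (\<lambda>\<xi>. of_real (f \<xi>))"
  by (simp_all add: vort_def flux_def RS_def)

lemma rad_zero_or_ge1: "rad \<xi> = 0 \<or> 1 \<le> rad \<xi>"
proof (cases "fst \<xi> = 0 \<and> snd \<xi> = 0")
  case True
  then show ?thesis by (simp add: rad_def)
next
  case False
  have "1 \<le> rad \<xi>"
  proof (cases "snd \<xi> = 0")
    case True
    then have "1 \<le> \<bar>real_of_int (fst \<xi>)\<bar>" using False by linarith
    moreover have "1 \<le> real k" using k by simp
    ultimately have "1 * 1 \<le> real k * \<bar>real_of_int (fst \<xi>)\<bar>" by (intro mult_mono) auto
    then show ?thesis using rad_ge(2)[of \<xi>] by linarith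
  next
    case False
    then have "1 \<le> \<bar>real_of_int (snd \<xi>)\<bar>" by linarith
    then show ?thesis using rad_ge(1)[of \<xi>] by linarith
  qed
  then show ?thesis ..
qed

lemma rad_eq_0D: "rad \<xi> = 0 \<Longrightarrow> \<xi> = 0"
  using emb_zero[of \<xi>] k by (auto simp: emb_def prod_eq_iff)

lemma rapid_rad:
  assumes "rapid (\<lambda>\<xi>. of_real (g \<xi>))"
  shows "rapid (\<lambda>\<xi>. of_real (rad \<xi> * g \<xi>))" "rapid (\<lambda>\<xi>. of_real (- (g \<xi> / rad \<xi>)))"
    "rapid (\<lambda>\<xi>. of_real (g \<xi> / (1 + (rad \<xi>)\<^sup>2)))" "rapid (\<lambda>\<xi>. of_real (asym \<xi> * g \<xi>))"
proof -
  have k1: "1 \<le> real k" using k by simp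
  have r: "rad \<xi> \<le> real k * (1 + sz \<xi>)" for \<xi>
    using rad_le[of \<xi>] by (simp add: distrib_left)
  show "rapid (\<lambda>\<xi>. of_real (rad \<xi> * g \<xi>))"
    by (rule rapid_mono[OF assms, where C = "real k" and M = 1])
       (use r in \<open>simp add: norm_mult mult_right_mono\<close>)
  have div: "\<bar>y / z\<bar> \<le> \<bar>y\<bar>" if "z = 0 \<or> 1 \<le> z" for y z :: real
  proof (cases "z = 0")
    case False
    then have "\<bar>y\<bar> / z \<le> \<bar>y\<bar> / 1" using that by (intro divide_left_mono) auto
    then show ?thesis using that False by simp
  qed simp
  have "\<bar>g \<xi> / rad \<xi>\<bar> \<le> \<bar>g \<xi>\<bar>" for \<xi>
    by (rule div[OF rad_zero_or_ge1])
  then show "rapid (\<lambda>\<xi>. of_real (- (g \<xi> / rad \<xi>)))"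
    by (intro rapid_mono[OF assms, where C = 1 and M = 0]) (simp only: norm_of_real, simp)
  have "\<bar>g \<xi> / (1 + (rad \<xi>)\<^sup>2)\<bar> \<le> \<bar>g \<xi>\<bar>" for \<xi>
    by (rule div) simp
  then show "rapid (\<lambda>\<xi>. of_real (g \<xi> / (1 + (rad \<xi>)\<^sup>2)))"
    by (intro rapid_mono[OF assms, where C = 1 and M = 0]) (simp only: norm_of_real, simp)
  have "\<bar>asym \<xi> * g \<xi>\<bar> \<le> cc * \<bar>g \<xi>\<bar>" for \<xi>
    using asym_bound by (simp add: abs_mult mult_right_mono)
  then show "rapid (\<lambda>\<xi>. of_real (asym \<xi> * g \<xi>))"
    by (intro rapid_mono[OF assms, where C = cc and M = 0]) (simp only: norm_of_real, simp)
qed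

lemma stream_RS: "rapid (\<lambda>\<xi>. of_real (g \<xi>)) \<Longrightarrow> stream (RS f g) = TS (\<lambda>\<xi>. of_real (- (g \<xi> / rad \<xi>)))"
  unfolding stream_def vort_RS inv_laplace_def
  by (subst TS_multiplier[OF rapid_summable[OF rapid_rad(1)]])
     (auto simp: emb_zero sqnorm_emb power2_eq_square intro!: arg_cong[where f = TS])

lemma potential_RS: "rapid (\<lambda>\<xi>. of_real (f \<xi>)) \<Longrightarrow> potential (RS f g) = TS (\<lambda>\<xi>. of_real (f \<xi> / (1 + (rad \<xi>)\<^sup>2)))"
  unfolding potential_def flux_RS inv_one_minus_laplace_def
  by (subst TS_multiplier[OF rapid_summable])
     (auto simp: sqnorm_emb intro!: arg_cong[where f = TS])

lemma A_op_TS: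
  assumes f: "rapid (\<lambda>\<xi>. of_real (f \<xi>))"
  shows "A_op k (TS (\<lambda>\<xi>. of_real (f \<xi>))) = TS (\<lambda>\<xi>. of_real (asym \<xi> * f \<xi>))"
proof
  fix x
  have i: "inv_one_minus_laplace (TS (\<lambda>\<xi>. of_real (f \<xi>))) = TS (\<lambda>\<xi>. of_real (f \<xi> / (1 + (rad \<xi>)\<^sup>2)))"
    using potential_RS[OF f] by (simp add: potential_def flux_RS)
  have s: "abs_summable (\<lambda>\<xi>. of_real cc * complex_of_real (f \<xi> / (1 + (rad \<xi>)\<^sup>2)))"
    unfolding norm_mult by (intro summable_on_cmult_right rapid_summable[OF rapid_rad(3)[OF f]])
  have "A_op k (TS (\<lambda>\<xi>. of_real (f \<xi>))) x =
      TS (\<lambda>\<xi>. of_real (f \<xi>) - of_real cc * of_real (f \<xi> / (1 + (rad \<xi>)\<^sup>2))) x"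
    unfolding TS_diff[OF rapid_summable[OF f] s] TS_cmult by (simp add: A_op_def i cc_def)
  also have "(\<lambda>\<xi>. complex_of_real (f \<xi>) - of_real cc * of_real (f \<xi> / (1 + (rad \<xi>)\<^sup>2))) = (\<lambda>\<xi>. of_real (asym \<xi> * f \<xi>))"
    by (auto simp: asym_def left_diff_distrib)
  finally show "A_op k (TS (\<lambda>\<xi>. of_real (f \<xi>))) x = TS (\<lambda>\<xi>. of_real (asym \<xi> * f \<xi>)) x" .
qed

lemma cos_d2_TS:
  assumes f: "rapid (\<lambda>\<xi>. of_real (f \<xi>))"
  shows "- (real k * cos (real k * fst x)) *\<^sub>R d2 (TS (\<lambda>\<xi>. of_real (f \<xi>))) x =
     TS (\<lambda>\<xi>. of_real (real k / 2 * of_int (snd \<xi>) * (f (sh (- 1) \<xi>) - f (sh 1 \<xi>)))) x"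
    "abs_summable (\<lambda>\<xi>. complex_of_real (real k / 2 * of_int (snd \<xi>) * (f (sh (- 1) \<xi>) - f (sh 1 \<xi>))))"
proof -
  have eq: "of_real (real k / 2) * (\<i> * of_int (snd (sh (- 1) \<xi>)) * of_real (f (sh (- 1) \<xi>)) -
      \<i> * of_int (snd (sh 1 \<xi>)) * of_real (f (sh 1 \<xi>))) / \<i> =
    complex_of_real (real k / 2 * of_int (snd \<xi>) * (f (sh (- 1) \<xi>) - f (sh 1 \<xi>)))" for \<xi>
    by (simp add: algebra_simps add_divide_distrib diff_divide_distrib)
  show "- (real k * cos (real k * fst x)) *\<^sub>R d2 (TS (\<lambda>\<xi>. of_real (f \<xi>))) x =
     TS (\<lambda>\<xi>. of_real (real k / 2 * of_int (snd \<xi>) * (f (sh (- 1) \<xi>) - f (sh 1 \<xi>)))) x"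
    "abs_summable (\<lambda>\<xi>. complex_of_real (real k / 2 * of_int (snd \<xi>) * (f (sh (- 1) \<xi>) - f (sh 1 \<xi>))))"
    unfolding TS_d(2)[OF f]
    using cos_TS(1)[OF rapid_summable[OF TS_d(4)[OF f]], of x] cos_TS(2)[OF rapid_summable[OF TS_d(4)[OF f]]]
    unfolding eq by auto
qed

definition linF :: "(freq \<Rightarrow> real) \<Rightarrow> freq \<Rightarrow> real" where
  "linF g \<xi> = cc * (real k * of_int (snd \<xi>) / 2 * (g (sh (- 1) \<xi>) / rad (sh (- 1) \<xi>) - g (sh 1 \<xi>) / rad (sh 1 \<xi>)))"

definition linG :: "(freq \<Rightarrow> real) \<Rightarrow> freq \<Rightarrow> real" where
  "linG f \<xi> = real k * of_int (snd \<xi>) / 2 / rad \<xi> * (asym (sh (- 1) \<xi>) * f (sh (- 1) \<xi>) - asym (sh 1 \<xi>) * f (sh 1 \<xi>))"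

lemma lin_op_RS:
  assumes f: "rapid (\<lambda>\<xi>. of_real (f \<xi>))" and g: "rapid (\<lambda>\<xi>. of_real (g \<xi>))"
  shows "lin_op k (RS f g) x = RS (linF g) (linG f) x"
    and "abs_summable (\<lambda>\<xi>. complex_of_real (rad \<xi> * linG f \<xi>))" "abs_summable (\<lambda>\<xi>. complex_of_real (linF g \<xi>))"
proof -
  have G: "(\<lambda>\<xi>. complex_of_real (real k / 2 * of_int (snd \<xi>) * (asym (sh (- 1) \<xi>) * f (sh (- 1) \<xi>) - asym (sh 1 \<xi>) * f (sh 1 \<xi>)))) =
      (\<lambda>\<xi>. of_real (rad \<xi> * linG f \<xi>))"
  proof
    fix \<xi>
    \<comment> \<open>At the zero frequency \<open>linG\<close> is 0 by division, and the left side
      vanishes with the second index.\<close>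
    have "rad \<xi> = 0 \<Longrightarrow> snd \<xi> = 0" using rad_eq_0D[of \<xi>] by simp
    then show "complex_of_real (real k / 2 * of_int (snd \<xi>) * (asym (sh (- 1) \<xi>) * f (sh (- 1) \<xi>) - asym (sh 1 \<xi>) * f (sh 1 \<xi>))) =
      of_real (rad \<xi> * linG f \<xi>)"
      by (cases "rad \<xi> = 0") (auto simp: linG_def)
  qed
  note cg = cos_d2_TS[OF rapid_rad(4)[OF f], unfolded G]
  have B: "B_op k (vort (RS f g)) = TS (\<lambda>\<xi>. of_real (cc * g \<xi> / rad \<xi>))"
  proof
    fix x
    have "inv_laplace (vort (RS f g)) = TS (\<lambda>\<xi>. of_real (- (g \<xi> / rad \<xi>)))"
      using stream_RS[OF g, of f] by (simp add: stream_def)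
    then have "B_op k (vort (RS f g)) x = TS (\<lambda>\<xi>. - of_real cc * of_real (- (g \<xi> / rad \<xi>))) x"
      unfolding TS_cmult by (simp add: B_op_def cc_def)
    then show "B_op k (vort (RS f g)) x = TS (\<lambda>\<xi>. of_real (cc * g \<xi> / rad \<xi>)) x" by simp
  qed
  have gr: "rapid (\<lambda>\<xi>. of_real (cc * g \<xi> / rad \<xi>))"
    by (rule rapid_mono[OF rapid_rad(2)[OF g], where C = cc and M = 0])
       (use cc_ge in \<open>simp add: norm_mult norm_divide\<close>)
  have F: "(\<lambda>\<xi>. complex_of_real (real k / 2 * of_int (snd \<xi>) * (cc * g (sh (- 1) \<xi>) / rad (sh (- 1) \<xi>) - cc * g (sh 1 \<xi>) / rad (sh 1 \<xi>)))) =
      (\<lambda>\<xi>. of_real (linF g \<xi>))"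
    by (rule ext) (simp add: linF_def right_diff_distrib mult_ac)
  note cf = cos_d2_TS[OF gr, unfolded F]
  show "lin_op k (RS f g) x = RS (linF g) (linG f) x"
    unfolding lin_op_def B flux_RS A_op_TS[OF f] scaleR_Pair cg(1) cf(1) RS_def ..
  show "abs_summable (\<lambda>\<xi>. complex_of_real (rad \<xi> * linG f \<xi>))" using cos_d2_TS(2)[OF rapid_rad(4)[OF f]] unfolding fun_cong[OF G] .
  show "abs_summable (\<lambda>\<xi>. complex_of_real (linF g \<xi>))" using cos_d2_TS(2)[OF gr] unfolding fun_cong[OF F] .
qed

text \<open>The stream function has coefficients \<open>- (g \<xi> / rad \<xi>)\<close>; together
  with the minus of the quadratic term this gives \<open>kF\<close> and \<open>kG\<close> a plus
  sign and \<open>kH\<close> a minus sign.\<close>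

lemma perturbation_rhs_RS:
  assumes f: "rapid (\<lambda>\<xi>. of_real (f \<xi>))" and g: "rapid (\<lambda>\<xi>. of_real (g \<xi>))"
    and hF: "\<And>\<zeta>. ((\<lambda>\<eta>. kF \<eta> (\<zeta> - \<eta>) * g \<eta> * f (\<zeta> - \<eta>)) has_sum NF \<zeta>) UNIV"
    and hG: "\<And>\<zeta>. ((\<lambda>\<eta>. kG \<eta> (\<zeta> - \<eta>) * g \<eta> * g (\<zeta> - \<eta>) - kH \<eta> (\<zeta> - \<eta>) * f \<eta> * f (\<zeta> - \<eta>)) has_sum NG \<zeta>) UNIV"
  shows "perturbation_rhs k (RS f g) x =
    RS (\<lambda>\<xi>. linF g \<xi> + NF \<xi>) (\<lambda>\<xi>. linG f \<xi> + NG \<xi>) x"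
proof -
  note lin = lin_op_RS[OF f g]
  define p where "p = (\<lambda>\<xi>. complex_of_real (- (g \<xi> / rad \<xi>)))"
  define q where "q = (\<lambda>\<xi>. complex_of_real (f \<xi> / (1 + (rad \<xi>)\<^sup>2)))"
  define w where "w = (\<lambda>\<xi>. complex_of_real (rad \<xi> * g \<xi>))"
  define h where "h = (\<lambda>\<xi>. complex_of_real (f \<xi>))"
  have r: "rapid p" "rapid q" "rapid w" "rapid h"
    unfolding p_def q_def w_def h_def by (rule rapid_rad f g)+
  define J where "J a b \<zeta> = (\<Sum>\<^sub>\<infinity>\<eta>. of_real (br \<eta> (\<zeta> - \<eta>)) * a \<eta> * b (\<zeta> - \<eta>))" for a b :: "freq \<Rightarrow> complex" and \<zeta> :: freq
  have J: "((\<lambda>\<eta>. of_real (br \<eta> (\<zeta> - \<eta>)) * a \<eta> * b (\<zeta> - \<eta>)) has_sum J a b \<zeta>) UNIV"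
    "abs_summable (J a b)" "advect (TS a) (TS b) x = TS (J a b) x" if "rapid a" "rapid b" for a b \<zeta> x
    unfolding J_def[abs_def] by (rule advect_TS that)+
  have JF: "J p h \<zeta> = - of_real (NF \<zeta>)" for \<zeta>
  proof -
    have e: "of_real (br \<eta> \<xi>) * p \<eta> * h \<xi> = - 1 * of_real (kF \<eta> \<xi> * g \<eta> * f \<xi>)" for \<eta> \<xi>
      by (simp add: p_def h_def kF_def)
    have "J p h \<zeta> = - 1 * of_real (NF \<zeta>)"
      by (rule has_sum_unique[OF J(1)[OF r(1,4), of \<zeta>, unfolded e] has_sum_cmult_right[OF has_sum_of_real[OF hF]]])
    then show ?thesis by simp
  qed
  have JG: "J p w \<zeta> + J q h \<zeta> = - of_real (rad \<zeta> * NG \<zeta>)" for \<zeta>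
  proof -
    have e: "of_real (br \<eta> (\<zeta> - \<eta>)) * p \<eta> * w (\<zeta> - \<eta>) + of_real (br \<eta> (\<zeta> - \<eta>)) * q \<eta> * h (\<zeta> - \<eta>) =
       - of_real (rad \<zeta>) * of_real (kG \<eta> (\<zeta> - \<eta>) * g \<eta> * g (\<zeta> - \<eta>) - kH \<eta> (\<zeta> - \<eta>) * f \<eta> * f (\<zeta> - \<eta>))" for \<eta>
    proof (cases "rad \<zeta> = 0")
      \<comment> \<open>At the zero frequency the right side is 0 and the bracket of opposite wave
        vectors vanishes: the nonlinearity preserves mean zero.\<close>
      case True
      then have "br \<eta> (\<zeta> - \<eta>) = 0" using br_add[of \<eta> "\<zeta> - \<eta>"] rad_eq_0D[of \<zeta>] by (simp add: br_def)
      then show ?thesis using True by simp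
    next
      case False
      have "1 + (rad \<eta>)\<^sup>2 \<noteq> 0" using zero_le_power2[of "rad \<eta>"] by linarith
      then have "br \<eta> (\<zeta> - \<eta>) * - (g \<eta> / rad \<eta>) * (rad (\<zeta> - \<eta>) * g (\<zeta> - \<eta>)) +
          br \<eta> (\<zeta> - \<eta>) * (f \<eta> / (1 + (rad \<eta>)\<^sup>2)) * f (\<zeta> - \<eta>) =
        - rad \<zeta> * (kG \<eta> (\<zeta> - \<eta>) * g \<eta> * g (\<zeta> - \<eta>) - kH \<eta> (\<zeta> - \<eta>) * f \<eta> * f (\<zeta> - \<eta>))"
        using False by (simp add: kG_def kH_def right_diff_distrib)
      from arg_cong[OF this, of complex_of_real] show ?thesis
        by (simp only: p_def q_def w_def h_def of_real_add of_real_mult of_real_minus)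
    qed
    have "J p w \<zeta> + J q h \<zeta> = - complex_of_real (rad \<zeta>) * of_real (NG \<zeta>)"
      by (rule has_sum_unique[OF has_sum_add[OF J(1)[OF r(1,3), of \<zeta>] J(1)[OF r(2,4), of \<zeta>], unfolded e]
            has_sum_cmult_right[OF has_sum_of_real[OF hG]]])
    then show ?thesis by simp
  qed
  have bil: "bilin (RS f g) (RS f g) x = (- (TS (J p w) x + TS (J q h) x), - TS (J p h) x)"
    unfolding bilin_def stream_RS[OF g] potential_RS[OF f] vort_RS flux_RS
      p_def[symmetric] q_def[symmetric] w_def[symmetric] h_def[symmetric]
      J(3)[OF r(1,3)] J(3)[OF r(2,4)] J(3)[OF r(1,4)]
    by (simp add: scaleR_conv_of_real algebra_simps)
  have sJ: "abs_summable (\<lambda>\<xi>. J p w \<xi> + J q h \<xi>)"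
    by (rule summable_on_comparison_test[OF summable_on_add[OF J(2)[OF r(1,3)] J(2)[OF r(2,4)]]])
       (auto intro: norm_triangle_ineq)
  show ?thesis
    unfolding perturbation_rhs_def bil lin(1) RS_def of_real_add distrib_left
    using TS_diff[OF lin(2) sJ, of x] TS_diff[OF lin(3) J(2)[OF r(1,4)], of x] TS_add[OF J(2)[OF r(1,3)] J(2)[OF r(2,4)], of x]
    unfolding JG ext[of "J p h", OF JF] by simp
qed

text \<open>Elements of the Hilbert space store Fourier coefficients multiplied by the weight \<open>ew \<kappa>\<close>.\<close>

definition St :: "real \<Rightarrow> freq ell2 \<times> freq ell2 \<Rightarrow> state" where
  "St \<kappa> u = RS (\<lambda>\<xi>. coord (fst u) \<xi> / ew \<kappa> \<xi>) (\<lambda>\<xi>. coord (snd u) \<xi> / ew \<kappa> \<xi>)"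

context
  fixes \<kappa> :: real
  assumes \<kappa>: "\<kappa> > 0"
begin

lemma rapid_coord: "rapid (\<lambda>\<xi>. of_real (coord y \<xi> / ew \<kappa> \<xi>))"
proof (rule rapid_exp[OF \<kappa>, where B = "norm y"])
  show "norm (complex_of_real (coord y \<xi> / ew \<kappa> \<xi>)) \<le> norm y * exp (- \<kappa> * sz \<xi>)" for \<xi>
    using abs_coord_le[of y \<xi>] unfolding norm_of_real
    by (simp add: ew_def exp_minus divide_inverse mult_right_mono abs_mult)
qed

lemmas rapid_u = rapid_coord rapid_rad(1)[OF rapid_coord]

text \<open>Dividing by \<open>ew \<kappa>\<close> is the passage to weight one, so the equation in
  the Hilbert space is the perturbation equation, coefficient by coefficient.\<close>

lemma St_rhs:
  assumes eq: "chg (ew \<kappa>) one u' = Lop one (chg (ew \<kappa>) one u) + Bop (ew \<kappa>) (ew \<kappa>) one u u"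
  shows "perturbation_rhs k (St \<kappa> u) x = St \<kappa> u' x"
proof -
  define f g where "f = (\<lambda>\<xi>. coord (fst u) \<xi> / ew \<kappa> \<xi>)" and "g = (\<lambda>\<xi>. coord (snd u) \<xi> / ew \<kappa> \<xi>)"
  let ?NF = "\<lambda>\<zeta>. coord (fst (Bop (ew \<kappa>) (ew \<kappa>) one u u)) \<zeta>"
  let ?NG = "\<lambda>\<zeta>. coord (snd (Bop (ew \<kappa>) (ew \<kappa>) one u u)) \<zeta>"
  note bs = Bop_has_sum[OF admissible_ew[OF \<kappa>]]
  have wl: "\<And>\<xi>. 1 \<le> ew \<kappa> \<xi>" "\<And>\<xi>. 0 < ew \<kappa> \<xi>" "\<And>\<xi>. (0::real) < 1"
    using weights_le(2)[OF \<kappa>] weights_pos(2)[OF \<kappa>] by auto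
  note cc1 = coord_chg[of one "ew \<kappa>", OF wl]
  have hF: "((\<lambda>\<eta>. kF \<eta> (\<zeta> - \<eta>) * g \<eta> * f (\<zeta> - \<eta>)) has_sum ?NF \<zeta>) UNIV" for \<zeta>
    using bs(1)[of \<zeta> u u] by (simp add: wk_def f_def g_def mult_ac)
  have hG: "((\<lambda>\<eta>. kG \<eta> (\<zeta> - \<eta>) * g \<eta> * g (\<zeta> - \<eta>) - kH \<eta> (\<zeta> - \<eta>) * f \<eta> * f (\<zeta> - \<eta>)) has_sum ?NG \<zeta>) UNIV" for \<zeta>
    using bs(2)[of \<zeta> u u] by (simp add: wk_def f_def g_def mult_ac)
  have F: "coord (fst u') \<xi> / ew \<kappa> \<xi> = linF g \<xi> + ?NF \<xi>" for \<xi>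
  proof -
    have "coord (fst u') \<xi> / ew \<kappa> \<xi> = coord (fst (Lop one (chg (ew \<kappa>) one u))) \<xi> + ?NF \<xi>"
      using cc1(1)[of u' \<xi>] unfolding eq by simp
    then show ?thesis
      by (simp add: Lop_def coord_Dop[OF slow_weight_one] Dco_def cc1 g_def linF_def right_diff_distrib mult_ac)
  qed
  have G: "coord (snd u') \<xi> / ew \<kappa> \<xi> = linG f \<xi> + ?NG \<xi>" for \<xi>
  proof -
    have "coord (snd u') \<xi> / ew \<kappa> \<xi> = coord (snd (Lop one (chg (ew \<kappa>) one u))) \<xi> + ?NG \<xi>"
      using cc1(2)[of u' \<xi>] unfolding eq by simp
    then show ?thesis
      by (simp add: Lop_def coord_Eop[OF slow_weight_one] coord_Aop Eco_def cc1 f_def linG_def right_diff_distrib mult_ac)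
  qed
  have "rapid (\<lambda>\<xi>. of_real (f \<xi>))" "rapid (\<lambda>\<xi>. of_real (g \<xi>))"
    unfolding f_def g_def by (rule rapid_coord)+
  from perturbation_rhs_RS[OF this hF hG, of x] show ?thesis
    unfolding St_def F G f_def[symmetric] g_def[symmetric] .
qed

lemma St_linear:
  "St \<kappa> (u + v) x = St \<kappa> u x + St \<kappa> v x" "St \<kappa> (u - v) x = St \<kappa> u x - St \<kappa> v x"
  "St \<kappa> (c *\<^sub>R u) x = c *\<^sub>R St \<kappa> u x"
proof -
  note s = rapid_u[THEN rapid_summable]
  show "St \<kappa> (u + v) x = St \<kappa> u x + St \<kappa> v x"
    unfolding St_def RS_def using TS_add[OF s(1) s(1), of "fst u" "fst v" x] TS_add[OF s(2) s(2), of "snd u" "snd v" x]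
    by (simp add: add_divide_distrib distrib_left)
  show "St \<kappa> (u - v) x = St \<kappa> u x - St \<kappa> v x"
    unfolding St_def RS_def using TS_diff[OF s(1) s(1), of "fst u" "fst v" x] TS_diff[OF s(2) s(2), of "snd u" "snd v" x]
    by (simp add: diff_divide_distrib right_diff_distrib)
  show "St \<kappa> (c *\<^sub>R u) x = c *\<^sub>R St \<kappa> u x"
    unfolding St_def RS_def
    using TS_cmult[of "of_real c" "\<lambda>\<xi>. of_real (coord (fst u) \<xi> / ew \<kappa> \<xi>)" x]
      TS_cmult[of "of_real c" "\<lambda>\<xi>. of_real (rad \<xi> * (coord (snd u) \<xi> / ew \<kappa> \<xi>))" x]
    by (simp add: scaleR_conv_of_real mult_ac)
qed

end

end

section \<open>Sobolev norms and strong solutions\<close>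

context wave
begin

lemma TS_weight_summable:
  assumes "rapid a"
  shows "(\<lambda>\<xi>. (1 + (rad \<xi>)\<^sup>2) ^ r * (norm (a \<xi>))\<^sup>2) summable_on UNIV"
proof -
  have k1: "1 \<le> real k" using k by simp
  define c where "c \<xi> = of_real (real k ^ r) * (of_real ((1 + sz \<xi>) ^ r) * a \<xi>)" for \<xi>
  have "abs_summable c"
    using assms unfolding c_def rapid_def norm_mult[of "of_real (real k ^ r)"] by (intro summable_on_cmult_right) blast
  note c = abs_summable_square[OF this]
  have le: "1 + (rad \<xi>)\<^sup>2 \<le> (real k * (1 + sz \<xi>))\<^sup>2" for \<xi>
  proof -
    have "1 + rad \<xi> \<le> real k * (1 + sz \<xi>)" using rad_le[of \<xi>] k1 by (simp add: distrib_left)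
    then have "(1 + rad \<xi>)\<^sup>2 \<le> (real k * (1 + sz \<xi>))\<^sup>2" by (intro power_mono) simp_all
    then have "1 + (rad \<xi>)\<^sup>2 + 2 * rad \<xi> \<le> (real k * (1 + sz \<xi>))\<^sup>2"
      by (simp add: power2_sum)
    with rad_nonneg[of \<xi>] show ?thesis by linarith
  qed
  show ?thesis
  proof (rule summable_on_comparison_test[OF c])
    fix \<xi>
    have "(1 + (rad \<xi>)\<^sup>2) ^ r * (norm (a \<xi>))\<^sup>2 \<le> ((real k * (1 + sz \<xi>))\<^sup>2) ^ r * (norm (a \<xi>))\<^sup>2"
      using le[of \<xi>] by (intro mult_right_mono power_mono) auto
    also have "\<dots> = (norm (c \<xi>))\<^sup>2"
      unfolding c_def norm_mult[of "of_real (real k ^ r)"] norm_sz_mult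
      by (simp add: norm_power power_mult_distrib power2_eq_square mult_ac)
    finally show "(1 + (rad \<xi>)\<^sup>2) ^ r * (norm (a \<xi>))\<^sup>2 \<le> (norm (c \<xi>))\<^sup>2" .
  qed simp
qed

lemma TS_sobolev:
  assumes a: "rapid a"
  shows "TS a \<in> sobolev r"
    and "sobolev_norm r (TS a) = sqrt (\<Sum>\<^sub>\<infinity>\<xi>. (1 + (rad \<xi>)\<^sup>2) ^ r * (norm (a \<xi>))\<^sup>2)"
proof -
  have e: "(1 + sqnorm (emb \<xi>)) ^ r * (norm (lift a (emb \<xi>)))\<^sup>2 = (1 + (rad \<xi>)\<^sup>2) ^ r * (norm (a \<xi>))\<^sup>2" for \<xi>
    by (simp add: sqnorm_emb lift_emb norm_mult)
  have "(\<lambda>\<xi>. (1 + sqnorm \<xi>) ^ r * (norm (lift a \<xi>))\<^sup>2) summable_on UNIV"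
    by (subst emb_summable) (simp_all add: lift_outside e TS_weight_summable[OF a])
  then show "TS a \<in> sobolev r"
    unfolding TS_def by (intro trig_sobolev abs_summable_lift rapid_summable a)
  have "(\<Sum>\<^sub>\<infinity>\<xi>. (1 + sqnorm \<xi>) ^ r * (norm (lift a \<xi>))\<^sup>2) = (\<Sum>\<^sub>\<infinity>\<xi>. (1 + (rad \<xi>)\<^sup>2) ^ r * (norm (a \<xi>))\<^sup>2)"
    by (subst emb_infsum) (simp_all add: lift_outside e)
  then show "sobolev_norm r (TS a) = sqrt (\<Sum>\<^sub>\<infinity>\<xi>. (1 + (rad \<xi>)\<^sup>2) ^ r * (norm (a \<xi>))\<^sup>2)"
    by (simp add: sobolev_norm_def fourier_coeff_TS[OF rapid_summable[OF a]])
qed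

lemma TS_flip:
  "TS a (x1 + 2*pi / real k, y) = TS a (x1, y)"
  "TS a (pi / real k - x1, y) = TS (\<lambda>\<xi>. a (- fst \<xi>, snd \<xi>)) (x1, y)"
  "TS a (x1, - y) = TS (\<lambda>\<xi>. a (fst \<xi>, - snd \<xi>)) (x1, y)"
  "cnj (TS a x) = TS (\<lambda>\<xi>. cnj (a (- \<xi>))) x"
proof -
  have b: "bij_betw (\<lambda>\<xi>. (- fst \<xi>, snd \<xi>)) (UNIV :: freq set) UNIV"
    "bij_betw (\<lambda>\<xi>. (fst \<xi>, - snd \<xi>)) (UNIV :: freq set) UNIV" "bij_betw uminus (UNIV :: freq set) UNIV"
    by (auto intro: bij_betwI[where g = "\<lambda>\<xi>. (- fst \<xi>, snd \<xi>)"] bij_betwI[where g = "\<lambda>\<xi>. (fst \<xi>, - snd \<xi>)"]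
        bij_betwI[where g = uminus])
  have e: "ek \<xi> (pi / real k - x1, y) = ek (- fst \<xi>, snd \<xi>) (x1, y)" "ek \<xi> (x1, - y) = ek (fst \<xi>, - snd \<xi>) (x1, y)" for \<xi>
    by (cases \<xi>; simp add: ek_simps)+
  show "TS a (x1 + 2*pi / real k, y) = TS a (x1, y)" by (simp add: TS_infsum ek_simps)
  show "TS a (pi / real k - x1, y) = TS (\<lambda>\<xi>. a (- fst \<xi>, snd \<xi>)) (x1, y)"
    unfolding TS_infsum e
    using infsum_reindex_bij_betw[OF b(1), of "\<lambda>\<xi>. a \<xi> * ek (- fst \<xi>, snd \<xi>) (x1, y)"] by simp
  show "TS a (x1, - y) = TS (\<lambda>\<xi>. a (fst \<xi>, - snd \<xi>)) (x1, y)"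
    unfolding TS_infsum e
    using infsum_reindex_bij_betw[OF b(2), of "\<lambda>\<xi>. a \<xi> * ek (fst \<xi>, - snd \<xi>) (x1, y)"] by simp
  show "cnj (TS a x) = TS (\<lambda>\<xi>. cnj (a (- \<xi>))) x"
    unfolding TS_infsum infsum_cnj[symmetric]
    using infsum_reindex_bij_betw[OF b(3), of "\<lambda>\<xi>. cnj (a \<xi>) * ek (- \<xi>) x"] by (simp add: ek_simps)
qed

lemma TS_reflect:
  assumes "\<And>m n. a (- m, n) = \<sigma> * a (m, n)" "\<And>m n. a (m, - n) = \<sigma> * a (m, n)"
  shows "TS a (x1 + 2*pi / real k, y) = TS a (x1, y)"
    "TS a (pi / real k - x1, y) = \<sigma> * TS a (x1, y)" "TS a (x1, - y) = \<sigma> * TS a (x1, y)"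
  by (simp_all add: TS_flip assms TS_cmult)

lemma TS_real:
  assumes "\<And>\<xi>. a (- \<xi>) = a \<xi>" "\<And>\<xi>. a \<xi> \<in> \<real>"
  shows "TS a x \<in> \<real>"
  using assms by (simp add: Reals_cnj_iff TS_flip)

text \<open>Real coefficients that are even under negation of the frequency give a real function,
  and oddness in each of the two indices is evenness under negation.\<close>

lemma RS_X_sym_real:
  assumes f: "rapid (\<lambda>\<xi>. of_real (f \<xi>))" and g: "rapid (\<lambda>\<xi>. of_real (g \<xi>))"
    and even: "\<And>m n. f (- m, n) = f (m, n) \<and> f (m, - n) = f (m, n)"
    and odd: "\<And>m n. g (- m, n) = - g (m, n) \<and> g (m, - n) = - g (m, n)"
  shows "RS f g \<in> X_sym_real k s"
proof -
  have z: "fourier_coeff (TS (\<lambda>\<xi>. of_real (rad \<xi> * g \<xi>))) (0, 0) = 0"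
    unfolding fourier_coeff_TS[OF rapid_summable[OF rapid_rad(1)[OF g]]] lift_def by (simp add: rad_def)
  have X: "RS f g \<in> X_space s"
    unfolding X_space_def sobolev0_def using z TS_sobolev(1)[OF rapid_rad(1)[OF g]] TS_sobolev(1)[OF f]
    by (simp add: vort_RS flux_RS)
  have F: "TS (\<lambda>\<xi>. of_real (f \<xi>)) (x1 + 2*pi / real k, y) = TS (\<lambda>\<xi>. of_real (f \<xi>)) (x1, y)"
    "TS (\<lambda>\<xi>. of_real (f \<xi>)) (pi / real k - x1, y) = TS (\<lambda>\<xi>. of_real (f \<xi>)) (x1, y)"
    "TS (\<lambda>\<xi>. of_real (f \<xi>)) (x1, - y) = TS (\<lambda>\<xi>. of_real (f \<xi>)) (x1, y)" for x1 y
    using TS_reflect[of "\<lambda>\<xi>. of_real (f \<xi>)" 1 x1 y] even by simp_all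
  have G: "TS (\<lambda>\<xi>. of_real (rad \<xi> * g \<xi>)) (x1 + 2*pi / real k, y) = TS (\<lambda>\<xi>. of_real (rad \<xi> * g \<xi>)) (x1, y)"
    "TS (\<lambda>\<xi>. of_real (rad \<xi> * g \<xi>)) (pi / real k - x1, y) = - TS (\<lambda>\<xi>. of_real (rad \<xi> * g \<xi>)) (x1, y)"
    "TS (\<lambda>\<xi>. of_real (rad \<xi> * g \<xi>)) (x1, - y) = - TS (\<lambda>\<xi>. of_real (rad \<xi> * g \<xi>)) (x1, y)" for x1 y
    using TS_reflect[of "\<lambda>\<xi>. of_real (rad \<xi> * g \<xi>)" "- 1" x1 y] odd by (simp_all add: rad_reflect)
  have neg: "f (- \<xi>) = f \<xi>" "g (- \<xi>) = g \<xi>" "rad (- \<xi>) = rad \<xi>" for \<xi>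
    using even odd rad_reflect by (cases \<xi>; metis add.inverse_inverse uminus_Pair)+
  have R: "TS (\<lambda>\<xi>. of_real (f \<xi>)) x \<in> \<real>" "TS (\<lambda>\<xi>. of_real (rad \<xi> * g \<xi>)) x \<in> \<real>" for x
    by (rule TS_real; simp add: neg)+
  show ?thesis
    unfolding X_sym_real_def X_sym_def real_state_def
    using X by (auto simp: vort_RS flux_RS F G RS_def R simp del: of_real_mult intro!: AE_I2)
qed

text \<open>The Sobolev weights combined with removal of \<open>ew \<kappa>\<close>, so that the
  norm of \<open>Psi s \<kappa> u\<close> is the norm in \<open>X_space s\<close> of the encoded
  state. It is bounded because exponentials dominate polynomials, and so carries limits from the
  Hilbert space to every \<open>s\<close>.\<close>

definition Psi :: "nat \<Rightarrow> real \<Rightarrow> freq ell2 \<times> freq ell2 \<Rightarrow> freq ell2 \<times> freq ell2" where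
  "Psi s \<kappa> u = (wop (\<lambda>\<xi>. sqrt ((1 + (rad \<xi>)\<^sup>2) ^ s) / ew \<kappa> \<xi>) id (fst u),
     wop (\<lambda>\<xi>. sqrt ((1 + (rad \<xi>)\<^sup>2) ^ (s - 1)) * rad \<xi> / ew \<kappa> \<xi>) id (snd u))"

context
  fixes \<kappa> :: real
  assumes \<kappa>: "\<kappa> > 0"
begin

lemma Psi_weights: "\<exists>B. (\<forall>\<xi>. \<bar>sqrt ((1 + (rad \<xi>)\<^sup>2) ^ r) / ew \<kappa> \<xi>\<bar> \<le> B) \<and> (\<forall>\<xi>. \<bar>sqrt ((1 + (rad \<xi>)\<^sup>2) ^ r) * rad \<xi> / ew \<kappa> \<xi>\<bar> \<le> B)"
proof -
  obtain C where C: "C > 0" "\<And>x. x \<ge> 0 \<Longrightarrow> (1 + x) ^ Suc r \<le> C * exp (\<kappa> * x)"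
    using polynomial_le_exp[OF \<kappa>] by blast
  have k1: "1 \<le> real k" using k by simp
  have le: "sqrt ((1 + (rad \<xi>)\<^sup>2) ^ r) * y / ew \<kappa> \<xi> \<le> real k ^ Suc r * C" if y: "0 \<le> y" "y \<le> 1 + rad \<xi>" for \<xi> y
  proof -
    have r1: "1 + rad \<xi> \<le> real k * (1 + sz \<xi>)" using rad_le[of \<xi>] k1 by (simp add: distrib_left)
    have "sqrt ((1 + (rad \<xi>)\<^sup>2) ^ r) \<le> (1 + rad \<xi>) ^ r"
      using rad_nonneg[of \<xi>] by (intro real_le_lsqrt) (auto simp: power_mult[symmetric] mult.commute[of r] power_mult[of _ 2 r] power2_sum intro!: power_mono)
    then have "sqrt ((1 + (rad \<xi>)\<^sup>2) ^ r) * y \<le> (1 + rad \<xi>) ^ r * (1 + rad \<xi>)"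
      using y rad_nonneg[of \<xi>] by (intro mult_mono) auto
    also have "\<dots> = (1 + rad \<xi>) ^ Suc r" by (simp add: mult.commute)
    also have "\<dots> \<le> (real k * (1 + sz \<xi>)) ^ Suc r" by (rule power_mono[OF r1]) simp
    also have "\<dots> \<le> real k ^ Suc r * (C * exp (\<kappa> * sz \<xi>))"
      unfolding power_mult_distrib by (rule mult_left_mono[OF C(2)]) auto
    finally show ?thesis by (simp only: ew_def pos_divide_le_eq exp_gt_zero mult.assoc)
  qed
  show ?thesis
  proof (intro exI[of _ "real k ^ Suc r * C"] conjI allI)
    fix \<xi>
    show "\<bar>sqrt ((1 + (rad \<xi>)\<^sup>2) ^ r) / ew \<kappa> \<xi>\<bar> \<le> real k ^ Suc r * C"
      using le[of 1 \<xi>] by (subst abs_of_nonneg) (simp_all add: ew_def)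
    show "\<bar>sqrt ((1 + (rad \<xi>)\<^sup>2) ^ r) * rad \<xi> / ew \<kappa> \<xi>\<bar> \<le> real k ^ Suc r * C"
      using le[of "rad \<xi>" \<xi>] by (subst abs_of_nonneg) (simp_all add: ew_def)
  qed
qed

lemma coord_Psi:
  "coord (fst (Psi s \<kappa> u)) \<xi> = sqrt ((1 + (rad \<xi>)\<^sup>2) ^ s) / ew \<kappa> \<xi> * coord (fst u) \<xi>"
  "coord (snd (Psi s \<kappa> u)) \<xi> = sqrt ((1 + (rad \<xi>)\<^sup>2) ^ (s - 1)) * rad \<xi> / ew \<kappa> \<xi> * coord (snd u) \<xi>"
proof -
  obtain B B' where B: "\<And>\<xi>. \<bar>sqrt ((1 + (rad \<xi>)\<^sup>2) ^ s) / ew \<kappa> \<xi>\<bar> \<le> B"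
    "\<And>\<xi>. \<bar>sqrt ((1 + (rad \<xi>)\<^sup>2) ^ (s - 1)) * rad \<xi> / ew \<kappa> \<xi>\<bar> \<le> B'"
    using Psi_weights by meson
  show "coord (fst (Psi s \<kappa> u)) \<xi> = sqrt ((1 + (rad \<xi>)\<^sup>2) ^ s) / ew \<kappa> \<xi> * coord (fst u) \<xi>"
    "coord (snd (Psi s \<kappa> u)) \<xi> = sqrt ((1 + (rad \<xi>)\<^sup>2) ^ (s - 1)) * rad \<xi> / ew \<kappa> \<xi> * coord (snd u) \<xi>"
    unfolding Psi_def fst_conv snd_conv using coord_wop[OF inj_on_id B(1)] coord_wop[OF inj_on_id B(2)] by simp_all
qed

lemma bounded_linear_Psi: "bounded_linear (Psi s \<kappa>)"
proof -
  obtain B B' where B: "\<And>\<xi>. \<bar>sqrt ((1 + (rad \<xi>)\<^sup>2) ^ s) / ew \<kappa> \<xi>\<bar> \<le> B"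
    "\<And>\<xi>. \<bar>sqrt ((1 + (rad \<xi>)\<^sup>2) ^ (s - 1)) * rad \<xi> / ew \<kappa> \<xi>\<bar> \<le> B'"
    using Psi_weights by meson
  show ?thesis
    unfolding Psi_def[abs_def]
    by (intro bounded_linear_Pair bounded_linear_compose[OF bounded_linear_wop[OF inj_on_id B(1)]]
        bounded_linear_compose[OF bounded_linear_wop[OF inj_on_id B(2)]] bounded_linear_fst bounded_linear_snd)
qed

lemma X_norm_St: "X_norm s (St \<kappa> u) = norm (Psi s \<kappa> u)"
proof -
  have q: "0 \<le> (1 + (rad \<xi>)\<^sup>2) ^ r" for \<xi> r by simp
  have F: "(sobolev_norm s (flux (St \<kappa> u)))\<^sup>2 = (norm (fst (Psi s \<kappa> u)))\<^sup>2"
    unfolding ell2_norm_sq coord_Psi St_def flux_RS TS_sobolev(2)[OF rapid_coord[OF \<kappa>]]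
    by (subst real_sqrt_pow2) (auto simp: power_mult_distrib power_divide norm_divide intro!: infsum_nonneg infsum_cong)
  have G: "(sobolev_norm (s - 1) (vort (St \<kappa> u)))\<^sup>2 = (norm (snd (Psi s \<kappa> u)))\<^sup>2"
    unfolding ell2_norm_sq coord_Psi St_def vort_RS TS_sobolev(2)[OF rapid_rad(1)[OF rapid_coord[OF \<kappa>]]]
    by (subst real_sqrt_pow2) (auto simp: power_mult_distrib power_divide norm_divide norm_mult intro!: infsum_nonneg infsum_cong)
  show ?thesis unfolding X_norm_def F G by (cases "Psi s \<kappa> u") (simp add: norm_Pair add.commute)
qed

lemma St_X_sym_real: "u \<in> sym_space \<Longrightarrow> St \<kappa> u \<in> X_sym_real k s"
  unfolding St_def
  by (rule RS_X_sym_real) (use even_weights[OF \<kappa>] in \<open>auto simp: rapid_coord[OF \<kappa>, unfolded of_real_divide] sym_space_def parity_def even_weight_def\<close>)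

lemma St_strong_solution:
  assumes T: "0 < T" and u': "continuous_on {0..T} u'"
    and u: "\<And>t. t \<in> {0..T} \<Longrightarrow> u t \<in> sym_space \<and> u' t \<in> sym_space \<and> (u has_vector_derivative u' t) (at t within {0..T})"
    and eq: "\<And>t x. t \<in> {0..T} \<Longrightarrow> G (St \<kappa> (u t)) x = St \<kappa> (u' t) x"
  shows "strong_solution k s G T (\<lambda>t. St \<kappa> (u t))"
proof -
  have P: "((\<lambda>\<tau>. norm (Psi r \<kappa> (h \<tau>))) \<longlongrightarrow> 0) F" if "(h \<longlongrightarrow> 0) F" for h r and F :: "real filter"
    using tendsto_norm_zero[OF bounded_linear.tendsto_zero[OF bounded_linear_Psi that]] .
  have C: "continuous_curve k r T (\<lambda>t. St \<kappa> (w t))" if "continuous_on {0..T} w" "\<And>t. t \<in> {0..T} \<Longrightarrow> w t \<in> sym_space" for w r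
    unfolding continuous_curve_def St_linear(2)[OF \<kappa>, symmetric] X_norm_St
  proof (intro ballI conjI St_X_sym_real that P)
    fix t assume "t \<in> {0..T}"
    then have "(w \<longlongrightarrow> w t) (at t within {0..T})" using that(1) by (simp add: continuous_on_def)
    then show "((\<lambda>\<tau>. w \<tau> - w t) \<longlongrightarrow> 0) (at t within {0..T})" by (rule LIM_zero)
  qed
  have uc: "continuous_on {0..T} u"
    by (rule continuous_on_vector_derivative) (use u in blast)
  have D: "curve_derivative (s - 1) T (\<lambda>t. St \<kappa> (u t)) (\<lambda>t. St \<kappa> (u' t))"
    unfolding curve_derivative_def St_linear[OF \<kappa>, symmetric] X_norm_St
  proof (intro ballI P)
    fix t assume t: "t \<in> {0..T}"
    have "(u has_derivative (\<lambda>x. x *\<^sub>R u' t)) (at t within {0..T})"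
      using u[OF t] by (simp add: has_vector_derivative_def)
    then have "((\<lambda>y. (1 / norm (y - t)) *\<^sub>R (u y - (u t + (y - t) *\<^sub>R u' t))) \<longlongrightarrow> 0) (at t within {0..T})"
      by (simp add: has_derivative_within)
    then have D0: "((\<lambda>y. norm ((1 / norm (y - t)) *\<^sub>R (u y - (u t + (y - t) *\<^sub>R u' t)))) \<longlongrightarrow> 0) (at t within {0..T})"
      by (rule tendsto_norm_zero)
    have N: "norm ((1 / norm (y - t)) *\<^sub>R (u y - (u t + (y - t) *\<^sub>R u' t))) = norm ((u y - u t) /\<^sub>R (y - t) - u' t)"
      if "y \<noteq> t" for y
    proof -
      have "(u y - u t) /\<^sub>R (y - t) - u' t = (1 / (y - t)) *\<^sub>R (u y - (u t + (y - t) *\<^sub>R u' t))"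
        using that by (simp add: scaleR_diff_right scaleR_add_right divide_inverse)
      then show ?thesis by (simp add: abs_divide)
    qed
    have "((\<lambda>y. norm ((u y - u t) /\<^sub>R (y - t) - u' t)) \<longlongrightarrow> 0) (at t within {0..T})"
      by (rule Lim_transform_eventually[OF D0]) (auto simp only: eventually_at_filter intro!: always_eventually N)
    then show "((\<lambda>y. (u y - u t) /\<^sub>R (y - t) - u' t) \<longlongrightarrow> 0) (at t within {0..T})"
      by (rule tendsto_norm_zero_cancel)
  qed
  show ?thesis
    unfolding strong_solution_def
  proof (intro conjI T exI[of _ "\<lambda>t. St \<kappa> (u' t)"] ballI C D uc u')
    show "St \<kappa> (u' t) \<doteq> G (St \<kappa> (u t))" if "t \<in> {0..T}" for t
      unfolding ae_eq_def eq[OF that] by simp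
  qed (use u in blast)+
qed

end

end

section \<open>The equilibrium\<close>

context wave
begin

lemma d_TS_lin:
  assumes a: "rapid a" and b: "rapid b"
  shows "d1 (\<lambda>x. TS a x + c * TS b x) x = d1 (TS a) x + c * d1 (TS b) x"
    "d2 (\<lambda>x. TS a x + c * TS b x) x = d2 (TS a) x + c * d2 (TS b) x"
proof -
  have cb: "rapid (\<lambda>\<xi>. c * b \<xi>)"
    by (rule rapid_mono[OF b, where C = "norm c" and M = 0]) (simp add: norm_mult)
  have ab: "rapid (\<lambda>\<xi>. a \<xi> + c * b \<xi>)"
    unfolding rapid_def
  proof
    fix N
    have "(\<lambda>\<xi>. norm (of_real ((1 + sz \<xi>) ^ N) * a \<xi>) + norm (of_real ((1 + sz \<xi>) ^ N) * (c * b \<xi>))) summable_on UNIV"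
      using a cb unfolding rapid_def by (intro summable_on_add) blast+
    then show "abs_summable (\<lambda>\<xi>. of_real ((1 + sz \<xi>) ^ N) * (a \<xi> + c * b \<xi>))"
      unfolding distrib_left by (rule summable_on_comparison_test) (auto intro: norm_triangle_ineq)
  qed
  have e: "(\<lambda>x. TS a x + c * TS b x) = TS (\<lambda>\<xi>. a \<xi> + c * b \<xi>)"
    by (rule ext) (simp add: TS_add rapid_summable[OF a] rapid_summable[OF cb] TS_cmult)
  have d: "(\<lambda>\<xi>. \<mu> \<xi> * (a \<xi> + c * b \<xi>)) = (\<lambda>\<xi>. \<mu> \<xi> * a \<xi> + c * (\<mu> \<xi> * b \<xi>))" for \<mu> :: "freq \<Rightarrow> complex"
    by (simp add: algebra_simps)
  have s: "abs_summable (\<lambda>\<xi>. c * h \<xi>)" if "rapid h" for h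
    using summable_on_cmult_right[OF rapid_summable[OF that], of "norm c"] by (simp add: norm_mult)
  show "d1 (\<lambda>x. TS a x + c * TS b x) x = d1 (TS a) x + c * d1 (TS b) x"
    unfolding e TS_d(1)[OF ab] TS_d(1)[OF a] TS_d(1)[OF b] d
    by (simp only: TS_add[OF rapid_summable[OF TS_d(3)[OF a]] s[OF TS_d(3)[OF b]]] TS_cmult)
  show "d2 (\<lambda>x. TS a x + c * TS b x) x = d2 (TS a) x + c * d2 (TS b) x"
    unfolding e TS_d(2)[OF ab] TS_d(2)[OF a] TS_d(2)[OF b] d
    by (simp only: TS_add[OF rapid_summable[OF TS_d(4)[OF a]] s[OF TS_d(4)[OF b]]] TS_cmult)
qed

text \<open>Coefficients of \<open>c * sin (k * x)\<close>, which is a cosine in the centred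
  variable.\<close>

definition sine :: "real \<Rightarrow> freq \<Rightarrow> real" where
  "sine c \<xi> = (if \<xi> = (1, 0) \<or> \<xi> = (- 1, 0) then c / 2 else 0)"

lemma TS_pair:
  assumes "\<And>\<xi>. \<xi> \<noteq> (1, 0) \<Longrightarrow> \<xi> \<noteq> (- 1, 0) \<Longrightarrow> a \<xi> = 0"
  shows "TS a x = a (1, 0) * ek (1, 0) x + a (- 1, 0) * ek (- 1, 0) x"
proof -
  have "TS a x = infsum (\<lambda>\<xi>. a \<xi> * ek \<xi> x) {(1, 0), (- 1, 0)}"
    unfolding TS_infsum by (rule infsum_cong_neutral) (use assms in auto)
  then show ?thesis by simp
qed

lemma rapid_sine: "rapid (\<lambda>\<xi>. of_real (sine c \<xi>))"
  by (rule rapid_exp[where \<kappa> = 1 and B = "\<bar>c\<bar> * exp 1"])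
     (auto simp: sine_def sz_def mult.assoc mult_exp_exp abs_mult)

lemma TS_sine:
  "TS (\<lambda>\<xi>. of_real (sine c \<xi>)) = (\<lambda>x. of_real (c * sin (real k * fst x)))"
  "d1 (TS (\<lambda>\<xi>. of_real (sine c \<xi>))) = (\<lambda>x. of_real (c * real k * cos (real k * fst x)))"
  "d2 (TS (\<lambda>\<xi>. of_real (sine c \<xi>))) = (\<lambda>x. 0)"
proof -
  have e: "ek (1, 0) x = of_real (sin (real k * fst x)) - \<i> * of_real (cos (real k * fst x))"
    "ek (- 1, 0) x = of_real (sin (real k * fst x)) + \<i> * of_real (cos (real k * fst x))" for x
    by (simp_all add: ek_def complex_eq_iff cos_diff sin_diff cos_add sin_add)
  show "TS (\<lambda>\<xi>. of_real (sine c \<xi>)) = (\<lambda>x. of_real (c * sin (real k * fst x)))"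
    by (rule ext, subst TS_pair) (auto simp: sine_def e field_simps)
  show "d1 (TS (\<lambda>\<xi>. of_real (sine c \<xi>))) = (\<lambda>x. of_real (c * real k * cos (real k * fst x)))"
    unfolding TS_d(1)[OF rapid_sine]
    by (rule ext, subst TS_pair) (auto simp: sine_def e field_simps)
  show "d2 (TS (\<lambda>\<xi>. of_real (sine c \<xi>))) = (\<lambda>x. 0)"
    unfolding TS_d(2)[OF rapid_sine]
    by (rule ext, subst TS_pair) (auto simp: sine_def)
qed

text \<open>At the two frequencies of the equilibrium \<open>1 + (rad \<xi>)\<^sup>2\<close> equals
  \<open>cc\<close>, so its potential is the sine of k x1. Its derivative in the second variable
  vanishes, hence it does not advect itself, and the mixed terms make up the linear
  operator.\<close>

lemma mhd_shift:
  assumes f: "rapid (\<lambda>\<xi>. of_real (f \<xi>))" and g: "rapid (\<lambda>\<xi>. of_real (g \<xi>))"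
  shows "mhd (RS (\<lambda>\<xi>. sine cc \<xi> + f \<xi>) g) x = perturbation_rhs k (RS f g) x"
proof -
  let ?h = "\<lambda>\<xi>. sine cc \<xi> + f \<xi>"
  define p where "p = (\<lambda>\<xi>. complex_of_real (- (g \<xi> / rad \<xi>)))"
  define q where "q = (\<lambda>\<xi>. complex_of_real (f \<xi> / (1 + (rad \<xi>)\<^sup>2)))"
  define w where "w = (\<lambda>\<xi>. complex_of_real (rad \<xi> * g \<xi>))"
  define h where "h = (\<lambda>\<xi>. complex_of_real (f \<xi>))"
  define S where "S c = (\<lambda>\<xi>. complex_of_real (sine c \<xi>))" for c
  have r: "rapid p" "rapid q" "rapid w" "rapid h" "rapid (S c)" for c
    unfolding p_def q_def w_def h_def S_def by (rule rapid_rad f g rapid_sine)+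
  note s = r[THEN rapid_summable]
  have rh: "rapid (\<lambda>\<xi>. of_real (?h \<xi>))"
    unfolding rapid_def
  proof
    fix N
    have "(\<lambda>\<xi>. norm (of_real ((1 + sz \<xi>) ^ N) * S cc \<xi>) + norm (of_real ((1 + sz \<xi>) ^ N) * h \<xi>)) summable_on UNIV"
      using r(4) r(5)[of cc] unfolding rapid_def by (intro summable_on_add) blast+
    then show "abs_summable (\<lambda>\<xi>. of_real ((1 + sz \<xi>) ^ N) * complex_of_real (?h \<xi>))"
      unfolding of_real_add distrib_left
      by (rule summable_on_comparison_test) (auto simp: S_def h_def intro: norm_triangle_ineq)
  qed
  have q': "complex_of_real (?h \<xi> / (1 + (rad \<xi>)\<^sup>2)) = S 1 \<xi> + q \<xi>" for \<xi>
  proof -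
    have "sine cc \<xi> / (1 + (rad \<xi>)\<^sup>2) = sine 1 \<xi>"
    proof (cases "\<xi> = (1, 0) \<or> \<xi> = (- 1, 0)")
      case True
      then have "1 + (rad \<xi>)\<^sup>2 = cc" by (auto simp: rad_sq cc_def)
      then show ?thesis using cc_ge by (simp add: sine_def)
    qed (simp add: sine_def)
    then show ?thesis by (simp only: S_def q_def add_divide_distrib of_real_add)
  qed
  have flux: "flux (RS ?h g) = (\<lambda>x. TS (S cc) x + 1 * TS h x)"
    unfolding flux_RS using TS_add[OF s(5) s(4), of cc] by (intro ext) (simp add: S_def h_def)
  have pot: "potential (RS ?h g) = (\<lambda>x. TS (S 1) x + 1 * TS q x)"
    unfolding potential_RS[OF rh] q' using TS_add[OF s(5) s(2), of 1] by (intro ext) simp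
  have U: "stream (RS f g) = TS p" "potential (RS f g) = TS q" "vort (RS f g) = TS w" "flux (RS f g) = TS h"
    "stream (RS ?h g) = TS p" "vort (RS ?h g) = TS w"
    by (simp_all add: stream_RS[OF g] potential_RS[OF f] vort_RS flux_RS p_def q_def w_def h_def)
  have A: "A_op k (TS h) = (\<lambda>x. TS h x + (- of_real cc) * TS q x)"
    using U(2) unfolding potential_def U(4) by (intro ext) (simp add: A_op_def cc_def algebra_simps)
  have B: "B_op k (TS w) = (\<lambda>x. TS (S 0) x + (- of_real cc) * TS p x)"
    using U(1) unfolding stream_def U(3)
    by (intro ext) (simp add: B_op_def cc_def S_def TS_sine(1)[of 0, simplified] algebra_simps)
  note D = d_TS_lin[OF r(5) r(4), of cc 1] d_TS_lin[OF r(5) r(2), of 1 1]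
    d_TS_lin(2)[OF r(4) r(2), of "- of_real cc"] d_TS_lin(2)[OF r(5) r(1), of 0 "- of_real cc"]
    TS_sine(2,3)[folded S_def]
  show ?thesis
    unfolding mhd_def perturbation_rhs_def lin_op_def bilin_def advect_def U flux pot A B D
    by (simp add: scaleR_conv_of_real algebra_simps)
qed

context
  fixes \<kappa> :: real
  assumes \<kappa>: "\<kappa> > 0"
begin

lemma equilibrium_St:
  obtains e where "e \<in> sym_space" "\<And>\<xi>. coord (fst e) \<xi> / ew \<kappa> \<xi> = sine cc \<xi>" "\<And>\<xi>. coord (snd e) \<xi> = 0"
    "St \<kappa> e = equilibrium k"
proof -
  have "(\<lambda>\<xi>. (ew \<kappa> \<xi> * sine cc \<xi>)\<^sup>2) summable_on {(1, 0), (- 1, 0)}" by simp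
  then have "(\<lambda>\<xi>. (ew \<kappa> \<xi> * sine cc \<xi>)\<^sup>2) summable_on UNIV"
    by (rule summable_on_cong_neutral[THEN iffD1, rotated -1]) (auto simp: sine_def)
  note c = of_coord_inverse'[OF this]
  define e :: "freq ell2 \<times> freq ell2" where "e = (of_coord (\<lambda>\<xi>. ew \<kappa> \<xi> * sine cc \<xi>), 0)"
  have "ew \<kappa> \<xi> \<noteq> 0" for \<xi> by (simp add: ew_def)
  then have e: "coord (fst e) \<xi> / ew \<kappa> \<xi> = sine cc \<xi>" "coord (snd e) \<xi> = 0" for \<xi>
    by (simp_all add: e_def c)
  have "e \<in> sym_space"
    unfolding sym_space_def parity_def e_def fst_conv snd_conv mem_Collect_eq c
    by (auto simp: sine_def ew_def sz_def)
  moreover have "St \<kappa> e = equilibrium k"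
    by (rule ext) (simp add: St_def e RS_def TS_sine equilibrium_def cc_def TS_infsum)
  ultimately show ?thesis using that e by blast
qed

lemma mhd_St:
  assumes "\<And>\<xi>. coord (fst e) \<xi> / ew \<kappa> \<xi> = sine cc \<xi>" "\<And>\<xi>. coord (snd e) \<xi> = 0"
  shows "mhd (St \<kappa> (e + u)) x = perturbation_rhs k (St \<kappa> u) x"
proof -
  have "St \<kappa> (e + u) = RS (\<lambda>\<xi>. sine cc \<xi> + coord (fst u) \<xi> / ew \<kappa> \<xi>) (\<lambda>\<xi>. coord (snd u) \<xi> / ew \<kappa> \<xi>)"
    by (simp add: St_def assms add_divide_distrib)
  then show ?thesis
    using mhd_shift[OF rapid_coord[OF \<kappa>] rapid_coord[OF \<kappa>]] by (simp add: St_def)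
qed

end

end

section \<open>Eigenfunctions in the given spaces: coefficients, branches and growth rates\<close>

section \<open>Regularity of eigenfunctions\<close>

text \<open>Affine maps with slopes of absolute value 1 preserve Lebesgue measure.\<close>

lemma AE_reflect:
  fixes P :: "real \<times> real \<Rightarrow> bool"
  assumes P: "AE p in lborel. P p" and c: "\<bar>c1\<bar> = 1" "\<bar>c2\<bar> = 1"
  shows "AE p in lborel. P (a + c1 * fst p, b + c2 * snd p)"
proof -
  define T where "T p = (a, b) + (\<Sum>j\<in>Basis. ((if j = (1, 0) then c1 else c2) * (p \<bullet> j)) *\<^sub>R j)" for p :: "real \<times> real"
  have T: "T p = (a + c1 * fst p, b + c2 * snd p)" for p
    unfolding T_def sum_Basis_prod_eq by (cases p) simp
  have cz: "(if j = (1, 0) then c1 else c2) \<noteq> 0" for j :: "real \<times> real" using c by auto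
  have p: "(\<Prod>j\<in>Basis. \<bar>if j = (1, 0) then c1 else c2\<bar>) = 1" for j :: "real \<times> real"
    using c by (intro prod.neutral) auto
  have D: "lborel = distr lborel borel T"
    using lborel_affine_euclidean[of "\<lambda>j. if j = (1, 0) then c1 else c2" "(a, b)", OF cz]
    unfolding p T_def[symmetric] by (simp add: density_1)
  have m: "T \<in> borel_measurable lborel"
    unfolding ext[of T, OF T] by (subst measurable_lborel2) (intro borel_measurable_continuous_onI continuous_intros)
  have "AE p in lborel. P (T p)"
    by (rule AE_distrD[OF m]) (subst D[symmetric], rule P)
  then show ?thesis by (simp add: T)
qed

lemma sqnorm_nonneg [simp]: "0 \<le> sqnorm \<xi>"
  by (simp add: sqnorm_def)

lemma inverse_sqnorm_summable: "(\<lambda>\<xi>. (1 / (1 + sqnorm \<xi>))\<^sup>2) summable_on UNIV"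
proof -
  have "(\<lambda>\<xi>. 16 * (1 / (1 + 1 * sz \<xi>)\<^sup>2)\<^sup>2) summable_on UNIV"
    by (intro summable_on_cmult_right decay_summable) simp
  then show ?thesis
  proof (rule summable_on_comparison_test)
    fix \<xi>
    define x y :: real where "x = \<bar>of_int (fst \<xi>)\<bar>" and "y = \<bar>of_int (snd \<xi>)\<bar>"
    have "(1 + (x + y))\<^sup>2 \<le> 4 * (1 + (x\<^sup>2 + y\<^sup>2))"
    proof -
      have "1 + X + Y + 2 * x + 2 * y + P \<le> 4 + 4 * X + 4 * Y"
        if "P \<le> X + Y" "2 * x \<le> X + 1" "2 * y \<le> Y + 1" "0 \<le> X" "0 \<le> Y" for X Y P
        using that by linarith
      from this[of "2 * x * y" "x\<^sup>2" "y\<^sup>2"] show ?thesis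
        using sum_squares_bound[of x y] sum_squares_bound[of x 1] sum_squares_bound[of y 1]
        by (simp add: power2_sum distrib_left)
    qed
    then have le: "(1 + sz \<xi>)\<^sup>2 \<le> 4 * (1 + sqnorm \<xi>)"
      by (simp add: sz_def sqnorm_def x_def y_def)
    have p: "0 < (1 + sz \<xi>)\<^sup>2" "0 < 1 + sqnorm \<xi>"
      using sz_nonneg[of \<xi>] sqnorm_nonneg[of \<xi>] by (auto intro!: zero_less_power add_pos_nonneg simp del: sz_nonneg sqnorm_nonneg)
    have "1 / (1 + sqnorm \<xi>) \<le> 4 * (1 / (1 + sz \<xi>)\<^sup>2)"
      using le p by (simp add: field_simps)
    then have "(1 / (1 + sqnorm \<xi>))\<^sup>2 \<le> (4 * (1 / (1 + sz \<xi>)\<^sup>2))\<^sup>2"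
      using p by (intro power_mono) auto
    then show "(1 / (1 + sqnorm \<xi>))\<^sup>2 \<le> 16 * (1 / (1 + 1 * sz \<xi>)\<^sup>2)\<^sup>2"
      by (simp only: power_mult_distrib mult_1) simp
  qed simp
qed

text \<open>From 2 x y <= x^2 + y^2 with \<open>y = 1 / (1 + sqnorm \<xi>)\<close>, whose square is
  summable on the plane lattice: two extra orders of regularity buy absolute convergence.\<close>

lemma sobolev_abs_summable:
  assumes u: "u \<in> sobolev r" and r: "2 * p + 2 \<le> r"
  shows "abs_summable (\<lambda>\<xi>. of_real ((1 + sqnorm \<xi>) ^ p) * fourier_coeff u \<xi>)"
proof -
  have "(\<lambda>\<xi>. (1 + sqnorm \<xi>) ^ r * (norm (fourier_coeff u \<xi>))\<^sup>2 + (1 / (1 + sqnorm \<xi>))\<^sup>2) summable_on UNIV"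
    using u by (intro summable_on_add inverse_sqnorm_summable) (simp add: sobolev_def)
  then show ?thesis
  proof (rule summable_on_comparison_test)
    fix \<xi>
    define q c where "q = 1 + sqnorm \<xi>" and "c = norm (fourier_coeff u \<xi>)"
    have q: "1 \<le> q" and c: "0 \<le> c" by (simp_all add: q_def c_def)
    have "2 * (q ^ p * c) = 2 * (q ^ (p + 1) * c) * (1 / q)"
      using q by simp
    also have "\<dots> \<le> (q ^ (p + 1) * c)\<^sup>2 + (1 / q)\<^sup>2"
      using sum_squares_bound[of "q ^ (p + 1) * c" "1 / q"] by simp
    also have "(q ^ (p + 1) * c)\<^sup>2 = q ^ (2 * p + 2) * c\<^sup>2"
      unfolding power_mult_distrib power_mult[symmetric] by (simp only: add_mult_distrib mult_1 mult.commute[of p])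
    also have "\<dots> \<le> q ^ r * c\<^sup>2"
      using q r by (intro mult_right_mono power_increasing) auto
    finally have "q ^ p * c \<le> q ^ r * c\<^sup>2 + (1 / q)\<^sup>2"
      using mult_nonneg_nonneg[of "q ^ p" c] q c zero_le_power[of q p] by linarith
    then show "norm (of_real ((1 + sqnorm \<xi>) ^ p) * fourier_coeff u \<xi>) \<le>
        (1 + sqnorm \<xi>) ^ r * (norm (fourier_coeff u \<xi>))\<^sup>2 + (1 / (1 + sqnorm \<xi>))\<^sup>2"
      using q by (simp add: q_def[symmetric] c_def[symmetric] norm_mult norm_power)
  qed simp
qed

lemma sobolev_coeff_summable: "u \<in> sobolev r \<Longrightarrow> 2 \<le> r \<Longrightarrow> abs_summable (fourier_coeff u)"
  using sobolev_abs_summable[of u r 0] by simp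

lemma sobolev_integrable:
  assumes u: "u \<in> sobolev r"
  shows "set_integrable lborel cell (\<lambda>x. u x * cnj (fourier_char \<eta> x))"
proof -
  have [measurable]: "u \<in> borel_measurable borel" using u by (simp add: sobolev_def)
  have [measurable]: "(\<lambda>x. cnj (fourier_char \<eta> x)) \<in> borel_measurable borel"
    by (intro borel_measurable_continuous_onI continuous_on_cnj continuous_fourier_char)
  have "set_integrable lborel cell (\<lambda>x. (norm (u x))\<^sup>2 + 1)"
    using u set_integrable_cell_continuous[of "\<lambda>_. 1 :: real"] by (intro set_integral_add) (auto simp: sobolev_def)
  then show ?thesis
  proof (rule set_integrable_bound)
    show "set_borel_measurable lborel cell (\<lambda>x. u x * cnj (fourier_char \<eta> x))"
      unfolding set_borel_measurable_def by measurable
    have "norm (u x * cnj (fourier_char \<eta> x)) \<le> norm ((norm (u x))\<^sup>2 + 1)" for x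
      proof -
      have "2 * norm (u x) \<le> (norm (u x))\<^sup>2 + 1" using sum_squares_bound[of "norm (u x)" 1] by simp
      then have "norm (u x) \<le> (norm (u x))\<^sup>2 + 1" using norm_ge_zero[of "u x"] by linarith
      then show ?thesis by (simp add: norm_mult fourier_char_simps)
    qed
    then show "AE x in lborel. x \<in> cell \<longrightarrow> norm (u x * cnj (fourier_char \<eta> x)) \<le> norm ((norm (u x))\<^sup>2 + 1)"
      by simp
  qed
qed

lemma trig_measurable: "abs_summable c \<Longrightarrow> trig c \<in> borel_measurable borel"
  by (intro borel_measurable_continuous_onI trig_props)

lemma trig_integrable: "abs_summable c \<Longrightarrow> set_integrable lborel cell (\<lambda>x. trig c x * cnj (fourier_char \<eta> x))"
  by (intro set_integrable_cell_continuous continuous_on_mult trig_props continuous_on_cnj continuous_fourier_char)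

lemma multiplier_trig: "multiplier m u = trig (\<lambda>\<xi>. m \<xi> * fourier_coeff u \<xi>)"
  by (simp add: fun_eq_iff multiplier_def trig_def)

lemma abs_summable_bounded_mult:
  fixes c :: "'a \<Rightarrow> complex"
  assumes "abs_summable c" "\<And>\<xi>. norm (m \<xi>) \<le> B"
  shows "abs_summable (\<lambda>\<xi>. m \<xi> * c \<xi>)"
  by (rule summable_on_comparison_test[OF summable_on_cmult_right[OF assms(1), of B]])
     (auto simp: norm_mult intro!: mult_right_mono assms(2))

lemma fourier_coeff_ops:
  assumes u: "u \<in> sobolev r" and r: "2 \<le> r"
  shows "fourier_coeff (A_op k u) \<xi> = of_real (1 - (1 + (real k)\<^sup>2) / (1 + sqnorm \<xi>)) * fourier_coeff u \<xi>"
    and "\<xi> \<noteq> (0, 0) \<Longrightarrow> fourier_coeff (B_op k u) \<xi> = of_real ((1 + (real k)\<^sup>2) / sqnorm \<xi>) * fourier_coeff u \<xi>"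
    and "fourier_coeff (B_op k u) (0, 0) = 0"
    and "A_op k u \<in> borel_measurable borel" and "B_op k u \<in> borel_measurable borel"
proof -
  have [measurable]: "u \<in> borel_measurable borel" using u by (simp add: sobolev_def)
  note s = sobolev_coeff_summable[OF u r]
  have q: "\<xi> \<noteq> (0, 0) \<Longrightarrow> 1 \<le> sqnorm \<xi>" for \<xi>
  proof -
    assume "\<xi> \<noteq> (0, 0)"
    then have "(fst \<xi>)\<^sup>2 + (snd \<xi>)\<^sup>2 > 0" by (cases \<xi>) (auto simp: sum_power2_gt_zero_iff)
    then have "(fst \<xi>)\<^sup>2 + (snd \<xi>)\<^sup>2 \<ge> 1" by linarith
    then have "real_of_int ((fst \<xi>)\<^sup>2 + (snd \<xi>)\<^sup>2) \<ge> 1" by linarith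
    then show ?thesis by (simp add: sqnorm_def)
  qed
  define a where "a \<xi> = 1 / complex_of_real (1 + sqnorm \<xi>) * fourier_coeff u \<xi>" for \<xi>
  define b where "b \<xi> = (if \<xi> = (0, 0) then 0 else - 1 / complex_of_real (sqnorm \<xi>)) * fourier_coeff u \<xi>" for \<xi>
  have "norm (1 / complex_of_real (1 + sqnorm \<xi>)) \<le> 1" for \<xi>
    unfolding norm_divide norm_of_real using sqnorm_nonneg[of \<xi>] by (simp add: divide_le_eq)
  then have a: "abs_summable a" unfolding a_def by (intro abs_summable_bounded_mult[OF s, where B = 1])
  have "norm (if \<xi> = (0, 0) then 0 else - 1 / complex_of_real (sqnorm \<xi>)) \<le> 1" for \<xi>
    using q[of \<xi>] by (auto simp: norm_divide divide_le_eq)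
  then have b: "abs_summable b" unfolding b_def by (intro abs_summable_bounded_mult[OF s, where B = 1])
  have A: "A_op k u = (\<lambda>x. u x + (- of_real (1 + (real k)\<^sup>2)) * trig a x)"
    unfolding A_op_def[abs_def] inv_one_minus_laplace_def multiplier_trig a_def[symmetric] by (simp only: mult_minus_left add_uminus_conv_diff)
  have B: "B_op k u = (\<lambda>x. (- of_real (1 + (real k)\<^sup>2)) * trig b x)"
    unfolding B_op_def[abs_def] inv_laplace_def multiplier_trig b_def ..
  have i: "set_integrable lborel cell (\<lambda>x. - of_real (1 + (real k)\<^sup>2) * trig a x * cnj (fourier_char \<xi> x))"
    unfolding mult.assoc by (intro set_integrable_mult_right) (rule trig_integrable[OF a, unfolded mult.assoc])
  have "1 + sqnorm \<xi> \<noteq> 0" using sqnorm_nonneg[of \<xi>] by linarith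
  then show "fourier_coeff (A_op k u) \<xi> = of_real (1 - (1 + (real k)\<^sup>2) / (1 + sqnorm \<xi>)) * fourier_coeff u \<xi>"
    unfolding A fourier_coeff_add[OF sobolev_integrable[OF u] i] fourier_coeff_cmult trig_props[OF a]
    by (simp add: a_def left_diff_distrib minus_divide_left[symmetric] del: of_real_add of_real_1 of_real_power)
  show "\<xi> \<noteq> (0, 0) \<Longrightarrow> fourier_coeff (B_op k u) \<xi> = of_real ((1 + (real k)\<^sup>2) / sqnorm \<xi>) * fourier_coeff u \<xi>"
    "fourier_coeff (B_op k u) (0, 0) = 0"
    unfolding B fourier_coeff_cmult trig_props[OF b] by (simp_all add: b_def del: of_real_add of_real_1 of_real_power)
  note [measurable] = trig_measurable[OF a] trig_measurable[OF b]
  show "A_op k u \<in> borel_measurable borel" "B_op k u \<in> borel_measurable borel"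
    unfolding A B by measurable
qed

lemma trig_shift:
  assumes "abs_summable c"
  shows "fourier_char \<zeta> x * trig c x = trig (\<lambda>\<xi>. c (\<xi> - \<zeta>)) x" "abs_summable (\<lambda>\<xi>. c (\<xi> - \<zeta>))"
proof -
  have bij: "bij_betw (\<lambda>\<xi>. \<xi> - \<zeta>) UNIV UNIV" by (rule bij_betwI[where g = "\<lambda>\<xi>. \<xi> + \<zeta>"]) auto
  show "abs_summable (\<lambda>\<xi>. c (\<xi> - \<zeta>))"
    using summable_on_reindex_bij_betw[OF bij, of "\<lambda>\<xi>. norm (c \<xi>)"] assms by simp
  have e: "c (\<xi> - \<zeta>) * fourier_char \<xi> x = fourier_char \<zeta> x * (c (\<xi> - \<zeta>) * fourier_char (\<xi> - \<zeta>) x)" for \<xi>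
    using fourier_char_simps(4)[of \<zeta> "\<xi> - \<zeta>" x] by simp
  show "fourier_char \<zeta> x * trig c x = trig (\<lambda>\<xi>. c (\<xi> - \<zeta>)) x"
    unfolding trig_def e infsum_cmult_right'
    by (subst infsum_reindex_bij_betw[OF bij, of "\<lambda>\<xi>. c \<xi> * fourier_char \<xi> x"]) (rule refl)
qed

lemma trig_cos:
  assumes c: "abs_summable c"
  shows "\<exists>d. abs_summable d \<and> (\<forall>x. of_real (r * cos (real k * fst x)) * trig c x = trig d x)"
proof -
  let ?z = "(int k, 0 :: int)"
  note t = trig_shift[OF c, of ?z] trig_shift[OF c, of "- ?z"]
  have s: "abs_summable (\<lambda>\<xi>. c (\<xi> - ?z) + c (\<xi> - - ?z))"
    by (rule summable_on_comparison_test[OF summable_on_add[OF t(2) t(4)]]) (auto intro: norm_triangle_ineq)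
  have "of_real (r * cos (real k * fst x)) * trig c x = trig (\<lambda>\<xi>. of_real (r / 2) * (c (\<xi> - ?z) + c (\<xi> - - ?z))) x" for x
  proof -
    have "of_real (r * cos (real k * fst x)) = of_real (r / 2) * (fourier_char ?z x + fourier_char (- ?z) x)"
      by (simp add: fourier_char_def complex_eq_iff)
    then show ?thesis
      unfolding trig_cmult trig_add[OF t(2) t(4)] t(1,3)[symmetric] by (simp add: algebra_simps)
  qed
  moreover have "abs_summable (\<lambda>\<xi>. of_real (r / 2) * (c (\<xi> - ?z) + c (\<xi> - - ?z)))"
    by (rule abs_summable_bounded_mult[OF s]) (rule order_refl)
  ultimately show ?thesis by (intro exI[of _ "\<lambda>\<xi>. of_real (r / 2) * (c (\<xi> - ?z) + c (\<xi> - - ?z))"]) blast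
qed

text \<open>
  No inversion theorem for Fourier series is needed for eigenfunctions: the eigenvalue equation itself
  expresses \<open>U\<close> as an absolutely convergent series.
\<close>

lemma eigenfunction_trig:
  assumes U: "U \<in> X_space s" and s: "4 \<le> s" and l: "l \<noteq> 0" and e: "lin_op k U \<doteq> (\<lambda>x. l *\<^sub>R U x)"
  shows "abs_summable (fourier_coeff (vort U))" "abs_summable (fourier_coeff (flux U))"
    "U \<doteq> (\<lambda>x. (trig (fourier_coeff (vort U)) x, trig (fourier_coeff (flux U)) x))"
    "\<And>x. lin_op k U x = lin_op k (\<lambda>x. (trig (fourier_coeff (vort U)) x, trig (fourier_coeff (flux U)) x)) x"
proof -
  have w: "vort U \<in> sobolev (s - 1)" and F: "flux U \<in> sobolev s"
    using U by (auto simp: X_space_def sobolev0_def)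
  have r: "2 \<le> s - 1" "2 \<le> s" "2 * 1 + 2 \<le> s" using s by auto
  show sw: "abs_summable (fourier_coeff (vort U))" and sF: "abs_summable (fourier_coeff (flux U))"
    by (rule sobolev_coeff_summable[OF w r(1)], rule sobolev_coeff_summable[OF F r(2)])
  note fw = fourier_coeff_ops[OF w r(1), where k = k] and fF = fourier_coeff_ops[OF F r(2), where k = k]
  have n2: "\<bar>real_of_int (snd \<xi>)\<bar> \<le> sqnorm \<xi>" for \<xi>
  proof -
    have "\<bar>snd \<xi>\<bar> \<le> (snd \<xi>)\<^sup>2"
    proof (cases "snd \<xi> = 0")
      case False
      then have "\<bar>snd \<xi>\<bar> * 1 \<le> \<bar>snd \<xi>\<bar> * \<bar>snd \<xi>\<bar>" by (intro mult_left_mono) linarith+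
      then show ?thesis by (simp only: power2_eq_square abs_mult_self_eq mult_1_right)
    qed simp
    then have "real_of_int \<bar>snd \<xi>\<bar> \<le> real_of_int ((snd \<xi>)\<^sup>2)" by (simp only: of_int_le_iff)
    then show ?thesis by (simp add: sqnorm_def add_increasing)
  qed
  have dA: "abs_summable (\<lambda>\<xi>. \<i> * of_int (snd \<xi>) * fourier_coeff (A_op k (flux U)) \<xi>)"
  proof (rule summable_on_comparison_test[OF summable_on_cmult_right[OF sobolev_abs_summable[OF F r(3)], of "2 + (real k)\<^sup>2"]])
    fix \<xi>
    have q: "0 \<le> (1 + (real k)\<^sup>2) / (1 + sqnorm \<xi>)" "(1 + (real k)\<^sup>2) / (1 + sqnorm \<xi>) \<le> 1 + (real k)\<^sup>2"
    proof -
      have "(1 + (real k)\<^sup>2) / (1 + sqnorm \<xi>) \<le> (1 + (real k)\<^sup>2) / 1"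
        using sqnorm_nonneg[of \<xi>] by (intro divide_left_mono) (simp_all add: add_pos_nonneg)
      then show "(1 + (real k)\<^sup>2) / (1 + sqnorm \<xi>) \<le> 1 + (real k)\<^sup>2" by simp
    qed (simp add: add_nonneg_nonneg)
    have "\<bar>1 - (1 + (real k)\<^sup>2) / (1 + sqnorm \<xi>)\<bar> \<le> 2 + (real k)\<^sup>2"
      using q by (intro abs_leI) linarith+
    then have "\<bar>of_int (snd \<xi>)\<bar> * \<bar>1 - (1 + (real k)\<^sup>2) / (1 + sqnorm \<xi>)\<bar> \<le> (1 + sqnorm \<xi>) * (2 + (real k)\<^sup>2)"
      using n2[of \<xi>] by (intro mult_mono) auto
    then have "\<bar>of_int (snd \<xi>)\<bar> * \<bar>1 - (1 + (real k)\<^sup>2) / (1 + sqnorm \<xi>)\<bar> * norm (fourier_coeff (flux U) \<xi>) \<le>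
       (1 + sqnorm \<xi>) * (2 + (real k)\<^sup>2) * norm (fourier_coeff (flux U) \<xi>)"
      by (rule mult_right_mono) simp
    then show "norm (\<i> * of_int (snd \<xi>) * fourier_coeff (A_op k (flux U)) \<xi>) \<le>
       (2 + (real k)\<^sup>2) * norm (of_real ((1 + sqnorm \<xi>) ^ 1) * fourier_coeff (flux U) \<xi>)"
      unfolding fF norm_mult norm_of_real power_one_right using sqnorm_nonneg[of \<xi>] by (simp add: mult_ac)
  qed simp
  have dB: "abs_summable (\<lambda>\<xi>. \<i> * of_int (snd \<xi>) * fourier_coeff (B_op k (vort U)) \<xi>)"
  proof (rule summable_on_comparison_test[OF summable_on_cmult_right[OF sw, of "1 + (real k)\<^sup>2"]])
    fix \<xi>
    show "norm (\<i> * of_int (snd \<xi>) * fourier_coeff (B_op k (vort U)) \<xi>) \<le> (1 + (real k)\<^sup>2) * norm (fourier_coeff (vort U) \<xi>)"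
    proof (cases "\<xi> = (0, 0)")
      case False
      have "\<bar>of_int (snd \<xi>)\<bar> * ((1 + (real k)\<^sup>2) / sqnorm \<xi>) \<le> 1 + (real k)\<^sup>2"
      proof (cases "sqnorm \<xi> = 0")
        case False
        then have "0 < sqnorm \<xi>" using sqnorm_nonneg[of \<xi>] by linarith
        then have "\<bar>real_of_int (snd \<xi>)\<bar> / sqnorm \<xi> \<le> 1" using n2[of \<xi>] by simp
        from mult_right_mono[OF this, of "1 + (real k)\<^sup>2"] show ?thesis by simp
      qed simp
      from mult_right_mono[OF this, of "norm (fourier_coeff (vort U) \<xi>)"]
      show ?thesis unfolding fw(2)[OF False] norm_mult norm_of_real by (simp add: mult_ac)
    qed (simp add: fw)
  qed simp
  have d2: "d2 u = trig (\<lambda>\<xi>. \<i> * of_int (snd \<xi>) * fourier_coeff u \<xi>)" for u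
    by (simp add: d2_def multiplier_trig)
  obtain dw dF where d: "abs_summable dw" "\<And>x. of_real (- real k / l * cos (real k * fst x)) * d2 (A_op k (flux U)) x = trig dw x"
    "abs_summable dF" "\<And>x. of_real (- real k / l * cos (real k * fst x)) * d2 (B_op k (vort U)) x = trig dF x"
    unfolding d2 using trig_cos[OF dA] trig_cos[OF dB] by metis
  have eqU: "U \<doteq> (\<lambda>x. (trig dw x, trig dF x))"
    unfolding ae_eq_def
  proof (rule AE_mp[OF e[unfolded ae_eq_def]], rule AE_I2, rule impI)
    fix x assume "lin_op k U x = l *\<^sub>R U x"
    then have "U x = (1 / l) *\<^sub>R lin_op k U x" using l by simp
    also have "\<dots> = (trig dw x, trig dF x)"
      unfolding d(2,4)[symmetric] using l by (simp add: lin_op_def scaleR_conv_of_real)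
    finally show "U x = (trig dw x, trig dF x)" .
  qed
  have ew: "AE x in lborel. vort U x = trig dw x" and eF: "AE x in lborel. flux U x = trig dF x"
    using eqU by (auto simp: ae_eq_def vort_def flux_def elim!: AE_mp)
  have m: "vort U \<in> borel_measurable borel" "flux U \<in> borel_measurable borel"
    using w F by (auto simp: sobolev_def)
  have c: "fourier_coeff (vort U) = dw" "fourier_coeff (flux U) = dF"
    using fourier_coeff_cong_AE[OF ew m(1) trig_measurable[OF d(1)]] fourier_coeff_cong_AE[OF eF m(2) trig_measurable[OF d(3)]]
    by (auto simp: trig_props d(1,3) fun_eq_iff)
  show U': "U \<doteq> (\<lambda>x. (trig (fourier_coeff (vort U)) x, trig (fourier_coeff (flux U)) x))"
    unfolding c by (rule eqU)
  define V where "V = (\<lambda>x. (trig dw x, trig dF x))"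
  have V: "vort V = trig dw" "flux V = trig dF" by (simp_all add: V_def vort_def flux_def fun_eq_iff)
  have cc: "fourier_coeff (vort U) = fourier_coeff (trig dw)" "fourier_coeff (flux U) = fourier_coeff (trig dF)"
    by (auto simp: c trig_props d(1,3) fun_eq_iff)
  have mm: "multiplier m (vort U) = multiplier m (vort V)" "multiplier m (flux U) = multiplier m (flux V)" for m
    by (simp_all add: multiplier_trig V cc)
  have "d2 (B_op k (vort U)) = d2 (B_op k (vort V))"
    by (simp add: B_op_def[abs_def] inv_laplace_def mm)
  \<comment> \<open>\<open>A_op\<close> contains its argument itself and so agrees only almost
    everywhere; \<open>d2\<close> sees only Fourier coefficients and restores equality
    everywhere.\<close>
  moreover have "d2 (A_op k (flux U)) = d2 (A_op k (flux V))"
  proof -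
    have A: "A_op k (flux V) = (\<lambda>x. trig dF x - of_real (1 + (real k)\<^sup>2) * inv_one_minus_laplace (flux U) x)"
      by (simp add: A_op_def[abs_def] inv_one_minus_laplace_def mm V)
    have "inv_one_minus_laplace (flux U) \<in> borel_measurable borel"
    proof -
      have "abs_summable (\<lambda>\<xi>. 1 / complex_of_real (1 + sqnorm \<xi>) * fourier_coeff (flux U) \<xi>)"
        by (rule abs_summable_bounded_mult[OF sF, where B = 1]) (simp only: norm_divide norm_of_real, simp add: divide_le_eq)
      then show ?thesis unfolding inv_one_minus_laplace_def multiplier_trig by (rule trig_measurable)
    qed
    note [measurable] = this trig_measurable[OF d(3)]
    have "fourier_coeff (A_op k (flux U)) \<xi> = fourier_coeff (A_op k (flux V)) \<xi>" for \<xi>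
    proof (rule fourier_coeff_cong_AE[OF _ fF(4)])
      show "AE x in lborel. A_op k (flux U) x = A_op k (flux V) x"
        using eF by (auto simp: A A_op_def elim!: AE_mp)
      show "A_op k (flux V) \<in> borel_measurable borel" unfolding A by measurable
    qed
    then show ?thesis by (simp add: d2)
  qed
  ultimately show "lin_op k U x = lin_op k (\<lambda>x. (trig (fourier_coeff (vort U)) x, trig (fourier_coeff (flux U)) x)) x" for x
    unfolding c V_def[symmetric] lin_op_def by simp
qed

context wave
begin

lemma TS_unique:
  assumes "abs_summable a" "abs_summable b" "AE x in lborel. TS a x = TS b x"
  shows "a = b"
proof
  fix \<xi>
  have "lift a = lift b"
    using assms unfolding TS_def by (intro trig_unique abs_summable_lift)
  then have "phase \<xi> * a \<xi> = phase \<xi> * b \<xi>" by (metis lift_emb)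
  then show "a \<xi> = b \<xi>" by simp
qed

text \<open>Translation by \<open>2 * pi / k\<close> multiplies each coefficient by
  \<open>z\<close>, which is 1 only when \<open>k\<close> divides the first index; uniqueness of
  coefficients kills the others.\<close>

lemma periodic_lift:
  assumes c: "abs_summable c" and p: "AE (x, y) in lborel. trig c (x + 2*pi / real k, y) = trig c (x, y)"
  shows "c = lift (\<lambda>\<xi>. cnj (phase \<xi>) * c (emb \<xi>))"
proof
  fix \<xi>
  define z where "z \<xi> = cis (of_int (fst \<xi>) * (2 * pi / real k))" for \<xi> :: "int \<times> int"
  have k0: "real k \<noteq> 0" using k by simp
  have "fourier_char \<eta> (x + 2*pi / real k, y) = z \<eta> * fourier_char \<eta> (x, y)" for \<eta> x y
    by (simp add: fourier_char_def z_def cis_mult algebra_simps)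
  then have t: "trig c (x + 2*pi / real k, y) = trig (\<lambda>\<xi>. z \<xi> * c \<xi>) (x, y)" for x y
    by (simp add: trig_def mult_ac)
  have "abs_summable (\<lambda>\<xi>. z \<xi> * c \<xi>)"
    by (rule abs_summable_bounded_mult[OF c, where B = 1]) (simp add: z_def)
  then have eq: "(\<lambda>\<xi>. z \<xi> * c \<xi>) = c"
    by (rule trig_unique[OF _ c]) (use p in \<open>simp add: t split_beta'\<close>)
  show "c \<xi> = lift (\<lambda>\<xi>. cnj (phase \<xi>) * c (emb \<xi>)) \<xi>"
  proof (cases "\<xi> \<in> range emb")
    case True
    then obtain \<eta> where "\<xi> = emb \<eta>" by blast
    moreover have "phase \<eta> * cnj (phase \<eta>) = 1" by (simp add: phase_def cis_cnj cis_mult)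
    ultimately show ?thesis by (simp add: lift_emb mult.assoc[symmetric])
  next
    case False
    have "z \<xi> \<noteq> 1"
    proof
      assume "z \<xi> = 1"
      then have "cos (of_int (fst \<xi>) * (2 * pi / real k)) = 1" by (simp add: z_def complex_eq_iff)
      then obtain i :: int where "of_int (fst \<xi>) * (2 * pi / real k) = of_int i * 2 * pi"
        unfolding cos_one_2pi_int by blast
      then have "real_of_int (fst \<xi>) = of_int (int k * i)" using k0 by (simp add: field_simps)
      then have "fst \<xi> = int k * i" by (simp only: of_int_eq_iff)
      then have "\<xi> = emb (i, snd \<xi>)" by (simp add: emb_def prod_eq_iff)
      then show False using False by blast
    qed
    then have "c \<xi> = 0" using fun_cong[OF eq, of \<xi>] by simp
    then show ?thesis using lift_outside[OF False] by simp
  qed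
qed

text \<open>Unlike \<open>lin_op_RS\<close> it asks only for the decay that membership in the
  Sobolev spaces gives directly: the analyticity of the eigenfunction is a later
  consequence.\<close>

lemma lin_op_TS:
  assumes a: "abs_summable (\<lambda>\<xi>. of_real (1 + (rad \<xi>)\<^sup>2) * a \<xi>)" and b: "abs_summable b"
    and P_def: "P = (\<lambda>\<xi>. of_real (asym \<xi>) * a \<xi>)" and Q_def: "Q = (\<lambda>\<xi>. of_real (cc / (rad \<xi>)\<^sup>2) * b \<xi>)"
  shows "lin_op k (\<lambda>x. (TS b x, TS a x)) x =
     (TS (\<lambda>\<xi>. of_real (real k / 2 * of_int (snd \<xi>)) * (P (sh (- 1) \<xi>) - P (sh 1 \<xi>))) x,
      TS (\<lambda>\<xi>. of_real (real k / 2 * of_int (snd \<xi>)) * (Q (sh (- 1) \<xi>) - Q (sh 1 \<xi>))) x)"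
    and "abs_summable (\<lambda>\<xi>. of_real (real k / 2 * of_int (snd \<xi>)) * (P (sh (- 1) \<xi>) - P (sh 1 \<xi>)))"
    and "abs_summable (\<lambda>\<xi>. of_real (real k / 2 * of_int (snd \<xi>)) * (Q (sh (- 1) \<xi>) - Q (sh 1 \<xi>)))"
proof -
  have n: "\<bar>of_int (snd \<xi>)\<bar> \<le> (rad \<xi>)\<^sup>2" for \<xi>
  proof -
    have "\<bar>of_int (snd \<xi>)\<bar> \<le> rad \<xi>" by (rule rad_ge)
    also have "rad \<xi> \<le> (rad \<xi>)\<^sup>2"
      using rad_zero_or_ge1[of \<xi>] by (auto simp: power2_eq_square)
    finally show ?thesis .
  qed
  have p1: "0 \<le> 1 + (rad \<xi>)\<^sup>2" "1 \<le> 1 + (rad \<xi>)\<^sup>2" for \<xi> by simp_all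
  have a0: "abs_summable a"
  proof (rule summable_on_comparison_test[OF a])
    show "norm (a \<xi>) \<le> norm (of_real (1 + (rad \<xi>)\<^sup>2) * a \<xi>)" for \<xi>
      using mult_right_mono[OF p1(2), of "norm (a \<xi>)" \<xi>] by (simp only: norm_mult norm_of_real abs_of_nonneg[OF p1(1)] norm_ge_zero mult_1)
  qed simp
  have P: "abs_summable P"
    unfolding P_def by (rule abs_summable_bounded_mult[OF a0, where B = cc]) (simp add: asym_bound)
  have dP: "abs_summable (\<lambda>\<xi>. \<i> * of_int (snd \<xi>) * P \<xi>)"
  proof (rule summable_on_comparison_test[OF summable_on_cmult_right[OF a, of cc]])
    fix \<xi>
    have "\<bar>of_int (snd \<xi>)\<bar> * (\<bar>asym \<xi>\<bar> * norm (a \<xi>)) \<le> (1 + (rad \<xi>)\<^sup>2) * (cc * norm (a \<xi>))"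
      using n[of \<xi>] asym_bound[of \<xi>] by (intro mult_mono mult_right_mono) auto
    then show "norm (\<i> * of_int (snd \<xi>) * P \<xi>) \<le> cc * norm (of_real (1 + (rad \<xi>)\<^sup>2) * a \<xi>)"
      unfolding P_def norm_mult norm_of_real abs_of_nonneg[OF p1(1)] by (simp add: mult_ac)
  qed simp
  have q: "\<bar>x / (rad \<xi>)\<^sup>2\<bar> \<le> B" if "\<bar>x\<bar> \<le> B * (rad \<xi>)\<^sup>2" "0 \<le> B" for x B \<xi>
    using that by (cases "rad \<xi> = 0") (auto simp: divide_le_eq)
  have il: "norm (1 / (rad \<xi>)\<^sup>2) \<le> 1" for \<xi>
    using rad_zero_or_ge1[of \<xi>] by (auto simp: divide_le_eq)
  have dQ: "abs_summable (\<lambda>\<xi>. \<i> * of_int (snd \<xi>) * Q \<xi>)"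
  proof -
    have "norm (of_real (of_int (snd \<xi>) * cc / (rad \<xi>)\<^sup>2) :: complex) \<le> cc" for \<xi>
      unfolding norm_of_real using n[of \<xi>] cc_ge by (intro q) (auto simp: abs_mult mult.commute)
    from abs_summable_bounded_mult[OF b this] have "abs_summable (\<lambda>\<xi>. of_real (of_int (snd \<xi>) * cc / (rad \<xi>)\<^sup>2) * b \<xi>)" .
    then show ?thesis by (simp add: Q_def norm_mult norm_divide mult_ac)
  qed
  define V where "V = (\<lambda>x. (TS b x, TS a x))"
  have V: "vort V = TS b" "flux V = TS a" by (simp_all add: V_def vort_def flux_def)
  have A: "A_op k (TS a) = TS P"
  proof
    fix x
    define a' where "a' \<xi> = 1 / complex_of_real (1 + (rad \<xi>)\<^sup>2) * a \<xi>" for \<xi>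
    have "norm (1 / complex_of_real (1 + (rad \<xi>)\<^sup>2)) \<le> 1" for \<xi>
    proof -
      have "1 / (1 + (rad \<xi>)\<^sup>2) \<le> 1 / 1" by (intro divide_left_mono) (simp_all add: add_pos_nonneg)
      then show ?thesis by (simp only: norm_divide norm_of_real abs_of_nonneg[OF p1(1)] norm_one div_by_1)
    qed
    then have a': "abs_summable (\<lambda>\<xi>. of_real cc * a' \<xi>)" unfolding norm_mult a'_def
      using abs_summable_bounded_mult[OF a0, of "\<lambda>\<xi>. 1 / complex_of_real (1 + (rad \<xi>)\<^sup>2)" 1]
      by (intro summable_on_cmult_right) (simp only: norm_mult)
    have "A_op k (TS a) x = TS a x - of_real cc * TS a' x"
      unfolding A_op_def inv_one_minus_laplace_def TS_multiplier[OF a0] sqnorm_emb a'_def cc_def ..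
    also have "\<dots> = TS (\<lambda>\<xi>. a \<xi> - of_real cc * a' \<xi>) x"
      unfolding TS_diff[OF a0 a'] TS_cmult ..
    also have "(\<lambda>\<xi>. a \<xi> - of_real cc * a' \<xi>) = P"
      by (auto simp: P_def asym_def a'_def left_diff_distrib)
    finally show "A_op k (TS a) x = TS P x" .
  qed
  have B: "B_op k (TS b) = TS Q"
  proof
    fix x
    have e: "- of_real cc * ((if emb \<xi> = (0, 0) then 0 else - 1 / complex_of_real (sqnorm (emb \<xi>))) * b \<xi>) = Q \<xi>" for \<xi>
      by (auto simp: Q_def emb_zero sqnorm_emb)
    show "B_op k (TS b) x = TS Q x"
      unfolding B_op_def inv_laplace_def TS_multiplier[OF b] cc_def[symmetric] TS_cmult[symmetric] e ..
  qed
  have Q: "abs_summable Q"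
  proof -
    have "norm (complex_of_real (cc / (rad \<xi>)\<^sup>2)) \<le> cc" for \<xi>
      using il[of \<xi>] cc_ge mult_left_mono[OF il[of \<xi>], of cc] by (simp add: norm_divide norm_power)
    then show ?thesis unfolding Q_def by (rule abs_summable_bounded_mult[OF b])
  qed
  have eq: "of_real (real k / 2) * (\<i> * of_int (snd (sh (- 1) \<xi>)) * R (sh (- 1) \<xi>) - \<i> * of_int (snd (sh 1 \<xi>)) * R (sh 1 \<xi>)) / \<i> =
      of_real (real k / 2 * of_int (snd \<xi>)) * (R (sh (- 1) \<xi>) - R (sh 1 \<xi>))" for R :: "freq \<Rightarrow> complex" and \<xi>
    by (simp add: sh_def algebra_simps add_divide_distrib diff_divide_distrib)
  have d2: "d2 (TS R) = TS (\<lambda>\<xi>. \<i> * of_int (snd \<xi>) * R \<xi>)" if "abs_summable R" for R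
    by (simp add: d2_def TS_multiplier[OF that] emb_def)
  note c = cos_TS[OF dP, unfolded eq] cos_TS[OF dQ, unfolded eq]
  show "lin_op k (\<lambda>x. (TS b x, TS a x)) x =
     (TS (\<lambda>\<xi>. of_real (real k / 2 * of_int (snd \<xi>)) * (P (sh (- 1) \<xi>) - P (sh 1 \<xi>))) x,
      TS (\<lambda>\<xi>. of_real (real k / 2 * of_int (snd \<xi>)) * (Q (sh (- 1) \<xi>) - Q (sh 1 \<xi>))) x)"
    unfolding V_def[symmetric] lin_op_def V A B d2[OF P] d2[OF Q] scaleR_Pair c(1,3) ..
  show "abs_summable (\<lambda>\<xi>. of_real (real k / 2 * of_int (snd \<xi>)) * (P (sh (- 1) \<xi>) - P (sh 1 \<xi>)))"
    "abs_summable (\<lambda>\<xi>. of_real (real k / 2 * of_int (snd \<xi>)) * (Q (sh (- 1) \<xi>) - Q (sh 1 \<xi>)))"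
    by (fact c(2), fact c(4))
qed

text \<open>The almost-everywhere symmetries pass to the continuous series and from there to the
  coefficients. The recursion is real, so real and imaginary parts solve it separately.\<close>

lemma eigenfunction_coeffs:
  assumes U: "U \<in> X_sym k s" and s: "4 \<le> s" and l: "l \<noteq> 0" and e: "lin_op k U \<doteq> (\<lambda>x. l *\<^sub>R U x)"
  obtains a b where "abs_summable a" "abs_summable b" "U \<doteq> (\<lambda>x. (TS b x, TS a x))"
    "fourier_coeff (vort U) = lift b" "fourier_coeff (flux U) = lift a"
    "\<And>\<xi>. a (- fst \<xi>, snd \<xi>) = a \<xi>" "\<And>\<xi>. a (fst \<xi>, - snd \<xi>) = a \<xi>"
    "\<And>\<xi>. b (- fst \<xi>, snd \<xi>) = - b \<xi>" "\<And>\<xi>. b (fst \<xi>, - snd \<xi>) = - b \<xi>"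
    "eig l (\<lambda>\<xi>. Re (a \<xi>)) (\<lambda>\<xi>. Re (b \<xi>) / rad \<xi>)" "eig l (\<lambda>\<xi>. Im (a \<xi>)) (\<lambda>\<xi>. Im (b \<xi>) / rad \<xi>)"
proof -
  have UX: "U \<in> X_space s" using U by (simp add: X_sym_def)
  note t = eigenfunction_trig[OF UX s l e]
  define cw cF where "cw = fourier_coeff (vort U)" and "cF = fourier_coeff (flux U)"
  define a b where "a \<xi> = cnj (phase \<xi>) * cF (emb \<xi>)" and "b \<xi> = cnj (phase \<xi>) * cw (emb \<xi>)" for \<xi>
  note t = t[folded cw_def cF_def]
  have eU: "AE p in lborel. U p = (trig cw p, trig cF p)" using t(3) by (simp add: ae_eq_def)
  \<comment> \<open>The series represents \<open>U\<close> only almost everywhere, so the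
    exceptional set is transported by each symmetry before values at reflected points are
    compared.\<close>
  note sh1 = AE_reflect[OF eU, of 1 1 "2*pi / real k" 0, simplified]
    AE_reflect[OF eU, of "- 1" 1 "pi / real k" 0, simplified] AE_reflect[OF eU, of 1 "- 1" 0 0, simplified]
  have sym: "AE p in lborel. U (fst p + 2*pi / real k, snd p) = U p \<and>
     vort U (pi / real k - fst p, snd p) = - vort U p \<and> flux U (pi / real k - fst p, snd p) = flux U p \<and>
     vort U (fst p, - snd p) = - vort U p \<and> flux U (fst p, - snd p) = flux U p"
    using U by (simp add: X_sym_def split_beta')
  have all: "AE p in lborel.
     (trig cw (fst p + 2*pi / real k, snd p) = trig cw p \<and> trig cF (fst p + 2*pi / real k, snd p) = trig cF p) \<and>
     (trig cw (pi / real k - fst p, snd p) = - trig cw p \<and> trig cF (pi / real k - fst p, snd p) = trig cF p) \<and>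
     (trig cw (fst p, - snd p) = - trig cw p \<and> trig cF (fst p, - snd p) = trig cF p)"
    using sym eU sh1 by eventually_elim (simp add: vort_def flux_def add.commute)
  have lw: "cw = lift b" unfolding b_def
    by (rule periodic_lift[OF t(1)]) (use all in \<open>auto simp: split_beta' elim!: AE_mp\<close>)
  have lF: "cF = lift a" unfolding a_def
    by (rule periodic_lift[OF t(2)]) (use all in \<open>auto simp: split_beta' elim!: AE_mp\<close>)
  have tw: "trig cw = TS b" and tF: "trig cF = TS a" by (simp_all add: TS_def lw lF)
  have sa: "abs_summable a" and sb: "abs_summable b"
    using t(1,2) unfolding lw lF by (simp_all add: abs_summable_lift_iff)
  have f: "abs_summable (\<lambda>\<xi>. c (- fst \<xi>, snd \<xi>))" "abs_summable (\<lambda>\<xi>. c (fst \<xi>, - snd \<xi>))"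
    if "abs_summable c" for c :: "freq \<Rightarrow> complex"
    using that summable_on_reindex_bij_betw[OF bij_betwI[where f = "\<lambda>\<xi>. (- fst \<xi>, snd \<xi>)" and g = "\<lambda>\<xi>. (- fst \<xi>, snd \<xi>)" and A = UNIV and B = UNIV], of "\<lambda>\<xi>. norm (c \<xi>)"]
      summable_on_reindex_bij_betw[OF bij_betwI[where f = "\<lambda>\<xi>. (fst \<xi>, - snd \<xi>)" and g = "\<lambda>\<xi>. (fst \<xi>, - snd \<xi>)" and A = UNIV and B = UNIV], of "\<lambda>\<xi>. norm (c \<xi>)"]
    by auto
  have sb': "abs_summable (\<lambda>\<xi>. - 1 * b \<xi>)" using sb by simp
  have TSm: "- TS b p = TS (\<lambda>\<xi>. - 1 * b \<xi>) p" for p unfolding TS_cmult by simp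
  have R: "TS (\<lambda>\<xi>. c (- fst \<xi>, snd \<xi>)) p = TS c (pi / real k - fst p, snd p)"
    "TS (\<lambda>\<xi>. c (fst \<xi>, - snd \<xi>)) p = TS c (fst p, - snd p)" for c p
    using TS_flip(2)[of c "fst p" "snd p"] TS_flip(3)[of c "fst p" "snd p"] by simp_all
  have even: "(\<lambda>\<xi>. a (- fst \<xi>, snd \<xi>)) = a" "(\<lambda>\<xi>. a (fst \<xi>, - snd \<xi>)) = a"
    by (rule TS_unique[OF f(1)[OF sa] sa], unfold R(1)[of a] tF[symmetric], use all in eventually_elim, simp)
       (rule TS_unique[OF f(2)[OF sa] sa], unfold R(2)[of a] tF[symmetric], use all in eventually_elim, simp)
  have odd: "(\<lambda>\<xi>. b (- fst \<xi>, snd \<xi>)) = (\<lambda>\<xi>. - 1 * b \<xi>)" "(\<lambda>\<xi>. b (fst \<xi>, - snd \<xi>)) = (\<lambda>\<xi>. - 1 * b \<xi>)"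
    by (rule TS_unique[OF f(1)[OF sb] sb'], unfold R(1)[of b] TSm[symmetric] tw[symmetric], use all in eventually_elim, simp)
       (rule TS_unique[OF f(2)[OF sb] sb'], unfold R(2)[of b] TSm[symmetric] tw[symmetric], use all in eventually_elim, simp)
  have sa2: "abs_summable (\<lambda>\<xi>. of_real (1 + (rad \<xi>)\<^sup>2) * a \<xi>)"
  proof -
    have "flux U \<in> sobolev s" using UX by (simp add: X_space_def)
    from sobolev_abs_summable[OF this, of 1] s
    have "abs_summable (\<lambda>\<xi>. of_real (1 + sqnorm \<xi>) * lift a \<xi>)" by (simp add: cF_def[symmetric] lF)
    then show ?thesis
      by (subst (asm) emb_summable) (simp_all add: lift_outside lift_emb sqnorm_emb norm_mult)
  qed
  define P Q where "P = (\<lambda>\<xi>. of_real (asym \<xi>) * a \<xi>)" and "Q = (\<lambda>\<xi>. of_real (cc / (rad \<xi>)\<^sup>2) * b \<xi>)"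
  note L = lin_op_TS[OF sa2 sb P_def Q_def]
  have eqn: "AE x in lborel. lin_op k (\<lambda>x. (TS b x, TS a x)) x = l *\<^sub>R (TS b x, TS a x)"
    using e eU unfolding ae_eq_def t(4) tw tF by eventually_elim simp
  have sl: "abs_summable (\<lambda>\<xi>. of_real l * c \<xi>)" if "abs_summable c" for c :: "freq \<Rightarrow> complex"
    using that by (intro abs_summable_bounded_mult[where B = "\<bar>l\<bar>"]) simp_all
  have RG: "(\<lambda>\<xi>. of_real (real k / 2 * of_int (snd \<xi>)) * (P (sh (- 1) \<xi>) - P (sh 1 \<xi>))) = (\<lambda>\<xi>. of_real l * b \<xi>)"
    by (rule TS_unique[OF L(2) sl[OF sb]]) (use eqn in \<open>eventually_elim, simp add: L(1) TS_cmult scaleR_conv_of_real\<close>)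
  have RF: "(\<lambda>\<xi>. of_real (real k / 2 * of_int (snd \<xi>)) * (Q (sh (- 1) \<xi>) - Q (sh 1 \<xi>))) = (\<lambda>\<xi>. of_real l * a \<xi>)"
    by (rule TS_unique[OF L(3) sl[OF sa]]) (use eqn in \<open>eventually_elim, simp add: L(1) TS_cmult scaleR_conv_of_real\<close>)
  have G: "of_real l * b (m, n) = of_real (real k / 2 * of_int n) * (of_real (asym (m - 1, n)) * a (m - 1, n) - of_real (asym (m + 1, n)) * a (m + 1, n))" for m n
    using fun_cong[OF RG, of "(m, n)"] by (simp add: P_def sh_def)
  have F: "of_real l * a (m, n) = of_real (real k / 2 * of_int n) * (of_real (cc / (rad (m - 1, n))\<^sup>2) * b (m - 1, n) - of_real (cc / (rad (m + 1, n))\<^sup>2) * b (m + 1, n))" for m n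
    using fun_cong[OF RF, of "(m, n)"] by (simp add: Q_def sh_def)
  show ?thesis
  proof (rule that[of a b, OF sa sb])
    show "U \<doteq> (\<lambda>x. (TS b x, TS a x))" using eU by (simp add: ae_eq_def tw tF)
    show "fourier_coeff (vort U) = lift b" "fourier_coeff (flux U) = lift a" using lw lF by (simp_all add: cw_def cF_def)
    show "a (- fst \<xi>, snd \<xi>) = a \<xi>" "a (fst \<xi>, - snd \<xi>) = a \<xi>" "b (- fst \<xi>, snd \<xi>) = - b \<xi>" "b (fst \<xi>, - snd \<xi>) = - b \<xi>" for \<xi>
      using fun_cong[OF even(1), of \<xi>] fun_cong[OF even(2), of \<xi>] fun_cong[OF odd(1), of \<xi>] fun_cong[OF odd(2), of \<xi>] by simp_all
    have q: "x / (rad \<xi>)\<^sup>2 = x / rad \<xi> / rad \<xi>" for x \<xi> by (simp add: power2_eq_square)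
    show "eig l (\<lambda>\<xi>. Re (a \<xi>)) (\<lambda>\<xi>. Re (b \<xi>) / rad \<xi>)"
      unfolding eig_def
    proof (intro allI conjI)
      fix m n
      show "l * Re (a (m, n)) = cc * (real k * of_int n / 2 * (Re (b (m - 1, n)) / rad (m - 1, n) / rad (m - 1, n) - Re (b (m + 1, n)) / rad (m + 1, n) / rad (m + 1, n)))"
        using arg_cong[OF F[of m n], of Re] by (simp add: q right_diff_distrib mult_ac)
      show "l * (Re (b (m, n)) / rad (m, n)) = real k * of_int n / 2 / rad (m, n) * (asym (m - 1, n) * Re (a (m - 1, n)) - asym (m + 1, n) * Re (a (m + 1, n)))"
        using arg_cong[OF G[of m n], of "\<lambda>z. Re z / rad (m, n)"] by (simp add: mult_ac)
    qed
    show "eig l (\<lambda>\<xi>. Im (a \<xi>)) (\<lambda>\<xi>. Im (b \<xi>) / rad \<xi>)"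
      unfolding eig_def
    proof (intro allI conjI)
      fix m n
      show "l * Im (a (m, n)) = cc * (real k * of_int n / 2 * (Im (b (m - 1, n)) / rad (m - 1, n) / rad (m - 1, n) - Im (b (m + 1, n)) / rad (m + 1, n) / rad (m + 1, n)))"
        using arg_cong[OF F[of m n], of Im] by (simp add: q right_diff_distrib mult_ac)
      show "l * (Im (b (m, n)) / rad (m, n)) = real k * of_int n / 2 / rad (m, n) * (asym (m - 1, n) * Im (a (m - 1, n)) - asym (m + 1, n) * Im (a (m + 1, n)))"
        using arg_cong[OF G[of m n], of "\<lambda>z. Im z / rad (m, n)"] by (simp add: mult_ac)
    qed
  qed
qed

end

section \<open>The branches\<close>

lemma cis_row_integral:
  fixes i n :: int
  assumes "\<bar>i\<bar> \<noteq> \<bar>n\<bar>"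
  shows "(LINT y:{0..2*pi}|lborel. of_real (cos (of_int n * y)) * cis (- of_int i * y)) = 0"
    "(LINT y:{0..2*pi}|lborel. of_real (sin (of_int n * y)) * cis (- of_int i * y)) = 0"
proof -
  have z: "n - i \<noteq> 0" "- n - i \<noteq> 0" using assms by auto
  have cint: "set_integrable lborel {0..2*pi} (\<lambda>y. cis (of_int j * y))" for j :: int
    by (intro borel_integrable_atLeastAtMost' continuous_intros)
  have int: "set_integrable lborel {0..2*pi} (\<lambda>y. c * cis (of_int j * y))" for c :: complex and j :: int
    by (intro set_integrable_mult_right cint)
  have zero: "(LINT y:{0..2*pi}|lborel. c * cis (of_int (n - i) * y) + d * cis (of_int (- n - i) * y)) = 0" for c d :: complex
    unfolding set_integral_add(2)[OF int int] set_integral_mult_right cis_integral_zero[OF z(1)] cis_integral_zero[OF z(2)] by simp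
  have c: "of_real (cos (of_int n * y)) * cis (- of_int i * y) = 1 / 2 * cis (of_int (n - i) * y) + 1 / 2 * cis (of_int (- n - i) * y)"
    and s: "of_real (sin (of_int n * y)) * cis (- of_int i * y) = - (\<i> / 2) * cis (of_int (n - i) * y) + \<i> / 2 * cis (of_int (- n - i) * y)" for y
  proof -
    have e: "cis (of_int (n - i) * y) = cis (of_int n * y) * cis (- of_int i * y)"
      "cis (of_int (- n - i) * y) = cis (- of_int n * y) * cis (- of_int i * y)"
      by (simp_all add: cis_mult left_diff_distrib)
    have "of_real (cos t) = 1 / 2 * cis t + 1 / 2 * cis (- t)" "of_real (sin t) = - (\<i> / 2) * cis t + \<i> / 2 * cis (- t)" for t
      by (simp_all add: complex_eq_iff)
    from this[of "of_int n * y"] show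
      "of_real (cos (of_int n * y)) * cis (- of_int i * y) = 1 / 2 * cis (of_int (n - i) * y) + 1 / 2 * cis (of_int (- n - i) * y)"
      "of_real (sin (of_int n * y)) * cis (- of_int i * y) = - (\<i> / 2) * cis (of_int (n - i) * y) + \<i> / 2 * cis (of_int (- n - i) * y)"
      unfolding e by (simp_all add: distrib_right left_diff_distrib mult.assoc)
  qed
  show "(LINT y:{0..2*pi}|lborel. of_real (cos (of_int n * y)) * cis (- of_int i * y)) = 0"
    "(LINT y:{0..2*pi}|lborel. of_real (sin (of_int n * y)) * cis (- of_int i * y)) = 0"
    unfolding c s by (rule zero)+
qed

lemma branch_coeff_zero:
  assumes V: "V \<in> branch k s n" and \<xi>: "\<bar>snd \<xi>\<bar> \<noteq> int n"
  shows "fourier_coeff (vort V) \<xi> = 0" "fourier_coeff (flux V) \<xi> = 0"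
proof -
  obtain f h where f [measurable]: "f \<in> borel_measurable borel" and h [measurable]: "h \<in> borel_measurable borel"
    and V': "V \<doteq> (\<lambda>(x, y). (h x * of_real (sin (real n * y)), f x * of_real (cos (real n * y))))"
    using V unfolding branch_def L2_closed_span_def by blast
  have m: "vort V \<in> borel_measurable borel" "flux V \<in> borel_measurable borel"
    using V by (auto simp: branch_def X_sym_def X_space_def sobolev0_def sobolev_def)
  have ae: "AE p in lborel. vort V p = h (fst p) * of_real (sin (real n * snd p))"
    "AE p in lborel. flux V p = f (fst p) * of_real (cos (real n * snd p))"
    using V' unfolding ae_eq_def by (auto simp: vort_def flux_def split_beta' elim!: AE_mp)
  have [measurable]: "(\<lambda>p :: real \<times> real. h (fst p) * of_real (sin (real n * snd p))) \<in> borel_measurable borel"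
    "(\<lambda>p :: real \<times> real. f (fst p) * of_real (cos (real n * snd p))) \<in> borel_measurable borel"
    unfolding borel_prod[symmetric] by measurable
  have e: "u * of_real t * cnj (fourier_char \<xi> p) = (u * cis (- of_int (fst \<xi>) * fst p)) * (of_real t * cis (- of_int (snd \<xi>) * snd p))" for u t p
    by (cases p) (simp add: fourier_char_simps cis_cnj mult_ac)
  have z: "\<bar>snd \<xi>\<bar> \<noteq> \<bar>int n\<bar>" using \<xi> by simp
  have "fourier_coeff (vort V) \<xi> = fourier_coeff (\<lambda>p. h (fst p) * of_real (sin (real n * snd p))) \<xi>"
    by (rule fourier_coeff_cong_AE[OF ae(1) m(1)]) measurable
  also have "\<dots> = 0"
    unfolding fourier_coeff_def e
    using product_integral_zero(1)[OF cis_row_integral(2)[OF z], of "\<lambda>x. h x * cis (- of_int (fst \<xi>) * x)"] by simp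
  finally show "fourier_coeff (vort V) \<xi> = 0" .
  have "fourier_coeff (flux V) \<xi> = fourier_coeff (\<lambda>p. f (fst p) * of_real (cos (real n * snd p))) \<xi>"
    by (rule fourier_coeff_cong_AE[OF ae(2) m(2)]) measurable
  also have "\<dots> = 0"
    unfolding fourier_coeff_def e
    using product_integral_zero(1)[OF cis_row_integral(1)[OF z], of "\<lambda>x. f x * cis (- of_int (fst \<xi>) * x)"] by simp
  finally show "fourier_coeff (flux V) \<xi> = 0" .
qed

lemma series_in_L2_closed_span:
  assumes c: "summable (\<lambda>j. norm (c j))" and e: "\<And>j. e j \<in> borel_measurable borel" "\<And>j x. \<bar>e j x\<bar> \<le> 1"
    and f: "\<And>x. (\<lambda>j. c j * of_real (e j x)) sums f x"
  shows "f \<in> L2_closed_span e"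
proof -
  note [measurable] = e(1)
  have F: "f = (\<lambda>x. \<Sum>j. c j * of_real (e j x))" using sums_unique[OF f] by auto
  have m: "f \<in> borel_measurable borel" unfolding F by measurable
  have le: "norm (c j * of_real (e j x)) \<le> norm (c j)" for j x
    using mult_left_mono[OF e(2)[of j x], of "norm (c j)"] by (simp add: norm_mult)
  have "\<exists>N (d :: nat \<Rightarrow> complex). (\<integral>\<^sup>+x\<in>{0..2*pi}. ennreal ((norm (f x - (\<Sum>j<N. d j * of_real (e j x))))^2) \<partial>lborel) < ennreal \<eta>"
    if \<eta>: "\<eta> > 0" for \<eta>
  proof -
    \<comment> \<open>A uniform error \<open>\<rho>\<close> over an interval of length
      \<open>2 * pi\<close> contributes \<open>\<eta> / 2\<close> to the squared L2 norm.\<close>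
    define \<rho> where "\<rho> = sqrt (\<eta> / (4 * pi))"
    have \<rho>: "\<rho> > 0" "\<rho>\<^sup>2 * (2 * pi) = \<eta> / 2" using \<eta> by (auto simp: \<rho>_def)
    obtain N where N: "norm (\<Sum>j. norm (c (j + N))) < \<rho>" using suminf_exist_split[OF \<rho>(1) c] by blast
    have b: "norm (f x - (\<Sum>j<N. c j * of_real (e j x))) \<le> \<rho>" for x
    proof -
      have s: "summable (\<lambda>j. norm (c (j + N)))" using c by (rule summable_ignore_initial_segment)
      have s': "summable (\<lambda>j. norm (c (j + N) * of_real (e (j + N) x)))"
        by (rule summable_comparison_test'[OF s]) (use le in simp)
      have "f x - (\<Sum>j<N. c j * of_real (e j x)) = (\<Sum>j. c (j + N) * of_real (e (j + N) x))"
        using suminf_split_initial_segment[OF sums_summable[OF f], of x N] by (simp add: F)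
      also have "norm \<dots> \<le> (\<Sum>j. norm (c (j + N)))"
        using summable_norm[OF s'] suminf_le[OF le s' s] by linarith
      finally show ?thesis using N by simp
    qed
    have "(\<integral>\<^sup>+x\<in>{0..2*pi}. ennreal ((norm (f x - (\<Sum>j<N. c j * of_real (e j x))))^2) \<partial>lborel) \<le>
        (\<integral>\<^sup>+x. ennreal (\<rho>\<^sup>2) * indicator {0..2*pi} x \<partial>lborel)"
      by (intro nn_integral_mono mult_right_mono ennreal_leI power_mono b) auto
    also have "\<dots> = ennreal (\<rho>\<^sup>2) * ennreal (2 * pi)"
      by (subst nn_integral_cmult_indicator) auto
    also have "\<dots> = ennreal (\<eta> / 2)" by (simp add: ennreal_mult[symmetric] \<rho>)
    also have "\<dots> < ennreal \<eta>" using \<eta> by (intro ennreal_lessI) auto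
    finally show ?thesis by blast
  qed
  then show ?thesis using m by (simp add: L2_closed_span_def)
qed

lemma has_sum_grouped:
  fixes F :: "'a \<Rightarrow> 'b::banach" and A :: "nat \<Rightarrow> 'a set"
  assumes F: "(F has_sum S) UNIV" and A: "\<And>j. finite (A j)" "\<And>i j. i \<noteq> j \<Longrightarrow> A i \<inter> A j = {}"
    and z: "\<And>x. x \<notin> (\<Union>j. A j) \<Longrightarrow> F x = 0"
  shows "((\<lambda>j. sum F (A j)) has_sum S) UNIV"
proof -
  have "(F has_sum S) (\<Union>j. A j)"
    using F by (rule has_sum_cong_neutral[THEN iffD1, rotated -1]) (use z in auto)
  also have "(\<Union>j. A j) = snd ` Sigma UNIV A" by force
  finally have "((F \<circ> snd) has_sum S) (Sigma UNIV A)"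
    by (subst (asm) has_sum_reindex) (use A(2) in \<open>auto simp: inj_on_def\<close>)
  then show ?thesis
    by (rule has_sum_SigmaD) (auto intro!: has_sum_finiteI A(1))
qed

context wave
begin

definition X1 :: "real \<Rightarrow> real" where
  "X1 x = real k * x - pi / 2"

text \<open>The span consists of cosines in x, the series of exponentials in the centred variable.
  For even m the cosine of m times \<open>X1 x\<close>, and for odd m the sine, is plus or minus
  \<open>cos (m * k * x)\<close>; the symmetry of \<open>a\<close> for parity \<open>p\<close>
  leaves exactly these. The factor \<open>\<tau>\<close> collects the i of the sine and a
  sign.\<close>

lemma row_series_span:
  assumes a: "abs_summable (a :: int \<Rightarrow> complex)" and p: "p = 0 \<or> p = 1"
    and par: "\<And>m. even m \<longleftrightarrow> p = 1 \<Longrightarrow> a m = 0" and sym: "\<And>m. a (- m) = (- 1) ^ p * a m"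
  shows "(\<lambda>x. (\<Sum>\<^sub>\<infinity>m. a m * cis (of_int m * X1 x))) \<in> L2_closed_span (\<lambda>j x. cos (real ((2 * j + p) * k) * x))"
proof -
  define M where "M j = 2 * int j + int p" for j
  define A where "A j = {M j, - M j}" for j
  define \<tau> where "\<tau> = (if p = 0 then 1 else - \<i>)"
  \<comment> \<open>Summing over the set \<open>A j\<close> counts frequency 0 once, where
    \<open>M j\<close> and \<open>- M j\<close> coincide.\<close>
  define c where "c j = \<tau> * (- 1) ^ j * (\<Sum>m\<in>A j. if m = M j then a m else (- 1) ^ p * a m)" for j
  have fin: "finite (A j)" for j by (simp add: A_def)
  have dis: "i \<noteq> j \<Longrightarrow> A i \<inter> A j = {}" for i j by (auto simp: A_def M_def)
  have cov: "F m = 0" if "m \<notin> (\<Union>j. A j)" "\<And>m. a m = 0 \<Longrightarrow> F m = 0" for m and F :: "int \<Rightarrow> 'z::zero"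
  proof (rule that(2), rule par, rule ccontr)
    assume n: "\<not> (even m \<longleftrightarrow> p = 1)"
    have "\<exists>j. \<bar>m\<bar> = M j"
    proof (cases "p = 0")
      case True
      then have "even \<bar>m\<bar>" using n p by auto
      then obtain i where "\<bar>m\<bar> = 2 * i" by (elim evenE)
      then show ?thesis using True by (intro exI[of _ "nat i"]) (auto simp: M_def)
    next
      case False
      then have "odd \<bar>m\<bar>" "p = 1" using n p by auto
      then obtain i where "\<bar>m\<bar> = 2 * i + 1" by (elim oddE)
      then show ?thesis using \<open>p = 1\<close> by (intro exI[of _ "nat i"]) (auto simp: M_def)
    qed
    then obtain j where "\<bar>m\<bar> = M j" by blast
    then have "m \<in> A j" unfolding A_def by auto
    then show False using that(1) by blast
  qed
  have Acard: "A j = {M j, - M j}" "M j = - M j \<longleftrightarrow> p = 0 \<and> j = 0" for j by (auto simp: A_def M_def)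
  have osc: "(\<Sum>m\<in>A j. a m * cis (of_int m * X1 x)) = c j * of_real (cos (real ((2 * j + p) * k) * x))" for j x
  proof -
    define \<theta> where "\<theta> = real ((2 * j + p) * k) * x"
    have \<theta>: "of_int (M j) * X1 x = \<theta> - real p * (pi / 2) - of_nat j * pi"
      by (simp add: \<theta>_def X1_def M_def algebra_simps)
    have jp: "cos (t - of_nat j * pi) = (- 1) ^ j * cos t" "sin (t - of_nat j * pi) = (- 1) ^ j * sin t" for t
      by (simp_all add: cos_diff sin_diff cos_npi mult.commute[of "real j" pi])
    show ?thesis
    proof (cases "M j = 0")
      case True
      then have "j = 0" "p = 0" by (auto simp: M_def)
      then show ?thesis by (simp add: c_def A_def M_def \<tau>_def)
    next
      case False
      have "(\<Sum>m\<in>A j. a m * cis (of_int m * X1 x)) = a (M j) * (cis (of_int (M j) * X1 x) + (- 1) ^ p * cis (- (of_int (M j) * X1 x)))"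
        using False by (simp add: A_def sym algebra_simps)
      also have "cis (of_int (M j) * X1 x) + (- 1) ^ p * cis (- (of_int (M j) * X1 x)) = 2 * \<tau> * (- 1) ^ j * of_real (cos \<theta>)"
      proof (cases "p = 0")
        case True
        have "cis t + cis (- t) = 2 * of_real (cos t)" for t by (simp add: complex_eq_iff)
        from this[of "\<theta> - of_nat j * pi"] show ?thesis using True unfolding \<theta> by (simp add: jp \<tau>_def)
      next
        case False
        then have p1: "p = 1" using p by simp
        have "cis t - cis (- t) = 2 * \<i> * of_real (sin t)" for t by (simp add: complex_eq_iff)
        from this[of "\<theta> - pi / 2 - of_nat j * pi"] show ?thesis using p1 unfolding \<theta> by (simp add: jp \<tau>_def sin_diff[of \<theta>])
      qed
      also have "c j = \<tau> * (- 1) ^ j * (2 * a (M j))"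
        using False by (simp add: c_def A_def sym mult.assoc[symmetric] power_add[symmetric]) 
      ultimately show ?thesis by (simp add: \<theta>_def mult_ac)
    qed
  qed
  have hs: "((\<lambda>j. c j * of_real (cos (real ((2 * j + p) * k) * x))) has_sum (\<Sum>\<^sub>\<infinity>m. a m * cis (of_int m * X1 x))) UNIV" for x
    unfolding osc[symmetric]
    by (rule has_sum_grouped[OF _ fin dis cov]) (auto intro!: has_sum_infsum abs_summable_product_bounded a)
  have "((\<lambda>j. \<Sum>m\<in>A j. norm (a m)) has_sum (\<Sum>\<^sub>\<infinity>m. norm (a m))) UNIV"
    by (rule has_sum_grouped[OF _ fin dis cov]) (auto intro!: has_sum_infsum a)
  then have sm: "summable (\<lambda>j. \<Sum>m\<in>A j. norm (a m))" using has_sum_imp_sums sums_summable by blast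
  have cn: "norm (c j) \<le> (\<Sum>m\<in>A j. norm (a m))" for j
  proof -
    have "norm (c j) = norm (\<Sum>m\<in>A j. if m = M j then a m else (- 1) ^ p * a m)"
      using p by (auto simp: c_def norm_mult norm_power \<tau>_def)
    also have "\<dots> \<le> (\<Sum>m\<in>A j. norm (a m))"
      by (rule order_trans[OF norm_sum sum_mono]) (simp add: norm_mult norm_power)
    finally show ?thesis .
  qed
  show ?thesis
  proof (rule series_in_L2_closed_span)
    show "summable (\<lambda>j. norm (c j))"
      by (rule summable_comparison_test'[OF sm]) (use cn in simp)
    show "(\<lambda>j. c j * of_real (cos (real ((2 * j + p) * k) * x))) sums (\<Sum>\<^sub>\<infinity>m. a m * cis (of_int m * X1 x))" for x
      by (rule has_sum_imp_sums[OF hs])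
  qed (auto intro!: borel_measurable_continuous_onI continuous_intros)
qed

lemma TS_rows:
  assumes c: "abs_summable c" and z: "\<And>m i. \<bar>i\<bar> \<noteq> n \<Longrightarrow> c (m, i) = 0" and n: "n > 0"
  shows "TS c (x, y) = (\<Sum>\<^sub>\<infinity>m. c (m, n) * cis (of_int m * X1 x)) * cis (of_int n * y) +
     (\<Sum>\<^sub>\<infinity>m. c (m, - n) * cis (of_int m * X1 x)) * cis (- of_int n * y)"
    and "abs_summable (\<lambda>m. c (m, n))" "abs_summable (\<lambda>m. c (m, - n))"
proof -
  define R where "R i = range (\<lambda>m :: int. (m, i :: int))" for i
  have inj: "inj (\<lambda>m :: int. (m, i :: int))" for i by (simp add: inj_def)
  show s: "abs_summable (\<lambda>m. c (m, n))" "abs_summable (\<lambda>m. c (m, - n))"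
    using summable_on_reindex[OF inj, of "\<lambda>\<xi>. norm (c \<xi>)"] summable_on_subset_banach[OF c] by (auto simp: o_def)
  have sm: "(\<lambda>\<xi>. c \<xi> * ek \<xi> (x, y)) summable_on R i" for i
    by (rule summable_on_subset_banach[OF has_sum_imp_summable[OF TS_has_sum[OF c]]]) simp
  have row: "infsum (\<lambda>\<xi>. c \<xi> * ek \<xi> (x, y)) (R i) = (\<Sum>\<^sub>\<infinity>m. c (m, i) * cis (of_int m * X1 x)) * cis (of_int i * y)" for i
    unfolding R_def
    by (subst infsum_reindex[OF inj])
       (simp add: o_def ek_def X1_def infsum_cmult_left'[symmetric] cis_mult[symmetric] mult.assoc)
  have "TS c (x, y) = infsum (\<lambda>\<xi>. c \<xi> * ek \<xi> (x, y)) (R n \<union> R (- n))"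
    unfolding TS_infsum by (rule infsum_cong_neutral) (use z in \<open>auto simp: R_def image_iff abs_if\<close>)
  also have "\<dots> = infsum (\<lambda>\<xi>. c \<xi> * ek \<xi> (x, y)) (R n) + infsum (\<lambda>\<xi>. c \<xi> * ek \<xi> (x, y)) (R (- n))"
    by (rule infsum_Un_disjoint[OF sm sm]) (use n in \<open>auto simp: R_def\<close>)
  finally show "TS c (x, y) = (\<Sum>\<^sub>\<infinity>m. c (m, n) * cis (of_int m * X1 x)) * cis (of_int n * y) +
     (\<Sum>\<^sub>\<infinity>m. c (m, - n) * cis (of_int m * X1 x)) * cis (- of_int n * y)"
    by (simp add: row)
qed


lemma rad_row: "i \<noteq> 0 \<Longrightarrow> rad (m, i) \<noteq> 0"
  using rad_eq_0D[of "(m, i)"] by (auto simp: zero_prod_def)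

lemma eigenfunction_rate:
  assumes e: "eig l (\<lambda>\<xi>. Re (a \<xi>)) (\<lambda>\<xi>. Re (b \<xi>) / rad \<xi>)" "eig l (\<lambda>\<xi>. Im (a \<xi>)) (\<lambda>\<xi>. Im (b \<xi>) / rad \<xi>)"
    and l: "l > 0" and b: "abs_summable b" and n: "i \<noteq> 0" "\<bar>i\<bar> < int k" and nz: "a (m, i) \<noteq> 0 \<or> b (m, i) \<noteq> 0"
  shows "l = sqrt (row_rate i)"
proof -
  have sq: "(\<lambda>\<xi>. (r \<xi> / rad \<xi>)\<^sup>2) summable_on UNIV" if "\<And>\<xi>. \<bar>r \<xi>\<bar> \<le> norm (b \<xi>)" for r :: "freq \<Rightarrow> real"
  proof (rule summable_on_comparison_test[OF abs_summable_square[OF b]])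
    fix \<xi>
    have "\<bar>r \<xi> / rad \<xi>\<bar> \<le> \<bar>r \<xi>\<bar>"
      using rad_zero_or_ge1[of \<xi>] divide_left_mono[of 1 "rad \<xi>" "\<bar>r \<xi>\<bar>"] by (auto simp: abs_divide)
    then have "\<bar>r \<xi> / rad \<xi>\<bar> \<le> norm (b \<xi>)" using that[of \<xi>] by linarith
    then show "(r \<xi> / rad \<xi>)\<^sup>2 \<le> (norm (b \<xi>))\<^sup>2" by (simp add: abs_le_square_iff[symmetric])
  qed simp
  note R = eig_unique[OF e(1) l sq[OF abs_Re_le_cmod] n] and I = eig_unique[OF e(2) l sq[OF abs_Im_le_cmod] n]
  have "Re (a (m, i)) \<noteq> 0 \<or> Im (a (m, i)) \<noteq> 0 \<or> Re (b (m, i)) / rad (m, i) \<noteq> 0 \<or> Im (b (m, i)) / rad (m, i) \<noteq> 0"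
    using nz rad_row[OF n(1)] by (auto simp: complex_eq_iff)
  then show ?thesis using R[of m] I[of m] by blast
qed

lemma branch_eigen_rate:
  assumes U: "U \<in> branch_eigenspace k s n l" and l: "0 < l" and nz: "\<not> U \<doteq> (\<lambda>x. 0)"
    and n: "1 \<le> n" "n < k" and s: "4 \<le> s"
  shows "l = sqrt (row_rate (int n))"
proof -
  have Ub: "U \<in> branch k s n" and US: "U \<in> X_sym k s" and e: "lin_op k U \<doteq> (\<lambda>x. l *\<^sub>R U x)"
    using U by (auto simp: branch_eigenspace_def branch_def)
  have l0: "l \<noteq> 0" using l by simp
  obtain a b where ab: "abs_summable a" "abs_summable b" "U \<doteq> (\<lambda>x. (TS b x, TS a x))"
    "fourier_coeff (vort U) = lift b" "fourier_coeff (flux U) = lift a"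
    "eig l (\<lambda>\<xi>. Re (a \<xi>)) (\<lambda>\<xi>. Re (b \<xi>) / rad \<xi>)" "eig l (\<lambda>\<xi>. Im (a \<xi>)) (\<lambda>\<xi>. Im (b \<xi>) / rad \<xi>)"
    by (rule eigenfunction_coeffs[OF US s l0 e])
  have row: "a (m, i) = 0 \<and> b (m, i) = 0" if "\<bar>i\<bar> \<noteq> int n" for m i
    using branch_coeff_zero[OF Ub, of "emb (m, i)"] that unfolding ab(4,5) by (simp add: lift_emb) (simp add: emb_def)
  have "\<exists>m i. a (m, i) \<noteq> 0 \<or> b (m, i) \<noteq> 0"
  proof (rule ccontr)
    assume "\<not> ?thesis"
    then have "a = (\<lambda>_. 0)" "b = (\<lambda>_. 0)" by auto
    then show False using nz ab(3) by (simp add: TS_infsum zero_prod_def)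
  qed
  then obtain m i where mi: "a (m, i) \<noteq> 0 \<or> b (m, i) \<noteq> 0" by blast
  then have i: "\<bar>i\<bar> = int n" using row by blast
  then have i': "i = int n \<or> i = - int n" by linarith
  have "l = sqrt (row_rate i)"
    by (rule eigenfunction_rate[OF ab(6,7) l ab(2) _ _ mi]) (use i n in auto)
  moreover have "row_rate i = row_rate (int n)"
    using i' n row_rate_minus[of "int n"] by auto
  ultimately show ?thesis by simp
qed

lemma RS_eigenfunction:
  assumes e: "eig l f g" and f: "rapid (\<lambda>\<xi>. of_real (f \<xi>))" and g: "rapid (\<lambda>\<xi>. of_real (g \<xi>))"
  shows "lin_op k (RS f g) x = l *\<^sub>R RS f g x"
proof -
  have "linF g \<xi> = l * f \<xi>" "linG f \<xi> = l * g \<xi>" for \<xi>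
    using eigD[OF e, of "fst \<xi>" "snd \<xi>"] by (simp_all add: linF_def linG_def sh_def)
  then have "linF g = (\<lambda>\<xi>. l * f \<xi>)" "linG f = (\<lambda>\<xi>. l * g \<xi>)" by auto
  then show ?thesis
    using TS_cmult[of "of_real l" "\<lambda>\<xi>. of_real (f \<xi>)" x] TS_cmult[of "of_real l" "\<lambda>\<xi>. of_real (rad \<xi> * g \<xi>)" x]
    unfolding lin_op_RS(1)[OF f g] by (simp add: RS_def scaleR_conv_of_real mult_ac)
qed

text \<open>The coefficient solution of \<open>eig_exists\<close> is realised as a state: rows
  \<open>n\<close> and \<open>- n\<close> combine by parity into a cosine for the flux and a sine
  for the vorticity.\<close>

lemma branch_eigen_exists:
  assumes n: "1 \<le> n" "n < k"
  shows "\<exists>U\<in>branch_eigenspace k s n (sqrt (row_rate (int n))). \<not> U \<doteq> (\<lambda>x. 0)"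
proof -
  define l where "l = sqrt (row_rate (int n))"
  have l: "l > 0" using row_rate(1)[of "int n"] n by (simp add: l_def)
  obtain a b :: "int \<Rightarrow> real" and B where ab: "\<And>m. a (- m) = a m" "\<And>m. b (- m) = - b m"
      "\<And>m. odd m \<Longrightarrow> a m = 0" "\<And>m. even m \<Longrightarrow> b m = 0" "b 1 \<noteq> 0" "\<And>m. \<bar>a m\<bar> \<le> B"
      "eig l (\<lambda>(m, i). if \<bar>i\<bar> = int n then a m else 0) (\<lambda>(m, i). if i = int n then b m else if i = - int n then - b m else 0)"
    using eig_exists[of "int n"] n unfolding l_def by auto
  define f where "f = (\<lambda>(m :: int, i). if \<bar>i\<bar> = int n then a m else 0)"
  define g where "g = (\<lambda>(m :: int, i). if i = int n then b m else if i = - int n then - b m else 0)"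
  have e: "eig l f g" using ab(7) by (simp add: f_def g_def)
  have fB: "\<bar>f \<xi>\<bar> \<le> B" for \<xi>
    using ab(6)[of "fst \<xi>"] abs_ge_zero[of "a 0"] ab(6)[of 0] by (cases \<xi>) (auto simp: f_def simp del: abs_ge_zero)
  obtain C where C: "\<And>\<xi>. \<bar>f \<xi>\<bar> \<le> C * exp (- 1 * sz \<xi>) \<and> \<bar>g \<xi>\<bar> \<le> C * exp (- 1 * sz \<xi>)"
  proof -
    have "int k \<le> \<bar>i\<bar> \<Longrightarrow> f (m, i) = 0 \<and> g (m, i) = 0" for m i using n by (auto simp: f_def g_def)
    from eig_decay[OF e l fB this, of 1] that show ?thesis by auto
  qed
  have rf: "rapid (\<lambda>\<xi>. of_real (f \<xi>))" and rg: "rapid (\<lambda>\<xi>. of_real (g \<xi>))"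
    by (rule rapid_exp[of 1 _ C]; use C in simp)+
  have Xs: "RS f g \<in> X_sym k s"
  proof -
    have "f (- m, i) = f (m, i) \<and> f (m, - i) = f (m, i)" "g (- m, i) = - g (m, i) \<and> g (m, - i) = - g (m, i)" for m i
      using n ab(1,2)[of m] by (auto simp: f_def g_def)
    from RS_X_sym_real[OF rf rg this] show ?thesis by (simp add: X_sym_real_def)
  qed
  have rm: "rad (m, - i) = rad (m, i)" "rad (- m, i) = rad (m, i)" for m i by (simp_all add: rad_reflect)
  have n0: "int n > 0" using n by simp
  have zf: "\<bar>i\<bar> \<noteq> int n \<Longrightarrow> complex_of_real (f (m, i)) = 0" for m i by (simp add: f_def)
  have zg: "\<bar>i\<bar> \<noteq> int n \<Longrightarrow> complex_of_real (rad (m, i) * g (m, i)) = 0" for m i by (auto simp: g_def)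
  note rowf = TS_rows[OF rapid_summable[OF rf] zf n0]
  note rowg = TS_rows[OF rapid_summable[OF rapid_rad(1)[OF rg]] zg n0]
  define F where "F x = (\<Sum>\<^sub>\<infinity>m. 2 * of_real (a m) * cis (of_int m * X1 x))" for x
  define H where "H x = (\<Sum>\<^sub>\<infinity>m. 2 * \<i> * of_real (rad (m, int n) * b m) * cis (of_int m * X1 x))" for x
  have sf: "abs_summable (\<lambda>m. 2 * complex_of_real (a m))"
    using summable_on_cmult_right[OF rowf(2), of 2] by (simp add: f_def norm_mult)
  have sg: "abs_summable (\<lambda>m. 2 * \<i> * complex_of_real (rad (m, int n) * b m))"
    using summable_on_cmult_right[OF rowg(2), of 2] by (simp add: g_def norm_mult)
  have FL: "F \<in> L2_closed_span (\<lambda>j x. cos (real (2 * j * k) * x))"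
    using row_series_span[OF sf, of 0] ab by (simp add: F_def[abs_def])
  have HL: "H \<in> L2_closed_span (\<lambda>j x. cos (real ((2 * j + 1) * k) * x))"
    using row_series_span[OF sg, of 1] ab rm by (simp add: H_def[abs_def])
  have fn: "f (m, int n) = a m" "f (m, - int n) = a m" for m by (simp_all add: f_def)
  have flux: "TS (\<lambda>\<xi>. of_real (f \<xi>)) (x, y) = F x * of_real (cos (real n * y))" for x y
  proof -
    have "TS (\<lambda>\<xi>. of_real (f \<xi>)) (x, y) = (\<Sum>\<^sub>\<infinity>m. of_real (a m) * cis (of_int m * X1 x)) * (cis (real n * y) + cis (- real n * y))"
      using rowf(1)[of x y] by (simp add: fn distrib_left)
    also have "cis (real n * y) + cis (- real n * y) = 2 * of_real (cos (real n * y))" by (simp add: complex_eq_iff)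
    finally show ?thesis unfolding F_def mult.assoc infsum_cmult_right' by (simp add: mult_ac)
  qed
  have vort: "TS (\<lambda>\<xi>. of_real (rad \<xi> * g \<xi>)) (x, y) = H x * of_real (sin (real n * y))" for x y
  proof -
    have m: "(\<Sum>\<^sub>\<infinity>m. of_real (rad (m, - int n) * g (m, - int n)) * cis (of_int m * X1 x)) = - (\<Sum>\<^sub>\<infinity>m. of_real (rad (m, int n) * b m) * cis (of_int m * X1 x))"
      using n by (simp add: g_def rm infsum_uminus)
    have p: "(\<Sum>\<^sub>\<infinity>m. of_real (rad (m, int n) * g (m, int n)) * cis (of_int m * X1 x)) = (\<Sum>\<^sub>\<infinity>m. of_real (rad (m, int n) * b m) * cis (of_int m * X1 x))"
      by (simp add: g_def)
    have "TS (\<lambda>\<xi>. of_real (rad \<xi> * g \<xi>)) (x, y) = (\<Sum>\<^sub>\<infinity>m. of_real (rad (m, int n) * b m) * cis (of_int m * X1 x)) * (cis (real n * y) - cis (- real n * y))"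
      using rowg(1)[of x y] unfolding m p by (simp add: right_diff_distrib)
    also have "cis (real n * y) - cis (- real n * y) = 2 * \<i> * of_real (sin (real n * y))" by (simp add: complex_eq_iff)
    finally show ?thesis unfolding H_def mult.assoc infsum_cmult_right' by (simp add: mult_ac)
  qed
  have "RS f g \<in> branch k s n"
    unfolding branch_def mem_Collect_eq
  proof (rule conjI[OF Xs], rule exI[of _ F], rule exI[of _ H], intro conjI FL HL)
    have "RS f g = (\<lambda>(x, y). (H x * of_real (sin (real n * y)), F x * of_real (cos (real n * y))))"
      by (auto simp: fun_eq_iff RS_def flux vort simp del: of_real_mult)
    then show "RS f g \<doteq> (\<lambda>(x, y). (H x * of_real (sin (real n * y)), F x * of_real (cos (real n * y))))"
      by (simp add: ae_eq_def)
  qed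
  moreover have "lin_op k (RS f g) \<doteq> (\<lambda>x. l *\<^sub>R RS f g x)"
    by (simp add: ae_eq_def RS_eigenfunction[OF e rf rg])
  moreover have "\<not> RS f g \<doteq> (\<lambda>x. 0)"
  proof
    assume "RS f g \<doteq> (\<lambda>x. 0)"
    then have "AE x in lborel. TS (\<lambda>\<xi>. of_real (rad \<xi> * g \<xi>)) x = TS (\<lambda>\<xi>. 0) x"
      unfolding ae_eq_def by (auto simp: RS_def zero_prod_def TS_infsum elim!: AE_mp)
    then have "(\<lambda>\<xi>. complex_of_real (rad \<xi> * g \<xi>)) = (\<lambda>\<xi>. 0)"
      by (intro TS_unique rapid_summable[OF rapid_rad(1)[OF rg]]) simp_all
    from fun_cong[OF this, of "(1, int n)"] show False
      using ab(5) rad_row[of "int n" 1] n by (simp add: g_def)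
  qed
  ultimately show ?thesis unfolding branch_eigenspace_def l_def[symmetric] by blast
qed

text \<open>Existence and uniqueness in the branch justify the definite description in
  \<open>growth_rate\<close> and identify its value through the row eigenvalue.\<close>

lemma growth_rate_eq:
  assumes n: "1 \<le> n" "n < k" and s: "4 \<le> s"
  shows "growth_rate k s n = sqrt (row_rate (int n))"
  unfolding growth_rate_def
proof (rule the_equality)
  show "0 < sqrt (row_rate (int n)) \<and> (\<exists>U\<in>branch_eigenspace k s n (sqrt (row_rate (int n))). \<not> U \<doteq> (\<lambda>x. 0))"
    using row_rate(1)[of "int n"] n branch_eigen_exists[OF n] by simp
qed (use branch_eigen_rate[OF _ _ _ n s] in blast)

end

section \<open>Instability of the equilibrium\<close>

section \<open>Instability\<close>

lemma fourier_coeff_sum: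
  assumes "finite I" "\<And>n. n \<in> I \<Longrightarrow> set_integrable lborel cell (\<lambda>x. u n x * cnj (fourier_char \<eta> x))"
  shows "fourier_coeff (\<lambda>x. \<Sum>n\<in>I. u n x) \<eta> = (\<Sum>n\<in>I. fourier_coeff (u n) \<eta>) \<and>
    set_integrable lborel cell (\<lambda>x. (\<Sum>n\<in>I. u n x) * cnj (fourier_char \<eta> x))"
  using assms
proof (induction I rule: finite_induct)
  case empty
  then show ?case by (simp add: fourier_coeff_def set_lebesgue_integral_def set_integrable_def)
next
  case (insert m I)
  then show ?case
    using fourier_coeff_add[of "u m" \<eta> "\<lambda>x. \<Sum>n\<in>I. u n x"] by (simp add: distrib_right set_integral_add)
qed

lemma X_norm_cong:
  assumes "U \<doteq> V" "vort U \<in> borel_measurable borel" "flux U \<in> borel_measurable borel"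
    "vort V \<in> borel_measurable borel" "flux V \<in> borel_measurable borel"
  shows "X_norm s U = X_norm s V"
proof -
  have "AE x in lborel. vort U x = vort V x" "AE x in lborel. flux U x = flux V x"
    using assms(1) by (auto simp: ae_eq_def vort_def flux_def elim!: AE_mp)
  then show ?thesis
    unfolding X_norm_def sobolev_norm_def using assms(2-5) by (simp add: fourier_coeff_cong_AE cong: infsum_cong)
qed

lemma X_sym_measurable:
  assumes "U \<in> X_sym k s"
  shows "vort U \<in> borel_measurable borel" "flux U \<in> borel_measurable borel"
    "vort U \<in> sobolev (s - 1)" "flux U \<in> sobolev s"
  using assms by (auto simp: X_sym_def X_space_def sobolev0_def sobolev_def)

text \<open>The state is a finite sum over branches \<open>n < k\<close>. The vanishing of all other
  rows is what \<open>eig_decay\<close> asks for in the second index.\<close>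

lemma leading_eigenspace_rows:
  assumes U: "U \<in> leading_eigenspace k s" and \<xi>: "int k \<le> \<bar>snd \<xi>\<bar>"
  shows "fourier_coeff (vort U) \<xi> = 0" "fourier_coeff (flux U) \<xi> = 0"
proof -
  define I where "I = {n \<in> {1..<k}. growth_rate k s n = leading_rate k s}"
  obtain V where V: "\<And>n. n \<in> I \<Longrightarrow> V n \<in> branch_eigenspace k s n (growth_rate k s n)"
    and U': "U \<doteq> (\<lambda>x. \<Sum>n\<in>I. V n x)" and US: "U \<in> X_sym k s"
    using U unfolding leading_eigenspace_def I_def by blast
  have fin: "finite I" by (simp add: I_def)
  have Vb: "V n \<in> branch k s n" "V n \<in> X_sym k s" if "n \<in> I" for n
    using V[OF that] by (auto simp: branch_eigenspace_def branch_def)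
  have row: "\<bar>snd \<xi>\<bar> \<noteq> int n" if "n \<in> I" for n using that \<xi> by (auto simp: I_def)
  have ae: "AE x in lborel. vort U x = (\<Sum>n\<in>I. vort (V n) x)" "AE x in lborel. flux U x = (\<Sum>n\<in>I. flux (V n) x)"
    using U' unfolding ae_eq_def by (auto simp: vort_def flux_def fst_sum snd_sum elim!: AE_mp)
  note m = X_sym_measurable[OF Vb(2)]
  have mm: "(\<lambda>x. \<Sum>n\<in>I. vort (V n) x) \<in> borel_measurable borel" "(\<lambda>x. \<Sum>n\<in>I. flux (V n) x) \<in> borel_measurable borel"
    by (intro borel_measurable_sum m; assumption)+
  have "fourier_coeff (vort U) \<xi> = (\<Sum>n\<in>I. fourier_coeff (vort (V n)) \<xi>)"
    using fourier_coeff_cong_AE[OF ae(1) X_sym_measurable(1)[OF US] mm(1)]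
      fourier_coeff_sum[OF fin, of "\<lambda>n. vort (V n)"] sobolev_integrable[OF m(3)] by simp
  then show "fourier_coeff (vort U) \<xi> = 0" using branch_coeff_zero(1)[OF Vb(1) row] by simp
  have "fourier_coeff (flux U) \<xi> = (\<Sum>n\<in>I. fourier_coeff (flux (V n)) \<xi>)"
    using fourier_coeff_cong_AE[OF ae(2) X_sym_measurable(2)[OF US] mm(2)]
      fourier_coeff_sum[OF fin, of "\<lambda>n. flux (V n)"] sobolev_integrable[OF m(4)] by simp
  then show "fourier_coeff (flux U) \<xi> = 0" using branch_coeff_zero(2)[OF Vb(1) row] by simp
qed

context wave
begin

lemma leading_rate_props:
  assumes k2: "2 \<le> k" and s: "4 \<le> s"
  shows "leading_rate k s > 0" "spectral_bound (leading_rate k s)"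
proof -
  have ge: "sqrt (row_rate (int n)) \<le> leading_rate k s" if "1 \<le> n" "n < k" for n
    unfolding leading_rate_def growth_rate_eq[OF that s, symmetric] using that by (intro Max_ge) auto
  have "0 < sqrt (row_rate 1)" using row_rate(1)[of 1] k2 by simp
  then show pos: "leading_rate k s > 0" using ge[of 1] k2 by (simp del: real_sqrt_gt_0_iff)
  show "spectral_bound (leading_rate k s)"
  proof (rule spectral_boundI)
    fix n assume n: "1 \<le> n" "n < int k"
    have "sqrt (row_rate n) \<le> leading_rate k s" using ge[of "nat n"] n by (simp add: nat_less_iff)
    then show "row_rate n \<le> (leading_rate k s)\<^sup>2" using pos by (simp add: real_sqrt_le_iff' sqrt_le_D)
  qed
qed

text \<open>Places the prescribed eigenfunction in the analytic class of whichever
  \<open>\<kappa>\<close> was fixed beforehand, as its coefficients decay at every exponential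
  rate.\<close>

lemma leading_vector:
  assumes s: "4 \<le> s" and U: "U \<in> leading_eigenspace k s" and r: "real_state U"
    and e: "lin_op k U \<doteq> (\<lambda>x. \<Lambda> *\<^sub>R U x)" and \<Lambda>: "\<Lambda> > 0" and \<kappa>: "\<kappa> > 0"
  shows "\<exists>v\<in>sym_space. Lop (W \<kappa> 1) v = \<Lambda> *\<^sub>R v \<and> U \<doteq> St \<kappa> (chg (W \<kappa> 1) (ew \<kappa>) v)"
proof -
  have US: "U \<in> X_sym k s" using U by (simp add: leading_eigenspace_def)
  have \<Lambda>0: "\<Lambda> \<noteq> 0" using \<Lambda> by simp
  obtain a b where ab: "abs_summable a" "abs_summable b" "U \<doteq> (\<lambda>x. (TS b x, TS a x))"
    "fourier_coeff (vort U) = lift b" "fourier_coeff (flux U) = lift a"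
    and a: "\<And>\<xi>. a (- fst \<xi>, snd \<xi>) = a \<xi>" "\<And>\<xi>. a (fst \<xi>, - snd \<xi>) = a \<xi>"
    and b: "\<And>\<xi>. b (- fst \<xi>, snd \<xi>) = - b \<xi>" "\<And>\<xi>. b (fst \<xi>, - snd \<xi>) = - b \<xi>"
    and eg: "eig \<Lambda> (\<lambda>\<xi>. Re (a \<xi>)) (\<lambda>\<xi>. Re (b \<xi>) / rad \<xi>)" "eig \<Lambda> (\<lambda>\<xi>. Im (a \<xi>)) (\<lambda>\<xi>. Im (b \<xi>) / rad \<xi>)"
    by (rule eigenfunction_coeffs[OF US s \<Lambda>0 e]) (rule that; (assumption | simp))
  have neg: "a (- \<xi>) = a \<xi>" "b (- \<xi>) = b \<xi>" for \<xi>
    using a(1)[of \<xi>] a(2)[of "(- fst \<xi>, snd \<xi>)"] b(1)[of \<xi>] b(2)[of "(- fst \<xi>, snd \<xi>)"]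
    by (simp_all add: uminus_prod_def)
  \<comment> \<open>For a real function, conjugating coefficients amounts to negating the frequency,
    and the parities make the coefficients invariant under negation.\<close>
  have real: "c \<xi> = of_real (Re (c \<xi>))"
    if c: "abs_summable c" "\<And>\<xi>. c (- \<xi>) = c \<xi>" "AE x in lborel. TS c x \<in> \<real>" for c :: "freq \<Rightarrow> complex" and \<xi>
  proof -
    have "AE x in lborel. TS (\<lambda>\<xi>. cnj (c (- \<xi>))) x = TS c x"
      using c(3) unfolding TS_flip(4)[symmetric] by eventually_elim (simp add: Reals_cnj_iff)
    then have "(\<lambda>\<xi>. cnj (c (- \<xi>))) = c"
      by (intro TS_unique c(1)) (simp_all add: c)
    from fun_cong[OF this, of \<xi>] show ?thesis by (simp add: c complex_eq_iff)
  qed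
  have "AE x in lborel. TS a x \<in> \<real> \<and> TS b x \<in> \<real>"
    using r ab(3) unfolding real_state_def ae_eq_def by eventually_elim (simp add: vort_def flux_def)
  then have re: "a \<xi> = of_real (Re (a \<xi>))" "b \<xi> = of_real (Re (b \<xi>))" for \<xi>
    by (auto intro!: real ab neg)
  define f g where "f = (\<lambda>\<xi>. Re (a \<xi>))" and "g = (\<lambda>\<xi>. Re (b \<xi>) / rad \<xi>)"
  have ae: "a = (\<lambda>\<xi>. of_real (f \<xi>))" using re(1) by (auto simp: f_def)
  have be: "b = (\<lambda>\<xi>. of_real (rad \<xi> * g \<xi>))"
  proof
    fix \<xi>
    have "b 0 = 0" using b(1)[of 0] by (simp add: zero_prod_def)
    then show "b \<xi> = of_real (rad \<xi> * g \<xi>)" using re(2)[of \<xi>] rad_eq_0D[of \<xi>] by (auto simp: g_def)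
  qed
  have URS: "U \<doteq> RS f g" using ab(3) by (simp add: ae_eq_def RS_def ae be)
  have rows: "f (m, n) = 0 \<and> g (m, n) = 0" if "int k \<le> \<bar>n\<bar>" for m n
    using leading_eigenspace_rows[OF U, of "emb (m, n)"] that
    unfolding ab(4,5) lift_emb by (simp add: f_def g_def) (simp add: emb_def)
  have fB: "\<bar>f \<xi>\<bar> \<le> (\<Sum>\<^sub>\<infinity>\<xi>. norm (a \<xi>))" for \<xi>
  proof -
    have "sum (\<lambda>\<xi>. norm (a \<xi>)) {\<xi>} \<le> (\<Sum>\<^sub>\<infinity>\<xi>. norm (a \<xi>))" by (rule finite_sum_le_infsum[OF ab(1)]) simp_all
    then show ?thesis using abs_Re_le_cmod[of "a \<xi>"] by (simp add: f_def)
  qed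
  have e': "eig \<Lambda> f g" using eg(1) by (simp add: f_def g_def)
  have "6 * \<kappa> > 0" using \<kappa> by simp
  then obtain C where C: "\<And>\<xi>. \<bar>f \<xi>\<bar> \<le> C * exp (- (6 * \<kappa>) * sz \<xi>) \<and> \<bar>g \<xi>\<bar> \<le> C * exp (- (6 * \<kappa>) * sz \<xi>)"
    using eig_decay[OF e' \<Lambda> fB rows] by blast
  obtain v where v: "\<And>\<xi>. coord (fst v) \<xi> = W \<kappa> 1 \<xi> * f \<xi>" "\<And>\<xi>. coord (snd v) \<xi> = W \<kappa> 1 \<xi> * g \<xi>"
    and L: "Lop (W \<kappa> 1) v = \<Lambda> *\<^sub>R v"
    using eig_vector[OF e' \<kappa> C] by blast
  have f_sym: "f (- m, n) = f (m, n)" "f (m, - n) = f (m, n)" for m n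
    using a(1)[of "(m, n)"] a(2)[of "(m, n)"] by (simp_all add: f_def)
  have g_sym: "g (- m, n) = - g (m, n)" "g (m, - n) = - g (m, n)" for m n
    using b(1)[of "(m, n)"] b(2)[of "(m, n)"] by (simp_all add: g_def rad_reflect)
  have "even_weight (W \<kappa> 1)" by (rule even_weights(1)[OF \<kappa>])
  then have "v \<in> sym_space"
    unfolding sym_space_def parity_def even_weight_def by (auto simp only: mem_Collect_eq v f_sym g_sym mult_1 mult_minus_left mult_minus_right)
  moreover have "St \<kappa> (chg (W \<kappa> 1) (ew \<kappa>) v) = RS f g"
  proof -
    note c = coord_chg[OF weights_le(1)[OF \<kappa> order_refl] weights_pos(1)[OF \<kappa>] weights_pos(2)[OF \<kappa>]]
    have nz: "W \<kappa> 1 \<xi> \<noteq> 0" "ew \<kappa> \<xi> \<noteq> 0" for \<xi>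
      using weights_pos(1)[OF \<kappa>, of 1 \<xi>] weights_pos(2)[OF \<kappa>, of \<xi>] by linarith+
    have q: "p / q * (q * z) / p = z" if "p \<noteq> 0" "q \<noteq> 0" for p q z :: real using that by simp
    show ?thesis unfolding St_def c v q[OF nz(2) nz(1)] ..
  qed
  ultimately show ?thesis using L URS by auto
qed

text \<open>At the final time the linear part has size exactly \<open>\<delta>\<close>, and up to
  then the remainder is at most \<open>\<delta> / 2\<close> in the norm of \<open>X_space s\<close>;
  both bounds follow by the triangle inequality. The same curve shifted by the equilibrium solves
  \<open>mhd\<close>.\<close>

lemma perturbed_solution:
  assumes k2: "2 \<le> k" and s: "4 \<le> s" and Us: "Us \<in> leading_eigenspace k s" and r: "real_state Us"
    and e: "lin_op k Us \<doteq> (\<lambda>x. leading_rate k s *\<^sub>R Us x)" and n1: "X_norm s Us = 1"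
  shows "\<exists>\<delta>>0. \<forall>\<epsilon>. 0 < \<epsilon> \<and> \<epsilon> < \<delta> \<longrightarrow> (\<exists>U.
     strong_solution k s (perturbation_rhs k) (1 / leading_rate k s * ln (\<delta> / \<epsilon>)) U \<and>
     strong_solution k s mhd (1 / leading_rate k s * ln (\<delta> / \<epsilon>)) (\<lambda>t x. equilibrium k x + U t x) \<and>
     U 0 \<doteq> (\<lambda>x. \<epsilon> *\<^sub>R Us x) \<and> X_norm s (U 0) = \<epsilon> \<and>
     (\<forall>t\<in>{0..1 / leading_rate k s * ln (\<delta> / \<epsilon>)}. X_norm s (U t) \<le> 2 * \<delta>) \<and>
     X_norm s (U (1 / leading_rate k s * ln (\<delta> / \<epsilon>))) \<ge> \<delta> / 2)"
proof -
  define \<Lambda> where "\<Lambda> = leading_rate k s"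
  have \<Lambda>: "\<Lambda> > 0" "spectral_bound \<Lambda>" using leading_rate_props[OF k2 s] by (simp_all add: \<Lambda>_def)
  obtain \<kappa> N c K C \<gamma> where \<kappa>: "\<kappa> > 0" and ge: "\<And>v. v \<in> sym_space \<Longrightarrow> Lop (W \<kappa> 1) v = \<Lambda> *\<^sub>R v \<Longrightarrow>
     graded_evolution (\<lambda>j. Lop (W \<kappa> j)) (\<lambda>i j. Bop (W \<kappa> i) (W \<kappa> j) (W \<kappa> (i + j))) N \<Lambda> \<gamma> c K C v sym_space"
    using graded_evolution_exists[OF \<Lambda>] by blast
  obtain v where v: "v \<in> sym_space" "Lop (W \<kappa> 1) v = \<Lambda> *\<^sub>R v" and Uv: "Us \<doteq> St \<kappa> (chg (W \<kappa> 1) (ew \<kappa>) v)"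
    using leading_vector[OF s Us r e _ \<kappa>] \<Lambda> unfolding \<Lambda>_def by blast
  define V where "V = chg (W \<kappa> 1) (ew \<kappa>) v"
  obtain D where D: "D > 0" and sol: "\<And>\<epsilon> T. 0 < \<epsilon> \<Longrightarrow> 0 < T \<Longrightarrow> D * \<epsilon> * exp (\<Lambda> * T) \<le> 1 / 8 \<Longrightarrow> (\<exists>u u'.
     u 0 = \<epsilon> *\<^sub>R V \<and> continuous_on {0..T} u' \<and> (\<forall>t\<in>{0..T}.
       u t \<in> sym_space \<and> u' t \<in> sym_space \<and>
       (u has_vector_derivative u' t) (at t within {0..T}) \<and>
       chg (ew \<kappa>) one (u' t) = Lop one (chg (ew \<kappa>) one (u t)) + Bop (ew \<kappa>) (ew \<kappa>) one (u t) (u t) \<and>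
       norm (u t - (\<epsilon> * exp (\<Lambda> * t)) *\<^sub>R V) \<le> 2 * (D * \<epsilon> * exp (\<Lambda> * t))\<^sup>2))"
    using analytic_solution[OF \<kappa> v(1) \<Lambda>(1) ge[OF v]] unfolding V_def by blast
  note bl = bounded_linear_Psi[OF \<kappa>, of s]
  obtain M where M: "M > 0" "\<And>z. norm (Psi s \<kappa> z) \<le> norm z * M"
    using bounded_linear.pos_bounded[OF bl] by blast
  have "vort (St \<kappa> V) \<in> borel_measurable borel" "flux (St \<kappa> V) \<in> borel_measurable borel"
  proof -
    have "V \<in> sym_space" unfolding V_def
      using v(1) even_weights[OF \<kappa>] weights_le(1)[OF \<kappa> order_refl] weights_pos[OF \<kappa>] by (intro chg_sym_space)
    then have "St \<kappa> V \<in> X_sym k s" using St_X_sym_real[OF \<kappa>] by (simp add: X_sym_real_def)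
    then show "vort (St \<kappa> V) \<in> borel_measurable borel" "flux (St \<kappa> V) \<in> borel_measurable borel"
      by (rule X_sym_measurable)+
  qed
  moreover have "Us \<in> X_sym k s" using Us by (simp add: leading_eigenspace_def)
  ultimately have PV: "norm (Psi s \<kappa> V) = 1"
    using X_norm_cong[OF Uv[folded V_def]] X_sym_measurable n1 X_norm_St[OF \<kappa>] by metis
  \<comment> \<open>The first entry is the convergence condition at the final time; the second makes
    the quadratic remainder \<open>M * (2 * (D * \<delta>)\<^sup>2)\<close> at most
    \<open>\<delta> / 2\<close>.\<close>
  define \<delta> where "\<delta> = min (1 / (8 * D)) (1 / (4 * M * D\<^sup>2))"
  have \<delta>: "\<delta> > 0" using D M by (simp add: \<delta>_def)
  have D8: "D * \<delta> \<le> 1 / 8"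
  proof -
    have "\<delta> \<le> 1 / (8 * D)" by (simp add: \<delta>_def)
    then have "D * \<delta> \<le> D * (1 / (8 * D))" using D by (intro mult_left_mono) auto
    then show ?thesis using D by simp
  qed
  have MD: "M * (2 * (D * \<delta>)\<^sup>2) \<le> \<delta> / 2"
  proof -
    have "\<delta> \<le> 1 / (4 * M * D\<^sup>2)" by (simp add: \<delta>_def)
    then have "2 * M * D\<^sup>2 * \<delta> * \<delta> \<le> 2 * M * D\<^sup>2 * \<delta> * (1 / (4 * M * D\<^sup>2))"
      using \<delta> D M by (intro mult_left_mono) auto
    also have "\<dots> = \<delta> / 2" using D M by simp
    finally show ?thesis by (simp add: power_mult_distrib power2_eq_square mult_ac)
  qed
  obtain eq where eq: "eq \<in> sym_space" "\<And>\<xi>. coord (fst eq) \<xi> / ew \<kappa> \<xi> = sine cc \<xi>" "\<And>\<xi>. coord (snd eq) \<xi> = 0"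
    "St \<kappa> eq = equilibrium k"
    by (rule equilibrium_St[OF \<kappa>]) (rule that; blast)
  show ?thesis
    unfolding \<Lambda>_def[symmetric]
  proof (intro exI[of _ \<delta>] conjI \<delta> allI impI)
    fix \<epsilon> assume \<epsilon>: "0 < \<epsilon> \<and> \<epsilon> < \<delta>"
    define T where "T = 1 / \<Lambda> * ln (\<delta> / \<epsilon>)"
    have lpos: "ln (\<delta> / \<epsilon>) > 0" using \<epsilon> by simp
    then have T: "T > 0" using \<Lambda> by (simp add: T_def)
    have "exp (\<Lambda> * T) = \<delta> / \<epsilon>" using \<Lambda> \<epsilon> \<delta> by (simp add: T_def)
    then have eT: "\<epsilon> * exp (\<Lambda> * T) = \<delta>" using \<epsilon> by simp
    have "D * \<epsilon> * exp (\<Lambda> * T) \<le> 1 / 8" using D8 eT by (simp add: mult.assoc)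
    from sol[OF _ T this] \<epsilon> obtain u u' where u0: "u 0 = \<epsilon> *\<^sub>R V" and cu': "continuous_on {0..T} u'"
      and u: "\<And>t. t \<in> {0..T} \<Longrightarrow> u t \<in> sym_space \<and> u' t \<in> sym_space \<and> (u has_vector_derivative u' t) (at t within {0..T})"
      and de: "\<And>t. t \<in> {0..T} \<Longrightarrow> chg (ew \<kappa>) one (u' t) = Lop one (chg (ew \<kappa>) one (u t)) + Bop (ew \<kappa>) (ew \<kappa>) one (u t) (u t)"
      and near: "\<And>t. t \<in> {0..T} \<Longrightarrow> norm (u t - (\<epsilon> * exp (\<Lambda> * t)) *\<^sub>R V) \<le> 2 * (D * \<epsilon> * exp (\<Lambda> * t))\<^sup>2"
      by blast
    have rhs: "perturbation_rhs k (St \<kappa> (u t)) x = St \<kappa> (u' t) x" if "t \<in> {0..T}" for t x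
      by (rule St_rhs[OF \<kappa> de[OF that]])
    have close: "\<bar>X_norm s (St \<kappa> (u t)) - \<epsilon> * exp (\<Lambda> * t)\<bar> \<le> \<delta> / 2" "\<epsilon> * exp (\<Lambda> * t) \<le> \<delta>" if t: "t \<in> {0..T}" for t
    proof -
      have "exp (\<Lambda> * t) \<le> exp (\<Lambda> * T)" using t \<Lambda> by simp
      then show et: "\<epsilon> * exp (\<Lambda> * t) \<le> \<delta>" unfolding eT[symmetric] using \<epsilon> by simp
      have "Psi s \<kappa> (u t - (\<epsilon> * exp (\<Lambda> * t)) *\<^sub>R V) = Psi s \<kappa> (u t) - (\<epsilon> * exp (\<Lambda> * t)) *\<^sub>R Psi s \<kappa> V"
        by (simp add: linear_diff[OF bounded_linear.linear[OF bl]] linear_scale[OF bounded_linear.linear[OF bl]])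
      then have "\<bar>norm (Psi s \<kappa> (u t)) - norm ((\<epsilon> * exp (\<Lambda> * t)) *\<^sub>R Psi s \<kappa> V)\<bar> \<le> norm (Psi s \<kappa> (u t - (\<epsilon> * exp (\<Lambda> * t)) *\<^sub>R V))"
        by (simp only: norm_triangle_ineq3)
      also have "\<dots> \<le> norm (u t - (\<epsilon> * exp (\<Lambda> * t)) *\<^sub>R V) * M" by (rule M)
      also have "\<dots> \<le> 2 * (D * \<epsilon> * exp (\<Lambda> * t))\<^sup>2 * M" using near[OF t] M by (intro mult_right_mono) auto
      also have "\<dots> \<le> 2 * (D * \<delta>)\<^sup>2 * M"
        using et \<epsilon> D M by (intro mult_right_mono mult_left_mono power_mono) (auto simp: mult.assoc)
      also have "\<dots> \<le> \<delta> / 2" using MD by (simp add: mult_ac)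
      finally show "\<bar>X_norm s (St \<kappa> (u t)) - \<epsilon> * exp (\<Lambda> * t)\<bar> \<le> \<delta> / 2"
        using \<epsilon> by (simp add: X_norm_St[OF \<kappa>] PV)
    qed
    show "\<exists>U. strong_solution k s (perturbation_rhs k) (1 / \<Lambda> * ln (\<delta> / \<epsilon>)) U \<and>
       strong_solution k s mhd (1 / \<Lambda> * ln (\<delta> / \<epsilon>)) (\<lambda>t x. equilibrium k x + U t x) \<and>
       U 0 \<doteq> (\<lambda>x. \<epsilon> *\<^sub>R Us x) \<and> X_norm s (U 0) = \<epsilon> \<and>
       (\<forall>t\<in>{0..1 / \<Lambda> * ln (\<delta> / \<epsilon>)}. X_norm s (U t) \<le> 2 * \<delta>) \<and>
       X_norm s (U (1 / \<Lambda> * ln (\<delta> / \<epsilon>))) \<ge> \<delta> / 2"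
      unfolding T_def[symmetric]
    proof (intro exI[of _ "\<lambda>t. St \<kappa> (u t)"] conjI ballI)
      show "strong_solution k s (perturbation_rhs k) T (\<lambda>t. St \<kappa> (u t))"
        by (rule St_strong_solution[OF \<kappa> T cu' u rhs])
      have "strong_solution k s mhd T (\<lambda>t. St \<kappa> (eq + u t))"
      proof (rule St_strong_solution[OF \<kappa> T cu'])
        show "eq + u t \<in> sym_space \<and> u' t \<in> sym_space \<and> ((\<lambda>t. eq + u t) has_vector_derivative u' t) (at t within {0..T})"
          if "t \<in> {0..T}" for t
          using u[OF that] subspace_add[OF subspace_sym_space eq(1)]
          by (auto intro!: derivative_eq_intros)
        show "mhd (St \<kappa> (eq + u t)) x = St \<kappa> (u' t) x" if "t \<in> {0..T}" for t x
          unfolding mhd_St[OF \<kappa> eq(2,3)] by (rule rhs[OF that])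
      qed
      moreover have "(\<lambda>t. St \<kappa> (eq + u t)) = (\<lambda>t x. equilibrium k x + St \<kappa> (u t) x)"
        by (intro ext) (simp add: St_linear(1)[OF \<kappa>] eq(4))
      ultimately show "strong_solution k s mhd T (\<lambda>t x. equilibrium k x + St \<kappa> (u t) x)" by simp
      show "St \<kappa> (u 0) \<doteq> (\<lambda>x. \<epsilon> *\<^sub>R Us x)"
        using Uv[folded V_def] unfolding ae_eq_def u0 St_linear(3)[OF \<kappa>] by eventually_elim simp
      show "X_norm s (St \<kappa> (u 0)) = \<epsilon>"
        unfolding X_norm_St[OF \<kappa>] u0 linear_scale[OF bounded_linear.linear[OF bl]] using \<epsilon> PV by simp
      show "X_norm s (St \<kappa> (u t)) \<le> 2 * \<delta>" if "t \<in> {0..T}" for t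
        using close[OF that] \<delta> unfolding abs_le_iff by linarith
      show "\<delta> / 2 \<le> X_norm s (St \<kappa> (u T))"
        using close(1)[of T] T unfolding eT abs_le_iff by simp
    qed
  qed
qed

end

theorem theorem4p2:
  fixes k s :: nat and Us :: state
  assumes "k \<ge> 2" and "s \<ge> 4"
    and "Us \<in> leading_eigenspace k s" and "smooth_state Us" and "real_state Us"
    and "lin_op k Us \<doteq> (\<lambda>x. leading_rate k s *\<^sub>R Us x)"
    and "X_norm s Us = 1"
  shows "(\<exists>\<delta>>0. \<exists>\<epsilon>0>0. \<exists>C>0. \<forall>\<epsilon>. 0 < \<epsilon> \<and> \<epsilon> < \<epsilon>0 \<longrightarrow>
      (let T = 1 / leading_rate k s * ln (\<delta> / \<epsilon>) in
        \<exists>U. strong_solution k s (perturbation_rhs k) T U \<and>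
          U 0 \<doteq> (\<lambda>x. \<epsilon> *\<^sub>R Us x) \<and>
          (\<forall>t\<in>{0..T}. X_norm s (U t) \<le> C * \<delta>) \<and>
          X_norm s (U T) \<ge> \<delta> / 2)) \<and>
    nonlinearly_unstable k s mhd (equilibrium k) \<and>
    (\<exists>\<eta>>0. \<exists>\<tau>. \<tau> \<in> O[at_right 0](\<lambda>\<epsilon>. \<bar>ln \<epsilon>\<bar>) \<and>
      (\<forall>\<^sub>F \<epsilon> in at_right 0. \<exists>W. strong_solution k s mhd (\<tau> \<epsilon>) W \<and>
          W 0 \<doteq> (\<lambda>x. equilibrium k x + \<epsilon> *\<^sub>R Us x) \<and>
          X_norm s (\<lambda>x. W (\<tau> \<epsilon>) x - equilibrium k x) \<ge> \<eta>))"
proof -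
  have "1 \<le> k" using assms(1) by simp
  then interpret wave k by (rule wave.intro)
  define \<Lambda> where "\<Lambda> = leading_rate k s"
  have \<Lambda>: "\<Lambda> > 0" using leading_rate_props(1)[OF assms(1,2)] by (simp add: \<Lambda>_def)
  obtain \<delta> where \<delta>: "\<delta> > 0" and sol: "\<And>\<epsilon>. 0 < \<epsilon> \<and> \<epsilon> < \<delta> \<Longrightarrow> \<exists>U.
     strong_solution k s (perturbation_rhs k) (1 / \<Lambda> * ln (\<delta> / \<epsilon>)) U \<and>
     strong_solution k s mhd (1 / \<Lambda> * ln (\<delta> / \<epsilon>)) (\<lambda>t x. equilibrium k x + U t x) \<and>
     U 0 \<doteq> (\<lambda>x. \<epsilon> *\<^sub>R Us x) \<and> X_norm s (U 0) = \<epsilon> \<and>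
     (\<forall>t\<in>{0..1 / \<Lambda> * ln (\<delta> / \<epsilon>)}. X_norm s (U t) \<le> 2 * \<delta>) \<and>
     X_norm s (U (1 / \<Lambda> * ln (\<delta> / \<epsilon>))) \<ge> \<delta> / 2"
    using perturbed_solution[OF assms(1-3,5-7)] unfolding \<Lambda>_def by blast
  show ?thesis
  proof (intro conjI)
    show "\<exists>\<delta>>0. \<exists>\<epsilon>0>0. \<exists>C>0. \<forall>\<epsilon>. 0 < \<epsilon> \<and> \<epsilon> < \<epsilon>0 \<longrightarrow>
      (let T = 1 / leading_rate k s * ln (\<delta> / \<epsilon>) in
        \<exists>U. strong_solution k s (perturbation_rhs k) T U \<and>
          U 0 \<doteq> (\<lambda>x. \<epsilon> *\<^sub>R Us x) \<and>
          (\<forall>t\<in>{0..T}. X_norm s (U t) \<le> C * \<delta>) \<and>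
          X_norm s (U T) \<ge> \<delta> / 2)"
      unfolding \<Lambda>_def[symmetric] Let_def
      by (rule exI[of _ \<delta>], rule conjI[OF \<delta>], rule exI[of _ \<delta>], rule conjI[OF \<delta>], rule exI[of _ 2])
         (use sol in auto)
    show "nonlinearly_unstable k s mhd (equilibrium k)"
      unfolding nonlinearly_unstable_def
    proof (rule exI[of _ "\<delta> / 2"], intro conjI allI impI)
      fix d :: real assume d: "d > 0"
      define \<epsilon> where "\<epsilon> = min (d / 2) (\<delta> / 2)"
      have \<epsilon>: "0 < \<epsilon> \<and> \<epsilon> < \<delta>" "\<epsilon> < d" using d \<delta> by (auto simp: \<epsilon>_def)
      define T where "T = 1 / \<Lambda> * ln (\<delta> / \<epsilon>)"
      have T: "T \<ge> 0" using \<epsilon> \<Lambda> by (simp add: T_def)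
      obtain U where U: "strong_solution k s mhd T (\<lambda>t x. equilibrium k x + U t x)" "X_norm s (U 0) = \<epsilon>" "X_norm s (U T) \<ge> \<delta> / 2"
        using sol[OF \<epsilon>(1)] unfolding T_def by blast
      show "\<exists>T W. strong_solution k s mhd T W \<and> X_norm s (\<lambda>x. W 0 x - equilibrium k x) < d \<and>
          (\<exists>t\<in>{0..T}. X_norm s (\<lambda>x. W t x - equilibrium k x) \<ge> \<delta> / 2)"
        using U \<epsilon>(2) T by (intro exI[of _ T] exI[of _ "\<lambda>t x. equilibrium k x + U t x"]) (auto intro!: bexI[of _ T])
    qed (use \<delta> in simp)
    define \<tau> where "\<tau> \<epsilon> = 1 / \<Lambda> * ln (\<delta> / \<epsilon>)" for \<epsilon>
    have small: "\<forall>\<^sub>F \<epsilon> in at_right 0. 0 < \<epsilon> \<and> \<epsilon> < r" if "r > 0" for r :: real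
      using that by (auto simp: eventually_at_right_field)
    have "\<tau> \<in> O[at_right 0](\<lambda>\<epsilon>. \<bar>ln \<epsilon>\<bar>)"
    \<comment> \<open>For \<epsilon> below \<open>exp (- \<bar>ln \<delta>\<bar>)\<close> the term
      \<open>ln \<delta>\<close> is dominated by \<open>ln \<epsilon>\<close>, whence the factor
      2.\<close>
    proof (rule bigoI[where c = "2 / \<Lambda>"])
      show "\<forall>\<^sub>F \<epsilon> in at_right 0. norm (\<tau> \<epsilon>) \<le> 2 / \<Lambda> * norm \<bar>ln \<epsilon>\<bar>"
        using small[of "exp (- \<bar>ln \<delta>\<bar>)", OF exp_gt_zero]
      proof eventually_elim
        case (elim \<epsilon>)
        then have "ln \<epsilon> < - \<bar>ln \<delta>\<bar>" by (metis exp_less_cancel_iff exp_ln)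
        moreover have "ln (\<delta> / \<epsilon>) = ln \<delta> - ln \<epsilon>" using elim \<delta> by (simp add: ln_div)
        ultimately have "\<bar>ln (\<delta> / \<epsilon>)\<bar> \<le> 2 * \<bar>ln \<epsilon>\<bar>" by linarith
        then have "1 / \<Lambda> * \<bar>ln (\<delta> / \<epsilon>)\<bar> \<le> 1 / \<Lambda> * (2 * \<bar>ln \<epsilon>\<bar>)" using \<Lambda> by (intro mult_left_mono) auto
        then show ?case using \<Lambda> by (simp add: \<tau>_def abs_mult)
      qed
    qed
    moreover have "\<forall>\<^sub>F \<epsilon> in at_right 0. \<exists>W. strong_solution k s mhd (\<tau> \<epsilon>) W \<and>
          W 0 \<doteq> (\<lambda>x. equilibrium k x + \<epsilon> *\<^sub>R Us x) \<and>
          X_norm s (\<lambda>x. W (\<tau> \<epsilon>) x - equilibrium k x) \<ge> \<delta> / 2"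
      using small[OF \<delta>]
    proof eventually_elim
      case (elim \<epsilon>)
      obtain U where U: "strong_solution k s mhd (\<tau> \<epsilon>) (\<lambda>t x. equilibrium k x + U t x)"
        "U 0 \<doteq> (\<lambda>x. \<epsilon> *\<^sub>R Us x)" "X_norm s (U (\<tau> \<epsilon>)) \<ge> \<delta> / 2"
        using sol[OF elim] unfolding \<tau>_def by blast
      have "(\<lambda>x. equilibrium k x + U 0 x) \<doteq> (\<lambda>x. equilibrium k x + \<epsilon> *\<^sub>R Us x)"
        using U(2) unfolding ae_eq_def by eventually_elim simp
      then show ?case using U(1,3) by (intro exI[of _ "\<lambda>t x. equilibrium k x + U t x"]) simp
    qed
    ultimately show "\<exists>\<eta>>0. \<exists>\<tau>. \<tau> \<in> O[at_right 0](\<lambda>\<epsilon>. \<bar>ln \<epsilon>\<bar>) \<and>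
      (\<forall>\<^sub>F \<epsilon> in at_right 0. \<exists>W. strong_solution k s mhd (\<tau> \<epsilon>) W \<and>
          W 0 \<doteq> (\<lambda>x. equilibrium k x + \<epsilon> *\<^sub>R Us x) \<and>
          X_norm s (\<lambda>x. W (\<tau> \<epsilon>) x - equilibrium k x) \<ge> \<eta>)"
      using \<delta> by (intro exI[of _ "\<delta> / 2"] exI[of _ \<tau>] conjI) auto
  qed
qed

end
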